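(* Let $(Q,\sigma)$ be a quiver with involution and duality structure $(s,\tau)$, let $\theta$ be a $\sigma$-compatible stability, and let $d\in\Lambda_Q^{\sigma,+}$ be such that $d_i$ is even whenever $\sigma(i)=i$ and $s_i=-1$. Let $k=\mathbb{F}_q$ be a finite field of odd characteristic. Then the coefficient of $\xi_d$ in $A_d^{\sigma,\theta}$, i.e. the number $\sum_{M}\frac{q^{\frac12\mathcal{E}(d)}}{\#\mathrm{Aut}_S(M)}$ (sum over isometry classes of semistable self-dual $\mathbb{F}_q$-representations $M$ of dimension vector $d$), is equal to $$q^{\frac12\mathcal{E}(d)}\sum_{(d^\bullet;d^\infty)}(-1)^{l(d^\bullet)}q^{-\chi(d^\bullet)-\chi(d^\infty,d^\bullet)-\mathcal{E}(d^\bullet)}\left(\prod_{i=1}^{l(d^\bullet)}\frac{q^{-\chi(d^i,d^i)}}{(q^{-1})_{d^i}}\right)\frac{q^{-\mathcal{E}(d^\infty)}}{(q^{-1})^\sigma_{d^\infty}},$$ where the sum is over all $n\ge0$ and $(d^\bullet;d^\infty)=(d^1,\dots,d^n;d^\infty)\in(\Lambda_Q^+)^n\times\Lambda_Q^{\sigma,+}$ with all $d^i\neq0$ and $\sum_{i=1}^nH(d^i)+d^\infty=d$, which are equal to $(\varnothing;d)$ or satisfy $\mu(\sum_{i=1}^jd^i)>0$ for $j=1,\dots,n$. In particular, there exists a rational function $a_d^{\sigma,\theta}(t)\in\mathbb{Z}(t^{\frac12})$ that specializes to (the coefficient of $\xi_d$ in) $A_d^{\sigma,\theta}$ over $\mathbb{F}_q$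 at $t=q$, for every odd prime power $q$.
   Context: Quivers. $Q$ is a quiver with finite sets of nodes $Q_0$ and arrows $Q_1$; $\Lambda_Q=\mathbb{Z}Q_0$, $\Lambda_Q^+=\mathbb{Z}_{\ge 0}Q_0$. A representation $M$ consists of finite dimensional $k$-vector spaces $M_i$ and linear maps $m_\alpha:M_i\to M_j$ for arrows $\alpha:i\to j$; $\mathbf{dim}\,M=\sum_i(\dim M_i)\,i$. The Euler form on $\Lambda_Q$ is $\chi(d,d')=\sum_{i\in Q_0}d_id'_i-\sum_{\alpha:i\to j}d_id'_j$. Involutions and duality structures. An involution $\sigma$ of $Q$ is a pair of involutions of $Q_0$ and $Q_1$ such that $\alpha:i\to j$ is sent to $\sigma(\alpha):\sigma(j)\to\sigma(i)$, and every arrow of the form $i\to\sigma(i)$ is fixed by $\sigma$. It acts on $\Lambda_Q$; $\Lambda_Q^{\sigma,+}\subset\Lambda_Q^+$ denotes the $\sigma$-invariants, and $H(d)=d+\sigma(d)$. A duality structure is a pair $s:Q_0\to\{\pm1\}$, $\tau:Q_1\to\{\pm1\}$ with $s$ $\sigma$-invariant and $\tau_\alpha\tau_{\sigma(\alpha)}=s_is_j$ for every $\alpha:i\to j$. Self-dual representations. A self-dual representation is a representation $M$ with a non-degenerate bilinear form $\langle\cdot,\cdot\rangle$ on $\bigoplus_iM_i$ such that $M_i$ and $M_j$ are orthogonal unless $i=\sigma(j)$; $\langle x,x'\rangle=s_i\langle x',x\rangle$ for $x,x'\in M_i+M_{\sigma(i)}$; and $\langle m_\alpha x,x'\rangle=\tau_\alpha\langle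 x,m_{\sigma(\alpha)}x'\rangle$ for every $\alpha:i\to j$, $x\in M_i$, $x'\in M_{\sigma(j)}$. Isometries are isomorphisms preserving the forms; $\mathrm{Aut}_S(M)$ is the group of self-isometries. A subrepresentation is isotropic if the form vanishes on it. Stability. A stability is $\theta\in\mathrm{Hom}_{\mathbb Z}(\Lambda_Q,\mathbb Z)$, $\sigma$-compatible if $\theta\circ\sigma=-\theta$. The slope of $0\ne d\in\Lambda_Q^+$ is $\mu(d)=\theta(d)/\sum_id_i$, and $\mu(U)=\mu(\mathbf{dim}\,U)$. A self-dual representation $M$ (which has slope $0$) is semistable if $\mu(V)\le0$ for all non-zero isotropic subrepresentations $V\subset M$. The zero self-dual representation counts as semistable. The function $\mathcal{E}:\Lambda_Q\to\mathbb{Z}$. Write $Q_0=Q_0^+\sqcup Q_0^\sigma\sqcup Q_0^-$ with $Q_0^\sigma$ the $\sigma$-fixed nodes and $\sigma(Q_0^+)=Q_0^-$, and similarly $Q_1=Q_1^+\sqcup Q_1^\sigma\sqcup Q_1^-$. Then $$\mathcal{E}(d)=\sum_{i\in Q_0^\sigma}\frac{d_i(d_i-s_i)}2+\sum_{i\in Q_0^+}d_{\sigma(i)}d_i-\sum_{(\alpha:\sigma(i)\to i)\in Q_1^\sigma}\frac{d_i(d_i+\tau_\alpha s_i)}2-\sum_{(\alpha:i\to j)\in Q_1^+}d_{\sigma(i)}d_j.$$ Series. $A_d^{\sigma,\theta}=\sum_M\frac{q^{\frac12\mathcal{E}(d)}}{\#\mathrm{Aut}_S(M)}\,\xi_d$,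 the sum over isometry classes of semistable self-dual $\mathbb{F}_q$-representations of dimension vector $d$, where $\xi_d$ is a basis symbol of a $\mathbb{Q}(q^{1/2})$-vector space. Notation. $(y)_n=\prod_{i=1}^n(1-y^i)$; $(y)_d=\prod_{i\in Q_0}(y)_{d_i}$ for $d\in\Lambda_Q^+$; $(y)^\sigma_e=\prod_{i\in Q_0^\sigma}(y^2)_{\lfloor e_i/2\rfloor}\times\prod_{i\in Q_0^+}(y)_{e_i}$ for $e\in\Lambda_Q^{\sigma,+}$. For $d^\bullet=(d^1,\dots,d^n)$: $l(d^\bullet)=n$, $\chi(d^\bullet)=\sum_{1\le i<j\le n}\chi(d^j,d^i)$, $\chi(e,d^\bullet)=\sum_{i=1}^n\chi(e,d^i)$, $\mathcal{E}(d^\bullet)=\mathcal{E}(\sum_{i=1}^nd^i)$. *)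

theory Defs
  imports
    Complex_Main
    "HOL-Library.Function_Algebras"
    "HOL-Computational_Algebra.Polynomial"
    "HOL-Computational_Algebra.Fraction_Field"
    "HOL-Algebra.Multiplicative_Group"
    "Jordan_Normal_Form.Missing_VectorSpace"
    "Graph_Theory.Digraph"
begin

section \<open>Quivers with involution and duality structure\<close>

locale quiver_involution = fin_digraph Q
  for Q :: "('v, 'a) pre_digraph" +
  fixes \<sigma>0 :: "'v \<Rightarrow> 'v" and \<sigma>1 :: "'a \<Rightarrow> 'a"
  assumes node_closed: "i \<in> verts Q \<Longrightarrow> \<sigma>0 i \<in> verts Q"
    and node_invol: "i \<in> verts Q \<Longrightarrow> \<sigma>0 (\<sigma>0 i) = i"
    and arrow_closed: "\<alpha> \<in> arcs Q \<Longrightarrow> \<sigma>1 \<alpha> \<in> arcs Q"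
    and arrow_invol: "\<alpha> \<in> arcs Q \<Longrightarrow> \<sigma>1 (\<sigma>1 \<alpha>) = \<alpha>"
    and tail_invol: "\<alpha> \<in> arcs Q \<Longrightarrow> tail Q (\<sigma>1 \<alpha>) = \<sigma>0 (head Q \<alpha>)"
    and head_invol: "\<alpha> \<in> arcs Q \<Longrightarrow> head Q (\<sigma>1 \<alpha>) = \<sigma>0 (tail Q \<alpha>)"
    and arrow_fixed: "\<alpha> \<in> arcs Q \<Longrightarrow> head Q \<alpha> = \<sigma>0 (tail Q \<alpha>) \<Longrightarrow> \<sigma>1 \<alpha> = \<alpha>"

locale quiver_duality = quiver_involution Q \<sigma>0 \<sigma>1
  for Q :: "('v, 'a) pre_digraph" and \<sigma>0 :: "'v \<Rightarrow> 'v" and \<sigma>1 :: "'a \<Rightarrow> 'a" +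
  fixes s :: "'v \<Rightarrow> int" and \<tau> :: "'a \<Rightarrow> int"
  assumes s_sign: "i \<in> verts Q \<Longrightarrow> s i \<in> {1, -1}"
    and tau_sign: "\<alpha> \<in> arcs Q \<Longrightarrow> \<tau> \<alpha> \<in> {1, -1}"
    and s_invariant: "i \<in> verts Q \<Longrightarrow> s (\<sigma>0 i) = s i"
    and tau_s: "\<alpha> \<in> arcs Q \<Longrightarrow> \<tau> \<alpha> * \<tau> (\<sigma>1 \<alpha>) = s (tail Q \<alpha>) * s (head Q \<alpha>)"

definition fixed_nodes :: "('v, 'a) pre_digraph \<Rightarrow> ('v \<Rightarrow> 'v) \<Rightarrow> 'v set" where
  "fixed_nodes Q \<sigma>0 = {i \<in> verts Q. \<sigma>0 i = i}"

definition fixed_arrows :: "('v, 'a) pre_digraph \<Rightarrow> ('a \<Rightarrow> 'a) \<Rightarrow> 'a set" where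
  "fixed_arrows Q \<sigma>1 = {\<alpha> \<in> arcs Q. \<sigma>1 \<alpha> = \<alpha>}"

text \<open>\<open>P0\<close> and \<open>P1\<close> are a choice of \<open>Q\<^sub>0\<^sup>+\<close> and \<open>Q\<^sub>1\<^sup>+\<close>; the sets \<open>Q\<^sub>0\<^sup>-\<close> and \<open>Q\<^sub>1\<^sup>-\<close> are their images
  under the involution.\<close>

definition involution_splitting ::
  "('v, 'a) pre_digraph \<Rightarrow> ('v \<Rightarrow> 'v) \<Rightarrow> ('a \<Rightarrow> 'a) \<Rightarrow> 'v set \<Rightarrow> 'a set \<Rightarrow> bool" where
  "involution_splitting Q \<sigma>0 \<sigma>1 P0 P1 \<longleftrightarrow>
     P0 \<union> fixed_nodes Q \<sigma>0 \<union> \<sigma>0 ` P0 = verts Q \<and>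
     P0 \<inter> fixed_nodes Q \<sigma>0 = {} \<and> P0 \<inter> \<sigma>0 ` P0 = {} \<and> fixed_nodes Q \<sigma>0 \<inter> \<sigma>0 ` P0 = {} \<and>
     P1 \<union> fixed_arrows Q \<sigma>1 \<union> \<sigma>1 ` P1 = arcs Q \<and>
     P1 \<inter> fixed_arrows Q \<sigma>1 = {} \<and> P1 \<inter> \<sigma>1 ` P1 = {} \<and> fixed_arrows Q \<sigma>1 \<inter> \<sigma>1 ` P1 = {}"


section \<open>Dimension vectors\<close>

text \<open>Elements of \<open>\<Lambda>\<^sub>Q\<close> are integer functions vanishing outside the nodes, so that equality of functions
  is equality in \<open>\<Lambda>\<^sub>Q\<close>. Addition and zero are pointwise.\<close>

definition Lam :: "('v, 'a) pre_digraph \<Rightarrow> ('v \<Rightarrow> int) set" where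
  "Lam Q = {d. \<forall>i. i \<notin> verts Q \<longrightarrow> d i = 0}"

definition Lam_pos :: "('v, 'a) pre_digraph \<Rightarrow> ('v \<Rightarrow> int) set" where
  "Lam_pos Q = {d \<in> Lam Q. \<forall>i. 0 \<le> d i}"

definition inv_act :: "('v, 'a) pre_digraph \<Rightarrow> ('v \<Rightarrow> 'v) \<Rightarrow> ('v \<Rightarrow> int) \<Rightarrow> 'v \<Rightarrow> int" where
  "inv_act Q \<sigma>0 d = (\<lambda>i. if i \<in> verts Q then d (\<sigma>0 i) else 0)"

definition Lam_inv_pos :: "('v, 'a) pre_digraph \<Rightarrow> ('v \<Rightarrow> 'v) \<Rightarrow> ('v \<Rightarrow> int) set" where
  "Lam_inv_pos Q \<sigma>0 = {d \<in> Lam_pos Q. inv_act Q \<sigma>0 d = d}"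

definition hyp :: "('v, 'a) pre_digraph \<Rightarrow> ('v \<Rightarrow> 'v) \<Rightarrow> ('v \<Rightarrow> int) \<Rightarrow> 'v \<Rightarrow> int" where
  "hyp Q \<sigma>0 d = d + inv_act Q \<sigma>0 d"

definition euler :: "('v, 'a) pre_digraph \<Rightarrow> ('v \<Rightarrow> int) \<Rightarrow> ('v \<Rightarrow> int) \<Rightarrow> int" where
  "euler Q d e = (\<Sum>i\<in>verts Q. d i * e i) - (\<Sum>\<alpha>\<in>arcs Q. d (tail Q \<alpha>) * e (head Q \<alpha>))"

text \<open>Both integer divisions by two are exact, because \<open>s i\<close> and \<open>\<tau> \<alpha> * s i\<close> are signs.
  For a fixed arrow the index \<open>i\<close> is its head; this matters when \<open>d\<close> is not invariant.\<close>

definition sd_euler ::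
  "('v, 'a) pre_digraph \<Rightarrow> ('v \<Rightarrow> 'v) \<Rightarrow> ('a \<Rightarrow> 'a) \<Rightarrow> ('v \<Rightarrow> int) \<Rightarrow> ('a \<Rightarrow> int) \<Rightarrow>
    'v set \<Rightarrow> 'a set \<Rightarrow> ('v \<Rightarrow> int) \<Rightarrow> int" where
  "sd_euler Q \<sigma>0 \<sigma>1 s \<tau> P0 P1 d =
     (\<Sum>i\<in>fixed_nodes Q \<sigma>0. (d i * (d i - s i)) div 2)
     + (\<Sum>i\<in>P0. d (\<sigma>0 i) * d i)
     - (\<Sum>\<alpha>\<in>fixed_arrows Q \<sigma>1.
          (d (head Q \<alpha>) * (d (head Q \<alpha>) + \<tau> \<alpha> * s (head Q \<alpha>))) div 2)
     - (\<Sum>\<alpha>\<in>P1. d (\<sigma>0 (tail Q \<alpha>)) * d (head Q \<alpha>))"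

text \<open>Only the restriction of \<open>\<theta>\<close> to \<open>\<Lambda>\<^sub>Q\<close> is relevant.\<close>

definition stability :: "('v, 'a) pre_digraph \<Rightarrow> (('v \<Rightarrow> int) \<Rightarrow> int) \<Rightarrow> bool" where
  "stability Q \<theta> \<longleftrightarrow> (\<forall>d\<in>Lam Q. \<forall>e\<in>Lam Q. \<theta> (d + e) = \<theta> d + \<theta> e)"

definition compatible_stability ::
  "('v, 'a) pre_digraph \<Rightarrow> ('v \<Rightarrow> 'v) \<Rightarrow> (('v \<Rightarrow> int) \<Rightarrow> int) \<Rightarrow> bool" where
  "compatible_stability Q \<sigma>0 \<theta> \<longleftrightarrow>
     stability Q \<theta> \<and> (\<forall>d\<in>Lam Q. \<theta> (inv_act Q \<sigma>0 d) = - \<theta> d)"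

definition slope :: "('v, 'a) pre_digraph \<Rightarrow> (('v \<Rightarrow> int) \<Rightarrow> int) \<Rightarrow> ('v \<Rightarrow> int) \<Rightarrow> rat" where
  "slope Q \<theta> d = of_int (\<theta> d) / of_int (\<Sum>i\<in>verts Q. d i)"


section \<open>Representations\<close>

record ('v, 'a, 'k, 'm) quiver_rep =
  space :: "'v \<Rightarrow> ('k, 'm) module"
  arrow_map :: "'a \<Rightarrow> 'm \<Rightarrow> 'm"

definition is_rep ::
  "'k ring \<Rightarrow> ('v, 'a) pre_digraph \<Rightarrow> ('v, 'a, 'k, 'm, 'z) quiver_rep_scheme \<Rightarrow> bool" where
  "is_rep K Q M \<longleftrightarrow>
     (\<forall>i\<in>verts Q. vectorspace K (space M i) \<and> vectorspace.fin_dim K (space M i)) \<and>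
     (\<forall>\<alpha>\<in>arcs Q. linear_map K (space M (tail Q \<alpha>)) (space M (head Q \<alpha>)) (arrow_map M \<alpha>))"

definition dim_vec ::
  "'k ring \<Rightarrow> ('v, 'a) pre_digraph \<Rightarrow> ('v, 'a, 'k, 'm, 'z) quiver_rep_scheme \<Rightarrow> 'v \<Rightarrow> int" where
  "dim_vec K Q M = (\<lambda>i. if i \<in> verts Q then int (vectorspace.dim K (space M i)) else 0)"

definition is_subrep ::
  "'k ring \<Rightarrow> ('v, 'a) pre_digraph \<Rightarrow> ('v, 'a, 'k, 'm, 'z) quiver_rep_scheme \<Rightarrow>
    ('v \<Rightarrow> 'm set) \<Rightarrow> bool" where
  "is_subrep K Q M U \<longleftrightarrow>
     (\<forall>i\<in>verts Q. subspace K (U i) (space M i)) \<and>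
     (\<forall>\<alpha>\<in>arcs Q. arrow_map M \<alpha> ` U (tail Q \<alpha>) \<subseteq> U (head Q \<alpha>))"

definition sub_rep ::
  "('v, 'a, 'k, 'm, 'z) quiver_rep_scheme \<Rightarrow> ('v \<Rightarrow> 'm set) \<Rightarrow>
    ('v, 'a, 'k, 'm, 'z) quiver_rep_scheme" where
  "sub_rep M U = M\<lparr>space := (\<lambda>i. (space M i)\<lparr>carrier := U i\<rparr>)\<rparr>"

definition nonzero_subrep ::
  "('v, 'a) pre_digraph \<Rightarrow> ('v, 'a, 'k, 'm, 'z) quiver_rep_scheme \<Rightarrow> ('v \<Rightarrow> 'm set) \<Rightarrow> bool" where
  "nonzero_subrep Q M U \<longleftrightarrow> (\<exists>i\<in>verts Q. U i \<noteq> {\<zero>\<^bsub>space M i\<^esub>})"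

text \<open>The direct sum of all \<open>M\<^sub>i\<close>. The fields \<open>mult\<close> and \<open>one\<close> of a module record are not used.\<close>

definition total_space ::
  "('v, 'a) pre_digraph \<Rightarrow> ('v, 'a, 'k, 'm, 'z) quiver_rep_scheme \<Rightarrow> ('k, 'v \<Rightarrow> 'm) module" where
  "total_space Q M =
     \<lparr>carrier = (\<Pi>\<^sub>E i\<in>verts Q. carrier (space M i)),
      mult = (\<lambda>x y. \<lambda>i\<in>verts Q. \<zero>\<^bsub>space M i\<^esub>),
      one = (\<lambda>i\<in>verts Q. \<zero>\<^bsub>space M i\<^esub>),
      zero = (\<lambda>i\<in>verts Q. \<zero>\<^bsub>space M i\<^esub>),
      add = (\<lambda>x y. \<lambda>i\<in>verts Q. x i \<oplus>\<^bsub>space M i\<^esub> y i),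
      smult = (\<lambda>c x. \<lambda>i\<in>verts Q. c \<odot>\<^bsub>space M i\<^esub> x i)\<rparr>"

definition embed ::
  "('v, 'a) pre_digraph \<Rightarrow> ('v, 'a, 'k, 'm, 'z) quiver_rep_scheme \<Rightarrow> 'v \<Rightarrow> 'm \<Rightarrow> 'v \<Rightarrow> 'm" where
  "embed Q M i x = (\<lambda>j\<in>verts Q. if j = i then x else \<zero>\<^bsub>space M j\<^esub>)"

definition partial_sum ::
  "('v, 'a) pre_digraph \<Rightarrow> ('v, 'a, 'k, 'm, 'z) quiver_rep_scheme \<Rightarrow> 'v set \<Rightarrow> ('v \<Rightarrow> 'm) set" where
  "partial_sum Q M I =
     {x \<in> carrier (total_space Q M). \<forall>j\<in>verts Q - I. x j = \<zero>\<^bsub>space M j\<^esub>}"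


section \<open>Self-dual representations\<close>

definition bilinear_form :: "'k ring \<Rightarrow> ('k, 'w) module \<Rightarrow> ('w \<Rightarrow> 'w \<Rightarrow> 'k) \<Rightarrow> bool" where
  "bilinear_form K V \<beta> \<longleftrightarrow>
     (\<forall>x\<in>carrier V. \<forall>y\<in>carrier V. \<beta> x y \<in> carrier K) \<and>
     (\<forall>x\<in>carrier V. \<forall>y\<in>carrier V. \<forall>z\<in>carrier V.
        \<beta> (x \<oplus>\<^bsub>V\<^esub> y) z = \<beta> x z \<oplus>\<^bsub>K\<^esub> \<beta> y z \<and>
        \<beta> x (y \<oplus>\<^bsub>V\<^esub> z) = \<beta> x y \<oplus>\<^bsub>K\<^esub> \<beta> x z) \<and>
     (\<forall>c\<in>carrier K. \<forall>x\<in>carrier V. \<forall>y\<in>carrier V.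
        \<beta> (c \<odot>\<^bsub>V\<^esub> x) y = c \<otimes>\<^bsub>K\<^esub> \<beta> x y \<and> \<beta> x (c \<odot>\<^bsub>V\<^esub> y) = c \<otimes>\<^bsub>K\<^esub> \<beta> x y)"

definition nondegenerate_form :: "'k ring \<Rightarrow> ('k, 'w) module \<Rightarrow> ('w \<Rightarrow> 'w \<Rightarrow> 'k) \<Rightarrow> bool" where
  "nondegenerate_form K V \<beta> \<longleftrightarrow>
     (\<forall>x\<in>carrier V. (\<forall>y\<in>carrier V. \<beta> x y = \<zero>\<^bsub>K\<^esub>) \<longrightarrow> x = \<zero>\<^bsub>V\<^esub>) \<and>
     (\<forall>y\<in>carrier V. (\<forall>x\<in>carrier V. \<beta> x y = \<zero>\<^bsub>K\<^esub>) \<longrightarrow> y = \<zero>\<^bsub>V\<^esub>)"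

record ('v, 'a, 'k, 'm) sd_rep = "('v, 'a, 'k, 'm) quiver_rep" +
  form :: "('v \<Rightarrow> 'm) \<Rightarrow> ('v \<Rightarrow> 'm) \<Rightarrow> 'k"

text \<open>\<open>[n] \<cdot>\<^bsub>K\<^esub> x\<close> is the integer multiple \<open>n x\<close>; here \<open>n\<close> is always a sign.\<close>

definition is_sd_rep ::
  "'k ring \<Rightarrow> ('v, 'a) pre_digraph \<Rightarrow> ('v \<Rightarrow> 'v) \<Rightarrow> ('a \<Rightarrow> 'a) \<Rightarrow> ('v \<Rightarrow> int) \<Rightarrow> ('a \<Rightarrow> int) \<Rightarrow>
    ('v, 'a, 'k, 'm) sd_rep \<Rightarrow> bool" where
  "is_sd_rep K Q \<sigma>0 \<sigma>1 s \<tau> M \<longleftrightarrow>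
     is_rep K Q M \<and>
     bilinear_form K (total_space Q M) (form M) \<and>
     nondegenerate_form K (total_space Q M) (form M) \<and>
     (\<forall>i\<in>verts Q. \<forall>j\<in>verts Q. i \<noteq> \<sigma>0 j \<longrightarrow>
        (\<forall>x\<in>carrier (space M i). \<forall>y\<in>carrier (space M j).
           form M (embed Q M i x) (embed Q M j y) = \<zero>\<^bsub>K\<^esub>)) \<and>
     (\<forall>i\<in>verts Q. \<forall>x\<in>partial_sum Q M {i, \<sigma>0 i}. \<forall>y\<in>partial_sum Q M {i, \<sigma>0 i}.
        form M x y = [s i] \<cdot>\<^bsub>K\<^esub> form M y x) \<and>
     (\<forall>\<alpha>\<in>arcs Q. \<forall>x\<in>carrier (space M (tail Q \<alpha>)). \<forall>y\<in>carrier (space M (\<sigma>0 (head Q \<alpha>))).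
        form M (embed Q M (head Q \<alpha>) (arrow_map M \<alpha> x)) (embed Q M (\<sigma>0 (head Q \<alpha>)) y) =
        [\<tau> \<alpha>] \<cdot>\<^bsub>K\<^esub> form M (embed Q M (tail Q \<alpha>) x)
                       (embed Q M (\<sigma>0 (tail Q \<alpha>)) (arrow_map M (\<sigma>1 \<alpha>) y)))"

definition isotropic ::
  "'k ring \<Rightarrow> ('v, 'a) pre_digraph \<Rightarrow> ('v, 'a, 'k, 'm) sd_rep \<Rightarrow> ('v \<Rightarrow> 'm set) \<Rightarrow> bool" where
  "isotropic K Q M U \<longleftrightarrow>
     (\<forall>x \<in> (\<Pi>\<^sub>E i\<in>verts Q. U i). \<forall>y \<in> (\<Pi>\<^sub>E i\<in>verts Q. U i). form M x y = \<zero>\<^bsub>K\<^esub>)"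

definition sd_semistable ::
  "'k ring \<Rightarrow> ('v, 'a) pre_digraph \<Rightarrow> (('v \<Rightarrow> int) \<Rightarrow> int) \<Rightarrow> ('v, 'a, 'k, 'm) sd_rep \<Rightarrow> bool" where
  "sd_semistable K Q \<theta> M \<longleftrightarrow>
     (\<forall>U. is_subrep K Q M U \<and> nonzero_subrep Q M U \<and> isotropic K Q M U \<longrightarrow>
        slope Q \<theta> (dim_vec K Q (sub_rep M U)) \<le> 0)"

text \<open>Isometries are taken to be undefined outside the carriers, so that the set of self-isometries
  has the right cardinality.\<close>

definition isometries ::
  "'k ring \<Rightarrow> ('v, 'a) pre_digraph \<Rightarrow> ('v, 'a, 'k, 'm) sd_rep \<Rightarrow> ('v, 'a, 'k, 'm) sd_rep \<Rightarrow>
    ('v \<Rightarrow> 'm \<Rightarrow> 'm) set" where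
  "isometries K Q M N =
     {\<phi> \<in> (\<Pi>\<^sub>E i\<in>verts Q. carrier (space M i) \<rightarrow>\<^sub>E carrier (space N i)).
        (\<forall>i\<in>verts Q. linear_map K (space M i) (space N i) (\<phi> i) \<and>
           bij_betw (\<phi> i) (carrier (space M i)) (carrier (space N i))) \<and>
        (\<forall>\<alpha>\<in>arcs Q. \<forall>x\<in>carrier (space M (tail Q \<alpha>)).
           \<phi> (head Q \<alpha>) (arrow_map M \<alpha> x) = arrow_map N \<alpha> (\<phi> (tail Q \<alpha>) x)) \<and>
        (\<forall>x\<in>carrier (total_space Q M). \<forall>y\<in>carrier (total_space Q M).
           form N (\<lambda>i\<in>verts Q. \<phi> i (x i)) (\<lambda>i\<in>verts Q. \<phi> i (y i)) = form M x y)}"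

definition Aut_S ::
  "'k ring \<Rightarrow> ('v, 'a) pre_digraph \<Rightarrow> ('v, 'a, 'k, 'm) sd_rep \<Rightarrow> ('v \<Rightarrow> 'm \<Rightarrow> 'm) set" where
  "Aut_S K Q M = isometries K Q M M"


section \<open>The series of semistable self-dual representations\<close>

text \<open>The vector spaces \<open>M\<^sub>i\<close> have elements in the type \<^typ>\<open>nat \<Rightarrow> 'k\<close>, which contains the spaces
  \<open>K\<^sup>n = ({..<n} \<rightarrow>\<^sub>E carrier K)\<close> and hence a copy of every finite-dimensional space over \<open>K\<close>, so every
  isometry class is represented. The vector spaces themselves are arbitrary.\<close>

definition semistable_sd_reps ::
  "'k ring \<Rightarrow> ('v, 'a) pre_digraph \<Rightarrow> ('v \<Rightarrow> 'v) \<Rightarrow> ('a \<Rightarrow> 'a) \<Rightarrow> ('v \<Rightarrow> int) \<Rightarrow> ('a \<Rightarrow> int) \<Rightarrow>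
    (('v \<Rightarrow> int) \<Rightarrow> int) \<Rightarrow> ('v \<Rightarrow> int) \<Rightarrow> ('v, 'a, 'k, nat \<Rightarrow> 'k) sd_rep set" where
  "semistable_sd_reps K Q \<sigma>0 \<sigma>1 s \<tau> \<theta> d =
     {M. is_sd_rep K Q \<sigma>0 \<sigma>1 s \<tau> M \<and> sd_semistable K Q \<theta> M \<and> dim_vec K Q M = d}"

definition isometry_classes ::
  "'k ring \<Rightarrow> ('v, 'a) pre_digraph \<Rightarrow> ('v, 'a, 'k, 'm) sd_rep set \<Rightarrow>
    ('v, 'a, 'k, 'm) sd_rep set set" where
  "isometry_classes K Q S = S // {(M, N). M \<in> S \<and> N \<in> S \<and> isometries K Q M N \<noteq> {}}"

text \<open>The coefficient of \<open>\<xi>\<^sub>d\<close> in \<open>A\<^sub>d\<^sup>\<sigma>\<^sup>,\<^sup>\<theta>\<close>, with \<open>q\<close> the cardinality of \<open>K\<close>.\<close>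

definition A_coeff ::
  "'k ring \<Rightarrow> ('v, 'a) pre_digraph \<Rightarrow> ('v \<Rightarrow> 'v) \<Rightarrow> ('a \<Rightarrow> 'a) \<Rightarrow> ('v \<Rightarrow> int) \<Rightarrow> ('a \<Rightarrow> int) \<Rightarrow>
    'v set \<Rightarrow> 'a set \<Rightarrow> (('v \<Rightarrow> int) \<Rightarrow> int) \<Rightarrow> ('v \<Rightarrow> int) \<Rightarrow> real" where
  "A_coeff K Q \<sigma>0 \<sigma>1 s \<tau> P0 P1 \<theta> d =
     (\<Sum>C\<in>isometry_classes K Q (semistable_sd_reps K Q \<sigma>0 \<sigma>1 s \<tau> \<theta> d).
        real (card (carrier K)) powr (real_of_int (sd_euler Q \<sigma>0 \<sigma>1 s \<tau> P0 P1 d) / 2)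
        / real (card (Aut_S K Q (SOME M. M \<in> C))))"


section \<open>The closed formula\<close>

definition qpoch :: "real \<Rightarrow> nat \<Rightarrow> real" where
  "qpoch y n = (\<Prod>i=1..n. 1 - y ^ i)"

definition qpoch_vec :: "('v, 'a) pre_digraph \<Rightarrow> real \<Rightarrow> ('v \<Rightarrow> int) \<Rightarrow> real" where
  "qpoch_vec Q y d = (\<Prod>i\<in>verts Q. qpoch y (nat (d i)))"

definition qpoch_sd ::
  "('v, 'a) pre_digraph \<Rightarrow> ('v \<Rightarrow> 'v) \<Rightarrow> 'v set \<Rightarrow> real \<Rightarrow> ('v \<Rightarrow> int) \<Rightarrow> real" where
  "qpoch_sd Q \<sigma>0 P0 y e =
     (\<Prod>i\<in>fixed_nodes Q \<sigma>0. qpoch (y\<^sup>2) (nat (e i) div 2)) * (\<Prod>i\<in>P0. qpoch y (nat (e i)))"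

text \<open>Tuples \<open>d\<^sup>\<bullet>\<close> are lists. List positions start at 0.\<close>

definition euler_tuple :: "('v, 'a) pre_digraph \<Rightarrow> ('v \<Rightarrow> int) list \<Rightarrow> int" where
  "euler_tuple Q ds = (\<Sum>j<length ds. \<Sum>i<j. euler Q (ds ! j) (ds ! i))"

definition euler_vec_tuple ::
  "('v, 'a) pre_digraph \<Rightarrow> ('v \<Rightarrow> int) \<Rightarrow> ('v \<Rightarrow> int) list \<Rightarrow> int" where
  "euler_vec_tuple Q e ds = (\<Sum>i<length ds. euler Q e (ds ! i))"

definition HN_types ::
  "('v, 'a) pre_digraph \<Rightarrow> ('v \<Rightarrow> 'v) \<Rightarrow> (('v \<Rightarrow> int) \<Rightarrow> int) \<Rightarrow> ('v \<Rightarrow> int) \<Rightarrow>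
    (('v \<Rightarrow> int) list \<times> ('v \<Rightarrow> int)) set" where
  "HN_types Q \<sigma>0 \<theta> d =
     {(ds, dinf).
        (\<forall>x\<in>set ds. x \<in> Lam_pos Q \<and> x \<noteq> 0) \<and> dinf \<in> Lam_inv_pos Q \<sigma>0 \<and>
        sum_list (map (hyp Q \<sigma>0) ds) + dinf = d \<and>
        ((ds, dinf) = ([], d) \<or>
         (\<forall>j\<in>{1..length ds}. slope Q \<theta> (sum_list (take j ds)) > 0))}"

text \<open>An element of \<open>\<int>(t\<^sup>1\<^sup>/\<^sup>2)\<close> is a fraction of integer polynomials in the variable \<open>u = t\<^sup>1\<^sup>/\<^sup>2\<close>.
  \<open>specializes_at a u v\<close>: the rational function \<open>a\<close> is defined at \<open>u\<close> and has the value \<open>v\<close> there.\<close>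

definition specializes_at :: "int poly fract \<Rightarrow> real \<Rightarrow> real \<Rightarrow> bool" where
  "specializes_at a u v \<longleftrightarrow>
     (\<exists>f g :: int poly. a = Fract f g \<and> poly (map_poly of_int g) u \<noteq> 0 \<and>
        v = poly (map_poly of_int f) u / poly (map_poly of_int g) u)"

text \<open>The characteristic of a finite field is the order of \<open>1\<close> in the additive group.\<close>

definition odd_finite_field :: "'k ring \<Rightarrow> bool" where
  "odd_finite_field K \<longleftrightarrow>
     field K \<and> finite (carrier K) \<and> odd (group.ord (add_monoid K) \<one>\<^bsub>K\<^esub>)"

end

(* Coordinates turn the weighted count of isometry classes into the number of pairs (arrow maps, form)
  on fixed graded spaces, divided by the order of the product of general linear groups. For such a pair
  let P be the poset of isotropic subrepresentations with positive theta. If P is nonempty, the smallest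
  maximiser of theta among all subrepresentations is isotropic, because theta agrees on a subrepresentation
  and on its orthogonal complement, and intersecting with it contracts P. Hence the signed number of chains
  in P is the indicator of semistability. After exchanging the two sums, each type (d1, ..., dn; dinf)
  contributes the number of flags of that type times the number of self-dual structures preserving a given
  flag. Through the form, the arrow maps of such a structure become arbitrary, symmetric or alternating
  bilinear forms vanishing on a filtration, so that everything is an explicit power of q times
  Pochhammer products. *)
theory Submission
 imports Defs
begin

section \<open>Counting lemmas\<close>

text \<open>Counting pairs (arrow maps, form) instead of representations over one fixed form avoids
  the classification of quadratic forms over a finite field and the orders of orthogonal and
  symplectic groups: all nondegenerate forms on a space are counted at once, and their number
  divided by the order of GL_n is a power of q over (q^-2)_(n div 2). For alternating forms this
  holds in even dimension, hence the parity condition on d; odd characteristic makes skew forms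
  alternating. Chains whose members have positive \<theta> take the place of Harder-Narasimhan
  filtrations, so no decreasing slopes have to be tracked, and the types in the formula constrain
  partial sums only. A flag U_1 < ... < U_N of isotropic subspaces is extended by its orthogonal
  complements to one with 2N + 1 steps. An arrow map m preserves U_k exactly when the form b (m x) y
  vanishes on U_k times its complement, because U_k is its own double complement; adjointness of the
  arrow maps becomes invariance under a signed transposition.\<close>

lemma card_fibres:
 assumes "finite B" "\<And>x. x : A ==> f x : B" "\<And>y. y : B ==> card {x : A. f x = y} = k" "finite A"
 shows "card A = card B * k"
proof -
 have "A = (\<Union>y\<in>B. {x : A. f x = y})" using assms(2) by blast
 also have "card \<dots> = (\<Sum>y\<in>B. card {x : A. f x = y})"
  using assms(1,4) by (intro card_UN_disjoint) auto
 finally show ?thesis using assms(3) by simp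
qed

text \<open>The relation expresses the values on the image of \<open>P\<close> through those on
  \<open>P\<close>, and at a fixed index it asks for a fixed point of \<open>t i\<close>. So a
  family is a free choice on \<open>P\<close> together with fixed points at the fixed indices.
  Instances below: matrix entries under transposition, forms at the nodes, and arrow maps in the
  guise of forms.\<close>

lemma card_twisted_families:
 assumes fin: "finite I" and \<rho>: "\<And>i. i : I ==> \<rho> i : I" "\<And>i. i : I ==> \<rho> (\<rho> i) = i"
  and split: "P \<union> {i\<in>I. \<rho> i = i} \<union> \<rho> ` P = I" "P \<inter> {i\<in>I. \<rho> i = i} = {}" "P \<inter> \<rho> ` P = {}"
  and t: "\<And>i x. i : I ==> x : S i ==> t i x : S (\<rho> i)"
   "\<And>i x. i : I ==> x : S i ==> t (\<rho> i) (t i x) = x"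
 shows "card {z : Pi\<^sub>E I S. \<forall>i\<in>I. z (\<rho> i) = t i (z i)} =
  (\<Prod>i\<in>P. card (S i)) * (\<Prod>i\<in>{i\<in>I. \<rho> i = i}. card {x : S i. t i x = x})"
proof -
 define F where "F = {i\<in>I. \<rho> i = i}"
 define J where "J = P \<union> F"
 define S' where "S' = (%i. if i : F then {x : S i. t i x = x} else S i)"
 have JI: "J \<subseteq> I" "P \<subseteq> I" "F \<subseteq> I" and PF: "P \<inter> F = {}" using split by (auto simp: J_def F_def)
 have Jc: "\<rho> i : P" if i: "i : I" "i \<notin> J" for i
 proof -
  have "i : P \<union> {i\<in>I. \<rho> i = i} \<union> \<rho> ` P" using i split(1) by simp
  then obtain j where "j : P" "i = \<rho> j" using i unfolding J_def F_def by blast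
  thus ?thesis using \<rho>(2)[of j] JI by auto
 qed
 have Pn: "\<rho> i \<notin> J" if "i : P" for i
 proof
  assume "\<rho> i : J"
  hence "\<rho> i : F" using that split(3) by (auto simp: J_def)
  hence "\<rho> i = i" using \<rho>(2)[of i] that JI by (auto simp: F_def)
  thus False using that PF \<open>\<rho> i : F\<close> by auto
 qed
 \<comment> \<open>The inverse of restriction to \<open>J\<close>: an index outside \<open>J\<close>
   has its image under \<open>\<rho>\<close> in \<open>P\<close>, from where the value is
   transported back by \<open>t\<close>.\<close>
 define h where "h = (%z'. \<lambda>i\<in>I. if i : J then z' i else t (\<rho> i) (z' (\<rho> i)))"
 have "bij_betw (%z. restrict z J) {z : Pi\<^sub>E I S. \<forall>i\<in>I. z (\<rho> i) = t i (z i)} (Pi\<^sub>E J S')"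
 proof (rule bij_betwI[where g = h])
  show "(%z. restrict z J) : {z : Pi\<^sub>E I S. \<forall>i\<in>I. z (\<rho> i) = t i (z i)} \<rightarrow> Pi\<^sub>E J S'"
  proof (intro funcsetI PiE_I)
   fix z i assume z: "z : {z : Pi\<^sub>E I S. \<forall>i\<in>I. z (\<rho> i) = t i (z i)}" and i: "i : J"
   hence iI: "i : I" using JI by auto
   hence 1: "z i : S i" "z (\<rho> i) = t i (z i)" using z by (auto simp: PiE_iff)
   show "restrict z J i : S' i" using i 1 by (auto simp: S'_def F_def)
  qed auto
  show "h : Pi\<^sub>E J S' \<rightarrow> {z : Pi\<^sub>E I S. \<forall>i\<in>I. z (\<rho> i) = t i (z i)}"
  proof (intro funcsetI CollectI conjI ballI PiE_I)
   fix z i assume z: "z : Pi\<^sub>E J S'" and i: "i : I"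
   have zS: "z j : S j" if "j : J" for j
    using that z by (fastforce simp: PiE_iff S'_def split: if_splits)
   show hS: "h z i : S i"
   proof (cases "i : J")
    case False
    hence "t (\<rho> i) (z (\<rho> i)) : S (\<rho> (\<rho> i))"
     using Jc[OF i] zS[of "\<rho> i"] \<rho>(1)[OF i] t(1) by (auto simp: J_def)
    thus ?thesis using False i \<rho>(2)[OF i] by (simp add: h_def)
   qed (use zS i in \<open>auto simp: h_def\<close>)
   show "h z (\<rho> i) = t i (h z i)"
   proof -
    consider "i : F" | "i : P" | "i \<notin> J" by (auto simp: J_def)
    thus ?thesis
    proof cases
     case 1
     hence "\<rho> i = i" "i : J" by (auto simp: F_def J_def)
     moreover have "t i (z i) = z i" using z 1 \<open>i : J\<close> by (auto simp: PiE_iff S'_def)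
     ultimately show ?thesis using i by (simp add: h_def)
    next
     case 2
     thus ?thesis using Pn[OF 2] i \<rho> by (simp add: h_def J_def)
    next
     case 3
     hence "\<rho> i : J" using Jc[OF i] by (auto simp: J_def)
     moreover have "t i (t (\<rho> i) (z (\<rho> i))) = z (\<rho> i)"
      using t(2)[OF \<rho>(1)[OF i], of "z (\<rho> i)"] zS[OF \<open>\<rho> i : J\<close>] \<rho>(2)[OF i] by simp
     ultimately show ?thesis using 3 i \<rho> by (simp add: h_def)
    qed
   qed
  qed (auto simp: h_def)
  show "h (restrict z J) = z" if z: "z : {z : Pi\<^sub>E I S. \<forall>i\<in>I. z (\<rho> i) = t i (z i)}" for z
  proof
   fix i
   show "h (restrict z J) i = z i"
   proof (cases "i : I")
    case False thus ?thesis using z by (auto simp: h_def PiE_iff extensional_def)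
   next
    case True
    show ?thesis
    proof (cases "i : J")
     case False
     hence "\<rho> i : J" using Jc[OF True] by (auto simp: J_def)
     moreover have "z i = t (\<rho> i) (z (\<rho> i))" using z \<rho>(1)[OF True] \<rho>(2)[OF True] by force
     ultimately show ?thesis using False True by (simp add: h_def)
    qed (use True in \<open>simp add: h_def\<close>)
   qed
  qed
  show "restrict (h z) J = z" if z: "z : Pi\<^sub>E J S'" for z
   using z JI by (auto simp: h_def fun_eq_iff restrict_def PiE_iff extensional_def subset_iff)
 qed
 hence "card {z : Pi\<^sub>E I S. \<forall>i\<in>I. z (\<rho> i) = t i (z i)} = card (Pi\<^sub>E J S')"
  by (rule bij_betw_same_card)
 also have "\<dots> = (\<Prod>i\<in>J. card (S' i))"
  using finite_subset[OF JI(1) fin] by (simp add: card_PiE)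
 also have "\<dots> = (\<Prod>i\<in>P. card (S' i)) * (\<Prod>i\<in>F. card (S' i))"
  unfolding J_def using PF finite_subset[OF JI(2) fin] finite_subset[OF JI(3) fin]
  by (rule prod.union_disjoint[rotated 2])
 also have "(\<Prod>i\<in>P. card (S' i)) = (\<Prod>i\<in>P. card (S i))"
  using PF by (intro prod.cong) (auto simp: S'_def)
 also have "(\<Prod>i\<in>F. card (S' i)) = (\<Prod>i\<in>F. card {x : S i. t i x = x})"
  by (intro prod.cong) (auto simp: S'_def)
 finally show ?thesis by (simp add: F_def)
qed

section \<open>Signed sums over chains\<close>

definition strict_lists :: "'p::order set => 'p list set" where
 "strict_lists P = {xs. sorted_wrt (<) xs \<and> set xs \<subseteq> P}"

text \<open>Minus the reduced Euler characteristic of the order complex: a chain of length n is a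
  simplex of dimension n - 1, and the empty chain is included.\<close>

definition chain_sum :: "'p::order set => int" where
 "chain_sum P = (\<Sum>xs\<in>strict_lists P. (-1) ^ length xs)"

lemma strict_order_distinct: "sorted_wrt (<) (xs :: 'p::order list) ==> distinct xs"
 by (induction xs) auto

lemma finite_strict_lists: "finite P ==> finite (strict_lists P)"
proof (rule finite_subset)
 assume "finite P"
 show "strict_lists P \<subseteq> {xs. set xs \<subseteq> P \<and> length xs \<le> card P}"
 proof
  fix xs assume "xs : strict_lists P"
  hence "distinct xs" "set xs \<subseteq> P"
   by (auto simp: strict_lists_def dest: strict_order_distinct)
  thus "xs : {xs. set xs \<subseteq> P \<and> length xs \<le> card P}"
   using \<open>finite P\<close> by (auto simp: distinct_card[symmetric] intro: card_mono)
 qed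
qed (auto intro: finite_lists_length_le)

lemma chain_sum_empty [simp]: "chain_sum {} = 1"
proof -
 have "strict_lists {} = {[] :: 'a list}" by (auto simp: strict_lists_def)
 thus ?thesis by (simp add: chain_sum_def)
qed

text \<open>Nonempty chains are sorted by their largest element; removing it flips the sign and
  leaves a chain below it. The 1 is the empty chain.\<close>

lemma chain_sum_rec:
 assumes "finite P"
 shows "chain_sum P = 1 - (\<Sum>U\<in>P. chain_sum {V\<in>P. V < U})"
proof -
 have eq: "strict_lists P = insert [] (\<Union>U\<in>P. (%ys. ys @ [U]) ` strict_lists {V\<in>P. V < U})"
 proof (intro equalityI subsetI)
  fix xs assume xs: "xs : strict_lists P"
  show "xs : insert [] (\<Union>U\<in>P. (%ys. ys @ [U]) ` strict_lists {V\<in>P. V < U})"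
  proof (cases xs rule: rev_cases)
   case (snoc ys U)
   hence "U : P" "ys : strict_lists {V\<in>P. V < U}"
    using xs by (auto simp: strict_lists_def sorted_wrt_append)
   thus ?thesis using snoc by blast
  qed auto
 qed (auto simp: strict_lists_def sorted_wrt_append subset_iff)
 have "chain_sum P = 1 + (\<Sum>xs\<in>(\<Union>U\<in>P. (%ys. ys @ [U]) ` strict_lists {V\<in>P. V < U}). (-1) ^ length xs)"
  unfolding chain_sum_def eq using assms
  by (subst sum.insert) (auto intro!: finite_strict_lists)
 also have "(\<Sum>xs\<in>(\<Union>U\<in>P. (%ys. ys @ [U]) ` strict_lists {V\<in>P. V < U}). (-1) ^ length xs) =
  (\<Sum>U\<in>P. \<Sum>xs\<in>(%ys. ys @ [U]) ` strict_lists {V\<in>P. V < U}. (-1::int) ^ length xs)"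
  using assms by (intro sum.UNION_disjoint) (auto intro!: finite_strict_lists)
 also have "\<dots> = (\<Sum>U\<in>P. - chain_sum {V\<in>P. V < U})"
  by (intro sum.cong refl) (auto simp: chain_sum_def sum.reindex inj_on_def sum_negf)
 finally show ?thesis by (simp add: sum_negf)
qed

text \<open>A poset with an element \<open>w\<close> admitting meets with every other element is conically contractible
 through \<open>U \<ge> m U \<le> w\<close>; this is the corresponding statement about Euler characteristics.\<close>

lemma chain_sum_cone:
 assumes "finite P" "w : P"
  and "\<And>U. U : P ==> \<exists>m\<in>P. m \<le> U \<and> m \<le> w \<and> (\<forall>z\<in>P. z \<le> U \<longrightarrow> z \<le> w \<longrightarrow> z \<le> m)"
 shows "chain_sum P = 0"
 using assms
proof (induction "card P" arbitrary: P w rule: less_induct)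
 case (less P w)
 \<comment> \<open>For \<open>U\<close> not below \<open>w\<close> the meet \<open>m\<close> of
   \<open>U\<close> and \<open>w\<close> is strictly below \<open>U\<close>, and it is a cone point
   of the set below \<open>U\<close>: the meet of \<open>V\<close> with \<open>w\<close> also serves
   as the meet of \<open>V\<close> with \<open>m\<close>.\<close>
 have zero: "chain_sum {V\<in>P. V < U} = 0" if U: "U : P" "\<not> U \<le> w" for U
 proof -
  obtain m where m: "m : P" "m \<le> U" "m \<le> w" "\<forall>z\<in>P. z \<le> U \<longrightarrow> z \<le> w \<longrightarrow> z \<le> m"
   using less.prems(3)[OF U(1)] by blast
  have mU: "m < U" using m U by (auto simp: less_le)
  show ?thesis
  proof (rule less.hyps)
   show "card {V\<in>P. V < U} < card P" using less.prems(1) U by (intro psubset_card_mono) auto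
   show "m : {V\<in>P. V < U}" using m mU by auto
   fix V assume V: "V : {V\<in>P. V < U}"
   then obtain n where n: "n : P" "n \<le> V" "n \<le> w" "\<forall>z\<in>P. z \<le> V \<longrightarrow> z \<le> w \<longrightarrow> z \<le> n"
    using less.prems(3)[of V] by blast
   have "n < U" "n \<le> m" using n V m by auto
   thus "\<exists>n\<in>{V\<in>P. V < U}. n \<le> V \<and> n \<le> m \<and> (\<forall>z\<in>{V\<in>P. V < U}. z \<le> V \<longrightarrow> z \<le> m \<longrightarrow> z \<le> n)"
    using n m by (intro bexI[of _ n]) auto
  qed (use less.prems in auto)
 qed
 \<comment> \<open>Only the elements \<open>U \<le> w\<close> remain. By the recursion for the set
   below \<open>w\<close>, the term of \<open>w\<close> and the terms with \<open>U < w\<close> add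
   up to 1, and the recursion for \<open>P\<close> then gives 1 - 1.\<close>
 have "(\<Sum>U\<in>P. chain_sum {V\<in>P. V < U}) = (\<Sum>U\<in>{U\<in>P. U \<le> w}. chain_sum {V\<in>P. V < U})"
  using zero less.prems(1) by (intro sum.mono_neutral_right) auto
 also have "{U\<in>P. U \<le> w} = insert w {U\<in>P. U < w}" using less.prems(2) by auto
 also have "(\<Sum>U\<in>insert w {U\<in>P. U < w}. chain_sum {V\<in>P. V < U}) =
  chain_sum {V\<in>P. V < w} + (\<Sum>U\<in>{U\<in>P. U < w}. chain_sum {V\<in>P. V < U})"
  using less.prems(1) by (subst sum.insert) auto
 also have "(\<Sum>U\<in>{U\<in>P. U < w}. chain_sum {V\<in>P. V < U}) =
   (\<Sum>U\<in>{U\<in>P. U < w}. chain_sum {V\<in>{V\<in>P. V < w}. V < U})"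
  by (intro sum.cong refl arg_cong[of _ _ chain_sum]) auto
 also have "chain_sum {V\<in>P. V < w} + \<dots> = 1"
  using chain_sum_rec[of "{V\<in>P. V < w}"] less.prems(1) by simp
 finally show ?case using chain_sum_rec[OF less.prems(1)] by simp
qed

section \<open>Linear algebra over a finite field\<close>

text \<open>Vectors come as sequences rather than as finite sets, so that bases are ordered and the
  initial segments of one basis can span all members of a flag.\<close>

primrec lc :: "('k, 'm, 'z) module_scheme => nat => (nat => 'm) => (nat => 'k) => 'm" where
 "lc V 0 v x = \<zero>\<^bsub>V\<^esub>"
| "lc V (Suc n) v x = lc V n v x \<oplus>\<^bsub>V\<^esub> x n \<odot>\<^bsub>V\<^esub> v n"

lemma lc_cong:
 "(\<And>i. i < n ==> v i = v' i) ==> (\<And>i. i < n ==> x i = x' i) ==> lc V n v x = lc V n v' x'"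
 by (induction n) auto

locale finite_field = field K for K :: "('k, 'e) ring_scheme" (structure) +
 assumes finite_K: "finite (carrier K)"
begin

abbreviation "orth c A B \<equiv> \<forall>x\<in>A. \<forall>y\<in>B. c x y = \<zero>"

definition q :: nat where "q = card (carrier K)"

lemma q_gt_1: "q > 1"
proof -
 have "card {\<zero>, \<one>} \<le> card (carrier K)" using finite_K by (intro card_mono) auto
 thus ?thesis by (simp add: q_def)
qed

lemma q_power_inj [simp]: "q ^ m = q ^ n \<longleftrightarrow> m = n"
 using q_gt_1 by simp

definition cf :: "nat => (nat => 'k) set" where
 "cf n = ({..<n} \<rightarrow>\<^sub>E carrier K)"

lemma card_cf: "card (cf n) = q ^ n" and finite_cf: "finite (cf n)"
 using finite_K by (auto simp: cf_def card_PiE q_def intro: finite_PiE)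

lemma cf_D: "x : cf n ==> i < n ==> x i : carrier K"
 by (auto simp: cf_def)

lemma cf_ext: "x : cf n ==> y : cf n ==> (\<And>i. i < n ==> x i = y i) ==> x = y"
 unfolding cf_def by (rule PiE_ext) auto

lemma vs_add_closed [simp]: "vectorspace K V ==> x : carrier V ==> y : carrier V ==> x \<oplus>\<^bsub>V\<^esub> y : carrier V"
proof -
 assume "vectorspace K V" and a: "x : carrier V" "y : carrier V"
 then interpret V: vectorspace K V by simp
 show ?thesis using a by simp
qed

lemma vs_zero_closed [simp]: "vectorspace K V ==> \<zero>\<^bsub>V\<^esub> : carrier V"
proof -
 assume "vectorspace K V"
 then interpret V: vectorspace K V by simp
 show ?thesis by simp
qed

lemma vs_smult_closed [simp]: "vectorspace K V ==> c : carrier K ==> x : carrier V ==> c \<odot>\<^bsub>V\<^esub> x : carrier V"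
proof -
 assume "vectorspace K V" and a: "c : carrier K" "x : carrier V"
 then interpret V: vectorspace K V by simp
 show ?thesis using a by simp
qed

lemma vs_neg:
 assumes "vectorspace K V" "x : carrier V"
 shows "(\<ominus> \<one>) \<odot>\<^bsub>V\<^esub> x : carrier V" "x \<oplus>\<^bsub>V\<^esub> (\<ominus> \<one>) \<odot>\<^bsub>V\<^esub> x = \<zero>\<^bsub>V\<^esub>"
  "(\<ominus> \<one>) \<odot>\<^bsub>V\<^esub> x \<oplus>\<^bsub>V\<^esub> x = \<zero>\<^bsub>V\<^esub>"
proof -
 interpret V: vectorspace K V by fact
 have "(\<ominus> \<one>) \<odot>\<^bsub>V\<^esub> x = \<ominus>\<^bsub>V\<^esub> x" using assms(2) by (simp add: V.smult_l_minus)
 thus "(\<ominus> \<one>) \<odot>\<^bsub>V\<^esub> x : carrier V" "x \<oplus>\<^bsub>V\<^esub> (\<ominus> \<one>) \<odot>\<^bsub>V\<^esub> x = \<zero>\<^bsub>V\<^esub>"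
  "(\<ominus> \<one>) \<odot>\<^bsub>V\<^esub> x \<oplus>\<^bsub>V\<^esub> x = \<zero>\<^bsub>V\<^esub>"
  using assms(2) by (auto simp: V.M.r_neg V.M.l_neg)
qed

lemma vs_simps:
 assumes "vectorspace K V"
 shows "x : carrier V ==> x \<oplus>\<^bsub>V\<^esub> \<zero>\<^bsub>V\<^esub> = x"
  and "x : carrier V ==> \<zero>\<^bsub>V\<^esub> \<oplus>\<^bsub>V\<^esub> x = x"
  and "x : carrier V ==> \<zero> \<odot>\<^bsub>V\<^esub> x = \<zero>\<^bsub>V\<^esub>"
  and "x : carrier V ==> \<one> \<odot>\<^bsub>V\<^esub> x = x"
  and "c : carrier K ==> c \<odot>\<^bsub>V\<^esub> \<zero>\<^bsub>V\<^esub> = \<zero>\<^bsub>V\<^esub>"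
proof -
 interpret V: vectorspace K V by fact
 show "x : carrier V ==> x \<oplus>\<^bsub>V\<^esub> \<zero>\<^bsub>V\<^esub> = x"
  and "x : carrier V ==> \<zero>\<^bsub>V\<^esub> \<oplus>\<^bsub>V\<^esub> x = x"
  and "x : carrier V ==> \<zero> \<odot>\<^bsub>V\<^esub> x = \<zero>\<^bsub>V\<^esub>"
  and "x : carrier V ==> \<one> \<odot>\<^bsub>V\<^esub> x = x"
  and "c : carrier K ==> c \<odot>\<^bsub>V\<^esub> \<zero>\<^bsub>V\<^esub> = \<zero>\<^bsub>V\<^esub>" by simp_all
qed

lemma vs_distrib:
 assumes "vectorspace K V"
 shows "a : carrier K ==> b : carrier K ==> x : carrier V ==> (a \<oplus> b) \<odot>\<^bsub>V\<^esub> x = a \<odot>\<^bsub>V\<^esub> x \<oplus>\<^bsub>V\<^esub> b \<odot>\<^bsub>V\<^esub> x"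
  and "a : carrier K ==> x : carrier V ==> y : carrier V ==> a \<odot>\<^bsub>V\<^esub> (x \<oplus>\<^bsub>V\<^esub> y) = a \<odot>\<^bsub>V\<^esub> x \<oplus>\<^bsub>V\<^esub> a \<odot>\<^bsub>V\<^esub> y"
  and "a : carrier K ==> b : carrier K ==> x : carrier V ==> (a \<otimes> b) \<odot>\<^bsub>V\<^esub> x = a \<odot>\<^bsub>V\<^esub> (b \<odot>\<^bsub>V\<^esub> x)"
proof -
 interpret V: vectorspace K V by fact
 show "a : carrier K ==> b : carrier K ==> x : carrier V ==> (a \<oplus> b) \<odot>\<^bsub>V\<^esub> x = a \<odot>\<^bsub>V\<^esub> x \<oplus>\<^bsub>V\<^esub> b \<odot>\<^bsub>V\<^esub> x"
  and "a : carrier K ==> x : carrier V ==> y : carrier V ==> a \<odot>\<^bsub>V\<^esub> (x \<oplus>\<^bsub>V\<^esub> y) = a \<odot>\<^bsub>V\<^esub> x \<oplus>\<^bsub>V\<^esub> a \<odot>\<^bsub>V\<^esub> y"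
  and "a : carrier K ==> b : carrier K ==> x : carrier V ==> (a \<otimes> b) \<odot>\<^bsub>V\<^esub> x = a \<odot>\<^bsub>V\<^esub> (b \<odot>\<^bsub>V\<^esub> x)"
  by (simp_all add: V.smult_l_distr V.smult_r_distr V.smult_assoc1)
qed

lemma vs_ac:
 assumes "vectorspace K V"
 shows "x : carrier V ==> y : carrier V ==> x \<oplus>\<^bsub>V\<^esub> y = y \<oplus>\<^bsub>V\<^esub> x"
  and "x : carrier V ==> y : carrier V ==> z : carrier V ==> (x \<oplus>\<^bsub>V\<^esub> y) \<oplus>\<^bsub>V\<^esub> z = x \<oplus>\<^bsub>V\<^esub> (y \<oplus>\<^bsub>V\<^esub> z)"
  and "x : carrier V ==> y : carrier V ==> z : carrier V ==> x \<oplus>\<^bsub>V\<^esub> (y \<oplus>\<^bsub>V\<^esub> z) = y \<oplus>\<^bsub>V\<^esub> (x \<oplus>\<^bsub>V\<^esub> z)"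
proof -
 interpret V: vectorspace K V by fact
 show "x : carrier V ==> y : carrier V ==> x \<oplus>\<^bsub>V\<^esub> y = y \<oplus>\<^bsub>V\<^esub> x"
  and "x : carrier V ==> y : carrier V ==> z : carrier V ==> (x \<oplus>\<^bsub>V\<^esub> y) \<oplus>\<^bsub>V\<^esub> z = x \<oplus>\<^bsub>V\<^esub> (y \<oplus>\<^bsub>V\<^esub> z)"
  and "x : carrier V ==> y : carrier V ==> z : carrier V ==> x \<oplus>\<^bsub>V\<^esub> (y \<oplus>\<^bsub>V\<^esub> z) = y \<oplus>\<^bsub>V\<^esub> (x \<oplus>\<^bsub>V\<^esub> z)"
  by (simp_all add: V.M.a_ac)
qed

lemma vs_add_eq_zero:
 assumes V: "vectorspace K V" and "x : carrier V" "y : carrier V" "x \<oplus>\<^bsub>V\<^esub> (\<ominus> \<one>) \<odot>\<^bsub>V\<^esub> y = \<zero>\<^bsub>V\<^esub>"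
 shows "x = y"
proof -
 have "(x \<oplus>\<^bsub>V\<^esub> (\<ominus> \<one>) \<odot>\<^bsub>V\<^esub> y) \<oplus>\<^bsub>V\<^esub> y = y" using assms by (simp add: vs_simps)
 moreover have "(x \<oplus>\<^bsub>V\<^esub> (\<ominus> \<one>) \<odot>\<^bsub>V\<^esub> y) \<oplus>\<^bsub>V\<^esub> y = x \<oplus>\<^bsub>V\<^esub> ((\<ominus> \<one>) \<odot>\<^bsub>V\<^esub> y \<oplus>\<^bsub>V\<^esub> y)"
  using assms vs_neg by (intro vs_ac(2)) auto
 ultimately show ?thesis using assms by (simp add: vs_neg(3) vs_simps)
qed

lemma subspace_D:
 assumes "subspace K U V"
 shows "vectorspace K V" "U \<subseteq> carrier V" "\<zero>\<^bsub>V\<^esub> : U" "x : U ==> x : carrier V"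
  "x : U ==> y : U ==> x \<oplus>\<^bsub>V\<^esub> y : U" "c : carrier K ==> x : U ==> c \<odot>\<^bsub>V\<^esub> x : U"
 using assms by (auto simp: subspace_def submodule_def)

lemma subspaceI:
 assumes "vectorspace K V" "U \<subseteq> carrier V" "\<zero>\<^bsub>V\<^esub> : U" "\<And>x y. x : U ==> y : U ==> x \<oplus>\<^bsub>V\<^esub> y : U"
  "\<And>c x. c : carrier K ==> x : U ==> c \<odot>\<^bsub>V\<^esub> x : U"
 shows "subspace K U V"
 using assms by (auto simp: subspace_def submodule_def vectorspace_def)

lemma subspace_carrier: "vectorspace K V ==> subspace K (carrier V) V"
 by (rule subspaceI) auto

lemma subspace_zero: "vectorspace K V ==> subspace K {\<zero>\<^bsub>V\<^esub>} V"
 by (rule subspaceI) (auto simp: vs_simps)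

lemma subspace_Int: "subspace K U V ==> subspace K U' V ==> subspace K (U \<inter> U') V"
 by (rule subspaceI) (auto dest: subspace_D)

lemma lc_in: 
 assumes "subspace K U V" "\<And>i. i < n ==> v i : U" "\<And>i. i < n ==> x i : carrier K"
 shows "lc V n v x : U"
 using assms(2,3) by (induction n) (auto intro: subspace_D[OF assms(1)])

lemma lc_closed: 
 assumes "vectorspace K V" "\<And>i. i < n ==> v i : carrier V" "\<And>i. i < n ==> x i : carrier K"
 shows "lc V n v x : carrier V"
 using lc_in[OF subspace_carrier] assms by blast

lemma lc_add:
 assumes "vectorspace K V" "\<And>i. i < n ==> v i : carrier V" "\<And>i. i < n ==> x i : carrier K"
  "\<And>i. i < n ==> y i : carrier K"
 shows "lc V n v (%i. x i \<oplus> y i) = lc V n v x \<oplus>\<^bsub>V\<^esub> lc V n v y"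
 using assms(2-)
proof (induction n)
 case (Suc n)
 hence "lc V n v x : carrier V" "lc V n v y : carrier V" by (auto intro!: lc_closed assms(1))
 thus ?case using Suc assms(1) by (simp add: vs_distrib vs_ac)
qed (use assms(1) in \<open>simp add: vs_simps\<close>)

lemma lc_smult:
 assumes "vectorspace K V" "\<And>i. i < n ==> v i : carrier V" "\<And>i. i < n ==> x i : carrier K" "c : carrier K"
 shows "lc V n v (%i. c \<otimes> x i) = c \<odot>\<^bsub>V\<^esub> lc V n v x"
 using assms(2-)
proof (induction n)
 case (Suc n)
 hence "lc V n v x : carrier V" by (auto intro!: lc_closed assms(1))
 thus ?case using Suc assms(1) by (simp add: vs_distrib)
qed (use assms(1) in \<open>simp add: vs_simps\<close>)

lemma lc_zero:
 assumes "vectorspace K V" "\<And>i. i < n ==> v i : carrier V" "\<And>i. i < n ==> x i = \<zero>"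
 shows "lc V n v x = \<zero>\<^bsub>V\<^esub>"
 using assms(2-) by (induction n) (auto simp: vs_simps assms(1))

lemma lc_unit:
 assumes "vectorspace K V" "\<And>i. i < n ==> v i : carrier V" "j < n"
 shows "lc V n v (%i. if i = j then \<one> else \<zero>) = v j"
 using assms(2-)
proof (induction n)
 case (Suc n)
 show ?case
 proof (cases "j = n")
  case True
  have "lc V n v (%i. if i = j then \<one> else \<zero>) = \<zero>\<^bsub>V\<^esub>"
   using True Suc.prems by (intro lc_zero assms(1)) auto
  thus ?thesis using True Suc.prems assms(1) by (simp add: vs_simps)
 qed (use Suc assms(1) in \<open>auto simp: vs_simps\<close>)
qed auto

section \<open>Independent sequences, spans and dimension\<close>

definition indep :: "('k, 'm, 'z) module_scheme => nat => (nat => 'm) => bool" where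
 "indep V n v \<longleftrightarrow> (\<forall>i<n. v i : carrier V) \<and> (\<forall>x\<in>cf n. lc V n v x = \<zero>\<^bsub>V\<^esub> \<longrightarrow> (\<forall>i<n. x i = \<zero>))"

definition lspan :: "('k, 'm, 'z) module_scheme => nat => (nat => 'm) => 'm set" where
 "lspan V n v = lc V n v ` cf n"

lemma lspan_cong: "(\<And>i. i < n ==> v i = v' i) ==> lspan V n v = lspan V n v'"
 unfolding lspan_def by (intro image_cong refl lc_cong) auto

lemma indep_cong: "(\<And>i. i < n ==> v i = v' i) ==> indep V n v = indep V n v'"
 using lc_cong[of n v v' _ _ V] unfolding indep_def by (intro conj_cong ball_cong all_cong refl) auto

lemma lspanI:
 assumes "\<And>i. i < n ==> x i : carrier K"
 shows "lc V n v x : lspan V n v"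
proof -
 have "lc V n v x = lc V n v (restrict x {..<n})" by (intro lc_cong) auto
 moreover have "restrict x {..<n} : cf n" using assms by (auto simp: cf_def)
 ultimately show ?thesis by (auto simp: lspan_def)
qed

lemma subspace_lspan:
 assumes V: "vectorspace K V" "\<And>i. i < n ==> v i : carrier V"
 shows "subspace K (lspan V n v) V"
proof (rule subspaceI)
 show "lspan V n v \<subseteq> carrier V" using assms by (auto simp: lspan_def cf_D intro!: lc_closed)
 have "lc V n v (%i. \<zero>) : lspan V n v" by (rule lspanI) auto
 thus "\<zero>\<^bsub>V\<^esub> : lspan V n v" using lc_zero[OF V, where x = "%i. \<zero>"] by simp
 show "x \<oplus>\<^bsub>V\<^esub> y : lspan V n v" if xy: "x : lspan V n v" "y : lspan V n v" for x y
 proof -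
  obtain a b where ab: "a : cf n" "b : cf n" "x = lc V n v a" "y = lc V n v b"
   using xy by (auto simp: lspan_def)
  have "x \<oplus>\<^bsub>V\<^esub> y = lc V n v (%i. a i \<oplus> b i)" using ab V by (subst lc_add) (auto dest: cf_D)
  thus ?thesis using ab by (auto intro!: lspanI dest: cf_D)
 qed
 show "c \<odot>\<^bsub>V\<^esub> x : lspan V n v" if x: "x : lspan V n v" and c: "c : carrier K" for x c
 proof -
  obtain a where a: "a : cf n" "x = lc V n v a" using x by (auto simp: lspan_def)
  have "c \<odot>\<^bsub>V\<^esub> x = lc V n v (%i. c \<otimes> a i)" using a c V by (subst lc_smult) (auto dest: cf_D)
  thus ?thesis using a c by (auto intro!: lspanI dest: cf_D)
 qed
qed (use V in auto)

lemma lspan_subset: "subspace K U V ==> (\<And>i. i < n ==> v i : U) ==> lspan V n v \<subseteq> U"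
 by (auto simp: lspan_def cf_D intro!: lc_in)

lemma lspan_mem:
 assumes "vectorspace K V" "\<And>i. i < n ==> v i : carrier V" "j < n"
 shows "v j : lspan V n v"
 using lspanI[of n "%i. if i = j then \<one> else \<zero>" V v] lc_unit[OF assms] by auto

lemma lspan_mono:
 assumes "vectorspace K V" "\<And>i. i < n ==> v i : carrier V" "m \<le> n"
 shows "lspan V m v \<subseteq> lspan V n v"
 using assms by (intro lspan_subset subspace_lspan lspan_mem) auto

lemma lspan_0 [simp]: "lspan V 0 v = {\<zero>\<^bsub>V\<^esub>}"
 by (auto simp: lspan_def cf_def)

lemma indep_0 [simp]: "indep V 0 v"
 by (simp add: indep_def)

lemma indep_D: "indep V n v ==> i < n ==> v i : carrier V"
 by (auto simp: indep_def)

lemma indep_inj: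
 assumes "vectorspace K V" "indep V n v"
 shows "inj_on (lc V n v) (cf n)"
proof (rule inj_onI)
 fix x y assume xy: "x : cf n" "y : cf n" "lc V n v x = lc V n v y"
 define z where "z = (\<lambda>i\<in>{..<n}. x i \<oplus> (\<ominus> \<one>) \<otimes> y i)"
 have z: "z : cf n" using xy by (auto simp: z_def cf_def)
 have "lc V n v z = lc V n v (%i. x i \<oplus> (\<ominus> \<one>) \<otimes> y i)" by (intro lc_cong) (auto simp: z_def)
 also have "\<dots> = lc V n v x \<oplus>\<^bsub>V\<^esub> (\<ominus> \<one>) \<odot>\<^bsub>V\<^esub> lc V n v y"
 proof -
  have "lc V n v (%i. (\<ominus> \<one>) \<otimes> y i) = (\<ominus> \<one>) \<odot>\<^bsub>V\<^esub> lc V n v y"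
   using assms xy by (intro lc_smult) (auto dest: cf_D indep_D)
  thus ?thesis using assms xy by (subst lc_add) (auto dest: cf_D indep_D)
 qed
 also have "\<dots> = \<zero>\<^bsub>V\<^esub>" using xy assms by (auto intro!: vs_neg lc_closed dest: cf_D indep_D)
 finally have "\<forall>i<n. z i = \<zero>" using assms(2) z by (auto simp: indep_def)
 have "x i = y i" if "i < n" for i
 proof -
  have c: "x i : carrier K" "y i : carrier K" using xy that by (auto dest: cf_D)
  have "x i \<oplus> (\<ominus> \<one>) \<otimes> y i = \<zero>" using \<open>\<forall>i<n. z i = \<zero>\<close> that by (simp add: z_def)
  hence "x i \<ominus> y i = \<zero>" using c by (simp add: a_minus_def l_minus)
  thus ?thesis using c by (simp add: r_right_minus_eq)
 qed
 thus "x = y" using xy by (intro cf_ext[of x n y])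
qed

lemma card_lspan: "vectorspace K V ==> indep V n v ==> card (lspan V n v) = q ^ n"
 by (simp add: lspan_def card_image indep_inj card_cf)

lemma finite_lspan: "finite (lspan V n v)"
 by (simp add: lspan_def finite_cf)

text \<open>This recursion is what makes independent sequences countable: the next vector may be
  anything outside the span of the previous ones.\<close>

lemma indep_Suc:
 assumes V: "vectorspace K V"
 shows "indep V (Suc n) v \<longleftrightarrow> indep V n v \<and> v n : carrier V - lspan V n v"
proof safe
 assume L: "indep V (Suc n) v"
 hence vc: "v i : carrier V" if "i \<le> n" for i using that by (auto simp: indep_def)
 show "v n : carrier V" using vc by simp
 show "indep V n v" unfolding indep_def
 proof safe
  fix x i assume x: "x : cf n" "lc V n v x = \<zero>\<^bsub>V\<^esub>" "i < n"
  have "lc V (Suc n) v (x(n := \<zero>)) = lc V n v x"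
   using lc_cong[of n v v "x(n:=\<zero>)" x V] x vc V by (auto simp: vs_simps)
  moreover have "x(n := \<zero>) : cf (Suc n)" using x by (auto simp: cf_def PiE_iff extensional_def)
  ultimately have "\<forall>i<Suc n. (x(n := \<zero>)) i = \<zero>"
   using L x(2) unfolding indep_def by (simp only: ball_simps) blast
  hence "(x(n := \<zero>)) i = \<zero>" using x(3) less_SucI by blast
  thus "x i = \<zero>" using x(3) by simp
 qed (use vc in auto)
 assume "v n : lspan V n v"
 then obtain x where x: "x : cf n" "v n = lc V n v x" by (auto simp: lspan_def)
 \<comment> \<open>If \<open>v n\<close> were in the span, the coefficient -1 at position
   \<open>n\<close> would give a vanishing combination, and independence would force -1 = 0.\<close>
 have "lc V (Suc n) v (x(n := \<ominus> \<one>)) = lc V n v x \<oplus>\<^bsub>V\<^esub> (\<ominus> \<one>) \<odot>\<^bsub>V\<^esub> lc V n v x"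
  using lc_cong[of n v v "x(n:=\<ominus> \<one>)" x V] x by auto
 also have "\<dots> = \<zero>\<^bsub>V\<^esub>" using vc[of n] x V by (intro vs_neg) auto
 finally have "lc V (Suc n) v (x(n := \<ominus> \<one>)) = \<zero>\<^bsub>V\<^esub>" .
 moreover have "x(n := \<ominus> \<one>) : cf (Suc n)" using x by (auto simp: cf_def PiE_iff extensional_def)
 ultimately have "\<ominus> \<one> = \<zero>" using L unfolding indep_def by (metis fun_upd_same lessI)
 hence "\<ominus> (\<ominus> \<one>) = \<zero>" by simp
 thus False by simp
next
 assume i: "indep V n v" and vn: "v n : carrier V" "v n \<notin> lspan V n v"
 have vc: "v i : carrier V" if "i \<le> n" for i using that i vn by (cases "i = n") (auto simp: indep_def)
 show "indep V (Suc n) v" unfolding indep_def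
 proof safe
  fix x j assume x: "x : cf (Suc n)" "lc V (Suc n) v x = \<zero>\<^bsub>V\<^esub>" and j: "j < Suc n"
  have xc: "x i : carrier K" if "i \<le> n" for i using x(1) that by (auto intro: cf_D)
  have l: "lc V n v x : carrier V" using xc vc V by (intro lc_closed) auto
  have xn: "x n = \<zero>"
  proof (rule ccontr)
   assume n0: "x n \<noteq> \<zero>"
   \<comment> \<open>Scaling the relation by the inverse of its last coefficient would put
     \<open>v n\<close> into the span of the earlier vectors.\<close>
   define c where "c = inv (x n)"
   have c: "c : carrier K" "c \<otimes> x n = \<one>" using n0 xc[of n] by (auto simp: c_def field_Units)
   have "c \<odot>\<^bsub>V\<^esub> (lc V n v x \<oplus>\<^bsub>V\<^esub> x n \<odot>\<^bsub>V\<^esub> v n) = \<zero>\<^bsub>V\<^esub>" using x(2) c V by (simp add: vs_simps)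
   hence "c \<odot>\<^bsub>V\<^esub> lc V n v x \<oplus>\<^bsub>V\<^esub> v n = \<zero>\<^bsub>V\<^esub>"
    using c l vn xc[of n] V by (simp add: vs_distrib(2) vs_distrib(3)[symmetric] vs_simps)
   hence 1: "v n \<oplus>\<^bsub>V\<^esub> c \<odot>\<^bsub>V\<^esub> lc V n v x = \<zero>\<^bsub>V\<^esub>"
    using c l vn V by (simp add: vs_ac(1))
   define y where "y = (\<ominus> \<one>) \<odot>\<^bsub>V\<^esub> (c \<odot>\<^bsub>V\<^esub> lc V n v x)"
   have "(\<ominus> \<one>) \<odot>\<^bsub>V\<^esub> y = c \<odot>\<^bsub>V\<^esub> lc V n v x"
    unfolding y_def using c l V by (simp add: vs_distrib(3)[symmetric] vs_simps l_minus r_minus)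
   hence 2: "v n \<oplus>\<^bsub>V\<^esub> (\<ominus> \<one>) \<odot>\<^bsub>V\<^esub> y = \<zero>\<^bsub>V\<^esub>" using 1 by (simp only:)
   have "y : carrier V" using c l V by (simp add: y_def)
   hence "v n = y" using vs_add_eq_zero[OF V vn(1) _ 2] by blast
   moreover have "y : lspan V n v" unfolding y_def
    using vc xc c(1) by (intro subspace_D(6)[OF subspace_lspan[OF V]] lspanI) auto
   ultimately show False using vn by simp
  qed
  have "lc V n v (restrict x {..<n}) = lc V n v x" by (intro lc_cong) auto
  also have "\<dots> = \<zero>\<^bsub>V\<^esub>" using x(2) xn l vn V by (simp add: vs_simps)
  finally have "lc V n v (restrict x {..<n}) = \<zero>\<^bsub>V\<^esub>" .
  moreover have "restrict x {..<n} : cf n" using xc by (auto simp: cf_def)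
  ultimately have "\<forall>i<n. restrict x {..<n} i = \<zero>" using i unfolding indep_def by blast
  hence "\<forall>i<n. x i = \<zero>" by simp
  thus "x j = \<zero>" using xn j by (auto simp: less_Suc_eq)
 qed (use vc in auto)
qed

lemma indep_mono: "vectorspace K V ==> indep V n v ==> m \<le> n ==> indep V m v"
 by (induction n) (auto simp: indep_Suc le_Suc_eq)

text \<open>Vectors of \<open>W\<close> outside the current span are appended until none is left.
  The given vectors stay in place, so the construction can be iterated along a flag.\<close>

lemma basis_extend:
 assumes V: "vectorspace K V" and W: "subspace K W V" "finite W" and v: "indep V n v" "lspan V n v \<subseteq> W"
 shows "\<exists>m v'. n \<le> m \<and> (\<forall>i<n. v' i = v i) \<and> indep V m v' \<and> lspan V m v' = W"
 using v
proof (induction "card (W - lspan V n v)" arbitrary: n v rule: less_induct)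
 case (less n v)
 show ?case
 proof (cases "lspan V n v = W")
  case True thus ?thesis using less.prems by blast
 next
  case False
  then obtain w where w: "w : W" "w \<notin> lspan V n v" using less.prems by auto
  define v' where "v' = v(n := w)"
  have eq: "lspan V n v' = lspan V n v" "indep V n v' = indep V n v"
   by (intro lspan_cong indep_cong; simp add: v'_def)+
  have i: "indep V (Suc n) v'"
   using eq less.prems w subspace_D(4)[OF W(1)] V by (auto simp: indep_Suc v'_def)
  have vW: "v' j : W" if "j < Suc n" for j
   using lspan_mem[OF V, of n v j] indep_D[OF less.prems(1)] less.prems(2) that w
   by (cases "j = n") (auto simp: v'_def)
  have sub: "lspan V (Suc n) v' \<subseteq> W" using vW by (intro lspan_subset W) auto
  have "w : lspan V (Suc n) v'" using lspan_mem[OF V, of "Suc n" v' n] indep_D[OF i] by (simp add: v'_def)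
  moreover have "lspan V n v \<subseteq> lspan V (Suc n) v'"
   using lspan_mono[OF V, of "Suc n" v' n] indep_D[OF i] eq by simp
  ultimately have "card (W - lspan V (Suc n) v') < card (W - lspan V n v)"
   using w W by (intro psubset_card_mono) auto
  from less.hyps[OF this i sub] obtain m u where "Suc n \<le> m" "\<forall>i<Suc n. u i = v' i" "indep V m u" "lspan V m u = W"
   by blast
  thus ?thesis by (intro exI[of _ m] exI[of _ u]) (auto simp: v'_def)
 qed
qed

lemma basis_exists:
 assumes "subspace K W V" "finite W"
 obtains n v where "indep V n v" "lspan V n v = W" "card W = q ^ n"
 using basis_extend[OF subspace_D(1)[OF assms(1)] assms, of 0 undefined] subspace_D[OF assms(1)]
  card_lspan[OF subspace_D(1)[OF assms(1)]] by auto

text \<open>Over a finite field the cardinality determines the dimension, so dimension formulas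
  below are obtained by counting. The value is meaningful for sets whose cardinality is a power of
  \<open>q\<close>, in particular for all finite subspaces.\<close>

definition sdim :: "'m set => nat" where
 "sdim U = (THE n. card U = q ^ n)"

lemma sdim_eqI: "card U = q ^ n ==> sdim U = n"
 unfolding sdim_def by (rule the_equality) auto

lemma card_subspace: "subspace K W V ==> finite W ==> card W = q ^ sdim W"
 by (metis basis_exists sdim_eqI)

lemma sdim_mono: "subspace K U V ==> subspace K W V ==> finite W ==> U \<subseteq> W ==> sdim U \<le> sdim W"
 using card_mono[of W U] card_subspace[of U V] card_subspace[of W V] q_gt_1 finite_subset[of U W]
 by (simp add: power_increasing_iff)

text \<open>A basis of each member is extended to one of the next. In such a basis a condition on
  members of the flag becomes a condition on blocks of coordinates, which is how all vanishing
  conditions are counted below.\<close>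

lemma adapted_basis:
 assumes V: "vectorspace K V" and L: "\<And>k. k \<le> T ==> subspace K (L k) V" "\<And>k. k \<le> T ==> finite (L k)"
  "\<And>k. k < T ==> L k \<subseteq> L (Suc k)"
 shows "\<exists>v. indep V (sdim (L T)) v \<and> (\<forall>k\<le>T. lspan V (sdim (L k)) v = L k)"
 using L
proof (induction T)
 case 0
 obtain n v where nv: "indep V n v" "lspan V n v = L 0" "card (L 0) = q ^ n"
  using basis_exists[of "L 0" V] 0 by auto
 have "sdim (L 0) = n" using nv by (intro sdim_eqI) auto
 thus ?case using nv by auto
next
 case (Suc T)
 then obtain v where v: "indep V (sdim (L T)) v" "\<forall>k\<le>T. lspan V (sdim (L k)) v = L k" by auto
 obtain m v' where m: "sdim (L T) \<le> m" "\<forall>i<sdim (L T). v' i = v i" "indep V m v'" "lspan V m v' = L (Suc T)"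
  using basis_extend[OF V, of "L (Suc T)" "sdim (L T)" v] v Suc.prems by auto
 have sm: "sdim (L (Suc T)) = m" using m V by (intro sdim_eqI) (metis card_lspan)
 have mono: "L k \<subseteq> L T" if "k \<le> T" for k
  using that
 proof (induction rule: inc_induct)
  case (step j) thus ?case using Suc.prems(3)[of j] by auto
 qed auto
 have "lspan V (sdim (L k)) v' = L k" if "k \<le> Suc T" for k
 proof (cases "k = Suc T")
  case False
  hence "sdim (L k) \<le> sdim (L T)" using that Suc.prems mono by (intro sdim_mono[of _ V]) auto
  hence "lspan V (sdim (L k)) v' = lspan V (sdim (L k)) v" using m by (intro lspan_cong) auto
  thus ?thesis using v False that by auto
 qed (use m sm in auto)
 thus ?case using m sm by blast
qed

text \<open>Since the sets \<open>S r\<close> increase, the span of the first \<open>r\<close>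
  vectors lies in \<open>S r\<close> and removes exactly \<open>q ^ r\<close> of its elements.
  Letting \<open>S\<close> vary with \<open>r\<close> admits matrices whose first rows are
  restricted.\<close>

lemma card_indep_tuples:
 assumes V: "vectorspace K V" and S: "\<And>r. r < n ==> subspace K (S r) V" "\<And>r. r < n ==> finite (S r)"
  "\<And>r r'. r \<le> r' ==> r' < n ==> S r \<subseteq> S r'"
 shows "card {v : Pi\<^sub>E {..<n} S. indep V n v} = (\<Prod>r<n. card (S r) - q ^ r)"
 using S
proof (induction n)
 case (Suc n)
 let ?A = "%n. {v : Pi\<^sub>E {..<n} S. indep V n v}"
 have fin: "finite (?A m)" if "m \<le> Suc n" for m
  using Suc.prems(2) that by (intro finite_subset[OF _ finite_PiE[of "{..<m}" S]]) auto
 have "card (?A (Suc n)) = card (?A n) * (card (S n) - q ^ n)"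
 proof (rule card_fibres[where f = "%v. restrict v {..<n}"])
  show "restrict v {..<n} : ?A n" if "v : ?A (Suc n)" for v
   using that indep_cong[of n v "restrict v {..<n}" V] by (auto simp: indep_Suc[OF V] PiE_iff)
  fix v assume v: "v : ?A n"
  have sp: "lspan V n v \<subseteq> S n"
  proof (intro lspan_subset Suc.prems)
   fix i assume "i < n"
   thus "v i : S n" using v Suc.prems(3)[of i n] by (auto simp: PiE_iff)
  qed auto
  have eq: "indep V n (v(n := w)) = indep V n v" "lspan V n (v(n := w)) = lspan V n v" for w
   by (intro indep_cong lspan_cong; simp)+
  have "{u : ?A (Suc n). restrict u {..<n} = v} = (%w. v(n := w)) ` (S n - lspan V n v)"
  proof (intro equalityI subsetI)
   fix u assume u: "u : {u : ?A (Suc n). restrict u {..<n} = v}"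
   have uv: "u = v(n := u n)"
   proof
    fix i show "u i = (v(n := u n)) i"
     using u by (cases "i < n"; cases "i = n") (auto simp: PiE_iff extensional_def)
   qed
   have "u n : S n" "u n \<notin> lspan V n u" using u by (auto simp: indep_Suc[OF V] PiE_iff)
   moreover have "lspan V n u = lspan V n v"
   proof (rule lspan_cong)
    fix i assume "i < n"
    moreover have "restrict u {..<n} = v" using u by simp
    ultimately show "u i = v i" by (metis restrict_apply lessThan_iff)
   qed
   ultimately show "u : (%w. v(n := w)) ` (S n - lspan V n v)" using uv by blast
  next
   fix u assume "u : (%w. v(n := w)) ` (S n - lspan V n v)"
   then obtain w where w: "w : S n" "w \<notin> lspan V n v" "u = v(n := w)" by auto
   have "indep V (Suc n) u" using v w subspace_D(4)[OF Suc.prems(1)[of n]] by (auto simp: indep_Suc[OF V] eq)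
   moreover have "restrict u {..<n} = v"
   proof
    fix i show "restrict u {..<n} i = v i" using v w(3) by (cases "i < n") (auto simp: PiE_iff extensional_def)
   qed
   moreover have "u : Pi\<^sub>E {..<Suc n} S"
   proof (rule PiE_I)
    fix i assume "i : {..<Suc n}"
    thus "u i : S i" using v w by (cases "i = n") (auto simp: PiE_iff)
   next
    fix i assume "i \<notin> {..<Suc n}"
    thus "u i = undefined" using v w by (auto simp: PiE_iff extensional_def)
   qed
   ultimately show "u : {u : ?A (Suc n). restrict u {..<n} = v}" by simp
  qed
  moreover have "inj_on (%w. v(n := w)) (S n - lspan V n v)"
   by (rule inj_onI) (metis fun_upd_same)
  ultimately have "card {u : ?A (Suc n). restrict u {..<n} = v} = card (S n - lspan V n v)"
   by (simp add: card_image)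
  also have "\<dots> = card (S n) - q ^ n"
   using v sp card_lspan[OF V, of n v] by (simp add: card_Diff_subset finite_lspan)
  finally show "card {u : ?A (Suc n). restrict u {..<n} = v} = card (S n) - q ^ n" .
 qed (use fin in auto)
 thus ?case using Suc by simp
qed auto

end

section \<open>Linear maps on subspaces and functionals\<close>

context finite_field
begin

text \<open>The field as a vector space over itself, the target of functionals and of bilinear forms
  with one argument fixed.\<close>

definition KV :: "('k, 'k) module" where
 "KV = \<lparr>carrier = carrier K, mult = (\<otimes>), one = \<one>, zero = \<zero>, add = (\<oplus>), smult = (\<otimes>)\<rparr>"

lemma KV_simps [simp]: "carrier KV = carrier K" "zero KV = \<zero>" "add KV = (\<oplus>)" "smult KV = (\<otimes>)"
 by (simp_all add: KV_def)

lemma vs_KV [simp]: "vectorspace K KV"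
proof (rule vs_criteria)
 show "\<forall>v\<in>carrier KV. \<exists>neg_v\<in>carrier KV. v \<oplus>\<^bsub>KV\<^esub> neg_v = \<zero>\<^bsub>KV\<^esub>"
  by (auto intro!: bexI[of _ "\<ominus> _"] r_neg)
qed (use field_axioms in \<open>auto simp: m_assoc a_ac l_distr r_distr\<close>)

abbreviation Vs :: "nat => ('k, nat => 'k) module" where
 "Vs n \<equiv> func_space {..<n}"

lemma vs_Vs [simp]: "vectorspace K (Vs n)"
 by (rule vectorspace.func_space_is_vs[OF vs_KV])

lemma Vs_simps [simp]: "carrier (Vs n) = cf n" "zero (Vs n) = (\<lambda>i\<in>{..<n}. \<zero>)"
 "add (Vs n) = (%x y. \<lambda>i\<in>{..<n}. x i \<oplus> y i)" "smult (Vs n) = (%c x. \<lambda>i\<in>{..<n}. c \<otimes> x i)"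
 by (simp_all add: func_space_def cf_def)

lemma lc_Vs: "s < n ==> lc (Vs n) l z a s = lc KV l (%r. z r s) a"
 by (induction l) auto

lemma basis_mem: "vectorspace K V ==> indep V n e ==> lspan V n e = U ==> i < n ==> e i : U"
 using lspan_mem[of V n e i] indep_D[of V n e] by auto

lemma adapted_basis2:
 assumes "subspace K A V" "subspace K L V" "A \<subseteq> L" "finite L"
 obtains e where "indep V (sdim L) e" "lspan V (sdim L) e = L" "lspan V (sdim A) e = A"
proof -
 define F where "F = (%k::nat. if k = 0 then A else L)"
 have "\<exists>e. indep V (sdim (F 1)) e \<and> (\<forall>k\<le>1. lspan V (sdim (F k)) e = F k)"
  by (rule adapted_basis[OF subspace_D(1)[OF assms(1)]])
   (use assms finite_subset[OF assms(3,4)] in \<open>auto simp: F_def\<close>)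
 then obtain e where e: "indep V (sdim (F 1)) e" "\<forall>k\<le>1. lspan V (sdim (F k)) e = F k" by blast
 show ?thesis using that[of e] e(1) e(2)[rule_format, of 0] e(2)[rule_format, of 1] by (simp add: F_def)
qed

text \<open>The domain is a subset of the carrier, so that maps on subspaces need no module
  structure of their own.\<close>

definition lin :: "('k, 'm, 'y) module_scheme => 'm set => ('k, 'n, 'z) module_scheme => ('m => 'n) => bool" where
 "lin V U W f \<longleftrightarrow> (\<forall>x\<in>U. f x : carrier W) \<and> (\<forall>x\<in>U. \<forall>y\<in>U. f (x \<oplus>\<^bsub>V\<^esub> y) = f x \<oplus>\<^bsub>W\<^esub> f y) \<and>
  (\<forall>c\<in>carrier K. \<forall>x\<in>U. f (c \<odot>\<^bsub>V\<^esub> x) = c \<odot>\<^bsub>W\<^esub> f x)"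

lemma linI:
 assumes "\<And>x. x : U ==> f x : carrier W" "\<And>x y. x : U ==> y : U ==> f (x \<oplus>\<^bsub>V\<^esub> y) = f x \<oplus>\<^bsub>W\<^esub> f y"
  "\<And>c x. c : carrier K ==> x : U ==> f (c \<odot>\<^bsub>V\<^esub> x) = c \<odot>\<^bsub>W\<^esub> f x"
 shows "lin V U W f"
 using assms by (auto simp: lin_def)

lemma lin_D:
 assumes "lin V U W f"
 shows "x : U ==> f x : carrier W" "x : U ==> y : U ==> f (x \<oplus>\<^bsub>V\<^esub> y) = f x \<oplus>\<^bsub>W\<^esub> f y"
  "c : carrier K ==> x : U ==> f (c \<odot>\<^bsub>V\<^esub> x) = c \<odot>\<^bsub>W\<^esub> f x"
 using assms by (auto simp: lin_def)

lemma lin_subset: "lin V U W f ==> U' \<subseteq> U ==> lin V U' W f"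
 by (auto simp: lin_def subset_iff)

lemma lin_cong:
 assumes "lin V U W f" "subspace K U V" "\<And>x. x : U ==> g x = f x"
 shows "lin V U W g"
proof (rule linI)
 show "g (x \<oplus>\<^bsub>V\<^esub> y) = g x \<oplus>\<^bsub>W\<^esub> g y" if "x : U" "y : U" for x y
  using that assms(3) lin_D[OF assms(1)] subspace_D(5)[OF assms(2)] by simp
 show "g (c \<odot>\<^bsub>V\<^esub> x) = c \<odot>\<^bsub>W\<^esub> g x" if "c : carrier K" "x : U" for c x
  using that assms(3) lin_D[OF assms(1)] subspace_D(6)[OF assms(2)] by simp
qed (use assms(3) lin_D[OF assms(1)] in auto)

lemma lin_zero:
 assumes "lin V U W f" "subspace K U V" "vectorspace K W"
 shows "f \<zero>\<^bsub>V\<^esub> = \<zero>\<^bsub>W\<^esub>"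
proof -
 have z: "\<zero>\<^bsub>V\<^esub> : U" by (rule subspace_D(3)[OF assms(2)])
 have "f \<zero>\<^bsub>V\<^esub> = f (\<zero> \<odot>\<^bsub>V\<^esub> \<zero>\<^bsub>V\<^esub>)" using subspace_D(1)[OF assms(2)] by (simp add: vs_simps)
 also have "\<dots> = \<zero> \<odot>\<^bsub>W\<^esub> f \<zero>\<^bsub>V\<^esub>" using lin_D(3)[OF assms(1) _ z] by simp
 also have "\<dots> = \<zero>\<^bsub>W\<^esub>" using lin_D(1)[OF assms(1) z] assms(3) by (simp add: vs_simps)
 finally show ?thesis .
qed

lemma lin_lc:
 assumes "lin V U W f" "subspace K U V" "vectorspace K W" "\<And>i. i < n ==> v i : U" "\<And>i. i < n ==> x i : carrier K"
 shows "f (lc V n v x) = lc W n (%i. f (v i)) x"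
 using assms(4,5)
proof (induction n)
 case (Suc n)
 have "lc V n v x : U" using Suc.prems by (intro lc_in[OF assms(2)]) auto
 moreover have "x n \<odot>\<^bsub>V\<^esub> v n : U" using Suc.prems by (intro subspace_D(6)[OF assms(2)]) auto
 ultimately show ?case using Suc.IH Suc.prems lin_D[OF assms(1)] by simp
qed (simp add: lin_zero[OF assms(1-3)])

lemma lin_comp:
 "lin V U W f ==> lin W U' X g ==> (\<And>x. x : U ==> f x : U') ==> lin V U X (%x. g (f x))"
 by (rule linI) (simp_all add: lin_D)

lemma lin_eq_on_basis:
 assumes "lin V U W f" "lin V U W g" "subspace K U V" "vectorspace K W"
  "indep V n e" "lspan V n e = U" "\<And>i. i < n ==> f (e i) = g (e i)" "x : U"
 shows "f x = g x"
proof -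
 obtain a where a: "a : cf n" "x = lc V n e a" using assms(6,8) by (auto simp: lspan_def)
 note e = basis_mem[OF subspace_D(1)[OF assms(3)] assms(5,6)]
 have "f x = lc W n (%i. f (e i)) a" unfolding a(2)
  by (rule lin_lc[OF assms(1,3,4) e cf_D[OF a(1)]])
 also have "\<dots> = lc W n (%i. g (e i)) a" by (rule lc_cong) (use assms(7) in auto)
 also have "\<dots> = g x" unfolding a(2)
  by (rule lin_lc[OF assms(2,3,4) e cf_D[OF a(1)], symmetric])
 finally show ?thesis .
qed

definition coord :: "('k, 'm, 'z) module_scheme => nat => (nat => 'm) => 'm => nat => 'k" where
 "coord V n v = inv_into (cf n) (lc V n v)"

lemma coord:
 assumes "vectorspace K V" "indep V n v"
 shows "u : lspan V n v ==> coord V n v u : cf n" "u : lspan V n v ==> lc V n v (coord V n v u) = u"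
  "x : cf n ==> coord V n v (lc V n v x) = x"
 unfolding coord_def lspan_def
 by (auto simp: inv_into_into f_inv_into_f inv_into_f_f[OF indep_inj[OF assms]])

lemma lin_coord: 
 assumes V: "vectorspace K V" and v: "indep V n v"
 shows "lin V (lspan V n v) (Vs n) (coord V n v)"
proof (rule linI)
 note vc = indep_D[OF v]
 note co = coord[OF V v]
 show "coord V n v x : carrier (Vs n)" if "x : lspan V n v" for x using co(1)[OF that] by simp
 show "coord V n v (x \<oplus>\<^bsub>V\<^esub> y) = coord V n v x \<oplus>\<^bsub>Vs n\<^esub> coord V n v y" if xy: "x : lspan V n v" "y : lspan V n v" for x y
 proof -
  have c: "coord V n v x \<oplus>\<^bsub>Vs n\<^esub> coord V n v y : cf n"
   using vs_add_closed[OF vs_Vs, of "coord V n v x" n "coord V n v y"] co(1) xy unfolding Vs_simps(1) by blast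
  have "lc V n v (coord V n v x \<oplus>\<^bsub>Vs n\<^esub> coord V n v y) = lc V n v (%i. coord V n v x i \<oplus> coord V n v y i)"
   by (rule lc_cong) auto
  also have "\<dots> = lc V n v (coord V n v x) \<oplus>\<^bsub>V\<^esub> lc V n v (coord V n v y)"
   by (rule lc_add[OF V vc cf_D[OF co(1)[OF xy(1)]] cf_D[OF co(1)[OF xy(2)]]])
  also have "\<dots> = x \<oplus>\<^bsub>V\<^esub> y" by (simp only: co(2)[OF xy(1)] co(2)[OF xy(2)])
  finally show ?thesis using co(3)[OF c] by simp
 qed
 show "coord V n v (c \<odot>\<^bsub>V\<^esub> x) = c \<odot>\<^bsub>Vs n\<^esub> coord V n v x" if x: "x : lspan V n v" and c: "c : carrier K" for x c
 proof -
  have cc: "c \<odot>\<^bsub>Vs n\<^esub> coord V n v x : cf n"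
   using vs_smult_closed[OF vs_Vs, of c "coord V n v x" n] co(1) x c unfolding Vs_simps(1) by blast
  have "lc V n v (c \<odot>\<^bsub>Vs n\<^esub> coord V n v x) = lc V n v (%i. c \<otimes> coord V n v x i)"
   by (rule lc_cong) auto
  also have "\<dots> = c \<odot>\<^bsub>V\<^esub> lc V n v (coord V n v x)"
   by (rule lc_smult[OF V vc cf_D[OF co(1)[OF x]] c])
  also have "\<dots> = c \<odot>\<^bsub>V\<^esub> x" by (simp only: co(2)[OF x])
  finally show ?thesis using co(3)[OF cc] by simp
 qed
qed

lemma lin_lc_right:
 assumes "vectorspace K W" "\<And>i. i < n ==> w i : carrier W"
 shows "lin (Vs n) (cf n) W (lc W n w)"
proof (rule linI)
 show "lc W n w x : carrier W" if "x : cf n" for x by (rule lc_closed[OF assms cf_D[OF that]])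
 show "lc W n w (x \<oplus>\<^bsub>Vs n\<^esub> y) = lc W n w x \<oplus>\<^bsub>W\<^esub> lc W n w y" if "x : cf n" "y : cf n" for x y
 proof -
  have "lc W n w (x \<oplus>\<^bsub>Vs n\<^esub> y) = lc W n w (%i. x i \<oplus> y i)" by (rule lc_cong) auto
  thus ?thesis by (simp only: lc_add[OF assms cf_D[OF that(1)] cf_D[OF that(2)]])
 qed
 show "lc W n w (c \<odot>\<^bsub>Vs n\<^esub> x) = c \<odot>\<^bsub>W\<^esub> lc W n w x" if "c : carrier K" "x : cf n" for c x
 proof -
  have "lc W n w (c \<odot>\<^bsub>Vs n\<^esub> x) = lc W n w (%i. c \<otimes> x i)" by (rule lc_cong) auto
  thus ?thesis by (simp only: lc_smult[OF assms cf_D[OF that(2)] that(1)])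
 qed
qed

lemma lin_extension:
 assumes V: "vectorspace K V" and e: "indep V n e" and W: "vectorspace K W" and w: "\<And>i. i < n ==> w i : carrier W"
 defines "f \<equiv> (%u. lc W n w (coord V n e u))"
 shows "lin V (lspan V n e) W f" "\<And>i. i < n ==> f (e i) = w i"
proof -
 show "lin V (lspan V n e) W f" unfolding f_def
  by (rule lin_comp[OF lin_coord[OF V e] lin_lc_right[OF W w]]) (simp_all add: coord(1)[OF V e])
 fix i assume i: "i < n"
 define d where "d = (\<lambda>j\<in>{..<n}. if j = i then \<one> else \<zero>)"
 have d: "d : cf n" by (auto simp: d_def cf_def)
 have dl: "lc X n x d = x i" if "vectorspace K X" "\<And>i. i < n ==> x i : carrier X" for X :: "('k, 'y, 'x) module_scheme" and x
 proof -
  have "lc X n x d = lc X n x (%j. if j = i then \<one> else \<zero>)" by (rule lc_cong) (auto simp: d_def)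
  thus ?thesis using lc_unit[OF that i] by simp
 qed
 have "coord V n e (e i) = d" using coord(3)[OF V e d] dl[OF V indep_D[OF e]] by simp
 thus "f (e i) = w i" unfolding f_def
  using lc_cong[of n w w d "%j. if j = i then \<one> else \<zero>" W] lc_unit[OF W w i] by (simp add: d_def)
qed

lemma lin_lc_fun:
 assumes "vectorspace K W" "\<And>r. r < l ==> lin V U W (fi r)" "\<And>r. r < l ==> a r : carrier K"
 shows "lin V U W (%y. lc W l (%r. fi r y) a)"
 using assms(2,3)
proof (induction l)
 case 0 thus ?case using assms(1) by (intro linI) (simp_all add: vs_simps)
next
 case (Suc l)
 have 1: "lin V U W (%y. lc W l (%r. fi r y) a)" using Suc by simp
 have 2: "lin V U W (fi l)" "a l : carrier K" using Suc.prems by auto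
 show ?case
 proof (rule linI)
  fix x assume x: "x : U"
  show "lc W (Suc l) (%r. fi r x) a : carrier W"
   using lin_D(1)[OF 1 x] lin_D(1)[OF 2(1) x] 2(2) assms(1) by simp
  fix y assume y: "y : U"
  show "lc W (Suc l) (%r. fi r (x \<oplus>\<^bsub>V\<^esub> y)) a = lc W (Suc l) (%r. fi r x) a \<oplus>\<^bsub>W\<^esub> lc W (Suc l) (%r. fi r y) a"
   using lin_D(1)[OF 1 x] lin_D(1)[OF 2(1) x] lin_D(1)[OF 1 y] lin_D(1)[OF 2(1) y] 2(2) assms(1)
    lin_D(2)[OF 1 x y] lin_D(2)[OF 2(1) x y] by (simp add: vs_distrib vs_ac)
 next
  fix c x assume c: "c : carrier K" and x: "x : U"
  have "a l \<odot>\<^bsub>W\<^esub> (c \<odot>\<^bsub>W\<^esub> fi l x) = c \<odot>\<^bsub>W\<^esub> (a l \<odot>\<^bsub>W\<^esub> fi l x)"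
   using lin_D(1)[OF 2(1) x] 2(2) c assms(1) by (simp add: vs_distrib(3)[symmetric] m_comm)
  thus "lc W (Suc l) (%r. fi r (c \<odot>\<^bsub>V\<^esub> x)) a = c \<odot>\<^bsub>W\<^esub> lc W (Suc l) (%r. fi r x) a"
   using lin_D(1)[OF 1 x] lin_D(1)[OF 2(1) x] 2(2) assms(1) c
    lin_D(3)[OF 1 c x] lin_D(3)[OF 2(1) c x] by (simp add: vs_distrib(2))
 qed
qed

definition Lin :: "('k, 'm, 'y) module_scheme => 'm set => ('k, 'n, 'z) module_scheme => ('m => 'n) set" where
 "Lin V U W = {f : U \<rightarrow>\<^sub>E carrier W. lin V U W f}"

lemma bij_Lin:
 assumes V: "vectorspace K V" and e: "indep V n e" and W: "vectorspace K W"
 shows "bij_betw (%f. \<lambda>i\<in>{..<n}. f (e i)) (Lin V (lspan V n e) W) ({..<n} \<rightarrow>\<^sub>E carrier W)"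
proof -
 let ?U = "lspan V n e"
 have U: "subspace K ?U V" by (rule subspace_lspan[OF V indep_D[OF e]])
 have eU: "e i : ?U" if "i < n" for i by (rule basis_mem[OF V e refl that])
 show ?thesis
 proof (rule bij_betw_imageI)
  show "inj_on (%f. \<lambda>i\<in>{..<n}. f (e i)) (Lin V ?U W)"
  proof (rule inj_onI)
   fix f g assume f: "f : Lin V ?U W" and g: "g : Lin V ?U W"
    and eq: "(\<lambda>i\<in>{..<n}. f (e i)) = (\<lambda>i\<in>{..<n}. g (e i))"
   have fg: "f (e i) = g (e i)" if "i < n" for i using fun_cong[OF eq, of i] that by simp
   have lf: "lin V ?U W f" "lin V ?U W g" using f g by (auto simp: Lin_def)
   have "f x = g x" if "x : ?U" for x
    by (rule lin_eq_on_basis[OF lf U W e refl fg that])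
   thus "f = g" using f g by (intro PiE_ext[of f ?U "%_. carrier W" g]) (auto simp: Lin_def)
  qed
  show "(%f. \<lambda>i\<in>{..<n}. f (e i)) ` Lin V ?U W = {..<n} \<rightarrow>\<^sub>E carrier W"
  proof (intro equalityI subsetI)
   fix w assume "w : (%f. \<lambda>i\<in>{..<n}. f (e i)) ` Lin V ?U W"
   then obtain f where f: "f : Lin V ?U W" "w = (\<lambda>i\<in>{..<n}. f (e i))" by blast
   have "f (e i) : carrier W" if "i < n" for i using f(1) eU[OF that] by (auto simp: Lin_def)
   thus "w : {..<n} \<rightarrow>\<^sub>E carrier W" unfolding f(2) by auto
  next
   fix w assume w: "w : {..<n} \<rightarrow>\<^sub>E carrier W"
   hence wc: "w i : carrier W" if "i < n" for i using that by auto
   define f where "f = restrict (%u. lc W n w (coord V n e u)) ?U"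
   note ext = lin_extension[of V n e W w, OF V e W wc]
   have f: "f : Lin V ?U W" unfolding Lin_def
    using lin_cong[OF ext(1) U, of f] lin_D(1)[OF ext(1)] by (auto simp: f_def)
   have "w = (\<lambda>i\<in>{..<n}. f (e i))"
   proof
    fix i show "w i = (\<lambda>i\<in>{..<n}. f (e i)) i"
     using w eU[of i] ext(2)[of i] by (cases "i < n") (auto simp: f_def)
   qed
   thus "w : (%f. \<lambda>i\<in>{..<n}. f (e i)) ` Lin V ?U W" using f by blast
  qed
 qed
qed

lemma card_Lin_KV:
 assumes "subspace K U V" "finite U"
 shows "card (Lin V U KV) = card U"
proof -
 obtain n e where e: "indep V n e" "lspan V n e = U" "card U = q ^ n" by (rule basis_exists[OF assms])
 show ?thesis using bij_betw_same_card[OF bij_Lin[OF subspace_D(1)[OF assms(1)] e(1) vs_KV]] e card_cf[of n]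
  by (simp add: cf_def)
qed

text \<open>All fibres of a nonzero functional are translates of its kernel, and there are
  \<open>q\<close> of them.\<close>

lemma card_kernel:
 assumes f: "lin V U KV f" and U: "subspace K U V" "finite U" and u: "u : U" "f u \<noteq> \<zero>"
 shows "q * card {x : U. f x = \<zero>} = card U"
proof -
 have fib: "card {x : U. f x = y} = card {x : U. f x = \<zero>}" if y: "y : carrier K" for y
 proof -
  \<comment> \<open>Scales \<open>u\<close> to a vector with value \<open>y\<close>, by which the
    kernel is translated onto the fibre over \<open>y\<close>.\<close>
  define c where "c = y \<otimes> inv (f u)"
  have fu: "f u : carrier K" "inv (f u) : carrier K" "inv (f u) \<otimes> f u = \<one>"
   using lin_D(1)[OF f u(1)] u(2) by (auto simp: field_Units)
  have c: "c : carrier K" using y fu by (simp add: c_def)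
  have "f (c \<odot>\<^bsub>V\<^esub> u) = c \<otimes> f u" using lin_D(3)[OF f c u(1)] by simp
  also have "\<dots> = y" using y fu by (simp add: c_def m_assoc)
  finally have fc: "f (c \<odot>\<^bsub>V\<^esub> u) = y" .
  define w where "w = c \<odot>\<^bsub>V\<^esub> u"
  define w' where "w' = (\<ominus> \<one>) \<odot>\<^bsub>V\<^esub> w"
  have w: "w : U" "w' : U" "f w = y" using subspace_D(6)[OF U(1)] c u fc by (auto simp: w_def w'_def)
  note VU = subspace_D(1)[OF U(1)]
  have wc: "w : carrier V" "w' : carrier V" using w subspace_D(4)[OF U(1)] by auto
  have ww: "w \<oplus>\<^bsub>V\<^esub> w' = \<zero>\<^bsub>V\<^esub>" "w' \<oplus>\<^bsub>V\<^esub> w = \<zero>\<^bsub>V\<^esub>" unfolding w'_def using vs_neg[OF VU wc(1)] by auto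
  have fw': "f w' = \<ominus> y" using lin_D(3)[OF f, of "\<ominus> \<one>" w] w y by (simp add: w'_def l_minus)
  have "bij_betw (%x. x \<oplus>\<^bsub>V\<^esub> w') {x : U. f x = y} {x : U. f x = \<zero>}"
  proof (rule bij_betwI[where g = "%x. x \<oplus>\<^bsub>V\<^esub> w"])
   show "(%x. x \<oplus>\<^bsub>V\<^esub> w') : {x : U. f x = y} \<rightarrow> {x : U. f x = \<zero>}"
    using w y subspace_D(5)[OF U(1)] by (auto simp: lin_D(2)[OF f] fw' r_neg)
   show "(%x. x \<oplus>\<^bsub>V\<^esub> w) : {x : U. f x = \<zero>} \<rightarrow> {x : U. f x = y}"
    using w y subspace_D(5)[OF U(1)] by (auto simp: lin_D(2)[OF f])
   show "(x \<oplus>\<^bsub>V\<^esub> w') \<oplus>\<^bsub>V\<^esub> w = x" if "x : {x : U. f x = y}" for x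
    using that wc ww subspace_D(4)[OF U(1)] VU by (simp add: vs_ac(2) vs_simps)
   show "(x \<oplus>\<^bsub>V\<^esub> w) \<oplus>\<^bsub>V\<^esub> w' = x" if "x : {x : U. f x = \<zero>}" for x
    using that wc ww subspace_D(4)[OF U(1)] VU by (simp add: vs_ac(2) vs_simps)
  qed
  thus ?thesis by (rule bij_betw_same_card)
 qed
 have "card U = card (carrier K) * card {x : U. f x = \<zero>}"
 proof (rule card_fibres[where f = f])
  show "f x : carrier K" if "x : U" for x using lin_D(1)[OF f that] by simp
  show "card {x : U. f x = y} = card {x : U. f x = \<zero>}" if "y : carrier K" for y by (rule fib[OF that])
 qed (rule finite_K U(2))+
 thus ?thesis by (simp add: q_def)
qed

subsection \<open>Bilinear forms\<close>

definition Bil :: "('k, 'm, 'y) module_scheme => 'm set => ('k, 'n, 'z) module_scheme => 'n set =>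
  ('m => 'n => 'k) set" where
 "Bil V U W U' = {c : U \<rightarrow>\<^sub>E (U' \<rightarrow>\<^sub>E carrier K).
  (\<forall>y\<in>U'. lin V U KV (%x. c x y)) \<and> (\<forall>x\<in>U. lin W U' KV (c x))}"

lemma Bil_D:
 assumes "c : Bil V U W U'"
 shows "y : U' ==> lin V U KV (%x. c x y)" "x : U ==> lin W U' KV (c x)"
  "x : U ==> y : U' ==> c x y : carrier K" "c : U \<rightarrow>\<^sub>E (U' \<rightarrow>\<^sub>E carrier K)"
 using assms by (auto simp: Bil_def PiE_iff)

lemma Bil_ext:
 assumes "c : Bil V U W U'" "c' : Bil V U W U'" "\<And>x y. x : U ==> y : U' ==> c x y = c' x y"
 shows "c = c'"
proof -
 have "c x = c' x" if x: "x : U" for x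
  using Bil_D(4)[OF assms(1)] Bil_D(4)[OF assms(2)] x assms(3)
  by (intro PiE_ext[of "c x" U' "%_. carrier K" "c' x"]) auto
 thus ?thesis using Bil_D(4)[OF assms(1)] Bil_D(4)[OF assms(2)]
  by (intro PiE_ext[of c U "%_. U' \<rightarrow>\<^sub>E carrier K" c']) auto
qed

lemma BilI:
 assumes U: "subspace K U V" and U': "subspace K U' W"
  and "\<And>y. y : U' ==> lin V U KV (%x. c x y)" "\<And>x. x : U ==> lin W U' KV (c x)"
 shows "(\<lambda>x\<in>U. \<lambda>y\<in>U'. c x y) : Bil V U W U'"
 unfolding Bil_def
proof (intro CollectI conjI ballI)
 show "lin V U KV (%x. (\<lambda>x\<in>U. \<lambda>y\<in>U'. c x y) x y)" if "y : U'" for y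
  by (rule lin_cong[OF assms(3)[OF that] U]) (use that in auto)
 show "lin W U' KV ((\<lambda>x\<in>U. \<lambda>y\<in>U'. c x y) x)" if "x : U" for x
  by (rule lin_cong[OF assms(4)[OF that] U']) (use that in auto)
 show "(\<lambda>x\<in>U. \<lambda>y\<in>U'. c x y) : U \<rightarrow>\<^sub>E U' \<rightarrow>\<^sub>E carrier K"
  using lin_D(1)[OF assms(4)] by auto
qed

lemma Bil_eq_on_basis:
 assumes c: "c : Bil V U W U'" "c' : Bil V U W U'" and V: "vectorspace K V" "vectorspace K W"
  and e: "indep V l e" "lspan V l e = U" and f: "indep W n f" "lspan W n f = U'"
  and eq: "\<And>r s. r < l ==> s < n ==> c (e r) (f s) = c' (e r) (f s)"
 shows "c = c'"
proof (rule Bil_ext[OF c])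
 fix x y assume x: "x : U" and y: "y : U'"
 have U: "subspace K U V" "subspace K U' W"
  using subspace_lspan[OF V(1) indep_D[OF e(1)]] subspace_lspan[OF V(2) indep_D[OF f(1)]] e f by auto
 have eU: "e r : U" if "r < l" for r using basis_mem[OF V(1) e that] .
 have 1: "c (e r) y = c' (e r) y" if r: "r < l" for r
  by (rule lin_eq_on_basis[OF Bil_D(2)[OF c(1) eU[OF r]] Bil_D(2)[OF c(2) eU[OF r]] U(2) vs_KV f eq[OF r] y])
 show "c x y = c' x y"
  by (rule lin_eq_on_basis[OF Bil_D(1)[OF c(1) y] Bil_D(1)[OF c(2) y] U(1) vs_KV e 1 x])
qed

lemma Bil_ex:
 assumes V: "vectorspace K V" "vectorspace K W"
  and e: "indep V l e" "lspan V l e = U" and f: "indep W n f" "lspan W n f = U'"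
  and z: "\<And>r s. r < l ==> s < n ==> z r s : carrier K"
 shows "\<exists>c\<in>Bil V U W U'. \<forall>r<l. \<forall>s<n. c (e r) (f s) = z r s"
proof -
 have U: "subspace K U V" "subspace K U' W"
  using subspace_lspan[OF V(1) indep_D[OF e(1)]] subspace_lspan[OF V(2) indep_D[OF f(1)]] e f by auto
 have eU: "e r : U" if "r < l" for r using basis_mem[OF V(1) e that] .
 have fU: "f r : U'" if "r < n" for r using basis_mem[OF V(2) f that] .
 define fi where "fi = (%r u. lc KV n (z r) (coord W n f u))"
 have zc: "z r i : carrier KV" if "r < l" "i < n" for r i using z that by simp
 have fi: "lin W U' KV (fi r)" "\<And>s. s < n ==> fi r (f s) = z r s" if r: "r < l" for r
  unfolding fi_def using lin_extension[of W n f KV "z r", OF V(2) f(1) vs_KV zc[OF r]] f(2) by auto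
 define c where "c = (%u u'. lc KV l (%r. fi r u') (coord V l e u))"
 have fic: "fi r y : carrier KV" if "r < l" "y : U'" for r y using lin_D(1)[OF fi(1)] that by blast
 have c1: "lin V U KV (%x. c x y)" "\<And>r. r < l ==> c (e r) y = fi r y" if "y : U'" for y
  unfolding c_def using lin_extension[OF V(1) e(1) vs_KV, where w = "%r. fi r y"] fic that e(2) by auto
 have c2: "lin W U' KV (c x)" if "x : U" for x
  unfolding c_def using lin_lc_fun[OF vs_KV fi(1)] cf_D[OF coord(1)[OF V(1) e(1)]] that e(2) by auto
 have "(\<lambda>x\<in>U. \<lambda>y\<in>U'. c x y) : Bil V U W U'" by (rule BilI[OF U c1(1) c2])
 moreover have "\<forall>r<l. \<forall>s<n. (\<lambda>x\<in>U. \<lambda>y\<in>U'. c x y) (e r) (f s) = z r s"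
  using eU fU c1(2) fi(2) by simp
 ultimately show ?thesis by blast
qed

lemma Bil_restrict:
 assumes c: "c : Bil V U W U'" and A: "subspace K A V" "A \<subseteq> U" and B: "subspace K B W" "B \<subseteq> U'"
 shows "(\<lambda>x\<in>A. \<lambda>y\<in>B. c x y) : Bil V A W B"
 by (rule BilI[OF A(1) B(1)]) (use A B in \<open>auto intro: lin_subset[OF Bil_D(1)[OF c]] lin_subset[OF Bil_D(2)[OF c]]\<close>)

lemma Bil_zero_on_basis:
 assumes c: "c : Bil V U W U'" and V: "vectorspace K V" "vectorspace K W"
  and e: "\<And>r. r < l ==> e r : U" and f: "\<And>s. s < n ==> f s : U'" and U: "subspace K U V" "subspace K U' W"
 shows "(orth c (lspan V l e) (lspan W n f)) \<longleftrightarrow> (\<forall>r<l. \<forall>s<n. c (e r) (f s) = \<zero>)"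
proof safe
 have ec: "e r : carrier V" if "r < l" for r using e[OF that] subspace_D(4)[OF U(1)] by blast
 have fc: "f r : carrier W" if "r < n" for r using f[OF that] subspace_D(4)[OF U(2)] by blast
 show "c (e r) (f s) = \<zero>" if "orth c (lspan V l e) (lspan W n f)" "r < l" "s < n" for r s
  using that lspan_mem[of V l e r] lspan_mem[of W n f s] V ec fc by blast
 fix x y assume z: "\<forall>r<l. \<forall>s<n. c (e r) (f s) = \<zero>" and x: "x : lspan V l e" and y: "y : lspan W n f"
 obtain a where a: "a : cf l" "x = lc V l e a" using x by (auto simp: lspan_def)
 obtain b where b: "b : cf n" "y = lc W n f b" using y by (auto simp: lspan_def)
 have yU: "y : U'" using lspan_subset[OF U(2), of n f] f y by blast
 have 1: "c (e r) y = \<zero>" if "r < l" for r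
 proof -
  have "c (e r) y = lc KV n (%s. c (e r) (f s)) b" unfolding b(2)
   by (rule lin_lc[OF Bil_D(2)[OF c e[OF that]] U(2) vs_KV f cf_D[OF b(1)]])
  also have "\<dots> = lc KV n (%s. \<zero>) b" by (rule lc_cong) (use z that in auto)
  also have "\<dots> = \<zero>" using cf_D[OF b(1)] by (induction n) auto
  finally show ?thesis .
 qed
 have "c x y = lc KV l (%r. c (e r) y) a" unfolding a(2)
  by (rule lin_lc[OF Bil_D(1)[OF c yU] U(1) vs_KV e cf_D[OF a(1)]])
 also have "\<dots> = lc KV l (%r. \<zero>) a" by (rule lc_cong) (use 1 in auto)
 also have "\<dots> = \<zero>" using cf_D[OF a(1)] by (induction l) auto
 finally show "c x y = \<zero>" .
qed

definition left_nondeg :: "('k, 'm, 'y) module_scheme => 'm set => 'n set => ('m => 'n => 'k) => bool" where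
 "left_nondeg V U U' c \<longleftrightarrow> (\<forall>x\<in>U. (\<forall>y\<in>U'. c x y = \<zero>) \<longrightarrow> x = \<zero>\<^bsub>V\<^esub>)"

text \<open>Double counting of the pairs with \<open>c x y = 0\<close>.\<close>

lemma card_perp:
 assumes c: "c : Bil V A W U" and A: "subspace K A V" "finite A" and U: "subspace K U W" "finite U"
  and nd: "left_nondeg V A U c"
 shows "card {y : U. \<forall>x\<in>A. c x y = \<zero>} * card A = card U"
proof -
 let ?P = "{y : U. \<forall>x\<in>A. c x y = \<zero>}"
 have z: "\<zero>\<^bsub>V\<^esub> : A" by (rule subspace_D(3)[OF A(1)])
 \<comment> \<open>Multiplied by \<open>q\<close> to avoid division: by nondegeneracy only x = 0
   annihilates all of \<open>U\<close>, every other \<open>x\<close> annihilates a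
   hyperplane.\<close>
 have L: "q * card {y : U. c x y = \<zero>} = (if x = \<zero>\<^bsub>V\<^esub> then q * card U else card U)" if x: "x : A" for x
 proof (cases "x = \<zero>\<^bsub>V\<^esub>")
  case True
  have "c x y = \<zero>" if "y : U" for y
   using lin_zero[OF Bil_D(1)[OF c that] A(1) vs_KV] True by simp
  hence "{y : U. c x y = \<zero>} = U" by blast
  thus ?thesis using True by simp
 next
  case False
  then obtain y where "y : U" "c x y \<noteq> \<zero>" using nd x by (auto simp: left_nondeg_def)
  thus ?thesis using card_kernel[OF Bil_D(2)[OF c x] U] False by simp
 qed
 \<comment> \<open>On the other side, \<open>y\<close> is annihilated by all of \<open>A\<close>
   when it lies in \<open>?P\<close>, and otherwise by a hyperplane of \<open>A\<close>.\<close>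
 have R: "q * card {x : A. c x y = \<zero>} = (if y : ?P then q * card A else card A)" if y: "y : U" for y
 proof (cases "y : ?P")
  case True
  hence "{x : A. c x y = \<zero>} = A" by blast
  thus ?thesis using True by simp
 next
  case False
  then obtain x where "x : A" "c x y \<noteq> \<zero>" using y by blast
  from card_kernel[OF Bil_D(1)[OF c y] A this] show ?thesis by (simp only: False if_False)
 qed
 have "card (SIGMA x:A. {y : U. c x y = \<zero>}) = card (SIGMA y:U. {x : A. c x y = \<zero>})"
  by (rule bij_betw_same_card[of prod.swap]) (rule bij_betwI[where g = prod.swap], auto)
 hence "(\<Sum>x\<in>A. q * card {y : U. c x y = \<zero>}) = (\<Sum>y\<in>U. q * card {x : A. c x y = \<zero>})"
  using A(2) U(2) by (simp add: sum_distrib_left[symmetric])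
 \<comment> \<open>Both counts are card A * card U plus an excess, which comes from x = 0 on one
   side and from the members of \<open>?P\<close> on the other; comparing the excesses gives the
   claim.\<close>
 also have "(\<Sum>x\<in>A. q * card {y : U. c x y = \<zero>}) = (\<Sum>x\<in>A. card U + (if x = \<zero>\<^bsub>V\<^esub> then (q - 1) * card U else 0))"
  using q_gt_1 by (intro sum.cong) (auto simp: L algebra_simps)
 also have "\<dots> = card A * card U + (q - 1) * card U" using A(2) z by (simp add: sum.distrib)
 also have "(\<Sum>y\<in>U. q * card {x : A. c x y = \<zero>}) = (\<Sum>y\<in>U. card A + (if y : ?P then (q - 1) * card A else 0))"
  using q_gt_1 by (intro sum.cong) (auto simp: R algebra_simps)
 also have "\<dots> = card U * card A + (\<Sum>y\<in>U. (if y : ?P then (q - 1) * card A else 0))" by (simp add: sum.distrib)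
 also have "(\<Sum>y\<in>U. (if y : ?P then (q - 1) * card A else 0)) = card ?P * ((q - 1) * card A)"
  using U(2) by (subst sum.If_cases) (auto simp: Int_def conj_ac)
 finally show ?thesis using q_gt_1 by simp
qed

lemma subspace_perp:
 assumes c: "c : Bil V A W U" and U: "subspace K U W"
 shows "subspace K {y : U. \<forall>x\<in>A. c x y = \<zero>} W"
proof (rule subspaceI)
 show "\<zero>\<^bsub>W\<^esub> : {y : U. \<forall>x\<in>A. c x y = \<zero>}"
  using subspace_D(3)[OF U] lin_zero[OF Bil_D(2)[OF c] U vs_KV] by auto
 show "x \<oplus>\<^bsub>W\<^esub> y : {y : U. \<forall>x\<in>A. c x y = \<zero>}"
  if "x : {y : U. \<forall>x\<in>A. c x y = \<zero>}" "y : {y : U. \<forall>x\<in>A. c x y = \<zero>}" for x y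
  using that subspace_D(5)[OF U] by (simp add: lin_D(2)[OF Bil_D(2)[OF c]])
 show "a \<odot>\<^bsub>W\<^esub> x : {y : U. \<forall>x\<in>A. c x y = \<zero>}"
  if "a : carrier K" "x : {y : U. \<forall>x\<in>A. c x y = \<zero>}" for a x
  using that subspace_D(6)[OF U] by (simp add: lin_D(3)[OF Bil_D(2)[OF c]])
qed (use subspace_D(1,2)[OF U] in auto)

lemma card_cf_zero: "b \<le> n ==> card {x : cf n. \<forall>s<b. x s = \<zero>} = q ^ (n - b)"
proof -
 assume b: "b \<le> n"
 have "{x : cf n. \<forall>s<b. x s = \<zero>} = (\<Pi>\<^sub>E s\<in>{..<n}. if s < b then {\<zero>} else carrier K)"
 proof (intro equalityI subsetI)
  fix x assume x: "x : (\<Pi>\<^sub>E s\<in>{..<n}. if s < b then {\<zero>} else carrier K)"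
  have xs: "x s = \<zero>" if "s < b" for s using PiE_mem[OF x, of s] that b by simp
  have "x s : carrier K" if "s < n" for s using PiE_mem[OF x, of s] that by (cases "s < b") simp_all
  hence "x : cf n" using x unfolding cf_def PiE_iff by simp
  thus "x : {x : cf n. \<forall>s<b. x s = \<zero>}" using xs by simp
 qed (simp add: cf_def PiE_iff)
 also have "card \<dots> = (\<Prod>s<n. if s < b then 1 else q)"
  by (auto simp: card_PiE q_def intro!: prod.cong)
 also have "\<dots> = (\<Prod>s\<in>{b..<n}. q)"
  by (rule prod.mono_neutral_cong_right) auto
 finally show ?thesis by simp
qed

text \<open>In bases adapted to \<open>A\<close> and \<open>B\<close> the form is left nondegenerate
  exactly when the rows of its matrix are independent, and it vanishes on \<open>A\<close> and
  \<open>B\<close> exactly when the first rows, those of \<open>A\<close>, start with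
  \<open>sdim B\<close> zeros. The restricted rows are chosen first, as the increasing sets in the
  count of independent tuples require.\<close>

lemma card_left_nondeg:
 assumes L: "subspace K L V" "finite L" and R: "subspace K R W" "finite R"
  and A: "subspace K A V" "A \<subseteq> L" and B: "subspace K B W" "B \<subseteq> R"
 shows "card {c : Bil V L W R. left_nondeg V L R c \<and> (orth c A B)} =
  (\<Prod>r<sdim L. q ^ (if r < sdim A then sdim R - sdim B else sdim R) - q ^ r)"
proof -
 note V = subspace_D(1)[OF L(1)] and W = subspace_D(1)[OF R(1)]
 have finAB: "finite A" "finite B" using A B L R finite_subset by blast+
 define l n a b where "l = sdim L" and "n = sdim R" and "a = sdim A" and "b = sdim B"
 have al: "a \<le> l" "b \<le> n" using sdim_mono A B L R by (auto simp: l_def n_def a_def b_def)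
 obtain e where e: "indep V l e" "lspan V l e = L" "lspan V a e = A"
  using adapted_basis2[OF A(1) L(1) A(2) L(2)] unfolding l_def a_def by blast
 obtain f where f: "indep W n f" "lspan W n f = R" "lspan W b f = B"
  using adapted_basis2[OF B(1) R(1) B(2) R(2)] unfolding n_def b_def by blast
 have eL: "e r : L" if "r < l" for r by (rule basis_mem[OF V e(1,2) that])
 have fR: "f r : R" if "r < n" for r by (rule basis_mem[OF W f(1,2) that])
 define S where "S = (%r. if r < a then {x : cf n. \<forall>s<b. x s = \<zero>} else cf n)"
 define G where "G = (%c. \<lambda>r\<in>{..<l}. \<lambda>s\<in>{..<n}. (c (e r) (f s) :: 'k))"
 \<comment> \<open>A combination of rows vanishes exactly when the corresponding vector of
   \<open>L\<close> pairs to zero with all of \<open>R\<close>.\<close>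
 have nd: "left_nondeg V L R c \<longleftrightarrow> indep (Vs n) l (G c)" if c: "c : Bil V L W R" for c
 proof -
  have Gc: "G c r : cf n" if "r < l" for r using that Bil_D(3)[OF c eL fR] by (auto simp: G_def cf_def)
  have key: "(\<forall>y\<in>R. c (lc V l e x) y = \<zero>) \<longleftrightarrow> lc (Vs n) l (G c) x = \<zero>\<^bsub>Vs n\<^esub>" if x: "x : cf l" for x
  proof -
   have xL: "lc V l e x : L" by (rule lc_in[OF L(1) eL cf_D[OF x]])
   have 1: "c (lc V l e x) (f s) = lc (Vs n) l (G c) x s" if s: "s < n" for s
   proof -
    have "c (lc V l e x) (f s) = lc KV l (%r. c (e r) (f s)) x"
     by (rule lin_lc[OF Bil_D(1)[OF c fR[OF s]] L(1) vs_KV eL cf_D[OF x]])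
    also have "\<dots> = lc KV l (%r. G c r s) x" by (rule lc_cong) (use s in \<open>auto simp: G_def\<close>)
    finally show ?thesis using s by (simp add: lc_Vs)
   qed
   have lz: "lc (Vs n) l (G c) x : cf n"
    using lc_closed[OF vs_Vs[of n], of l "G c" x] Gc cf_D[OF x] unfolding Vs_simps(1) by blast
   have "(\<forall>y\<in>R. c (lc V l e x) y = \<zero>) \<longleftrightarrow> (\<forall>s<n. c (lc V l e x) (f s) = \<zero>)"
   proof safe
    fix y assume 2: "\<forall>s<n. c (lc V l e x) (f s) = \<zero>" and y: "y : R"
    have "lin W R KV (%_. \<zero>)" by (rule linI) auto
    from lin_eq_on_basis[OF Bil_D(2)[OF c xL] this R(1) vs_KV f(1,2) _ y] 2
    show "c (lc V l e x) y = \<zero>" by blast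
   qed (use fR in auto)
   also have "\<dots> \<longleftrightarrow> (\<forall>s<n. lc (Vs n) l (G c) x s = \<zero>)" using 1 by simp
   also have "\<dots> \<longleftrightarrow> lc (Vs n) l (G c) x = \<zero>\<^bsub>Vs n\<^esub>"
    using cf_ext[OF lz, of "\<zero>\<^bsub>Vs n\<^esub>"] by (auto simp: cf_def)
   finally show ?thesis .
  qed
  have z0: "lc V l e x = \<zero>\<^bsub>V\<^esub> \<longleftrightarrow> (\<forall>i<l. x i = \<zero>)" if x: "x : cf l" for x
   using e(1) x lc_zero[of V l e x] V unfolding indep_def by blast
  have "left_nondeg V L R c \<longleftrightarrow> (\<forall>x\<in>cf l. (\<forall>y\<in>R. c (lc V l e x) y = \<zero>) \<longrightarrow> lc V l e x = \<zero>\<^bsub>V\<^esub>)"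
   unfolding left_nondeg_def e(2)[symmetric] lspan_def by blast
  also have "\<dots> \<longleftrightarrow> indep (Vs n) l (G c)"
   unfolding indep_def Vs_simps(1) using key z0 Gc by (simp only: Ball_def) blast
  finally show ?thesis .
 qed
 have AB: "(orth c A B) \<longleftrightarrow> (\<forall>r<a. \<forall>s<b. G c r s = \<zero>)" if c: "c : Bil V L W R" for c
 proof -
  have "(orth c (lspan V a e) (lspan W b f)) \<longleftrightarrow> (\<forall>r<a. \<forall>s<b. c (e r) (f s) = \<zero>)"
   using al eL fR by (intro Bil_zero_on_basis[OF c V W _ _ L(1) R(1)]) auto
  thus ?thesis using al e f by (simp add: G_def)
 qed
 have "bij_betw G {c : Bil V L W R. left_nondeg V L R c \<and> (orth c A B)}
  {z : Pi\<^sub>E {..<l} S. indep (Vs n) l z}"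
 proof (rule bij_betw_imageI)
  show "inj_on G {c : Bil V L W R. left_nondeg V L R c \<and> (orth c A B)}"
  proof (rule inj_onI, clarify)
   fix c c' assume c: "c : Bil V L W R" "c' : Bil V L W R" and eq: "G c = G c'"
   have "c (e r) (f s) = c' (e r) (f s)" if "r < l" "s < n" for r s
    using fun_cong[OF fun_cong[OF eq, of r], of s] that by (simp add: G_def)
   thus "c = c'" using Bil_eq_on_basis[OF c V W e(1,2) f(1,2)] by blast
  qed
  show "G ` {c : Bil V L W R. left_nondeg V L R c \<and> (orth c A B)} = {z : Pi\<^sub>E {..<l} S. indep (Vs n) l z}"
  proof (intro equalityI subsetI)
   fix z assume "z : G ` {c : Bil V L W R. left_nondeg V L R c \<and> (orth c A B)}"
   then obtain c where c: "c : Bil V L W R" "left_nondeg V L R c" "orth c A B" "z = G c" by blast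
   have "G c r : S r" if "r < l" for r
   proof -
    have "G c r : cf n" using that Bil_D(3)[OF c(1) eL fR] by (auto simp: G_def cf_def)
    thus ?thesis using AB[OF c(1)] c(3) by (auto simp: S_def)
   qed
   hence "z : Pi\<^sub>E {..<l} S" using c(4) by (auto simp: G_def)
   thus "z : {z : Pi\<^sub>E {..<l} S. indep (Vs n) l z}" using nd[OF c(1)] c(2,4) by simp
  next
   fix z assume z: "z : {z : Pi\<^sub>E {..<l} S. indep (Vs n) l z}"
   have zS: "z r : S r" if "r < l" for r using z that by auto
   have zc: "z r : cf n" if "r < l" for r using zS[OF that] by (auto simp: S_def split: if_splits)
   obtain c where c: "c : Bil V L W R" "\<forall>r<l. \<forall>s<n. c (e r) (f s) = z r s"
    using Bil_ex[OF V W e(1,2) f(1,2), of z] cf_D[OF zc] by blast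
   have G: "G c = z"
   proof
    fix r show "G c r = z r"
    proof (cases "r < l")
     case True
     thus ?thesis using c(2) zc[OF True] by (intro cf_ext[of _ n]) (auto simp: G_def cf_def)
    qed (use z in \<open>auto simp: G_def PiE_iff extensional_def\<close>)
   qed
   have "\<forall>r<a. \<forall>s<b. G c r s = \<zero>"
   proof (intro allI impI)
    fix r s assume "r < a" "s < b"
    thus "G c r s = \<zero>" using zS[of r] al unfolding G S_def by simp
   qed
   hence "orth c A B" using AB[OF c(1)] by blast
   moreover have "left_nondeg V L R c" using nd[OF c(1)] z G by simp
   ultimately show "z : G ` {c : Bil V L W R. left_nondeg V L R c \<and> (orth c A B)}"
    using c(1) G by blast
  qed
 qed
 hence "card {c : Bil V L W R. left_nondeg V L R c \<and> (orth c A B)} =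
  card {z : Pi\<^sub>E {..<l} S. indep (Vs n) l z}" by (rule bij_betw_same_card)
 also have "\<dots> = (\<Prod>r<l. card (S r) - q ^ r)"
 proof (rule card_indep_tuples[OF vs_Vs])
  show "subspace K (S r) (Vs n)" for r
   unfolding S_def by (rule subspaceI) (use al in \<open>auto simp: cf_def PiE_iff extensional_def\<close>)
  show "finite (S r)" for r by (auto simp: S_def finite_cf)
  show "S r \<subseteq> S r'" if "r \<le> r'" for r r' using that by (auto simp: S_def)
 qed
 also have "\<dots> = (\<Prod>r<l. q ^ (if r < a then n - b else n) - q ^ r)"
  by (intro prod.cong refl) (simp add: S_def card_cf card_cf_zero[OF al(2)])
 finally show ?thesis unfolding l_def n_def a_def b_def .
qed

end

subsection \<open>Symmetric and alternating forms\<close>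

locale odd_field = finite_field +
 assumes two_nonzero: "\<one> \<oplus> \<one> \<noteq> \<zero>"
begin

text \<open>Odd characteristic enters the counting through this lemma: a skew form vanishes on the
  diagonal.\<close>

lemma eq_neg_imp_zero:
 assumes "x : carrier K" "x = \<ominus> x"
 shows "x = \<zero>"
proof -
 have "(\<one> \<oplus> \<one>) \<otimes> x = x \<oplus> x" using assms(1) by (simp add: l_distr)
 also have "\<dots> = x \<oplus> \<ominus> x" using assms(2) by simp
 also have "\<dots> = \<zero>" using assms(1) by (rule r_neg)
 finally show ?thesis using two_nonzero assms(1) integral by blast
qed

text \<open>Integer signs acting on the field, so that symmetric and alternating forms are treated
  together.\<close>

definition sg :: "int => 'a => 'a" where
 "sg ep x = (if ep = 1 then x else \<ominus> x)"

lemma sg_simps [simp]: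
 "x : carrier K ==> sg ep x : carrier K" "sg ep \<zero> = \<zero>"
 "x : carrier K ==> sg ep (sg ep x) = x"
 by (simp_all add: sg_def)

lemma sg_add: "x : carrier K ==> y : carrier K ==> sg ep (x \<oplus> y) = sg ep x \<oplus> sg ep y"
 and sg_mult: "x : carrier K ==> y : carrier K ==> sg ep (x \<otimes> y) = x \<otimes> sg ep y"
 by (simp_all add: sg_def minus_add r_minus)

lemma sg_zero_iff: "x : carrier K ==> sg ep x = \<zero> \<longleftrightarrow> x = \<zero>"
 by (metis sg_simps(2,3))

definition Sf :: "int => ('a, 'm, 'y) module_scheme => 'm set => ('m => 'm => 'a) set" where
 "Sf ep V U = {b : Bil V U V U. \<forall>x\<in>U. \<forall>y\<in>U. b x y = sg ep (b y x)}"

abbreviation "extf ep V U A X \<equiv> {b : Sf ep V U. left_nondeg V U U b \<and> (\<forall>x\<in>A. \<forall>y\<in>U. b x y = X x y)}"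

lemma Bil_flip:
 assumes b: "b : Bil V U W U'" and U: "subspace K U V" "subspace K U' W"
 shows "(\<lambda>y\<in>U'. \<lambda>x\<in>U. sg ep (b x y)) : Bil W U' V U"
proof (rule BilI[OF U(2,1)])
 show "lin W U' KV (%y. sg ep (b x y))" if x: "x : U" for x
  using lin_D[OF Bil_D(2)[OF b x]] by (intro linI) (simp_all add: sg_add sg_mult)
 show "lin V U KV (%x. sg ep (b x y))" if y: "y : U'" for y
  using lin_D[OF Bil_D(1)[OF b y]] by (intro linI) (simp_all add: sg_add sg_mult)
qed

lemma Sf_basis:
 assumes b: "b : Bil V U V U" and V: "vectorspace K V" and e: "indep V n e" "lspan V n e = U"
  and eq: "\<And>r s. r < n ==> s < n ==> b (e r) (e s) = sg ep (b (e s) (e r))"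
 shows "b : Sf ep V U"
proof -
 have U: "subspace K U V" using subspace_lspan[OF V, of n e] indep_D[OF e(1)] e(2) by simp
 have "b = (\<lambda>y\<in>U. \<lambda>x\<in>U. sg ep (b x y))"
  by (rule Bil_eq_on_basis[OF b Bil_flip[OF b U U] V V e e])
   (simp add: basis_mem[OF V e] eq[symmetric])
 note eqb = this
 have "b x y = sg ep (b y x)" if "x : U" "y : U" for x y
 proof -
  have "b x y = (\<lambda>y\<in>U. \<lambda>x\<in>U. sg ep (b x y)) x y" by (rule fun_cong[OF fun_cong[OF eqb, of x], of y])
  also have "\<dots> = sg ep (b y x)" using that by simp
  finally show ?thesis .
 qed
 thus ?thesis using b unfolding Sf_def by blast
qed

text \<open>A form is a matrix invariant under signed transposition. Outside \<open>Z\<close> one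
  entry of each off-diagonal pair is free, while a diagonal entry is arbitrary for
  \<open>ep = 1\<close> and must be 0 for \<open>ep = -1\<close>.\<close>

lemma card_Sf_prescribed:
 assumes V: "vectorspace K V" and e: "indep V n e" "lspan V n e = U" and ep: "ep : {1, -1}"
  and Z: "Z \<subseteq> {..<n} \<times> {..<n}" "\<And>r s. (r, s) : Z ==> (s, r) : Z"
  and z: "\<And>r s. (r, s) : Z ==> z r s : carrier K" "\<And>r s. (r, s) : Z ==> z r s = sg ep (z s r)"
 shows "card {b : Sf ep V U. \<forall>(r,s)\<in>Z. b (e r) (e s) = z r s} =
  q ^ (card {(r, s). r < s \<and> s < n \<and> (r, s) \<notin> Z} + (if ep = 1 then card {r. r < n \<and> (r, r) \<notin> Z} else 0))"
proof -
 define I where "I = {..<n} \<times> {..<n}"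
 define P where "P = {(r, s). r < s \<and> s < n}"
 define S where "S = (%p. if p : Z then {z (fst p) (snd p)} else carrier K)"
 define H where "H = (%b. \<lambda>p\<in>I. b (e (fst p)) (e (snd p)) :: 'a)"
 let ?L = "{b : Sf ep V U. \<forall>(r,s)\<in>Z. b (e r) (e s) = z r s}"
 let ?R = "{w : Pi\<^sub>E I S. \<forall>p\<in>I. w (prod.swap p) = sg ep (w p)}"
 note eU = basis_mem[OF V e]
 have SK: "x : carrier K" if "x : S p" for x p
  using that z(1)[of "fst p" "snd p"] by (cases "p : Z") (simp_all add: S_def)
 have "bij_betw H ?L ?R"
 proof (rule bij_betw_imageI)
  show "inj_on H ?L"
  proof (rule inj_onI)
   fix b b' assume b: "b : ?L" "b' : ?L" and eq: "H b = H b'"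
   have bb: "b : Bil V U V U" "b' : Bil V U V U" using b by (simp_all add: Sf_def)
   show "b = b'"
   proof (rule Bil_eq_on_basis[OF bb V V e e])
    show "b (e r) (e s) = b' (e r) (e s)" if "r < n" "s < n" for r s
     using fun_cong[OF eq, of "(r, s)"] that by (simp add: H_def I_def)
   qed
  qed
  show "H ` ?L = ?R"
  proof (intro equalityI subsetI)
   fix w assume "w : H ` ?L"
   then obtain b where b: "b : Sf ep V U" "\<forall>(r,s)\<in>Z. b (e r) (e s) = z r s" "w = H b" by blast
   have bB: "b : Bil V U V U" using b(1) by (simp add: Sf_def)
   have "w : Pi\<^sub>E I S"
   proof (rule PiE_I)
    fix p assume p: "p : I"
    obtain r s where rs: "p = (r, s)" by (cases p)
    show "w p : S p"
    proof (cases "p : Z")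
     case True
     thus ?thesis using b(2,3) p rs by (auto simp: S_def H_def)
    next
     case False
     thus ?thesis using b(3) p rs Bil_D(3)[OF bB eU eU] by (simp add: S_def H_def I_def)
    qed
   qed (simp add: b(3) H_def)
   moreover have "w (prod.swap p) = sg ep (w p)" if "p : I" for p
   proof -
    obtain r s where p: "p = (r, s)" "r < n" "s < n" using \<open>p : I\<close> by (auto simp: I_def)
    have "b (e s) (e r) = sg ep (b (e r) (e s))"
     using b(1) eU[OF p(2)] eU[OF p(3)] unfolding Sf_def by blast
    thus ?thesis using p by (simp add: b(3) H_def I_def)
   qed
   ultimately show "w : ?R" by blast
  next
   fix w assume w: "w : ?R"
   have wP: "w : Pi\<^sub>E I S" using w by blast
   have wS: "w (r, s) : S (r, s)" if "r < n" "s < n" for r s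
    using wP that PiE_mem[of w I S "(r,s)"] by (simp add: I_def)
   have "\<exists>b\<in>Bil V U V U. \<forall>r<n. \<forall>s<n. b (e r) (e s) = w (r, s)"
    by (rule Bil_ex[OF V V e e]) (rule SK[OF wS])
   then obtain b where b: "b : Bil V U V U" "\<forall>r<n. \<forall>s<n. b (e r) (e s) = w (r, s)" by blast
   have "b : Sf ep V U"
   proof (rule Sf_basis[OF b(1) V e])
    fix r s assume rs: "r < n" "s < n"
    have "w (prod.swap (s, r)) = sg ep (w (s, r))" using w rs unfolding I_def by blast
    thus "b (e r) (e s) = sg ep (b (e s) (e r))" using b(2) rs by simp
   qed
   moreover have "b (e r) (e s) = z r s" if "(r, s) : Z" for r s
   proof -
    have "r < n" "s < n" using that Z(1) by blast+
    thus ?thesis using b(2) wS[of r s] that by (simp add: S_def)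
   qed
   moreover have "H b = w"
   proof
    fix p show "H b p = w p"
    proof (cases "p : I")
     case True thus ?thesis using b(2) by (cases p) (simp add: H_def I_def)
    next
     case False thus ?thesis using PiE_arb[OF wP False] by (simp add: H_def)
    qed
   qed
   ultimately show "w : H ` ?L" by blast
  qed
 qed
 hence "card ?L = card ?R" by (rule bij_betw_same_card)
 also have "\<dots> = (\<Prod>p\<in>P. card (S p)) * (\<Prod>p\<in>{p : I. prod.swap p = p}. card {x : S p. sg ep x = x})"
 proof (rule card_twisted_families)
  show "P \<union> {p : I. prod.swap p = p} \<union> prod.swap ` P = I"
  proof (intro equalityI subsetI)
   fix p assume "p : I"
   then obtain r s where p: "p = (r, s)" "r < n" "s < n" by (auto simp: I_def)
   consider "r < s" | "r = s" | "s < r" by linarith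
   thus "p : P \<union> {p : I. prod.swap p = p} \<union> prod.swap ` P"
   proof cases
    case 3
    hence "p = prod.swap (s, r)" "(s, r) : P" using p by (simp_all add: P_def)
    thus ?thesis by blast
   qed (use p in \<open>simp_all add: P_def I_def\<close>)
  qed (auto simp: P_def I_def)
  show "P \<inter> {p : I. prod.swap p = p} = {}" "P \<inter> prod.swap ` P = {}" by (auto simp: P_def)
  fix p x assume p: "p : I" and x: "x : S p"
  obtain r s where rs: "p = (r, s)" by (cases p)
  show "sg ep x : S (prod.swap p)"
  proof (cases "(r, s) : Z")
   case True
   hence "(s, r) : Z" by (rule Z(2))
   thus ?thesis using True x rs z(2)[of s r, symmetric] by (simp add: S_def)
  next
   case False
   hence "(s, r) \<notin> Z" using Z(2) by blast
   thus ?thesis using rs sg_simps(1)[OF SK[OF x], of ep] by (simp add: S_def)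
  qed
  show "sg ep (sg ep x) = x" by (rule sg_simps(3)[OF SK[OF x]])
 qed (auto simp: I_def)
 also have "(\<Prod>p\<in>P. card (S p)) = q ^ card {(r, s). r < s \<and> s < n \<and> (r, s) \<notin> Z}"
 proof -
  have fP: "finite P" by (rule finite_subset[of _ "{..<n} \<times> {..<n}"]) (auto simp: P_def)
  have "(\<Prod>p\<in>P. card (S p)) = (\<Prod>p\<in>P - Z. q)"
   using fP by (intro prod.mono_neutral_cong_right) (auto simp: S_def q_def)
  also have "P - Z = {(r, s). r < s \<and> s < n \<and> (r, s) \<notin> Z}" by (auto simp: P_def)
  finally show ?thesis by simp
 qed
 also have "(\<Prod>p\<in>{p : I. prod.swap p = p}. card {x : S p. sg ep x = x}) =
  q ^ (if ep = 1 then card {r. r < n \<and> (r, r) \<notin> Z} else 0)"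
 proof -
  have D: "{p : I. prod.swap p = p} = (%r. (r, r)) ` {..<n}"
  proof (intro equalityI subsetI)
   fix p assume p: "p : {p : I. prod.swap p = p}"
   obtain r s where rs: "p = (r, s)" by (cases p)
   have "prod.swap (r, s) = (r, s)" using p unfolding rs by blast
   hence "s = r" unfolding swap_simp by blast
   moreover have "r < n" using p unfolding rs I_def by blast
   ultimately show "p : (%r. (r, r)) ` {..<n}" unfolding rs by blast
  qed (auto simp: I_def)
  have "(\<Prod>p\<in>{p : I. prod.swap p = p}. card {x : S p. sg ep x = x}) = (\<Prod>r<n. card {x : S (r, r). sg ep x = x})"
   unfolding D by (subst prod.reindex) (auto simp: inj_on_def)
  also have "\<dots> = (\<Prod>r<n. if (r, r) : Z then 1 else if ep = 1 then q else 1)"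
  proof (intro prod.cong refl)
   fix r assume "r : {..<n}"
   have neg: "{x : carrier K. \<ominus> x = x} = {\<zero>}"
   proof (intro equalityI subsetI)
    fix x assume "x : {x : carrier K. \<ominus> x = x}"
    hence "x = \<zero>" by (intro eq_neg_imp_zero) auto
    thus "x : {\<zero>}" by simp
   qed simp
   have "{x : S (r, r). sg ep x = x} = {z r r}" if "(r, r) : Z"
    using that z(2)[OF that, symmetric] by (auto simp: S_def)
   thus "card {x : S (r, r). sg ep x = x} = (if (r, r) : Z then 1 else if ep = 1 then q else 1)"
    using neg by (cases "(r, r) : Z") (simp_all add: S_def sg_def q_def)
  qed
  also have "\<dots> = (\<Prod>r\<in>{r. r < n \<and> (r, r) \<notin> Z}. if ep = 1 then q else 1)"
   by (rule prod.mono_neutral_cong_right) auto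
  also have "\<dots> = q ^ (if ep = 1 then card {r. r < n \<and> (r, r) \<notin> Z} else 0)" by simp
  finally show ?thesis .
 qed
 finally show ?thesis by (simp add: power_add)
qed

subsubsection \<open>Splitting a basis\<close>

lemma lc_split:
 assumes V: "vectorspace K V" and "\<And>i. i < m + k ==> v i : carrier V" "\<And>i. i < m + k ==> x i : carrier K"
 shows "lc V (m + k) v x = lc V m v x \<oplus>\<^bsub>V\<^esub> lc V k (%i. v (m + i)) (%i. x (m + i))"
 using assms(2,3)
proof (induction k)
 case 0
 have "lc V m v x : carrier V" using 0 by (intro lc_closed V) auto
 thus ?case using V by (simp add: vs_simps)
next
 case (Suc k)
 have "lc V m v x : carrier V" using Suc.prems by (intro lc_closed V) auto
 moreover have "lc V k (%i. v (m + i)) (%i. x (m + i)) : carrier V" using Suc.prems by (intro lc_closed V) auto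
 ultimately show ?case using Suc V by (simp add: vs_ac(2))
qed

text \<open>The tail of a basis spans a complement of the span of the head. In this way the
  orthogonal space of an isotropic \<open>A\<close> will be split into \<open>A\<close> and a space
  that carries the induced form.\<close>

lemma basis_split:
 assumes V: "vectorspace K V" and v: "indep V (m + k) v"
 shows "indep V k (%i. v (m + i))"
  and "u : lspan V (m + k) v ==> \<exists>a\<in>lspan V m v. \<exists>p\<in>lspan V k (%i. v (m + i)). u = a \<oplus>\<^bsub>V\<^esub> p"
  and "u : lspan V m v ==> u : lspan V k (%i. v (m + i)) ==> u = \<zero>\<^bsub>V\<^esub>"
proof -
 note vc = indep_D[OF v]
 let ?v = "%i. v (m + i)"
 \<comment> \<open>A relation between the two parts is a single relation \<open>y\<close> of the
   whole basis.\<close>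
 have key: "(\<forall>i<m. x i = \<zero>) \<and> (\<forall>i<k. x' i = \<zero>)"
  if x: "\<And>i. i < m ==> x i : carrier K" and x': "\<And>i. i < k ==> x' i : carrier K"
   and z: "lc V m v x \<oplus>\<^bsub>V\<^esub> lc V k ?v x' = \<zero>\<^bsub>V\<^esub>" for x x'
 proof -
  define y where "y = (\<lambda>i\<in>{..<m+k}. if i < m then x i else x' (i - m))"
  have y: "y : cf (m + k)" using x x' by (simp add: y_def cf_def)
  have "lc V (m + k) v y = lc V m v y \<oplus>\<^bsub>V\<^esub> lc V k ?v (%i. y (m + i))"
   by (rule lc_split[OF V]) (use vc cf_D[OF y] in auto)
  also have "lc V m v y = lc V m v x" by (rule lc_cong) (simp_all add: y_def)
  also have "lc V k ?v (%i. y (m + i)) = lc V k ?v x'" by (rule lc_cong) (simp_all add: y_def)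
  finally have "lc V (m + k) v y = \<zero>\<^bsub>V\<^esub>" using z by simp
  hence y0: "y i = \<zero>" if "i < m + k" for i using v y that unfolding indep_def by blast
  have "x i = \<zero>" if "i < m" for i using y0[of i] that by (simp add: y_def)
  moreover have "x' i = \<zero>" if "i < k" for i using y0[of "m + i"] that by (simp add: y_def)
  ultimately show ?thesis by blast
 qed
 show "indep V k ?v" unfolding indep_def
 proof (intro conjI ballI impI)
  fix x' assume x': "x' : cf k" "lc V k ?v x' = \<zero>\<^bsub>V\<^esub>"
  have "lc V m v (%_. \<zero>) = \<zero>\<^bsub>V\<^esub>" by (rule lc_zero[OF V]) (use vc in auto)
  hence "lc V m v (%_. \<zero>) \<oplus>\<^bsub>V\<^esub> lc V k ?v x' = \<zero>\<^bsub>V\<^esub>" using x'(2) V by (simp add: vs_simps)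
  thus "\<forall>i<k. x' i = \<zero>" using key[of "%_. \<zero>" x'] cf_D[OF x'(1)] by simp
 qed (use vc in auto)
 show "\<exists>a\<in>lspan V m v. \<exists>p\<in>lspan V k ?v. u = a \<oplus>\<^bsub>V\<^esub> p" if u: "u : lspan V (m + k) v"
 proof -
  obtain x where x: "x : cf (m + k)" "u = lc V (m + k) v x" using u by (auto simp: lspan_def)
  have "u = lc V m v x \<oplus>\<^bsub>V\<^esub> lc V k ?v (%i. x (m + i))"
   unfolding x(2) by (rule lc_split[OF V]) (use vc cf_D[OF x(1)] in auto)
  moreover have "lc V m v x : lspan V m v" by (rule lspanI) (use cf_D[OF x(1)] in auto)
  moreover have "lc V k ?v (%i. x (m + i)) : lspan V k ?v" by (rule lspanI) (use cf_D[OF x(1)] in auto)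
  ultimately show ?thesis by blast
 qed
 show "u = \<zero>\<^bsub>V\<^esub>" if u: "u : lspan V m v" "u : lspan V k ?v"
 proof -
  obtain x where x: "x : cf m" "u = lc V m v x" using u(1) by (auto simp: lspan_def)
  obtain y where y: "y : cf k" "u = lc V k ?v y" using u(2) by (auto simp: lspan_def)
  have uc: "u : carrier V" unfolding x(2) by (rule lc_closed[OF V]) (use vc cf_D[OF x(1)] in auto)
  have "lc V k ?v (%i. (\<ominus> \<one>) \<otimes> y i) = (\<ominus> \<one>) \<odot>\<^bsub>V\<^esub> lc V k ?v y"
   by (rule lc_smult[OF V]) (use vc cf_D[OF y(1)] in auto)
  hence "lc V m v x \<oplus>\<^bsub>V\<^esub> lc V k ?v (%i. (\<ominus> \<one>) \<otimes> y i) = \<zero>\<^bsub>V\<^esub>"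
   using vs_neg(2)[OF V uc] x(2) y(2) by simp
  note lz = this
  have "(\<forall>i<m. x i = \<zero>) \<and> (\<forall>i<k. (\<ominus> \<one>) \<otimes> y i = \<zero>)"
  proof (rule key[of x "%i. (\<ominus> \<one>) \<otimes> y i", OF _ _ lz])
   show "x i : carrier K" if "i < m" for i by (rule cf_D[OF x(1) that])
   show "(\<ominus> \<one>) \<otimes> y i : carrier K" if "i < k" for i using cf_D[OF y(1) that] by simp
  qed
  thus ?thesis unfolding x(2) by (intro lc_zero[OF V]) (use vc in auto)
 qed
qed

lemma adapted_basis3:
 assumes "subspace K A V" "subspace K P V" "subspace K L V" "A \<subseteq> P" "P \<subseteq> L" "finite L"
 obtains e where "indep V (sdim L) e" "lspan V (sdim L) e = L" "lspan V (sdim P) e = P" "lspan V (sdim A) e = A"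
proof -
 define F where "F = (%k::nat. if k = 0 then A else if k = 1 then P else L)"
 have fin: "finite P" "finite A" using finite_subset[OF assms(5,6)] finite_subset[OF assms(4)] by blast+
 have "\<exists>e. indep V (sdim (F 2)) e \<and> (\<forall>k\<le>2. lspan V (sdim (F k)) e = F k)"
  by (rule adapted_basis[OF subspace_D(1)[OF assms(1)]])
   (use assms fin in \<open>auto simp: F_def\<close>)
 then obtain e where e: "indep V (sdim (F 2)) e" "\<forall>k\<le>2. lspan V (sdim (F k)) e = F k" by blast
 show ?thesis using that[of e] e(1) e(2)[rule_format, of 0] e(2)[rule_format, of 1] e(2)[rule_format, of 2]
  by (simp add: F_def)
qed

lemma sum_shift_gauss: "(\<Sum>j<a. c + j) = a * c + a * (a - 1) div (2::nat)"
proof (induction a)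
 case (Suc a)
 have "Suc a * a div 2 = a * (a - 1) div 2 + a"
 proof (cases a)
  case (Suc b)
  have "Suc a * a = a * (a - 1) + a * 2" by (simp add: Suc algebra_simps)
  thus ?thesis by simp
 qed simp
 thus ?case using Suc by simp
qed simp

lemma agree_on_lspan:
 assumes b: "b : Bil V U W U'" and X: "X : Bil V A W U'" and U: "subspace K A V" "A \<subseteq> U" "subspace K U V" "subspace K U' W"
  and e: "indep V a e" "lspan V a e = A" and f: "indep W n f" "lspan W n f = U'"
  and eq: "\<And>r s. r < a ==> s < n ==> b (e r) (f s) = X (e r) (f s)" and xy: "x : A" "y : U'"
 shows "b x y = X x y"
proof -
 note V = subspace_D(1)[OF U(1)] and W = subspace_D(1)[OF U(4)]
 have "(\<lambda>x\<in>A. \<lambda>y\<in>U'. b x y) = X"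
  by (rule Bil_eq_on_basis[OF Bil_restrict[OF b U(1,2) U(4) subset_refl] X V W e f])
   (simp add: basis_mem[OF V e] basis_mem[OF W f] eq)
 from fun_cong[OF fun_cong[OF this, of x], of y] show ?thesis using xy by simp
qed

end

section \<open>Extending a form from a subspace\<close>

context odd_field
begin

lemma Sf_sym: "b : Sf ep V U ==> x : U ==> y : U ==> b x y = sg ep (b y x)"
 and Sf_Bil: "b : Sf ep V U ==> b : Bil V U V U"
 unfolding Sf_def by blast+

lemma finite_Bil: "finite U ==> finite U' ==> finite (Bil V U W U')"
 by (rule finite_subset[of _ "U \<rightarrow>\<^sub>E (U' \<rightarrow>\<^sub>E carrier K)"]) (auto simp: Bil_def finite_K intro!: finite_PiE)

lemma finite_Sf: "finite U ==> finite (Sf ep V U)"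
 by (rule finite_subset[OF _ finite_Bil[of U U V V]]) (auto simp: Sf_def)

lemma Sf_restrict:
 assumes b: "b : Sf ep V U" and P: "subspace K P V" "P \<subseteq> U"
 shows "(\<lambda>x\<in>P. \<lambda>y\<in>P. b x y) : Sf ep V P"
 unfolding Sf_def
proof (intro CollectI conjI ballI)
 show "(\<lambda>x\<in>P. \<lambda>y\<in>P. b x y) : Bil V P V P" by (rule Bil_restrict[OF Sf_Bil[OF b] P P])
 fix x y assume xy: "x : P" "y : P"
 have "b x y = sg ep (b y x)" by (rule Sf_sym[OF b]) (use xy P in blast)+
 thus "(\<lambda>x\<in>P. \<lambda>y\<in>P. b x y) x y = sg ep ((\<lambda>x\<in>P. \<lambda>y\<in>P. b x y) y x)" 
  unfolding restrict_apply using xy by (simp only: if_True)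
qed

lemma sdim_perp:
 assumes c: "c : Bil V A W U" and A: "subspace K A V" "finite A" and U: "subspace K U W" "finite U"
  and nd: "left_nondeg V A U c"
 shows "sdim A + sdim {y : U. \<forall>x\<in>A. c x y = \<zero>} = sdim U"
proof -
 let ?P = "{y : U. \<forall>x\<in>A. c x y = \<zero>}"
 have "q ^ (sdim ?P + sdim A) = q ^ sdim U"
  using card_perp[OF assms] card_subspace[OF A] card_subspace[OF U] card_subspace[OF subspace_perp[OF c U(1)]] U(2)
  by (simp add: power_add)
 hence "sdim ?P + sdim A = sdim U" unfolding q_power_inj .
 thus ?thesis by simp
qed

text \<open>Basis positions fall into three blocks: \<open>A\<close> (size \<open>a\<close>), a
  complement of \<open>A\<close> in its orthogonal space (size \<open>c\<close>), and the rest (size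
  \<open>a\<close> again). Rows and columns of \<open>A\<close> and the middle square are
  prescribed. Free are the \<open>a * c\<close> entries between middle and last block, and the last
  square, with \<open>a * (a - 1) div 2\<close> entries above its diagonal and \<open>a\<close> on
  it.\<close>

lemma card_free_pairs:
 assumes m: "m = a + c" "n = m + a"
  and Z: "Z = {(r, s). r < n \<and> s < n \<and> (r < a \<or> s < a \<or> (r < m \<and> s < (m::nat)))}"
 shows "card {(r, s). r < s \<and> s < n \<and> (r, s) \<notin> Z} = a * c + a * (a - 1) div 2"
  and "card {r. r < n \<and> (r, r) \<notin> Z} = a"
proof -
 have "{(r, s). r < s \<and> s < n \<and> (r, s) \<notin> Z} = prod.swap ` (SIGMA s:{m..<n}. {a..<s})"
 proof (intro equalityI subsetI)
  fix p assume p: "p : {(r, s). r < s \<and> s < n \<and> (r, s) \<notin> Z}"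
  obtain r s where rs: "p = (r, s)" by (cases p)
  have "(s, r) : (SIGMA s:{m..<n}. {a..<s})" using p by (auto simp: rs Z)
  hence "prod.swap (s, r) : prod.swap ` (SIGMA s:{m..<n}. {a..<s})" by (rule imageI)
  thus "p : prod.swap ` (SIGMA s:{m..<n}. {a..<s})" by (simp only: rs swap_simp)
 next
  fix p assume "p : prod.swap ` (SIGMA s:{m..<n}. {a..<s})"
  then obtain r s where "p = prod.swap (s, r)" "s : {m..<n}" "r : {a..<s}" by blast
  thus "p : {(r, s). r < s \<and> s < n \<and> (r, s) \<notin> Z}" using m by (simp add: Z)
 qed
 hence "card {(r, s). r < s \<and> s < n \<and> (r, s) \<notin> Z} = card (SIGMA s:{m..<n}. {a..<s})"
  by (simp add: card_image)
 also have "\<dots> = (\<Sum>s\<in>{m..<n}. s - a)" by simp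
 also have "\<dots> = (\<Sum>j<a. c + j)"
  by (rule sum.reindex_bij_witness[of _ "%j. m + j" "%s. s - m"]) (use m in auto)
 finally show "card {(r, s). r < s \<and> s < n \<and> (r, s) \<notin> Z} = a * c + a * (a - 1) div 2"
  by (simp only: sum_shift_gauss)
 have "{r. r < n \<and> (r, r) \<notin> Z} = {m..<n}" using m by (auto simp: Z)
 thus "card {r. r < n \<and> (r, r) \<notin> Z} = a" using m by simp
qed

text \<open>The values \<open>X\<close> on \<open>A\<close> already determine the orthogonal space
  \<open>P\<close> of \<open>A\<close>. With \<open>P\<close> split into \<open>A\<close> and
  \<open>P'\<close>, an extension of \<open>X\<close> is nondegenerate exactly when its restriction
  to \<open>P'\<close> is, and every form on \<open>P'\<close> leaves the same matrix entries free.
  The count \<open>N\<close> is assumed for all spaces of the right dimension because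
  \<open>P'\<close> depends on \<open>X\<close>.\<close>

lemma card_ext_isotropic:
 assumes U: "subspace K U V" "finite U" and A: "subspace K A V" "A \<subseteq> U"
  and X: "X : Bil V A V U" "left_nondeg V A U X" "orth X A A"
  and ep: "ep : {1, -1}"
  and N: "\<And>P'. subspace K P' V ==> P' \<subseteq> U ==> sdim P' = sdim U - 2 * sdim A ==>
    card {b : Sf ep V P'. left_nondeg V P' P' b} = N"
 shows "2 * sdim A \<le> sdim U"
  and "card (extf ep V U A X) =
   N * q ^ (sdim A * (sdim U - 2 * sdim A) + sdim A * (sdim A - 1) div 2 + (if ep = 1 then sdim A else 0))"
proof -
 define a n c P where "a = sdim A" and "n = sdim U" and "c = sdim U - 2 * sdim A"
  and "P = {y : U. \<forall>x\<in>A. X x y = \<zero>}"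
 note V = subspace_D(1)[OF U(1)]
 have fA: "finite A" using A U finite_subset by blast
 have P: "subspace K P V" unfolding P_def by (rule subspace_perp[OF X(1) U(1)])
 have PU: "P \<subseteq> U" by (auto simp: P_def)
 have AP: "A \<subseteq> P" using X(3) A(2) by (auto simp: P_def)
 have fP: "finite P" using PU U finite_subset by blast
 have sP: "a + sdim P = n" unfolding a_def n_def P_def by (rule sdim_perp[OF X(1) A(1) fA U X(2)])
 have "a \<le> sdim P" unfolding a_def by (rule sdim_mono[OF A(1) P fP AP])
 hence sP': "sdim P = a + c" "n = a + c + a" and le: "2 * a \<le> n" using sP by (auto simp: c_def a_def n_def)
 show "2 * sdim A \<le> sdim U" using le by (simp add: a_def n_def)
 obtain e where e: "indep V n e" "lspan V n e = U" and eP: "lspan V (a + c) e = P" and eA: "lspan V a e = A"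
  using adapted_basis3[OF A(1) P U(1) AP PU U(2)] sP'(1) unfolding a_def n_def by metis
 have iac: "indep V (a + c) e" and ia: "indep V a e" using indep_mono[OF V e(1)] sP'(2) by auto
 define e' where "e' = (%i. e (a + i))"
 define P' where "P' = lspan V c e'"
 note split = basis_split[OF V iac, folded e'_def P'_def, unfolded eP eA]
 note eU = basis_mem[OF V e]
 have e'P': "e' i : P'" if "i < c" for i using basis_mem[OF V split(1) refl that] by (simp add: P'_def)
 have P': "subspace K P' V" unfolding P'_def by (rule subspace_lspan[OF V]) (rule indep_D[OF split(1)])
 have P'P: "P' \<subseteq> P" unfolding P'_def
  by (rule lspan_subset[OF P]) (use basis_mem[OF V iac eP] in \<open>simp add: e'_def\<close>)
 have P'U: "P' \<subseteq> U" using P'P PU by blast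
 have fP': "finite P'" using P'U U finite_subset by blast
 have sdP': "sdim P' = c" by (rule sdim_eqI) (simp add: P'_def card_lspan[OF V split(1)])
 define T where "T = extf ep V U A X"
 define B' where "B' = {b : Sf ep V P'. left_nondeg V P' P' b}"
 define R where "R = (%b :: 'c => 'c => 'a. \<lambda>x\<in>P'. \<lambda>y\<in>P'. b x y)"
 have cB: "card B' = N" unfolding B'_def by (rule N[OF P' P'U]) (simp add: sdP' c_def)
 \<comment> \<open>The positions whose entries are fixed by \<open>X\<close>, by symmetry, or by the
   form on \<open>P'\<close>.\<close>
 define Z where "Z = {(r, s). r < n \<and> s < n \<and> (r < a \<or> s < a \<or> (r < a + c \<and> s < a + c))}"
 have fib: "card {b : T. R b = b'} = q ^ (a * c + a * (a - 1) div 2 + (if ep = 1 then a else 0))" if b': "b' : B'" for b'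
 proof -
  have b'S: "b' : Sf ep V P'" and b'n: "left_nondeg V P' P' b'" using b' by (simp_all add: B'_def)
  define z where "z = (%r s. if r < a then X (e r) (e s) else if s < a then sg ep (X (e s) (e r)) else b' (e r) (e s))"
  have eA': "e r : A" if "r < a" for r by (rule basis_mem[OF V ia eA that])
  have eP': "e r : P'" if "a \<le> r" "r < a + c" for r using e'P'[of "r - a"] that by (simp add: e'_def)
  have "{b : T. R b = b'} = {b : Sf ep V U. \<forall>(r,s)\<in>Z. b (e r) (e s) = z r s}"
  proof (intro equalityI subsetI)
   fix b assume b: "b : {b : T. R b = b'}"
   hence bS: "b : Sf ep V U" and bX: "\<And>x y. x : A ==> y : U ==> b x y = X x y" and Rb: "R b = b'"
    by (simp_all add: T_def)
   have "b (e r) (e s) = z r s" if "(r, s) : Z" for r s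
   proof -
    have rs: "r < n" "s < n" using that by (simp_all add: Z_def)
    consider "r < a" | "\<not> r < a" "s < a" | "\<not> r < a" "\<not> s < a" by blast
    thus ?thesis
    proof cases
     case 1
     thus ?thesis using bX[OF eA' eU[OF rs(2)]] by (simp add: z_def)
    next
     case 2
     have "b (e r) (e s) = sg ep (b (e s) (e r))" by (rule Sf_sym[OF bS eU[OF rs(1)] eU[OF rs(2)]])
     also have "b (e s) (e r) = X (e s) (e r)" by (rule bX[OF eA'[OF 2(2)] eU[OF rs(1)]])
     finally show ?thesis using 2 by (simp add: z_def)
    next
     case 3
     hence "r < a + c" "s < a + c" using that by (simp_all add: Z_def)
     hence "e r : P'" "e s : P'" using 3 eP' by simp_all
     hence "R b (e r) (e s) = b (e r) (e s)" by (simp add: R_def)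
     thus ?thesis using 3 Rb by (simp add: z_def)
    qed
   qed
   thus "b : {b : Sf ep V U. \<forall>(r,s)\<in>Z. b (e r) (e s) = z r s}" using bS by blast
  next
   fix b assume b: "b : {b : Sf ep V U. \<forall>(r,s)\<in>Z. b (e r) (e s) = z r s}"
   hence bS: "b : Sf ep V U" and bz: "\<And>r s. (r, s) : Z ==> b (e r) (e s) = z r s" by blast+
   note bB = Sf_Bil[OF bS]
   have bX: "b x y = X x y" if "x : A" "y : U" for x y
   proof (rule agree_on_lspan[OF bB X(1) A U(1) U(1) ia eA e _ that])
    fix r s assume rs: "r < a" "s < n"
    hence "(r, s) : Z" using sP'(2) by (simp add: Z_def)
    from bz[OF this] show "b (e r) (e s) = X (e r) (e s)" using rs by (simp add: z_def)
   qed
   have Rb: "R b = b'" unfolding R_def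
   proof (rule Bil_eq_on_basis[OF Bil_restrict[OF bB P' P'U P' P'U] Sf_Bil[OF b'S] V V split(1) P'_def[symmetric] split(1) P'_def[symmetric]])
    fix r s assume rs: "r < c" "s < c"
    have "(a + r, a + s) : Z" using rs sP'(2) by (simp add: Z_def)
    from bz[OF this] show "(\<lambda>x\<in>P'. \<lambda>y\<in>P'. b x y) (e' r) (e' s) = b' (e' r) (e' s)"
     using e'P' rs by (simp add: z_def e'_def)
   qed
   \<comment> \<open>A vector of the radical is orthogonal to \<open>A\<close>, so it lies in
     \<open>P\<close>. Its component in \<open>P'\<close> vanishes because the form there is
     nondegenerate, and the remaining component lies in \<open>A\<close>, where \<open>X\<close> is
     nondegenerate.\<close>
   have "left_nondeg V U U b" unfolding left_nondeg_def
   proof (intro ballI impI)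
    fix x assume x: "x : U" and x0: "\<forall>y\<in>U. b x y = \<zero>"
    have "X y x = \<zero>" if y: "y : A" for y
    proof -
     have yU: "y : U" using y A by blast
     have "X y x = b y x" by (rule bX[OF y x, symmetric])
     also have "\<dots> = sg ep (b x y)" by (rule Sf_sym[OF bS yU x])
     also have "b x y = \<zero>" using x0 yU by blast
     finally show ?thesis by simp
    qed
    hence "x : P" using x by (simp add: P_def)
    from split(2)[OF this] obtain a0 p where ap: "a0 : A" "p : P'" "x = a0 \<oplus>\<^bsub>V\<^esub> p" by blast
    have apU: "a0 : U" "p : U" using ap A P'U by blast+
    have "b' p y = \<zero>" if y: "y : P'" for y
    proof -
     have yU: "y : U" and yP: "y : P" using y P'U P'P by blast+
     have "b x y = b a0 y \<oplus> b p y" unfolding ap(3) using lin_D(2)[OF Bil_D(1)[OF bB yU] apU] by simp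
     moreover have "b x y = \<zero>" using x0 yU by blast
     moreover have "b a0 y = \<zero>" using bX[OF ap(1) yU] yP ap(1) by (simp add: P_def)
     moreover have "b p y : carrier K" by (rule Bil_D(3)[OF bB apU(2) yU])
     ultimately have "b p y = \<zero>" by simp
     thus ?thesis unfolding Rb[symmetric] using ap(2) y by (simp add: R_def)
    qed
    hence "p = \<zero>\<^bsub>V\<^esub>" using b'n ap(2) unfolding left_nondeg_def by blast
    hence xA: "x : A" using ap subspace_D(4)[OF A(1) ap(1)] V by (simp add: vs_simps)
    have "\<forall>y\<in>U. X x y = \<zero>" using x0 bX[OF xA] by simp
    thus "x = \<zero>\<^bsub>V\<^esub>" using X(2) xA unfolding left_nondeg_def by blast
   qed
   thus "b : {b : T. R b = b'}" using bS bX Rb by (simp add: T_def)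
  qed
  also have "card \<dots> = q ^ (card {(r, s). r < s \<and> s < n \<and> (r, s) \<notin> Z} + (if ep = 1 then card {r. r < n \<and> (r, r) \<notin> Z} else 0))"
  proof (rule card_Sf_prescribed[OF V e ep])
   show "Z \<subseteq> {..<n} \<times> {..<n}" by (auto simp: Z_def)
   show "(s, r) : Z" if "(r, s) : Z" for r s using that by (auto simp: Z_def)
   fix r s assume rsZ: "(r, s) : Z"
   hence rs: "r < n" "s < n" by (simp_all add: Z_def)
   have XK: "X (e i) (e j) : carrier K" if "i < a" "j < n" for i j
    by (rule Bil_D(3)[OF X(1) eA'[OF that(1)] eU[OF that(2)]])
   consider "r < a" "s < a" | "r < a" "\<not> s < a" | "\<not> r < a" "s < a" | "\<not> r < a" "\<not> s < a" by blast
   hence "z r s : carrier K \<and> z r s = sg ep (z s r)"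
   proof cases
    case 1
    hence "X (e r) (e s) = \<zero>" "X (e s) (e r) = \<zero>" using X(3) eA' by blast+
    thus ?thesis using 1 by (simp add: z_def)
   next
    case 4
    hence "r < a + c" "s < a + c" using rsZ by (simp_all add: Z_def)
    hence eP: "e r : P'" "e s : P'" using 4 eP' by simp_all
    have "b' (e r) (e s) = sg ep (b' (e s) (e r))" by (rule Sf_sym[OF b'S eP])
    moreover have "b' (e r) (e s) : carrier K" by (rule Bil_D(3)[OF Sf_Bil[OF b'S] eP])
    ultimately show ?thesis using 4 unfolding z_def by (simp only: if_False simp_thms)
   qed (use XK rs in \<open>simp_all add: z_def\<close>)
   thus "z r s : carrier K" "z r s = sg ep (z s r)" by blast+
  qed
  also have "\<dots> = q ^ (a * c + a * (a - 1) div 2 + (if ep = 1 then a else 0))"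
   using card_free_pairs[OF refl sP'(2) Z_def] by simp
  finally show ?thesis .
 qed
 have "card T = card B' * q ^ (a * c + a * (a - 1) div 2 + (if ep = 1 then a else 0))"
 proof (rule card_fibres[where f = R, OF _ _ fib])
  show "finite B'" unfolding B'_def by (rule finite_subset[OF _ finite_Sf[OF fP', where V = V]]) blast
  show "finite T" unfolding T_def by (rule finite_subset[OF _ finite_Sf[OF U(2), where V = V]]) blast
  fix b assume "b : T"
  hence bS: "b : Sf ep V U" and bn: "left_nondeg V U U b" and bX: "\<And>x y. x : A ==> y : U ==> b x y = X x y"
   by (simp_all add: T_def)
  note bB = Sf_Bil[OF bS]
  define bP where "bP = (\<lambda>x\<in>P. \<lambda>y\<in>U. b x y)"
  \<comment> \<open>The orthogonal space of \<open>P\<close> contains \<open>A\<close> and has the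
    same dimension, hence equals \<open>A\<close>. A vector in the radical of the restriction to
    \<open>P'\<close> is orthogonal to all of \<open>P\<close>, so it lies in both \<open>A\<close>
    and \<open>P'\<close> and is 0.\<close>
  define Pp where "Pp = {y : U. \<forall>x\<in>P. bP x y = \<zero>}"
  have bPB: "bP : Bil V P V U" unfolding bP_def by (rule Bil_restrict[OF bB P PU U(1) subset_refl])
  have bPv: "bP x y = b x y" if "x : P" "y : U" for x y using that by (simp add: bP_def)
  have "left_nondeg V P U bP" unfolding left_nondeg_def
  proof (intro ballI impI)
   fix x assume x: "x : P" "\<forall>y\<in>U. bP x y = \<zero>"
   hence "\<forall>y\<in>U. b x y = \<zero>" using bPv by simp
   thus "x = \<zero>\<^bsub>V\<^esub>" using bn x(1) PU unfolding left_nondeg_def by blast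
  qed
  from sdim_perp[OF bPB P fP U this] have "sdim Pp = a" using sP by (simp add: Pp_def n_def)
  moreover have fPp: "finite Pp" using U by (simp add: Pp_def)
  moreover have sPp: "subspace K Pp V" unfolding Pp_def by (rule subspace_perp[OF bPB U(1)])
  ultimately have "card Pp = card A"
   using card_subspace[OF sPp fPp] card_subspace[OF A(1) fA] by (simp add: a_def)
  moreover have "A \<subseteq> Pp"
  proof
   fix y assume y: "y : A"
   have yU: "y : U" using y A by blast
   have "bP x y = \<zero>" if x: "x : P" for x
   proof -
    have xU: "x : U" using x PU by blast
    have "b x y = sg ep (b y x)" by (rule Sf_sym[OF bS xU yU])
    also have "b y x = X y x" by (rule bX[OF y xU])
    also have "X y x = \<zero>" using x y by (simp add: P_def)
    finally show ?thesis using bPv[OF x yU] by simp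
   qed
   thus "y : Pp" using yU by (simp add: Pp_def)
  qed
  ultimately have PpA: "A = Pp" using card_subset_eq[OF fPp] by metis
  have "left_nondeg V P' P' (R b)" unfolding left_nondeg_def
  proof (intro ballI impI)
   fix x assume x: "x : P'" and x0: "\<forall>y\<in>P'. R b x y = \<zero>"
   have xU: "x : U" and xP: "x : P" using x P'U P'P by blast+
   have "bP w x = \<zero>" if w: "w : P" for w
   proof -
    obtain a0 p where ap: "a0 : A" "p : P'" "w = a0 \<oplus>\<^bsub>V\<^esub> p" using split(2)[OF w] by blast
    have apU: "a0 : U" "p : U" using ap A P'U by blast+
    have "R b x p = b x p" using x ap(2) by (simp add: R_def)
    hence "b x p = \<zero>" using x0 ap(2) by simp
    hence "b p x = \<zero>" using Sf_sym[OF bS apU(2) xU] by simp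
    moreover have "b a0 x = \<zero>" using bX[OF ap(1) xU] xP ap(1) by (simp add: P_def)
    moreover have "b w x = b a0 x \<oplus> b p x" unfolding ap(3) using lin_D(2)[OF Bil_D(1)[OF bB xU] apU] by simp
    ultimately show ?thesis using bPv[OF w xU] by simp
   qed
   hence "x : A" unfolding PpA using xU by (simp add: Pp_def)
   thus "x = \<zero>\<^bsub>V\<^esub>" by (rule split(3)[OF _ x])
  qed
  moreover have "R b : Sf ep V P'" unfolding R_def by (rule Sf_restrict[OF bS P' P'U])
  ultimately show "R b : B'" by (simp add: B'_def)
 qed
 thus "card (extf ep V U A X) =
   N * q ^ (sdim A * (sdim U - 2 * sdim A) + sdim A * (sdim A - 1) div 2 + (if ep = 1 then sdim A else 0))"
  unfolding cB T_def a_def c_def .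
qed

text \<open>Here \<open>U\<close> is the orthogonal sum of \<open>P\<close> and the line of
  \<open>v\<close>, so an extension is determined by its restriction to \<open>P\<close>. The lemma
  is restricted to symmetric forms because a skew form never takes a nonzero value at
  \<open>v\<close>, \<open>v\<close>.\<close>

lemma card_ext_anisotropic:
 assumes U: "subspace K U V" "finite U" and v: "v : U" and A: "A = lspan V 1 (%_. v)"
  and X: "X : Bil V A V U" "X v v \<noteq> \<zero>"
  and N: "\<And>P. subspace K P V ==> P \<subseteq> U ==> sdim P + 1 = sdim U ==>
    card {b : Sf 1 V P. left_nondeg V P P b} = N"
 shows "card (extf 1 V U A X) = N"
proof -
 note V = subspace_D(1)[OF U(1)]
 have vc: "v : carrier V" by (rule subspace_D(4)[OF U(1) v])
 have vA: "v : A" unfolding A using lspan_mem[OF V, of 1 "%_. v" 0] vc by simp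
 have sA: "subspace K A V" unfolding A by (rule subspace_lspan[OF V]) (rule vc)
 have AU: "A \<subseteq> U" unfolding A by (rule lspan_subset[OF U(1)]) (rule v)
 have fA: "finite A" using AU U finite_subset by blast
 have v0: "v \<noteq> \<zero>\<^bsub>V\<^esub>"
 proof
  assume "v = \<zero>\<^bsub>V\<^esub>"
  hence "X v v = \<zero>" using lin_zero[OF Bil_D(2)[OF X(1) vA] U(1) vs_KV] by simp
  thus False using X(2) by simp
 qed
 have i1: "indep V 1 (%_. v)" using indep_Suc[OF V, of 0 "%_. v"] vc v0 by simp
 have sdA: "sdim A = 1" by (rule sdim_eqI) (unfold A, rule card_lspan[OF V i1])
 define P where "P = {y : U. \<forall>x\<in>A. X x y = \<zero>}"
 have Ael: "\<exists>k\<in>carrier K. x = k \<odot>\<^bsub>V\<^esub> v" if x: "x : A" for x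
 proof -
  obtain y where y: "y : cf 1" "x = lc V 1 (%_. v) y" using x unfolding A lspan_def by blast
  have "x = y 0 \<odot>\<^bsub>V\<^esub> v" using y(2) cf_D[OF y(1), of 0] V vc by (simp add: vs_simps)
  thus ?thesis using cf_D[OF y(1), of 0] by auto
 qed
 have nd: "left_nondeg V A U X" unfolding left_nondeg_def
 proof (intro ballI impI)
  fix x assume x: "x : A" and x0: "\<forall>y\<in>U. X x y = \<zero>"
  obtain k where k: "k : carrier K" "x = k \<odot>\<^bsub>V\<^esub> v" using Ael[OF x] by blast
  have "X x v = k \<otimes> X v v" unfolding k(2) using lin_D(3)[OF Bil_D(1)[OF X(1) v] k(1) vA] by simp
  hence "k \<otimes> X v v = \<zero>" using x0 v by simp
  hence "k = \<zero>" using k(1) Bil_D(3)[OF X(1) vA v] X(2) by (simp add: integral_iff)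
  thus "x = \<zero>\<^bsub>V\<^esub>" unfolding k(2) using V vc by (simp add: vs_simps)
 qed
 have P: "subspace K P V" unfolding P_def by (rule subspace_perp[OF X(1) U(1)])
 have PU: "P \<subseteq> U" by (auto simp: P_def)
 have fP: "finite P" using PU U finite_subset by blast
 define m where "m = sdim P"
 have sP: "m + 1 = sdim U" using sdim_perp[OF X(1) sA fA U nd] sdA by (simp add: P_def m_def)
 have vP: "v \<notin> P" using X(2) vA by (auto simp: P_def)
 obtain f where f: "indep V m f" "lspan V m f = P"
 proof -
  obtain m' f where "indep V m' f" "lspan V m' f = P" "card P = q ^ m'" by (rule basis_exists[OF P fP])
  moreover from this(3) have "m' = m" unfolding m_def by (intro sdim_eqI[symmetric])
  ultimately show ?thesis using that by blast
 qed
 define e where "e = f(m := v)"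
 have em: "e m = v" by (simp add: e_def)
 have ef: "indep V m e" "lspan V m e = P"
  using f indep_cong[of m e f V] lspan_cong[of m e f V] by (simp_all add: e_def)
 have e1: "indep V (m + 1) e" using indep_Suc[OF V, of m e] ef vc vP em by simp
 have eUm: "e r : U" if "r < m + 1" for r
  using basis_mem[OF V ef, of r] PU v em that by (cases "r = m") auto
 have "lspan V (m + 1) e \<subseteq> U" by (rule lspan_subset[OF U(1)]) (rule eUm)
 moreover have "card (lspan V (m + 1) e) = card U"
  using card_lspan[OF V e1] card_subspace[OF U] unfolding sP by (rule trans[OF _ sym])
 ultimately have e2: "lspan V (m + 1) e = U" using card_subset_eq[OF U(2)] by blast
 have "lspan V 1 (%i. e (m + i)) = A" unfolding A by (rule lspan_cong) (simp add: em)
 note split = basis_split(2)[OF V e1, unfolded e2 ef this]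
 define T where "T = extf 1 V U A X"
 define B' where "B' = {b : Sf 1 V P. left_nondeg V P P b}"
 define R where "R = (%b :: 'c => 'c => 'a. \<lambda>x\<in>P. \<lambda>y\<in>P. b x y)"
 have fib: "card {b : T. R b = b'} = 1" if b': "b' : B'" for b'
 proof -
  have b'S: "b' : Sf 1 V P" and b'n: "left_nondeg V P P b'" using b' by (simp_all add: B'_def)
  \<comment> \<open>Every position is prescribed, so the general count gives
    \<open>q ^ 0\<close>.\<close>
  define Z where "Z = {..<m+1} \<times> {..<m+1}"
  define z where "z = (%r s. if r = m then X v (e s) else if s = m then X v (e r) else b' (e r) (e s))"
  have eP: "e r : P" if "r < m" for r by (rule basis_mem[OF V ef that])
  have "{b : T. R b = b'} = {b : Sf 1 V U. \<forall>(r,s)\<in>Z. b (e r) (e s) = z r s}"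
  proof (intro equalityI subsetI)
   fix b assume b: "b : {b : T. R b = b'}"
   hence bS: "b : Sf 1 V U" and bX: "\<And>x y. x : A ==> y : U ==> b x y = X x y" and Rb: "R b = b'"
    by (simp_all add: T_def)
   have "b (e r) (e s) = z r s" if "(r, s) : Z" for r s
   proof -
    have rs: "r < m + 1" "s < m + 1" using that by (simp_all add: Z_def)
    consider "r = m" | "r < m" "s = m" | "r < m" "s < m" using rs by linarith
    thus ?thesis
    proof cases
     case 1
     thus ?thesis using bX[OF vA eUm[OF rs(2)]] by (simp add: z_def em)
    next
     case 2
     have "b (e r) v = sg 1 (b v (e r))" by (rule Sf_sym[OF bS eUm[OF rs(1)] v])
     also have "b v (e r) = X v (e r)" by (rule bX[OF vA eUm[OF rs(1)]])
     finally show ?thesis using 2 by (simp add: z_def em sg_def)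
    next
     case 3
     hence "R b (e r) (e s) = b (e r) (e s)" using eP by (simp add: R_def)
     thus ?thesis using 3 Rb by (simp add: z_def)
    qed
   qed
   thus "b : {b : Sf 1 V U. \<forall>(r,s)\<in>Z. b (e r) (e s) = z r s}" using bS by blast
  next
   fix b assume b: "b : {b : Sf 1 V U. \<forall>(r,s)\<in>Z. b (e r) (e s) = z r s}"
   hence bS: "b : Sf 1 V U" and bz: "\<And>r s. r < m + 1 ==> s < m + 1 ==> b (e r) (e s) = z r s"
    unfolding Z_def by blast+
   note bB = Sf_Bil[OF bS]
   have bX: "b x y = X x y" if "x : A" "y : U" for x y
   proof (rule agree_on_lspan[OF bB X(1) sA AU U(1) U(1) i1 A[symmetric] e1 e2 _ that])
    show "b v (e s) = X v (e s)" if "s < m + 1" for s using bz[of m s] that by (simp add: z_def em)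
   qed
   have Rb: "R b = b'" unfolding R_def
   proof (rule Bil_eq_on_basis[OF Bil_restrict[OF bB P PU P PU] Sf_Bil[OF b'S] V V ef ef])
    fix r s assume rs: "r < m" "s < m"
    thus "(\<lambda>x\<in>P. \<lambda>y\<in>P. b x y) (e r) (e s) = b' (e r) (e s)"
     using eP bz[of r s] by (simp add: z_def)
   qed
   have "left_nondeg V U U b" unfolding left_nondeg_def
   proof (intro ballI impI)
    fix x assume x: "x : U" and x0: "\<forall>y\<in>U. b x y = \<zero>"
    have "X y x = \<zero>" if y: "y : A" for y
    proof -
     have yU: "y : U" using y AU by blast
     have "X y x = b y x" by (rule bX[OF y x, symmetric])
     also have "\<dots> = sg 1 (b x y)" by (rule Sf_sym[OF bS yU x])
     also have "b x y = \<zero>" using x0 yU by blast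
     finally show ?thesis by simp
    qed
    hence xP: "x : P" using x by (simp add: P_def)
    have "b' x y = \<zero>" if y: "y : P" for y
    proof -
     have "y : U" using y PU by blast
     thus ?thesis unfolding Rb[symmetric] using xP y x0 by (simp add: R_def)
    qed
    thus "x = \<zero>\<^bsub>V\<^esub>" using b'n xP unfolding left_nondeg_def by blast
   qed
   thus "b : {b : T. R b = b'}" using bS bX Rb by (simp add: T_def)
  qed
  also have "card \<dots> = q ^ (card {(r, s). r < s \<and> s < m + 1 \<and> (r, s) \<notin> Z} + (if 1 = (1::int) then card {r. r < m + 1 \<and> (r, r) \<notin> Z} else 0))"
  proof (rule card_Sf_prescribed[OF V e1 e2])
   fix r s assume rsZ: "(r, s) : Z"
   hence rs: "r < m + 1" "s < m + 1" by (simp_all add: Z_def)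
   have XK: "X v (e j) : carrier K" if "j < m + 1" for j
    by (rule Bil_D(3)[OF X(1) vA eUm[OF that]])
   consider "r = m" "s = m" | "r = m" "s < m" | "r < m" "s = m" | "r < m" "s < m" using rs by linarith
   hence "z r s : carrier K \<and> z r s = sg 1 (z s r)"
   proof cases
    case 4
    have eP': "e r : P" "e s : P" using 4 eP by simp_all
    have "b' (e r) (e s) = sg 1 (b' (e s) (e r))" by (rule Sf_sym[OF b'S eP'])
    moreover have "b' (e r) (e s) : carrier K" by (rule Bil_D(3)[OF Sf_Bil[OF b'S] eP'])
    moreover have "r \<noteq> m" "s \<noteq> m" using 4 by simp_all
    ultimately show ?thesis unfolding z_def by (simp only: if_False simp_thms)
   qed (use XK rs in \<open>simp_all add: z_def sg_def\<close>)
   thus "z r s : carrier K" "z r s = sg 1 (z s r)" by blast+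
  qed (auto simp: Z_def)
  also have "\<dots> = 1"
  proof -
   have "{(r, s). r < s \<and> s < m + 1 \<and> (r, s) \<notin> Z} = {}" "{r. r < m + 1 \<and> (r, r) \<notin> Z} = {}"
    by (auto simp: Z_def)
   thus ?thesis by (simp only: card.empty) simp
  qed
  finally show ?thesis .
 qed
 have "card T = card B' * 1"
 proof (rule card_fibres[where f = R, OF _ _ fib])
  show "finite B'" unfolding B'_def by (rule finite_subset[OF _ finite_Sf[OF fP, where V = V]]) blast
  show "finite T" unfolding T_def by (rule finite_subset[OF _ finite_Sf[OF U(2), where V = V]]) blast
  fix b assume "b : T"
  hence bS: "b : Sf 1 V U" and bn: "left_nondeg V U U b" and bX: "\<And>x y. x : A ==> y : U ==> b x y = X x y"
   by (simp_all add: T_def)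
  note bB = Sf_Bil[OF bS]
  have "left_nondeg V P P (R b)" unfolding left_nondeg_def
  proof (intro ballI impI)
   fix x assume x: "x : P" and x0: "\<forall>y\<in>P. R b x y = \<zero>"
   have xU: "x : U" using x PU by blast
   have "b x w = \<zero>" if w: "w : U" for w
   proof -
    obtain p t where pt: "p : P" "t : A" "w = p \<oplus>\<^bsub>V\<^esub> t" using split[OF w] by blast
    have ptU: "p : U" "t : U" using pt PU AU by blast+
    have "R b x p = b x p" using x pt(1) by (simp add: R_def)
    hence "b x p = \<zero>" using x0 pt(1) by simp
    moreover have "b x t = \<zero>"
    proof -
     have "b x t = sg 1 (b t x)" by (rule Sf_sym[OF bS xU ptU(2)])
     also have "b t x = X t x" by (rule bX[OF pt(2) xU])
     also have "X t x = \<zero>" using x pt(2) by (simp add: P_def)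
     finally show ?thesis by simp
    qed
    moreover have "b x w = b x p \<oplus> b x t" unfolding pt(3) using lin_D(2)[OF Bil_D(2)[OF bB xU] ptU] by simp
    ultimately show ?thesis by simp
   qed
   thus "x = \<zero>\<^bsub>V\<^esub>" using bn xU unfolding left_nondeg_def by blast
  qed
  moreover have "R b : Sf 1 V P" unfolding R_def by (rule Sf_restrict[OF bS P PU])
  ultimately show "R b : B'" by (simp add: B'_def)
 qed
 moreover have "card B' = N" unfolding B'_def by (rule N[OF P PU]) (use sP in \<open>simp add: m_def\<close>)
 ultimately show ?thesis by (simp add: T_def)
qed

end

section \<open>The number of nondegenerate symmetric and alternating forms\<close>

context odd_field
begin

lemma exists_subspace:
 assumes U: "subspace K U V" "finite U" and k: "k \<le> sdim U"
 obtains P where "subspace K P V" "P \<subseteq> U" "sdim P = k"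
proof -
 note V = subspace_D(1)[OF U(1)]
 obtain n v where v: "indep V n v" "lspan V n v = U" "card U = q ^ n" by (rule basis_exists[OF U])
 have n: "k \<le> n" using k sdim_eqI[OF v(3)] by simp
 have i: "indep V k v" by (rule indep_mono[OF V v(1) n])
 show ?thesis
 proof (rule that)
  show "subspace K (lspan V k v) V" by (rule subspace_lspan[OF V]) (rule indep_D[OF i])
  show "lspan V k v \<subseteq> U" using lspan_mono[OF V, of n v k] indep_D[OF v(1)] n v(2) by simp
  show "sdim (lspan V k v) = k" by (rule sdim_eqI[OF card_lspan[OF V i]])
 qed
qed

text \<open>The product of 1 - q^(-j) over the odd j \<le> n, that is, (q^-1)_n divided by (q^-2)_(n
  div 2).\<close>

primrec hh :: "nat => real" where
 "hh 0 = 1"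
| "hh (Suc n) = hh n * (if even n then 1 - 1 / real q ^ Suc n else 1)"

text \<open>\<open>ff ep n\<close> is the number of nondegenerate \<open>ep\<close>-symmetric forms on an \<open>n\<close>-dimensional space.\<close>

definition ff :: "int => nat => real" where
 "ff ep n = (if ep = 1 \<or> even n then real q ^ (n * (n - 1) div 2 + (if ep = 1 then n else 0)) * hh n else 0)"

lemma tri_Suc: "Suc n * n div 2 = n * (n - 1) div 2 + (n::nat)"
 using sum_shift_gauss[of 0 "Suc n"] sum_shift_gauss[of 0 n] by simp

lemma ff_rec_alt: "ff (-1) (Suc (Suc k)) = (real q ^ (k + 1) - 1) * real q ^ k * ff (-1) k"
proof -
 have t: "Suc (Suc k) * (Suc (Suc k) - 1) div 2 = k * (k - 1) div 2 + k + Suc k"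
  using tri_Suc[of "Suc k"] tri_Suc[of k] by (simp only: diff_Suc_1)
 have q0: "real q \<noteq> 0" using q_gt_1 by simp
 have "real q ^ Suc k * (1 - 1 / real q ^ Suc k) = real q ^ Suc k - 1" using q0 by (simp add: field_simps)
 thus ?thesis unfolding ff_def t by (simp add: power_add mult_ac)
qed

text \<open>The terms correspond to a fixed nonzero \<open>v\<close> in dimension
  \<open>k + 2\<close>. Either \<open>v\<close> is isotropic, with q^(k+1) - 1 choices for the
  functional \<open>b v\<close> and a form in dimension \<open>k\<close>; or it is anisotropic, with
  a form on its orthogonal space of dimension \<open>k + 1\<close>.\<close>

lemma ff_rec_sym:
 "ff 1 (Suc (Suc k)) = (real q ^ (k + 1) - 1) * real q ^ (k + 1) * ff 1 k
  + (real q ^ (k + 2) - real q ^ (k + 1)) * ff 1 (Suc k)"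
proof -
 have t: "Suc (Suc k) * (Suc (Suc k) - 1) div 2 = k * (k - 1) div 2 + k + Suc k"
  using tri_Suc[of "Suc k"] tri_Suc[of k] by (simp only: diff_Suc_1)
 have t1: "Suc k * (Suc k - 1) div 2 = k * (k - 1) div 2 + k"
  using tri_Suc[of k] by (simp only: diff_Suc_1)
 have q0: "real q \<noteq> 0" using q_gt_1 by simp
 define Q where "Q = real q ^ k"
 have Q0: "Q \<noteq> 0" using q0 by (simp add: Q_def)
 define x where "x = real q ^ (k * (k - 1) div 2)"
 have f2: "ff 1 (Suc (Suc k)) = x * Q ^ 3 * real q ^ 3 * hh (Suc (Suc k))"
  unfolding ff_def t x_def Q_def by (simp add: power_add power3_eq_cube mult_ac)
 have f1: "ff 1 (Suc k) = x * Q ^ 2 * real q * hh (Suc k)"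
  unfolding ff_def t1 x_def Q_def by (simp add: power_add power2_eq_square mult_ac)
 have f0: "ff 1 k = x * Q * hh k" unfolding ff_def x_def Q_def by (simp add: power_add)
 have pw: "real q ^ (k + 1) = Q * real q" "real q ^ (k + 2) = Q * real q ^ 2"
  by (simp_all add: Q_def power_add power2_eq_square)
 show ?thesis
 proof (cases "even k")
  case True
  have "hh (Suc (Suc k)) = hh (Suc k)" "hh (Suc k) = hh k * (1 - 1 / (Q * real q))"
   using True by (simp_all add: Q_def mult.commute)
  note h = this
  show ?thesis unfolding f2 f1 f0 pw h
   using q0 Q0 by (simp del: hh.simps add: field_simps power2_eq_square power3_eq_cube)
 next
  case False
  have "hh (Suc (Suc k)) = hh k * (1 - 1 / (Q * real q ^ 2))" "hh (Suc k) = hh k"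
   using False by (simp_all add: Q_def power2_eq_square mult.commute mult.left_commute)
  note h = this
  show ?thesis unfolding f2 f1 f0 pw h
   using q0 Q0 by (simp del: hh.simps add: field_simps power2_eq_square power3_eq_cube)
 qed
qed

lemma ff_0: "ff ep 0 = 1" by (simp add: ff_def)

lemma ff_1: "ff ep (Suc 0) = (if ep = 1 then real q - 1 else 0)"
 using q_gt_1 by (simp add: ff_def field_simps)

text \<open>The induction below supplies counts as real values of \<open>ff\<close>, whereas the
  counting lemma takes one natural number valid for all subspaces; a witness subspace provides
  it.\<close>

lemma card_ext_isotropic_real:
 assumes U: "subspace K U V" "finite U" and A: "subspace K A V" "A \<subseteq> U"
  and X: "X : Bil V A V U" "left_nondeg V A U X" "orth X A A"
  and ep: "ep : {1, -1}"
  and r: "\<And>P. subspace K P V ==> P \<subseteq> U ==> sdim P = sdim U - 2 * sdim A ==>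
    real (card {b : Sf ep V P. left_nondeg V P P b}) = r"
 shows "real (card (extf ep V U A X)) =
   r * real q ^ (sdim A * (sdim U - 2 * sdim A) + sdim A * (sdim A - 1) div 2 + (if ep = 1 then sdim A else 0))"
proof -
 obtain P where P: "subspace K P V" "P \<subseteq> U" "sdim P = sdim U - 2 * sdim A"
  by (rule exists_subspace[OF U, of "sdim U - 2 * sdim A"]) auto
 define N where "N = card {b : Sf ep V P. left_nondeg V P P b}"
 have rN: "real N = r" unfolding N_def by (rule r[OF P])
 have N: "card {b : Sf ep V P'. left_nondeg V P' P' b} = N"
  if "subspace K P' V" "P' \<subseteq> U" "sdim P' = sdim U - 2 * sdim A" for P'
  using r[OF that] rN by linarith
 have "card (extf ep V U A X) =
   N * q ^ (sdim A * (sdim U - 2 * sdim A) + sdim A * (sdim A - 1) div 2 + (if ep = 1 then sdim A else 0))"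
  by (rule card_ext_isotropic(2)[OF U A X ep N])
 thus ?thesis unfolding rN[symmetric] by (simp only: of_nat_mult of_nat_power)
qed

lemma card_ext_anisotropic_real:
 assumes U: "subspace K U V" "finite U" and v: "v : U" and A: "A = lspan V 1 (%_. v)"
  and X: "X : Bil V A V U" "X v v \<noteq> \<zero>" and s: "sdim U = Suc k"
  and r: "\<And>P. subspace K P V ==> P \<subseteq> U ==> sdim P = k ==>
    real (card {b : Sf 1 V P. left_nondeg V P P b}) = r"
 shows "real (card (extf 1 V U A X)) = r"
proof -
 obtain P where P: "subspace K P V" "P \<subseteq> U" "sdim P = k"
  by (rule exists_subspace[OF U, of k]) (use s in auto)
 define N where "N = card {b : Sf 1 V P. left_nondeg V P P b}"
 have rN: "real N = r" unfolding N_def by (rule r[OF P])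
 have N: "card {b : Sf 1 V P'. left_nondeg V P' P' b} = N"
  if "subspace K P' V" "P' \<subseteq> U" "sdim P' + 1 = sdim U" for P'
 proof -
  have "sdim P' = k" using that(3) s by simp
  from r[OF that(1,2) this] rN show ?thesis by linarith
 qed
 have "card (extf 1 V U A X) = N"
  by (rule card_ext_anisotropic[OF U v A X N])
 thus ?thesis using rN by (simp only:)
qed

lemma card_by_restriction:
 assumes U: "subspace K U V" "finite U" and A: "subspace K A V" "A \<subseteq> U"
  and S: "\<And>X. X : S ==> X : Bil V A V U"
 shows "card {b : Sf ep V U. left_nondeg V U U b \<and> (\<lambda>x\<in>A. \<lambda>y\<in>U. b x y) : S} =
  (\<Sum>X\<in>S. card (extf ep V U A X))"
proof -
 have fA: "finite A" using A U finite_subset by blast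
 have fS: "finite S" by (rule finite_subset[OF _ finite_Bil[OF fA U(2), of V V]]) (use S in blast)
 have iff: "(\<forall>x\<in>A. \<forall>y\<in>U. b x y = X x y) \<longleftrightarrow> (\<lambda>x\<in>A. \<lambda>y\<in>U. b x y) = X" if X: "X : S" and b: "b : Sf ep V U" for X b
 proof
  assume eq: "\<forall>x\<in>A. \<forall>y\<in>U. b x y = X x y"
  show "(\<lambda>x\<in>A. \<lambda>y\<in>U. b x y) = X"
   by (rule Bil_ext[OF Bil_restrict[OF Sf_Bil[OF b] A U(1) subset_refl] S[OF X]]) (simp add: eq)
 next
  assume eq: "(\<lambda>x\<in>A. \<lambda>y\<in>U. b x y) = X"
  show "\<forall>x\<in>A. \<forall>y\<in>U. b x y = X x y" unfolding eq[symmetric] by simp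
 qed
 have "{b : Sf ep V U. left_nondeg V U U b \<and> (\<lambda>x\<in>A. \<lambda>y\<in>U. b x y) : S} =
  (\<Union>X\<in>S. extf ep V U A X)"
  using iff by blast
 also have "card \<dots> = (\<Sum>X\<in>S. card (extf ep V U A X))"
 proof (rule card_UN_disjoint[OF fS])
  show "\<forall>X\<in>S. finite (extf ep V U A X)"
   by (intro ballI finite_subset[OF _ finite_Sf[OF U(2), of ep V]]) blast
  show "\<forall>X\<in>S. \<forall>Y\<in>S. X \<noteq> Y \<longrightarrow> extf ep V U A X \<inter>
   extf ep V U A Y = {}"
   using iff by blast
 qed
 finally show ?thesis .
qed

lemma left_nondeg_restrict:
 assumes "left_nondeg V U W b" "A \<subseteq> U"
 shows "left_nondeg V A W (\<lambda>x\<in>A. \<lambda>y\<in>W. b x y)"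
 unfolding left_nondeg_def
proof (intro ballI impI)
 fix x assume x: "x : A" "\<forall>y\<in>W. (\<lambda>x\<in>A. \<lambda>y\<in>W. b x y) x y = \<zero>"
 have "\<forall>y\<in>W. b x y = \<zero>" using x by simp
 thus "x = \<zero>\<^bsub>V\<^esub>" using assms x(1) unfolding left_nondeg_def by blast
qed

lemma sdim_zero: "sdim {\<zero>\<^bsub>V\<^esub>} = 0" by (rule sdim_eqI) simp

text \<open>Fix a nonzero \<open>v\<close> with span \<open>A\<close> and sort the forms by their
  restriction to \<open>A\<close> and \<open>U\<close>, in effect by the functional
  \<open>b v\<close>. If this functional kills \<open>v\<close>, the dimension drops by two,
  otherwise by one, and \<open>ff\<close> solves the resulting recursion.\<close>

theorem card_nondeg_forms:
 assumes ep: "ep : {1, -1}" and "subspace K U V" "finite U"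
 shows "real (card {b : Sf ep V U. left_nondeg V U U b}) = ff ep (sdim U)"
 using assms(2,3)
proof (induction "sdim U" arbitrary: U rule: less_induct)
 case (less U)
 note U = less.prems
 note V = subspace_D(1)[OF U(1)]
 have IH: "real (card {b : Sf ep V P. left_nondeg V P P b}) = ff ep j"
  if "subspace K P V" "P \<subseteq> U" "sdim P = j" "j < sdim U" for P j
  using less.hyps[of P] that finite_subset[OF that(2) U(2)] by simp
 show ?case
 proof (cases "sdim U")
  case 0
  have "card U = 1" using card_subspace[OF U] 0 by simp
  then obtain u where "U = {u}" by (rule card_1_singletonE)
  hence U0: "U = {\<zero>\<^bsub>V\<^esub>}" using subspace_D(3)[OF U(1)] by simp
  have "{b : Sf ep V U. left_nondeg V U U b} = {b : Bil V U V U. left_nondeg V U U b \<and> (orth b U U)}"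
  proof -
   have z: "b x y = \<zero>" if "b : Bil V U V U" "x : U" "y : U" for b x y
    using lin_zero[OF Bil_D(2)[OF that(1,2)] U(1) vs_KV] that(3) U0 by simp
   have "b : Sf ep V U" if b: "b : Bil V U V U" for b
    unfolding Sf_def
   proof (intro CollectI conjI b ballI)
    fix x y assume "x : U" "y : U"
    hence "b x y = \<zero>" "b y x = \<zero>" using z[OF b] by blast+
    thus "b x y = sg ep (b y x)" by simp
   qed
   thus ?thesis using z Sf_Bil by blast
  qed
  also have "card \<dots> = 1" using card_left_nondeg[OF U U U(1) subset_refl U(1) subset_refl] 0 by simp
  finally show ?thesis by (simp add: 0 ff_0)
 next
  case (Suc k)
  have "card U \<noteq> 1" using card_subspace[OF U] Suc q_gt_1 by simp
  hence "U \<noteq> {\<zero>\<^bsub>V\<^esub>}" by auto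
  then obtain v where v: "v : U" "v \<noteq> \<zero>\<^bsub>V\<^esub>" using subspace_D(3)[OF U(1)] by blast
  have vc: "v : carrier V" by (rule subspace_D(4)[OF U(1) v(1)])
  define A where "A = lspan V 1 (%_. v)"
  have vA: "v : A" unfolding A_def using lspan_mem[OF V, of 1 "%_. v" 0] vc by simp
  have sA: "subspace K A V" unfolding A_def by (rule subspace_lspan[OF V]) (rule vc)
  have AU: "A \<subseteq> U" unfolding A_def by (rule lspan_subset[OF U(1)]) (rule v(1))
  have i1: "indep V 1 (%_. v)" using indep_Suc[OF V, of 0 "%_. v"] vc v(2) by simp
  have sdA: "sdim A = 1" by (rule sdim_eqI) (unfold A_def, rule card_lspan[OF V i1])
  have fA: "finite A" using AU U finite_subset by blast
  \<comment> \<open>The condition on the zero space brings the set of all left nondegenerate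
    pairings into the shape of \<open>card_left_nondeg\<close>.\<close>
  define S where "S = {X : Bil V A V U. left_nondeg V A U X \<and> (orth X {\<zero>\<^bsub>V\<^esub>} {\<zero>\<^bsub>V\<^esub>})}"
  define S0 where "S0 = {X : Bil V A V U. left_nondeg V A U X \<and> (orth X A A)}"
  have z: "subspace K {\<zero>\<^bsub>V\<^esub>} V" "{\<zero>\<^bsub>V\<^esub>} \<subseteq> A" "{\<zero>\<^bsub>V\<^esub>} \<subseteq> U"
   using subspace_zero[OF V] subspace_D(3)[OF sA] subspace_D(3)[OF U(1)] by auto
  have cS: "card S = q ^ Suc k - 1"
   using card_left_nondeg[OF sA fA U z(1,2) z(1,3)] by (simp add: S_def sdim_zero sdA Suc)
  have cS0: "card S0 = q ^ k - 1"
   using card_left_nondeg[OF sA fA U sA subset_refl sA AU] by (simp add: S0_def sdA Suc)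
  have Sz: "X x y = \<zero>" if "X : Bil V A V U" "x = \<zero>\<^bsub>V\<^esub>" "y : U" for X x y
   using lin_zero[OF Bil_D(1)[OF that(1,3)] sA vs_KV] that(2) by simp
  have S0S: "S0 \<subseteq> S" using Sz z(3) unfolding S0_def S_def by blast
  have fS: "finite S" by (rule finite_subset[OF _ finite_Bil[OF fA U(2), of V V]]) (auto simp: S_def)
  \<comment> \<open>On a line, vanishing at the generator is isotropy, so outside \<open>S0\<close>
    all restrictions are anisotropic at \<open>v\<close>.\<close>
  have S0v: "X : S0" if X: "X : S" "X v v = \<zero>" for X
  proof -
   have XB: "X : Bil V A V U" using X(1) by (simp add: S_def)
   have "X x y = \<zero>" if xy: "x : A" "y : A" for x y
   proof -
    have el: "\<exists>k\<in>carrier K. x = k \<odot>\<^bsub>V\<^esub> v" if x: "x : A" for x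
    proof -
     obtain y where y: "y : cf 1" "x = lc V 1 (%_. v) y" using x unfolding A_def lspan_def by blast
     have "x = y 0 \<odot>\<^bsub>V\<^esub> v" using y(2) cf_D[OF y(1), of 0] V vc by (simp add: vs_simps)
     thus ?thesis using cf_D[OF y(1), of 0] by auto
    qed
    obtain i j where ij: "i : carrier K" "x = i \<odot>\<^bsub>V\<^esub> v" "j : carrier K" "y = j \<odot>\<^bsub>V\<^esub> v"
     using el[OF xy(1)] el[OF xy(2)] by blast
    have yU: "y : U" using xy AU by blast
    have "X v y = j \<otimes> X v v" unfolding ij(4) using lin_D(3)[OF Bil_D(2)[OF XB vA] ij(3) v(1)] by simp
    hence "X v y = \<zero>" using X(2) ij(3) by simp
    moreover have "X x y = i \<otimes> X v y" unfolding ij(2) using lin_D(3)[OF Bil_D(1)[OF XB yU] ij(1) vA] by simp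
    ultimately show ?thesis using ij(1) by simp
   qed
   thus ?thesis using X(1) unfolding S_def S0_def by blast
  qed
  define g where "g = (%X. real (card (extf ep V U A X)))"
  have "{b : Sf ep V U. left_nondeg V U U b} = {b : Sf ep V U. left_nondeg V U U b \<and> (\<lambda>x\<in>A. \<lambda>y\<in>U. b x y) : S}"
  proof -
   have "(\<lambda>x\<in>A. \<lambda>y\<in>U. b x y) : S" if b: "b : Sf ep V U" "left_nondeg V U U b" for b
   proof -
    have B: "(\<lambda>x\<in>A. \<lambda>y\<in>U. b x y) : Bil V A V U" by (rule Bil_restrict[OF Sf_Bil[OF b(1)] sA AU U(1) subset_refl])
    show ?thesis unfolding S_def using B left_nondeg_restrict[OF b(2) AU] Sz[OF B] z(3) by blast
   qed
   thus ?thesis by blast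
  qed
  hence "real (card {b : Sf ep V U. left_nondeg V U U b}) = (\<Sum>X\<in>S. g X)"
   using card_by_restriction[OF U sA AU, of S ep] by (simp add: g_def S_def)
  also have "\<dots> = (\<Sum>X\<in>S - S0. g X) + (\<Sum>X\<in>S0. g X)" by (rule sum.subset_diff[OF S0S fS])
  also have "(\<Sum>X\<in>S0. g X) = (real q ^ k - 1) * (if k = 0 then 0 else
    ff ep (k - 1) * real q ^ (k - 1 + (if ep = 1 then 1 else 0)))"
  proof (cases "k = 0")
   case True
   hence "S0 = {}" using cS0 finite_subset[OF S0S fS] by simp
   thus ?thesis using True by simp
  next
   case False
   have "g X = ff ep (k - 1) * real q ^ (k - 1 + (if ep = 1 then 1 else 0))" if X: "X : S0" for X
   proof -
    have "g X = ff ep (k - 1) * real q ^ (sdim A * (sdim U - 2 * sdim A) + sdim A * (sdim A - 1) div 2 + (if ep = 1 then sdim A else 0))"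
     unfolding g_def
    proof (rule card_ext_isotropic_real[OF U sA AU _ _ _ ep])
     fix P assume P: "subspace K P V" "P \<subseteq> U" "sdim P = sdim U - 2 * sdim A"
     show "real (card {b : Sf ep V P. left_nondeg V P P b}) = ff ep (k - 1)"
      by (rule IH[OF P(1,2)]) (use P(3) sdA Suc in auto)
    qed (use X in \<open>auto simp: S0_def\<close>)
    thus ?thesis using False by (simp add: sdA Suc)
   qed
   hence "(\<Sum>X\<in>S0. g X) = real (card S0) * (ff ep (k - 1) * real q ^ (k - 1 + (if ep = 1 then 1 else 0)))" by simp
   also have "real (card S0) = real q ^ k - 1" using cS0 q_gt_1 by (simp add: of_nat_diff)
   finally show ?thesis using False by simp
  qed
  also have "(\<Sum>X\<in>S - S0. g X) = (if ep = 1 then (real q ^ Suc k - real q ^ k) * ff 1 k else 0)"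
  proof (cases "ep = 1")
   case True
   have "g X = ff 1 k" if X: "X : S - S0" for X
    unfolding g_def True
   proof (rule card_ext_anisotropic_real[OF U v(1) A_def _ _ Suc])
    fix P assume P: "subspace K P V" "P \<subseteq> U" "sdim P = k"
    show "real (card {b : Sf 1 V P. left_nondeg V P P b}) = ff 1 k"
     using IH[OF P] Suc True by simp
   qed (use X S0v in \<open>auto simp: S_def\<close>)
   hence "(\<Sum>X\<in>S - S0. g X) = real (card (S - S0)) * ff 1 k" by simp
   also have "card (S - S0) = q ^ Suc k - q ^ k"
    using card_Diff_subset[OF finite_subset[OF S0S fS] S0S] cS cS0 q_gt_1 by simp
   finally show ?thesis using True q_gt_1 by (simp add: of_nat_diff)
  next
   case False
   hence e: "ep = -1" using ep by simp
   \<comment> \<open>A skew form satisfies \<open>b v v = \<ominus> b v v\<close> and therefore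
     extends no anisotropic restriction.\<close>
   have "g X = 0" if X: "X : S - S0" for X
   proof -
    have "b v v = \<zero>" if b: "b : Sf ep V U" for b
    proof (rule eq_neg_imp_zero)
     show "b v v : carrier K" by (rule Bil_D(3)[OF Sf_Bil[OF b] v(1) v(1)])
     have "b v v = sg ep (b v v)" by (rule Sf_sym[OF b v(1) v(1)])
     thus "b v v = \<ominus> b v v" unfolding sg_def using e by (simp only:) simp
    qed
    moreover have "X v v \<noteq> \<zero>" using X S0v by blast
    ultimately have "extf ep V U A X = {}"
     using vA v(1) by fastforce
    thus ?thesis unfolding g_def by (simp only: card.empty of_nat_0)
   qed
   thus ?thesis using False by simp
  qed
  finally have eq: "real (card {b : Sf ep V U. left_nondeg V U U b}) =
   (if ep = 1 then (real q ^ Suc k - real q ^ k) * ff 1 k else 0) +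
   (real q ^ k - 1) * (if k = 0 then 0 else ff ep (k - 1) * real q ^ (k - 1 + (if ep = 1 then 1 else 0)))" .
  show ?thesis
  proof (cases k)
   case 0
   thus ?thesis unfolding eq Suc using ff_1[of ep] by (simp add: ff_0)
  next
   case (Suc j)
   show ?thesis
   proof (cases "ep = 1")
    case True
    show ?thesis using eq unfolding True \<open>sdim U = Suc k\<close> Suc ff_rec_sym[of j] by (simp add: mult_ac)
   next
    case False
    hence e: "ep = -1" using ep by simp
    show ?thesis using eq unfolding e \<open>sdim U = Suc k\<close> Suc ff_rec_alt[of j] by (simp add: mult_ac)
   qed
  qed
 qed
qed

text \<open>The number of injective linear maps from dimension \<open>a\<close> to dimension
  \<open>n\<close>, equivalently of independent \<open>a\<close>-tuples. So \<open>ij n n\<close> is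
  the order of GL_n, and for \<open>a > n\<close> one factor is 0.\<close>

definition ij :: "nat => nat => real" where
 "ij a n = (\<Prod>r<a. real q ^ n - real q ^ r)"

lemma ij_nonzero: "a \<le> n ==> ij a n \<noteq> 0"
 using q_gt_1 by (auto simp: ij_def)

lemma ij_nat: "real (\<Prod>r<a. q ^ n - q ^ r) = ij a n"
proof (cases "a \<le> n")
 case True
 have "real (q ^ n - q ^ r) = real q ^ n - real q ^ r" if "r < a" for r
  using that True q_gt_1 by (subst of_nat_diff) (auto intro: power_increasing)
 thus ?thesis by (simp add: ij_def)
next
 case False
 hence "(\<Prod>r<a. q ^ n - q ^ r) = 0" by (intro prod_zero) (auto intro!: bexI[of _ n])
 moreover have "ij a n = 0" unfolding ij_def using False by (intro prod_zero) (auto intro!: bexI[of _ n])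
 ultimately show ?thesis by simp
qed

text \<open>Forms are sorted by their restriction to \<open>A\<close> and \<open>U\<close>. A left
  nondegenerate restriction that kills \<open>A\<close> amounts to an injective map from
  \<open>A\<close> into the dual of U / A, and each of them has the same number of
  extensions.\<close>

theorem card_isotropic_forms:
 assumes U: "subspace K U V" "finite U" and A: "subspace K A V" "A \<subseteq> U" and ep: "ep : {1, -1}"
 shows "real (card {b : Sf ep V U. left_nondeg V U U b \<and> (orth b A A)}) =
  ij (sdim A) (sdim U - sdim A) * (ff ep (sdim U - 2 * sdim A) *
   real q ^ (sdim A * (sdim U - 2 * sdim A) + sdim A * (sdim A - 1) div 2 + (if ep = 1 then sdim A else 0)))"
  (is "_ = _ * ?g")
proof -
 have fA: "finite A" using A U finite_subset by blast
 define S where "S = {X : Bil V A V U. left_nondeg V A U X \<and> (orth X A A)}"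
 have cS: "real (card S) = ij (sdim A) (sdim U - sdim A)"
  using card_left_nondeg[OF A(1) fA U A(1) subset_refl A] unfolding S_def ij_nat[symmetric] by simp
 have g: "real (card (extf ep V U A X)) = ?g" if X: "X : S" for X
 proof (rule card_ext_isotropic_real[OF U A _ _ _ ep])
  fix P assume P: "subspace K P V" "P \<subseteq> U" "sdim P = sdim U - 2 * sdim A"
  show "real (card {b : Sf ep V P. left_nondeg V P P b}) = ff ep (sdim U - 2 * sdim A)"
   using card_nondeg_forms[OF ep P(1) finite_subset[OF P(2) U(2)]] P(3) by simp
 qed (use X in \<open>auto simp: S_def\<close>)
 have "{b : Sf ep V U. left_nondeg V U U b \<and> (orth b A A)} =
  {b : Sf ep V U. left_nondeg V U U b \<and> (\<lambda>x\<in>A. \<lambda>y\<in>U. b x y) : S}"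
 proof (intro Collect_cong conj_cong refl)
  fix b assume b: "b : Sf ep V U" "left_nondeg V U U b"
  have "(\<forall>x\<in>A. \<forall>y\<in>A. (\<lambda>x\<in>A. \<lambda>y\<in>U. b x y) x y = \<zero>) \<longleftrightarrow> (orth b A A)"
   using A(2) by (intro ball_cong refl) auto
  thus "(orth b A A) = ((\<lambda>x\<in>A. \<lambda>y\<in>U. b x y) : S)"
   using Bil_restrict[OF Sf_Bil[OF b(1)] A U(1) subset_refl] left_nondeg_restrict[OF b(2) A(2)]
   unfolding S_def by blast
 qed
 hence "real (card {b : Sf ep V U. left_nondeg V U U b \<and> (orth b A A)}) = (\<Sum>X\<in>S. ?g)"
  using card_by_restriction[OF U A, of S ep] g by (simp add: S_def)
 thus ?thesis using cS by simp
qed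

text \<open>The rows of \<open>A\<close> contribute \<open>ij (sdim A) (sdim L - sdim B)\<close>.
  The remaining rows complete an independent tuple to a basis, which is possible in as many ways as
  the order of GL_n divided by the number of independent tuples of that length.\<close>

theorem card_pairings:
 assumes L: "subspace K L V" "finite L" and R: "subspace K R W" "finite R" and n: "sdim R = sdim L"
  and A: "subspace K A V" "A \<subseteq> L" and B: "subspace K B W" "B \<subseteq> R"
 shows "real (card {c : Bil V L W R. left_nondeg V L R c \<and> (orth c A B)}) =
  ij (sdim A) (sdim L - sdim B) * ij (sdim L) (sdim L) / ij (sdim A) (sdim L)"
proof -
 define a b n where "a = sdim A" and "b = sdim B" and "n = sdim L"
 have a: "a \<le> n" unfolding a_def n_def by (rule sdim_mono[OF A(1) L A(2)])
 have n0: "ij a n \<noteq> 0" by (rule ij_nonzero[OF a])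
 have split: "(\<Prod>r<n. h r) = (\<Prod>r<a. h r) * (\<Prod>r\<in>{a..<n}. h r)" for h :: "nat => nat"
  using prod.atLeastLessThan_concat[of 0 a n h] a by (simp add: lessThan_atLeast0)
 have "(\<Prod>r<n. q ^ (if r < a then n - b else n) - q ^ r) =
   (\<Prod>r<a. q ^ (n - b) - q ^ r) * (\<Prod>r\<in>{a..<n}. q ^ n - q ^ r)"
  unfolding split[of "%r. q ^ (if r < a then n - b else n) - q ^ r"] by (intro arg_cong2[of _ _ _ _ "(*)"] prod.cong) auto
 hence "real (\<Prod>r<n. q ^ (if r < a then n - b else n) - q ^ r) = ij a (n - b) * real (\<Prod>r\<in>{a..<n}. q ^ n - q ^ r)"
  by (simp only: of_nat_mult ij_nat)
 moreover have "ij a n * real (\<Prod>r\<in>{a..<n}. q ^ n - q ^ r) = ij n n"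
  unfolding ij_nat[symmetric] split[of "%r. q ^ n - q ^ r"] by (simp only: of_nat_mult)
 hence "real (\<Prod>r\<in>{a..<n}. q ^ n - q ^ r) = ij n n / ij a n" using n0 by (subst nonzero_eq_divide_eq) (simp_all only: mult.commute not_False_eq_True)
 ultimately have "real (\<Prod>r<n. q ^ (if r < a then n - b else n) - q ^ r) = ij a (n - b) * (ij n n / ij a n)"
  by (simp only:)
 thus ?thesis unfolding card_left_nondeg[OF L R A B] using n by (simp only: a_def b_def n_def) simp
qed

end

context odd_field
begin

subsection \<open>Duality\<close>

lemma Bil_kernel_inj:
 assumes b: "b : Bil V U W U'" and U: "subspace K U V" and nd: "left_nondeg V U U' b"
  and z: "z : U" "z' : U" "\<And>y. y : U' ==> b z y = b z' y"
 shows "z = z'"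
proof -
 note V = subspace_D(1)[OF U]
 have nz: "(\<ominus> \<one>) \<odot>\<^bsub>V\<^esub> z' : U" by (rule subspace_D(6)[OF U _ z(2)]) simp
 have w: "z \<oplus>\<^bsub>V\<^esub> (\<ominus> \<one>) \<odot>\<^bsub>V\<^esub> z' : U" by (rule subspace_D(5)[OF U z(1) nz])
 have "b (z \<oplus>\<^bsub>V\<^esub> (\<ominus> \<one>) \<odot>\<^bsub>V\<^esub> z') y = \<zero>" if y: "y : U'" for y
 proof -
  have "b (z \<oplus>\<^bsub>V\<^esub> (\<ominus> \<one>) \<odot>\<^bsub>V\<^esub> z') y = b z y \<oplus> b ((\<ominus> \<one>) \<odot>\<^bsub>V\<^esub> z') y"
   using lin_D(2)[OF Bil_D(1)[OF b y] z(1) nz] by simp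
  also have "b ((\<ominus> \<one>) \<odot>\<^bsub>V\<^esub> z') y = (\<ominus> \<one>) \<otimes> b z' y"
   using lin_D(3)[OF Bil_D(1)[OF b y] _ z(2), of "\<ominus> \<one>"] by simp
  also have "b z y = b z' y" by (rule z(3)[OF y])
  also have "b z' y \<oplus> (\<ominus> \<one>) \<otimes> b z' y = \<zero>"
   using Bil_D(3)[OF b z(2) y] by (simp add: l_minus r_neg)
  finally show ?thesis .
 qed
 hence "z \<oplus>\<^bsub>V\<^esub> (\<ominus> \<one>) \<odot>\<^bsub>V\<^esub> z' = \<zero>\<^bsub>V\<^esub>" using nd w unfolding left_nondeg_def by blast
 thus ?thesis by (rule vs_add_eq_zero[OF V subspace_D(4)[OF U z(1)] subspace_D(4)[OF U z(2)]])
qed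

text \<open>In equal dimensions the right radical has dimension 0, by the dimension formula for
  orthogonal spaces.\<close>

lemma right_nondeg:
 assumes b: "b : Bil V U W U'" and U: "subspace K U V" "finite U" and U': "subspace K U' W" "finite U'"
  and s: "sdim U = sdim U'" and nd: "left_nondeg V U U' b"
 shows "left_nondeg W U' U (\<lambda>y\<in>U'. \<lambda>x\<in>U. sg ep (b x y))"
 unfolding left_nondeg_def
proof (intro ballI impI)
 fix y assume y: "y : U'" and y0: "\<forall>x\<in>U. (\<lambda>y\<in>U'. \<lambda>x\<in>U. sg ep (b x y)) y x = \<zero>"
 let ?P = "{y : U'. \<forall>x\<in>U. b x y = \<zero>}"
 have "sdim ?P = 0" using sdim_perp[OF b U U' nd] s by simp
 moreover have sP: "subspace K ?P W" by (rule subspace_perp[OF b U'(1)])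
 moreover have "finite ?P" using U'(2) by simp
 ultimately have "card ?P = 1" using card_subspace[of ?P W] by simp
 then obtain u where u: "?P = {u}" by (rule card_1_singletonE)
 have "b x y = \<zero>" if "x : U" for x using y0 that y sg_zero_iff[OF Bil_D(3)[OF b that y], of ep] by simp
 hence "y : ?P" using y by blast
 moreover have "\<zero>\<^bsub>W\<^esub> : ?P" by (rule subspace_D(3)[OF sP])
 ultimately show "y = \<zero>\<^bsub>W\<^esub>" unfolding u by blast
qed

text \<open>The map sending z to b z is injective into the dual space, which has the same number of
  elements.\<close>

lemma riesz:
 assumes b: "b : Bil V U W U'" and U: "subspace K U V" "finite U" and U': "subspace K U' W" "finite U'"
  and s: "sdim U = sdim U'" and nd: "left_nondeg V U U' b" and fi: "lin W U' KV fi"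
 shows "\<exists>z\<in>U. \<forall>y\<in>U'. b z y = fi y"
proof -
 have sub: "b ` U \<subseteq> Lin W U' KV"
  using Bil_D(2)[OF b] Bil_D(4)[OF b] by (auto simp: Lin_def)
 have inj: "inj_on b U"
 proof (rule inj_onI)
  fix z z' assume "z : U" "z' : U" "b z = b z'"
  thus "z = z'" by (intro Bil_kernel_inj[OF b U(1) nd]) auto
 qed
 have cL: "card (Lin W U' KV) = card U" using card_Lin_KV[OF U'] card_subspace[OF U] card_subspace[OF U'] s by simp
 have fL: "finite (Lin W U' KV)"
  by (rule finite_subset[of _ "U' \<rightarrow>\<^sub>E carrier K"]) (auto simp: Lin_def finite_K U'(2) intro!: finite_PiE)
 have "b ` U = Lin W U' KV" by (rule card_subset_eq[OF fL sub]) (simp add: card_image[OF inj] cL)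
 moreover have "restrict fi U' : Lin W U' KV"
  unfolding Lin_def using lin_cong[OF fi U'(1), of "restrict fi U'"] lin_D(1)[OF fi] by simp
 ultimately obtain z where z: "z : U" "b z = restrict fi U'" by (metis imageE)
 have "b z y = fi y" if "y : U'" for y unfolding z(2) using that by simp
 thus ?thesis using z(1) by blast
qed

text \<open>Since functionals are represented by vectors, every bilinear form on \<open>T\<close>
  and \<open>U'\<close> is \<open>b (m x) y\<close> for a unique linear \<open>m\<close>. This is
  what turns arrow maps into bilinear forms.\<close>

lemma hom_bil_bij:
 assumes b: "b : Bil V (carrier V) W U'" and V: "vectorspace K V" "finite (carrier V)" and U': "subspace K U' W" "finite U'"
  and s: "sdim (carrier V) = sdim U'" and nd: "left_nondeg V (carrier V) U' b" and X: "subspace K T X"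
 shows "bij_betw (%m. \<lambda>x\<in>T. \<lambda>y\<in>U'. b (m x) y) (Lin X T V) (Bil X T W U')"
proof (rule bij_betw_imageI)
 note sV = subspace_carrier[OF V(1)]
 let ?\<Phi> = "%m. \<lambda>x\<in>T. \<lambda>y\<in>U'. b (m x) y"
 have mT: "m x : carrier V" if "m : Lin X T V" "x : T" for m x using that by (auto simp: Lin_def)
 show "inj_on ?\<Phi> (Lin X T V)"
 proof (rule inj_onI)
  fix m m' assume m: "m : Lin X T V" "m' : Lin X T V" and eq: "?\<Phi> m = ?\<Phi> m'"
  have "m x = m' x" if x: "x : T" for x
  proof (rule Bil_kernel_inj[OF b sV nd mT[OF m(1) x] mT[OF m(2) x]])
   fix y assume y: "y : U'"
   show "b (m x) y = b (m' x) y" using fun_cong[OF fun_cong[OF eq, of x], of y] x y by simp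
  qed
  thus "m = m'" using m by (intro PiE_ext[of m T "%_. carrier V" m']) (auto simp: Lin_def)
 qed
 show "?\<Phi> ` Lin X T V = Bil X T W U'"
 proof (intro equalityI subsetI)
  fix c assume "c : ?\<Phi> ` Lin X T V"
  then obtain m where m: "m : Lin X T V" "c = ?\<Phi> m" by blast
  have lm: "lin X T V m" using m(1) by (simp add: Lin_def)
  show "c : Bil X T W U'" unfolding m(2)
  proof (rule BilI[OF X U'(1)])
   show "lin X T KV (%x. b (m x) y)" if "y : U'" for y
    by (rule lin_comp[OF lm Bil_D(1)[OF b that]]) (rule mT[OF m(1)])
   show "lin W U' KV (b (m x))" if "x : T" for x by (rule Bil_D(2)[OF b mT[OF m(1) that]])
  qed
 next
  fix c assume c: "c : Bil X T W U'"
  have ex: "\<exists>z. z : carrier V \<and> (\<forall>y\<in>U'. b z y = c x y)" if x: "x : T" for x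
   using riesz[OF b sV V(2) U' s nd Bil_D(2)[OF c x]] by blast
  \<comment> \<open>The chosen representatives depend linearly on \<open>x\<close> because they are
    unique.\<close>
  define m where "m = (\<lambda>x\<in>T. SOME z. z : carrier V \<and> (\<forall>y\<in>U'. b z y = c x y))"
  have m: "m x : carrier V" "\<And>y. y : U' ==> b (m x) y = c x y" if x: "x : T" for x
   using someI_ex[OF ex[OF x]] x by (simp_all add: m_def)
  have "lin X T V m"
  proof (rule linI)
   show "m x : carrier V" if "x : T" for x by (rule m(1)[OF that])
   fix x x' assume x: "x : T" "x' : T"
   have xx: "x \<oplus>\<^bsub>X\<^esub> x' : T" by (rule subspace_D(5)[OF X x])
   show "m (x \<oplus>\<^bsub>X\<^esub> x') = m x \<oplus>\<^bsub>V\<^esub> m x'"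
   proof (rule Bil_kernel_inj[OF b sV nd m(1)[OF xx]])
    show "m x \<oplus>\<^bsub>V\<^esub> m x' : carrier V" using m(1) x V(1) by simp
    fix y assume y: "y : U'"
    have "b (m x \<oplus>\<^bsub>V\<^esub> m x') y = b (m x) y \<oplus> b (m x') y"
     using lin_D(2)[OF Bil_D(1)[OF b y] m(1)[OF x(1)] m(1)[OF x(2)]] by simp
    also have "\<dots> = c (x \<oplus>\<^bsub>X\<^esub> x') y" using lin_D(2)[OF Bil_D(1)[OF c y] x] m(2)[OF x(1) y] m(2)[OF x(2) y] by simp
    finally show "b (m (x \<oplus>\<^bsub>X\<^esub> x')) y = b (m x \<oplus>\<^bsub>V\<^esub> m x') y" using m(2)[OF xx y] by simp
   qed
  next
   fix k x assume k: "k : carrier K" and x: "x : T"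
   have xx: "k \<odot>\<^bsub>X\<^esub> x : T" by (rule subspace_D(6)[OF X k x])
   show "m (k \<odot>\<^bsub>X\<^esub> x) = k \<odot>\<^bsub>V\<^esub> m x"
   proof (rule Bil_kernel_inj[OF b sV nd m(1)[OF xx]])
    show "k \<odot>\<^bsub>V\<^esub> m x : carrier V" using m(1) x k V(1) by simp
    fix y assume y: "y : U'"
    have "b (k \<odot>\<^bsub>V\<^esub> m x) y = k \<otimes> b (m x) y"
     using lin_D(3)[OF Bil_D(1)[OF b y] k m(1)[OF x]] by simp
    also have "\<dots> = c (k \<odot>\<^bsub>X\<^esub> x) y" using lin_D(3)[OF Bil_D(1)[OF c y] k x] m(2)[OF x y] by simp
    finally show "b (m (k \<odot>\<^bsub>X\<^esub> x)) y = b (k \<odot>\<^bsub>V\<^esub> m x) y" using m(2)[OF xx y] by simp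
   qed
  qed
  hence mL: "m : Lin X T V" unfolding Lin_def using m(1) by (simp add: m_def)
  have "c = ?\<Phi> m"
  proof (rule Bil_ext[OF c])
   have "lin X T V m" using mL by (simp add: Lin_def)
   show "?\<Phi> m : Bil X T W U'"
   proof (rule BilI[OF X U'(1)])
    show "lin X T KV (%x. b (m x) y)" if "y : U'" for y
     by (rule lin_comp[OF \<open>lin X T V m\<close> Bil_D(1)[OF b that]]) (rule mT[OF mL])
    show "lin W U' KV (b (m x))" if "x : T" for x by (rule Bil_D(2)[OF b mT[OF mL that]])
   qed
   show "c x y = ?\<Phi> m x y" if "x : T" "y : U'" for x y using m(2)[OF that] that by simp
  qed
  thus "c : ?\<Phi> ` Lin X T V" using mL by blast
 qed
qed

definition perp :: "('m => 'n => 'a) => 'm set => 'n set => 'n set" where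
 "perp b A U' = {y : U'. \<forall>x\<in>A. b x y = \<zero>}"

text \<open>The last claim says that \<open>A\<close> is its own double orthogonal space. It follows
  from the dimension formula applied to the flipped form, which is where nondegeneracy on the other
  side is needed.\<close>

lemma perp_facts:
 assumes b: "b : Bil V U W U'" and U: "subspace K U V" "finite U" and U': "subspace K U' W" "finite U'"
  and s: "sdim U = sdim U'" and nd: "left_nondeg V U U' b" and A: "subspace K A V" "A \<subseteq> U"
 shows "subspace K (perp b A U') W" "perp b A U' \<subseteq> U'" "sdim A + sdim (perp b A U') = sdim U'"
  "x : U ==> (\<And>y. y : perp b A U' ==> b x y = \<zero>) ==> x : A"
proof -
 have fA: "finite A" using A U finite_subset by blast
 have main: "subspace K (perp b A U') W \<and> sdim A + sdim (perp b A U') = sdim U'" if A: "subspace K A V" "A \<subseteq> U" for A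
 proof -
  have fA: "finite A" using A U finite_subset by blast
  define c where "c = (\<lambda>x\<in>A. \<lambda>y\<in>U'. b x y)"
  have c: "c : Bil V A W U'" unfolding c_def by (rule Bil_restrict[OF b A U'(1) subset_refl])
  have nc: "left_nondeg V A U' c" unfolding c_def by (rule left_nondeg_restrict[OF nd A(2)])
  have "perp b A U' = {y : U'. \<forall>x\<in>A. c x y = \<zero>}" by (simp add: perp_def c_def cong: conj_cong)
  thus ?thesis using sdim_perp[OF c A(1) fA U' nc] subspace_perp[OF c U'(1)] by simp
 qed
 show p1: "subspace K (perp b A U') W" and p3: "sdim A + sdim (perp b A U') = sdim U'" using main[OF A] by blast+
 show p2: "perp b A U' \<subseteq> U'" by (auto simp: perp_def)
 have fP: "finite (perp b A U')" using p2 U' finite_subset by blast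
 assume x: "x : U" and x0: "\<And>y. y : perp b A U' ==> b x y = \<zero>"
 define d where "d = (\<lambda>y\<in>U'. \<lambda>x\<in>U. sg 1 (b x y))"
 have d: "d : Bil W U' V U" unfolding d_def by (rule Bil_flip[OF b U(1) U'(1)])
 have dv: "d y x = b x y" if "y : U'" "x : U" for x y using that by (simp add: d_def sg_def)
 have nd': "left_nondeg W U' U d" unfolding d_def by (rule right_nondeg[OF b U U' s nd])
 define Q where "Q = {x : U. \<forall>y\<in>perp b A U'. b x y = \<zero>}"
 define c where "c = (\<lambda>y\<in>perp b A U'. \<lambda>x\<in>U. d y x)"
 have c: "c : Bil W (perp b A U') V U" unfolding c_def by (rule Bil_restrict[OF d p1 p2 U(1) subset_refl])
 have nc: "left_nondeg W (perp b A U') U c" unfolding c_def by (rule left_nondeg_restrict[OF nd' p2])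
 have cv: "c y x = b x y" if "y : perp b A U'" "x : U" for x y using that p2 dv by (auto simp: c_def)
 have Qc: "Q = {x : U. \<forall>y\<in>perp b A U'. c y x = \<zero>}" unfolding Q_def using cv by auto
 have sQ: "subspace K Q V" unfolding Qc by (rule subspace_perp[OF c U(1)])
 have "sdim (perp b A U') + sdim Q = sdim U" unfolding Qc by (rule sdim_perp[OF c p1 fP U nc])
 hence "sdim Q = sdim A" using p3 s by simp
 moreover have fQ: "finite Q" using U by (simp add: Q_def)
 ultimately have "card A = card Q" using card_subspace[OF sQ fQ] card_subspace[OF A(1) fA] by simp
 moreover have "A \<subseteq> Q" using A(2) by (auto simp: Q_def perp_def)
 ultimately have "A = Q" using card_subset_eq[OF fQ] by blast
 moreover have "x : Q" using x x0 by (simp add: Q_def)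
 ultimately show "x : A" by simp
qed

lemma perp_antimono: "A \<subseteq> B ==> perp b B U' \<subseteq> perp b A U'"
 by (auto simp: perp_def)

subsection \<open>Counting maps compatible with filtrations\<close>

lemma card_Bil_prescribed:
 assumes V: "vectorspace K V" "vectorspace K W"
  and e: "indep V l e" "lspan V l e = U" and f: "indep W n f" "lspan W n f = U'"
  and NZ: "NZ \<subseteq> {..<l} \<times> {..<n}"
 shows "card {c : Bil V U W U'. \<forall>r<l. \<forall>s<n. (r, s) \<notin> NZ \<longrightarrow> c (e r) (f s) = \<zero>} = q ^ card NZ"
proof -
 let ?L = "{c : Bil V U W U'. \<forall>r<l. \<forall>s<n. (r, s) \<notin> NZ \<longrightarrow> c (e r) (f s) = \<zero>}"
 define H where "H = (%c. \<lambda>p\<in>NZ. c (e (fst p)) (f (snd p)) :: 'a)"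
 note eU = basis_mem[OF V(1) e] and fU = basis_mem[OF V(2) f]
 have fNZ: "finite NZ" by (rule finite_subset[OF NZ]) simp
 have "bij_betw H ?L (NZ \<rightarrow>\<^sub>E carrier K)"
 proof (rule bij_betw_imageI)
  show "inj_on H ?L"
  proof (rule inj_onI)
   fix c c' assume c: "c : ?L" "c' : ?L" and eq: "H c = H c'"
   have cB: "c : Bil V U W U'" "c' : Bil V U W U'" using c by blast+
   show "c = c'"
   proof (rule Bil_eq_on_basis[OF cB V e f])
    fix r s assume rs: "r < l" "s < n"
    show "c (e r) (f s) = c' (e r) (f s)"
    proof (cases "(r, s) : NZ")
     case True
     thus ?thesis using fun_cong[OF eq, of "(r, s)"] by (simp add: H_def)
    next
     case False
     hence "c (e r) (f s) = \<zero>" "c' (e r) (f s) = \<zero>" using c rs by blast+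
     thus ?thesis by simp
    qed
   qed
  qed
  show "H ` ?L = NZ \<rightarrow>\<^sub>E carrier K"
  proof (intro equalityI subsetI)
   fix w assume "w : H ` ?L"
   then obtain c where c: "c : Bil V U W U'" "w = H c" by blast
   show "w : NZ \<rightarrow>\<^sub>E carrier K" unfolding c(2) H_def
   proof (rule restrict_PiE_iff[THEN iffD2], rule ballI)
    fix p assume "p : NZ"
    hence "fst p < l" "snd p < n" using NZ by auto
    thus "c (e (fst p)) (f (snd p)) : carrier K" by (intro Bil_D(3)[OF c(1)] eU fU)
   qed
  next
   fix w assume w: "w : NZ \<rightarrow>\<^sub>E carrier K"
   define z where "z = (%r s. if (r, s) : NZ then w (r, s) else \<zero>)"
   have "\<exists>c\<in>Bil V U W U'. \<forall>r<l. \<forall>s<n. c (e r) (f s) = z r s"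
    by (rule Bil_ex[OF V e f]) (use w in \<open>auto simp: z_def\<close>)
   then obtain c where c: "c : Bil V U W U'" "\<forall>r<l. \<forall>s<n. c (e r) (f s) = z r s" by blast
   have "H c = w"
   proof
    fix p show "H c p = w p"
    proof (cases "p : NZ")
     case True
     hence "fst p < l" "snd p < n" using NZ by auto
     thus ?thesis using True c(2) by (simp add: H_def z_def)
    next
     case False thus ?thesis using PiE_arb[OF w False] by (simp add: H_def)
    qed
   qed
   moreover have "c : ?L" using c by (simp add: z_def)
   ultimately show "w : H ` ?L" by blast
  qed
 qed
 hence "card ?L = card (NZ \<rightarrow>\<^sub>E carrier K)" by (rule bij_betw_same_card)
 also have "\<dots> = q ^ card NZ" using fNZ by (simp add: card_PiE q_def)
 finally show ?thesis .
qed

end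

text \<open>The matrix positions, in adapted bases, that are not forced to be 0 when a form vanishes
  on member \<open>k\<close> of one filtration times member \<open>T - k\<close> of another, for all
  \<open>k\<close>; the dimensions are \<open>\<kappa>\<close> and \<open>\<rho>\<close>.\<close>

definition NZ :: "nat => (nat => nat) => (nat => nat) => (nat \<times> nat) set" where
 "NZ T \<kappa> \<rho> = {(r, s). r < \<kappa> T \<and> s < \<rho> T \<and> (\<forall>k\<le>T. \<not> (r < \<kappa> k \<and> s < \<rho> (T - k)))}"

lemma mono_upto:
 assumes "\<And>k. k < T ==> \<kappa> k \<le> (\<kappa> (Suc k) :: nat)" "i \<le> j" "j \<le> T"
 shows "\<kappa> i \<le> \<kappa> j"
 using assms(2,3)
proof (induction rule: dec_induct)
 case (step j) thus ?case using assms(1)[of j] by linarith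
qed simp

text \<open>A row between \<open>\<kappa> k\<close> and \<open>\<kappa> (Suc k)\<close> is
  restricted by the conditions with index at least \<open>Suc k\<close>. As \<open>\<rho>\<close> is
  monotone, the condition \<open>Suc k\<close> is the strongest, so the free columns are those from
  \<open>\<rho> (T - Suc k)\<close> on.\<close>

lemma card_NZ:
 assumes \<kappa>: "\<kappa> 0 = 0" "\<And>k. k < T ==> \<kappa> k \<le> \<kappa> (Suc k)" and \<rho>: "\<And>k. k < T ==> \<rho> k \<le> \<rho> (Suc k)"
 shows "card (NZ T \<kappa> \<rho>) = (\<Sum>k<T. (\<kappa> (Suc k) - \<kappa> k) * (\<rho> T - \<rho> (T - Suc k)))"
proof -
 define X where "X = (%k. {\<kappa> k..<\<kappa> (Suc k)} \<times> {\<rho> (T - Suc k)..<\<rho> T})"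
 have lm: "\<kappa> i \<le> \<kappa> j" if "i \<le> j" "j \<le> T" for i j by (rule mono_upto[of T \<kappa>, OF \<kappa>(2) that])
 have rm: "\<rho> i \<le> \<rho> j" if "i \<le> j" "j \<le> T" for i j by (rule mono_upto[of T \<rho>, OF \<rho> that])
 have "NZ T \<kappa> \<rho> = (\<Union>k<T. X k)"
 proof (intro equalityI subsetI)
  fix p assume "p : NZ T \<kappa> \<rho>"
  then obtain r s where p: "p = (r, s)" "r < \<kappa> T" "s < \<rho> T" and nz: "\<And>k. k \<le> T ==> r < \<kappa> k ==> \<rho> (T - k) \<le> s"
   unfolding NZ_def by fastforce
  define k where "k = (LEAST k. r < \<kappa> k)"
  have k: "r < \<kappa> k" unfolding k_def by (rule LeastI[of _ T]) (rule p(2))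
  have "k \<le> T" unfolding k_def by (rule Least_le) (rule p(2))
  have "k \<noteq> 0" using k \<kappa>(1) by (cases k) auto
  then obtain j where j: "k = Suc j" by (cases k) auto
  have "\<not> r < \<kappa> j" using not_less_Least[of j "%k. r < \<kappa> k"] j unfolding k_def by simp
  hence "p : X j" using p k nz[OF \<open>k \<le> T\<close> k] j by (simp add: X_def)
  moreover have "j < T" using j \<open>k \<le> T\<close> by simp
  ultimately show "p : (\<Union>k<T. X k)" by blast
 next
  fix p assume "p : (\<Union>k<T. X k)"
  then obtain j r s where j: "j < T" "p = (r, s)" "\<kappa> j \<le> r" "r < \<kappa> (Suc j)" "\<rho> (T - Suc j) \<le> s" "s < \<rho> T"
   by (auto simp: X_def)
  have "\<not> (r < \<kappa> k \<and> s < \<rho> (T - k))" if k: "k \<le> T" for k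
  proof
   assume a: "r < \<kappa> k \<and> s < \<rho> (T - k)"
   have "j < k" using lm[of k j] a j by (cases "j < k") auto
   hence "\<rho> (T - k) \<le> \<rho> (T - Suc j)" by (intro rm) auto
   thus False using a j by simp
  qed
  moreover have "r < \<kappa> T" using lm[of "Suc j" T] j by simp
  ultimately show "p : NZ T \<kappa> \<rho>" using j by (simp add: NZ_def)
 qed
 moreover have "card (\<Union>k<T. X k) = (\<Sum>k<T. card (X k))"
 proof (rule card_UN_disjoint)
  show "\<forall>i\<in>{..<T}. \<forall>j\<in>{..<T}. i \<noteq> j \<longrightarrow> X i \<inter> X j = {}"
  proof (intro ballI impI)
   fix i j assume ij: "i : {..<T}" "j : {..<T}" "i \<noteq> j"
   have "\<kappa> (Suc i) \<le> \<kappa> j \<or> \<kappa> (Suc j) \<le> \<kappa> i" using lm[of "Suc i" j] lm[of "Suc j" i] ij by (cases "i < j") auto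
   thus "X i \<inter> X j = {}" by (auto simp: X_def)
  qed
 qed (auto simp: X_def)
 ultimately show ?thesis by (simp add: X_def)
qed

text \<open>Replacing \<open>k\<close> by \<open>T - k\<close> exchanges the conditions, so the free
  positions are symmetric under transposition. A diagonal position is free iff \<open>r\<close> is
  at least the minimum of \<open>\<kappa> k\<close> and \<open>\<kappa> (T - k)\<close> for every
  \<open>k\<close>; the largest of these minima is \<open>\<kappa> N\<close>, since
  \<open>T - N = Suc N\<close>.\<close>

lemma card_NZ_sym:
 assumes \<kappa>: "\<And>k. k < Suc (2 * N) ==> \<kappa> k \<le> \<kappa> (Suc k)"
 defines "T \<equiv> Suc (2 * N)"
 shows "card (NZ T \<kappa> \<kappa>) = 2 * card {(r, s). r < s \<and> s < \<kappa> T \<and> (r, s) : NZ T \<kappa> \<kappa>} + card {r. r < \<kappa> T \<and> (r, r) : NZ T \<kappa> \<kappa>}"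
  and "card {r. r < \<kappa> T \<and> (r, r) : NZ T \<kappa> \<kappa>} = \<kappa> T - \<kappa> N"
  and "(r, s) : NZ T \<kappa> \<kappa> ==> (s, r) : NZ T \<kappa> \<kappa>"
proof -
 have lm: "\<kappa> i \<le> \<kappa> j" if "i \<le> j" "j \<le> T" for i j
  by (rule mono_upto[of T \<kappa>, OF _ that]) (simp add: \<kappa> T_def)
 have sym: "(s, r) : NZ T \<kappa> \<kappa>" if "(r, s) : NZ T \<kappa> \<kappa>" for r s
 proof -
  have "\<not> (s < \<kappa> k \<and> r < \<kappa> (T - k))" if "k \<le> T" for k
  proof -
   have "\<not> (r < \<kappa> (T - k) \<and> s < \<kappa> (T - (T - k)))"
    using \<open>(r, s) : NZ T \<kappa> \<kappa>\<close> unfolding NZ_def by (simp only: mem_Collect_eq prod.case) (meson diff_le_self)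
   thus ?thesis using that by auto
  qed
  thus ?thesis using that by (simp add: NZ_def)
 qed
 show "(r, s) : NZ T \<kappa> \<kappa> ==> (s, r) : NZ T \<kappa> \<kappa>" by (rule sym)
 define A where "A = {(r, s). r < s \<and> s < \<kappa> T \<and> (r, s) : NZ T \<kappa> \<kappa>}"
 define D where "D = {r. r < \<kappa> T \<and> (r, r) : NZ T \<kappa> \<kappa>}"
 have fin: "finite (NZ T \<kappa> \<kappa>)" by (rule finite_subset[of _ "{..<\<kappa> T} \<times> {..<\<kappa> T}"]) (auto simp: NZ_def)
 have fA: "finite A" by (rule finite_subset[OF _ fin]) (auto simp: A_def)
 have fD: "finite D" by (simp add: D_def)
 have "NZ T \<kappa> \<kappa> = (A \<union> prod.swap ` A) \<union> (%r. (r, r)) ` D"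
 proof (intro equalityI subsetI)
  fix p assume p: "p : NZ T \<kappa> \<kappa>"
  obtain r s where rs: "p = (r, s)" by (cases p)
  have b: "r < \<kappa> T" "s < \<kappa> T" using p by (simp_all add: rs NZ_def)
  consider "r < s" | "s < r" | "r = s" by linarith
  thus "p : (A \<union> prod.swap ` A) \<union> (%r. (r, r)) ` D"
  proof cases
   case 2
   hence "(s, r) : A" using sym[of r s] p b by (simp add: A_def rs)
   hence "prod.swap (s, r) : prod.swap ` A" by (rule imageI)
   thus ?thesis by (simp add: rs)
  qed (use p b in \<open>simp_all add: A_def D_def rs\<close>)
 next
  fix p assume "p : (A \<union> prod.swap ` A) \<union> (%r. (r, r)) ` D"
  thus "p : NZ T \<kappa> \<kappa>" using sym by (auto simp: A_def D_def)
 qed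
 moreover have "card ((A \<union> prod.swap ` A) \<union> (%r. (r, r)) ` D) = card (A \<union> prod.swap ` A) + card ((%r. (r, r)) ` D)"
  using fA fD by (intro card_Un_disjoint) (auto simp: A_def)
 moreover have "card (A \<union> prod.swap ` A) = card A + card (prod.swap ` A)"
  using fA by (intro card_Un_disjoint) (auto simp: A_def)
 moreover have "card (prod.swap ` A) = card A" by (rule card_image) simp
 moreover have "card ((%r. (r, r)) ` D) = card D" by (rule card_image) (simp add: inj_on_def)
 ultimately show "card (NZ T \<kappa> \<kappa>) = 2 * card {(r, s). r < s \<and> s < \<kappa> T \<and> (r, s) : NZ T \<kappa> \<kappa>} + card {r. r < \<kappa> T \<and> (r, r) : NZ T \<kappa> \<kappa>}"
  by (simp add: A_def D_def)
 have "D = {\<kappa> N..<\<kappa> T}"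
 proof (intro equalityI subsetI)
  fix r assume r: "r : D"
  have "\<forall>k\<le>T. \<not> (r < \<kappa> k \<and> r < \<kappa> (T - k))" using r unfolding D_def NZ_def by blast
  moreover have "N \<le> T" by (simp add: T_def)
  ultimately have "\<not> (r < \<kappa> N \<and> r < \<kappa> (T - N))" by blast
  moreover have "\<kappa> N \<le> \<kappa> (T - N)" by (rule lm) (auto simp: T_def)
  ultimately show "r : {\<kappa> N..<\<kappa> T}" using r by (auto simp: D_def)
 next
  fix r assume r: "r : {\<kappa> N..<\<kappa> T}"
  have "\<not> (r < \<kappa> k \<and> r < \<kappa> (T - k))" if "k \<le> T" for k
  proof (cases "k \<le> N")
   case True
   hence "\<kappa> k \<le> \<kappa> N" by (intro lm) (auto simp: T_def)
   thus ?thesis using r by auto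
  next
   case False
   hence "\<kappa> (T - k) \<le> \<kappa> N" by (intro lm) (auto simp: T_def)
   thus ?thesis using r by auto
  qed
  thus "r : D" using r by (auto simp: D_def NZ_def)
 qed
 thus "card {r. r < \<kappa> T \<and> (r, r) : NZ T \<kappa> \<kappa>} = \<kappa> T - \<kappa> N" by (simp add: D_def)
qed

context odd_field
begin

lemma filtration_zero_iff:
 assumes V: "vectorspace K V" "vectorspace K W"
  and L: "\<And>k. k \<le> T ==> subspace K (L k) V" "\<And>k. k < T ==> L k \<subseteq> L (Suc k)" "finite (L T)"
  and R: "\<And>k. k \<le> T ==> subspace K (R k) W" "\<And>k. k < T ==> R k \<subseteq> R (Suc k)" "finite (R T)"
  and e: "indep V (sdim (L T)) e" "\<And>k. k \<le> T ==> lspan V (sdim (L k)) e = L k"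
  and f: "indep W (sdim (R T)) f" "\<And>k. k \<le> T ==> lspan W (sdim (R k)) f = R k"
  and c: "c : Bil V (L T) W (R T)"
 shows "(\<forall>k\<le>T. orth c (L k) (R (T - k))) \<longleftrightarrow>
  (\<forall>r<sdim (L T). \<forall>s<sdim (R T). (r, s) \<notin> NZ T (%k. sdim (L k)) (%k. sdim (R k)) \<longrightarrow> c (e r) (f s) = \<zero>)"
proof -
 have LT: "L k \<subseteq> L T" if "k \<le> T" for k
  using that by (induction rule: inc_induct) (use L(2) in blast)+
 have RT: "R k \<subseteq> R T" if "k \<le> T" for k
  using that by (induction rule: inc_induct) (use R(2) in blast)+
 have lT: "sdim (L k) \<le> sdim (L T)" if "k \<le> T" for k by (rule sdim_mono[OF L(1)[OF that] L(1)[OF le_refl] L(3) LT[OF that]])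
 have rT: "sdim (R k) \<le> sdim (R T)" if "k \<le> T" for k by (rule sdim_mono[OF R(1)[OF that] R(1)[OF le_refl] R(3) RT[OF that]])
 have eU: "e r : L T" if "r < sdim (L T)" for r by (rule basis_mem[OF V(1) e(1) e(2)[OF le_refl] that])
 have fU: "f r : R T" if "r < sdim (R T)" for r by (rule basis_mem[OF V(2) f(1) f(2)[OF le_refl] that])
 have k: "(orth c (L k) (R (T - k))) \<longleftrightarrow> (\<forall>r<sdim (L k). \<forall>s<sdim (R (T - k)). c (e r) (f s) = \<zero>)" if k: "k \<le> T" for k
 proof -
  have k': "T - k \<le> T" by simp
  have "(\<forall>x\<in>lspan V (sdim (L k)) e. \<forall>y\<in>lspan W (sdim (R (T - k))) f. c x y = \<zero>) \<longleftrightarrow>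
   (\<forall>r<sdim (L k). \<forall>s<sdim (R (T - k)). c (e r) (f s) = \<zero>)"
  proof (rule Bil_zero_on_basis[OF c V _ _ L(1)[OF le_refl] R(1)[OF le_refl]])
   show "e r : L T" if "r < sdim (L k)" for r using eU[of r] lT[OF k] that by simp
   show "f s : R T" if "s < sdim (R (T - k))" for s using fU[of s] rT[OF k'] that by simp
  qed
  thus ?thesis unfolding e(2)[OF k] f(2)[OF k'] .
 qed
 show ?thesis
 proof
  assume "\<forall>k\<le>T. orth c (L k) (R (T - k))"
  hence "\<And>i r s. i \<le> T ==> r < sdim (L i) ==> s < sdim (R (T - i)) ==> c (e r) (f s) = \<zero>" using k by blast
  thus "\<forall>r<sdim (L T). \<forall>s<sdim (R T). (r, s) \<notin> NZ T (%k. sdim (L k)) (%k. sdim (R k)) \<longrightarrow> c (e r) (f s) = \<zero>"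
   unfolding NZ_def by blast
 next
  assume a: "\<forall>r<sdim (L T). \<forall>s<sdim (R T). (r, s) \<notin> NZ T (%k. sdim (L k)) (%k. sdim (R k)) \<longrightarrow> c (e r) (f s) = \<zero>"
  have "c (e r) (f s) = \<zero>" if i: "i \<le> T" and rs: "r < sdim (L i)" "s < sdim (R (T - i))" for i r s
  proof -
   have "r < sdim (L T)" "s < sdim (R T)" using lT[OF i] rT[of "T - i"] rs by auto
   moreover have "(r, s) \<notin> NZ T (%k. sdim (L k)) (%k. sdim (R k))" using i rs unfolding NZ_def by blast
   ultimately show ?thesis using a by blast
  qed
  thus "\<forall>k\<le>T. orth c (L k) (R (T - k))" using k by blast
 qed
qed

lemma card_Bil_filtered:
 assumes V: "vectorspace K V" "vectorspace K W"
  and L: "\<And>k. k \<le> T ==> subspace K (L k) V" "\<And>k. k < T ==> L k \<subseteq> L (Suc k)" "\<And>k. k \<le> T ==> finite (L k)" "L 0 = {\<zero>\<^bsub>V\<^esub>}"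
  and R: "\<And>k. k \<le> T ==> subspace K (R k) W" "\<And>k. k < T ==> R k \<subseteq> R (Suc k)" "\<And>k. k \<le> T ==> finite (R k)"
 shows "card {c : Bil V (L T) W (R T). \<forall>k\<le>T. orth c (L k) (R (T - k))} =
  q ^ (\<Sum>k<T. (sdim (L (Suc k)) - sdim (L k)) * (sdim (R T) - sdim (R (T - Suc k))))"
proof -
 obtain e where e: "indep V (sdim (L T)) e" "\<And>k. k \<le> T ==> lspan V (sdim (L k)) e = L k"
  using adapted_basis[where L = L and T = T, OF V(1) L(1,3,2)] by blast
 obtain f where f: "indep W (sdim (R T)) f" "\<And>k. k \<le> T ==> lspan W (sdim (R k)) f = R k"
  using adapted_basis[where L = R and T = T, OF V(2) R(1,3,2)] by blast
 define \<Lambda> where "\<Lambda> = NZ T (%k. sdim (L k)) (%k. sdim (R k))"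
 have "{c : Bil V (L T) W (R T). \<forall>k\<le>T. orth c (L k) (R (T - k))} =
  {c : Bil V (L T) W (R T). \<forall>r<sdim (L T). \<forall>s<sdim (R T). (r, s) \<notin> \<Lambda> \<longrightarrow> c (e r) (f s) = \<zero>}"
  unfolding \<Lambda>_def
  by (intro Collect_cong conj_cong refl filtration_zero_iff[OF V L(1,2) L(3)[OF le_refl] R(1,2) R(3)[OF le_refl] e f])
 also have "card \<dots> = q ^ card \<Lambda>"
  by (rule card_Bil_prescribed[OF V e(1) e(2)[OF le_refl] f(1) f(2)[OF le_refl]]) (auto simp: \<Lambda>_def NZ_def)
 also have "card \<Lambda> = (\<Sum>k<T. (sdim (L (Suc k)) - sdim (L k)) * (sdim (R T) - sdim (R (T - Suc k))))"
  unfolding \<Lambda>_def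
 proof (rule card_NZ)
  show "sdim (L 0) = 0" by (simp add: L(4) sdim_zero)
  show "sdim (L k) \<le> sdim (L (Suc k))" if "k < T" for k
   by (rule sdim_mono[OF L(1) L(1) L(3) L(2)[OF that]]) (use that in auto)
  show "sdim (R k) \<le> sdim (R (Suc k))" if "k < T" for k
   by (rule sdim_mono[OF R(1) R(1) R(3) R(2)[OF that]]) (use that in auto)
 qed
 finally show ?thesis .
qed

text \<open>The exponent is stated doubled. Of the free positions off the diagonal one half counts,
  and those on the diagonal count fully for \<open>ep = 1\<close> and not at all for
  \<open>ep = -1\<close>; so twice the exponent is the number of all free positions plus
  \<open>ep\<close> times the number of diagonal ones.\<close>

lemma card_Sf_filtered:
 assumes V: "vectorspace K V" and T: "T = Suc (2 * N)" and ep: "ep : {1, -1}"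
  and L: "\<And>k. k \<le> T ==> subspace K (L k) V" "\<And>k. k < T ==> L k \<subseteq> L (Suc k)" "\<And>k. k \<le> T ==> finite (L k)" "L 0 = {\<zero>\<^bsub>V\<^esub>}"
 obtains E where "card {c : Sf ep V (L T). \<forall>k\<le>T. orth c (L k) (L (T - k))} = q ^ E"
  "2 * int E = int (\<Sum>k<T. (sdim (L (Suc k)) - sdim (L k)) * (sdim (L T) - sdim (L (T - Suc k)))) +
   ep * int (sdim (L T) - sdim (L N))"
proof -
 obtain e where e: "indep V (sdim (L T)) e" "\<And>k. k \<le> T ==> lspan V (sdim (L k)) e = L k"
  using adapted_basis[where L = L and T = T, OF V L(1,3,2)] by blast
 define n where "n = sdim (L T)"
 define \<Lambda> where "\<Lambda> = NZ T (%k. sdim (L k)) (%k. sdim (L k))"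
 have mono: "sdim (L k) \<le> sdim (L (Suc k))" if "k < T" for k
  by (rule sdim_mono[OF L(1) L(1) L(3) L(2)[OF that]]) (use that in auto)
 note N = card_NZ_sym[of N "%k. sdim (L k)", folded T, OF mono, folded \<Lambda>_def n_def]
 define Z where "Z = {(r, s). r < n \<and> s < n \<and> (r, s) \<notin> \<Lambda>}"
 have "{c : Sf ep V (L T). \<forall>k\<le>T. orth c (L k) (L (T - k))} =
  {c : Sf ep V (L T). \<forall>(r, s)\<in>Z. c (e r) (e s) = \<zero>}"
 proof (intro Collect_cong conj_cong refl)
  fix c assume "c : Sf ep V (L T)"
  hence c: "c : Bil V (L T) V (L T)" by (rule Sf_Bil)
  have "(\<forall>k\<le>T. orth c (L k) (L (T - k))) \<longleftrightarrow>
   (\<forall>r<n. \<forall>s<n. (r, s) \<notin> \<Lambda> \<longrightarrow> c (e r) (e s) = \<zero>)" unfolding n_def \<Lambda>_def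
   by (rule filtration_zero_iff[where L = L and R = L and T = T,
     OF V V L(1,2) L(3)[OF le_refl] L(1,2) L(3)[OF le_refl] e e c])
  thus "(\<forall>k\<le>T. orth c (L k) (L (T - k))) = (\<forall>(r, s)\<in>Z. c (e r) (e s) = \<zero>)"
   unfolding Z_def by blast
 qed
 also have "card \<dots> = q ^ (card {(r, s). r < s \<and> s < n \<and> (r, s) \<notin> Z} + (if ep = 1 then card {r. r < n \<and> (r, r) \<notin> Z} else 0))"
  unfolding n_def
 proof (rule card_Sf_prescribed[OF V e(1) e(2)[OF le_refl] ep])
  show "(s, r) : Z" if "(r, s) : Z" for r s using that N(3)[of s r] by (auto simp: Z_def)
 qed (auto simp: Z_def n_def)
 also have "{(r, s). r < s \<and> s < n \<and> (r, s) \<notin> Z} = {(r, s). r < s \<and> s < n \<and> (r, s) : \<Lambda>}" by (auto simp: Z_def)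
 also have "{r. r < n \<and> (r, r) \<notin> Z} = {r. r < n \<and> (r, r) : \<Lambda>}" by (auto simp: Z_def)
 finally have c: "card {c : Sf ep V (L T). \<forall>k\<le>T. orth c (L k) (L (T - k))} =
  q ^ (card {(r, s). r < s \<and> s < n \<and> (r, s) : \<Lambda>} + (if ep = 1 then card {r. r < n \<and> (r, r) : \<Lambda>} else 0))" .
 have "card \<Lambda> = (\<Sum>k<T. (sdim (L (Suc k)) - sdim (L k)) * (sdim (L T) - sdim (L (T - Suc k))))"
  unfolding \<Lambda>_def
 proof (rule card_NZ)
  show "sdim (L 0) = 0" by (simp add: L(4) sdim_zero)
 qed (rule mono, assumption)+
 moreover have "2 * int (card {(r, s). r < s \<and> s < n \<and> (r, s) : \<Lambda>} + (if ep = 1 then card {r. r < n \<and> (r, r) : \<Lambda>} else 0)) =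
  int (card \<Lambda>) + ep * int (card {r. r < n \<and> (r, r) : \<Lambda>})"
  using N(1) ep by auto
 ultimately have "2 * int (card {(r, s). r < s \<and> s < n \<and> (r, s) : \<Lambda>} + (if ep = 1 then card {r. r < n \<and> (r, r) : \<Lambda>} else 0)) =
  int (\<Sum>k<T. (sdim (L (Suc k)) - sdim (L k)) * (sdim (L T) - sdim (L (T - Suc k)))) + ep * int (sdim (L T) - sdim (L N))"
  using N(2) by (simp only: n_def)
 thus ?thesis using c that by blast
qed

subsection \<open>General linear groups and Grassmannians\<close>

text \<open>Between spaces of equal cardinality a linear map is bijective exactly when it sends a
  basis to an independent tuple.\<close>

lemma card_GL:
 assumes V: "vectorspace K V" "finite (carrier V)" and W: "vectorspace K W" "finite (carrier W)"
  and s: "card (carrier W) = card (carrier V)"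
 shows "real (card {g : Lin V (carrier V) W. bij_betw g (carrier V) (carrier W)}) = ij (sdim (carrier V)) (sdim (carrier V))"
proof -
 define n where "n = sdim (carrier V)"
 note sV = subspace_carrier[OF V(1)]
 obtain m e where e: "indep V m e" "lspan V m e = carrier V" "card (carrier V) = q ^ m" by (rule basis_exists[OF sV V(2)])
 have mn: "m = n" unfolding n_def by (rule sdim_eqI[OF e(3), symmetric])
 let ?\<Phi> = "%f. \<lambda>i\<in>{..<m}. f (e i)"
 have bij: "bij_betw ?\<Phi> (Lin V (carrier V) W) ({..<m} \<rightarrow>\<^sub>E carrier W)"
  using bij_Lin[OF V(1) e(1) W(1)] unfolding e(2) .
 note eU = basis_mem[OF V(1) e(1,2)]
 have iff: "bij_betw g (carrier V) (carrier W) \<longleftrightarrow> indep W m (?\<Phi> g)" if g: "g : Lin V (carrier V) W" for g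
 proof -
  have lg: "lin V (carrier V) W g" and gc: "g : carrier V \<rightarrow> carrier W" using g by (auto simp: Lin_def)
  have glc: "g (lc V m e x) = lc W m (?\<Phi> g) x" if x: "x : cf m" for x
  proof -
   have "g (lc V m e x) = lc W m (%i. g (e i)) x" by (rule lin_lc[OF lg sV W(1) eU cf_D[OF x]])
   also have "\<dots> = lc W m (?\<Phi> g) x" by (rule lc_cong) auto
   finally show ?thesis .
  qed
  have ge: "?\<Phi> g i : carrier W" if "i < m" for i using gc eU[OF that] that by auto
  show ?thesis
  proof
   assume b: "bij_betw g (carrier V) (carrier W)"
   show "indep W m (?\<Phi> g)" unfolding indep_def
   proof (intro conjI ballI impI)
    show "\<forall>i<m. ?\<Phi> g i : carrier W" using ge by blast
    fix x assume x: "x : cf m" "lc W m (?\<Phi> g) x = \<zero>\<^bsub>W\<^esub>"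
    have xl: "lc V m e x : carrier V" by (rule lc_closed[OF V(1) eU cf_D[OF x(1)]])
    have "g (lc V m e x) = g \<zero>\<^bsub>V\<^esub>" using glc[OF x(1)] x(2) lin_zero[OF lg sV W(1)] by (simp only:)
    hence "lc V m e x = \<zero>\<^bsub>V\<^esub>" using inj_onD[OF bij_betw_imp_inj_on[OF b] _ xl] V(1) by simp
    thus "\<forall>i<m. x i = \<zero>" using e(1) x(1) unfolding indep_def by blast
   qed
  next
   assume i: "indep W m (?\<Phi> g)"
   have "inj_on g (carrier V)"
   proof (rule inj_onI)
    fix u u' assume u: "u : carrier V" "u' : carrier V" "g u = g u'"
    obtain x where x: "x : cf m" "u = lc V m e x" using u(1) e(2) unfolding lspan_def by blast
    obtain x' where x': "x' : cf m" "u' = lc V m e x'" using u(2) e(2) unfolding lspan_def by blast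
    have "lc W m (?\<Phi> g) x = lc W m (?\<Phi> g) x'" using u(3) glc[OF x(1)] glc[OF x'(1)] unfolding x(2) x'(2) by (simp only:)
    hence "x = x'" by (rule inj_onD[OF indep_inj[OF W(1) i] _ x(1) x'(1)])
    thus "u = u'" using x(2) x'(2) by simp
   qed
   moreover have "g ` carrier V = carrier W"
    by (rule card_subset_eq[OF W(2)]) (use gc s card_image[OF \<open>inj_on g (carrier V)\<close>] in auto)
   ultimately show "bij_betw g (carrier V) (carrier W)" by (simp add: bij_betw_def)
  qed
 qed
 have "bij_betw ?\<Phi> {g : Lin V (carrier V) W. bij_betw g (carrier V) (carrier W)} {w : {..<m} \<rightarrow>\<^sub>E carrier W. indep W m w}"
 proof (rule bij_betw_imageI)
  show "inj_on ?\<Phi> {g : Lin V (carrier V) W. bij_betw g (carrier V) (carrier W)}"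
   by (rule inj_on_subset[OF bij_betw_imp_inj_on[OF bij]]) blast
  show "?\<Phi> ` {g : Lin V (carrier V) W. bij_betw g (carrier V) (carrier W)} = {w : {..<m} \<rightarrow>\<^sub>E carrier W. indep W m w}"
  proof (intro equalityI subsetI)
   fix w assume "w : ?\<Phi> ` {g : Lin V (carrier V) W. bij_betw g (carrier V) (carrier W)}"
   then obtain g where g: "w = ?\<Phi> g" "g : Lin V (carrier V) W" "bij_betw g (carrier V) (carrier W)" by blast
   have "w : {..<m} \<rightarrow>\<^sub>E carrier W" unfolding g(1) using bij_betwE[OF bij] g(2) by blast
   moreover have "indep W m w" unfolding g(1) using iff[OF g(2)] g(3) by (simp only:)
   ultimately show "w : {w : {..<m} \<rightarrow>\<^sub>E carrier W. indep W m w}" by blast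
  next
   fix w assume w: "w : {w : {..<m} \<rightarrow>\<^sub>E carrier W. indep W m w}"
   hence "w : ?\<Phi> ` Lin V (carrier V) W" unfolding bij_betw_imp_surj_on[OF bij] by blast
   then obtain g where g: "w = ?\<Phi> g" "g : Lin V (carrier V) W" by blast
   have "indep W m (?\<Phi> g)" using w unfolding g(1) by blast
   hence "bij_betw g (carrier V) (carrier W)" using iff[OF g(2)] by (simp only:)
   thus "w : ?\<Phi> ` {g : Lin V (carrier V) W. bij_betw g (carrier V) (carrier W)}" using g by blast
  qed
 qed
 hence "card {g : Lin V (carrier V) W. bij_betw g (carrier V) (carrier W)} = card {w : {..<m} \<rightarrow>\<^sub>E carrier W. indep W m w}"
  by (rule bij_betw_same_card)
 also have "\<dots> = (\<Prod>r<m. card (carrier W) - q ^ r)"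
  by (rule card_indep_tuples[OF W(1)]) (use subspace_carrier[OF W(1)] W(2) in auto)
 also have "real \<dots> = ij m m" unfolding s e(3) by (rule ij_nat)
 finally show ?thesis by (simp add: mn n_def)
qed

text \<open>Independent \<open>u\<close>-tuples in \<open>W\<close> are sorted by their span. Each
  fibre consists of the ordered bases of one subspace, so its size is the order of GL_u.\<close>

lemma card_subspaces:
 assumes W: "subspace K W V" "finite W"
 shows "real (card {Q. subspace K Q V \<and> Q \<subseteq> W \<and> sdim Q = u}) * ij u u = ij u (sdim W)"
proof -
 note V = subspace_D(1)[OF W(1)]
 let ?B = "{Q. subspace K Q V \<and> Q \<subseteq> W \<and> sdim Q = u}"
 let ?T = "{v : {..<u} \<rightarrow>\<^sub>E W. indep V u v}"
 have fT: "finite ({..<u} \<rightarrow>\<^sub>E W)" using W(2) by (intro finite_PiE) auto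
 have "card ?T = card ?B * (\<Prod>r<u. q ^ u - q ^ r)"
 proof (rule card_fibres[where f = "lspan V u"])
  show "finite ?B" by (rule finite_subset[of _ "Pow W"]) (use W(2) in auto)
  show "finite ?T" by (rule finite_subset[OF _ fT]) blast
  show "lspan V u v : ?B" if v: "v : ?T" for v
  proof -
   have i: "indep V u v" and vW: "\<And>i. i < u ==> v i : W" using v by auto
   have "subspace K (lspan V u v) V" by (rule subspace_lspan[OF V]) (rule indep_D[OF i])
   moreover have "lspan V u v \<subseteq> W" by (rule lspan_subset[OF W(1)]) (rule vW)
   moreover have "sdim (lspan V u v) = u" by (rule sdim_eqI[OF card_lspan[OF V i]])
   ultimately show ?thesis by blast
  qed
  fix Q assume Q: "Q : ?B"
  have sQ: "subspace K Q V" "Q \<subseteq> W" "sdim Q = u" and fQ: "finite Q" using Q W(2) finite_subset by blast+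
  have cQ: "card Q = q ^ u" using card_subspace[OF sQ(1) fQ] sQ(3) by simp
  have "{v : ?T. lspan V u v = Q} = {v : {..<u} \<rightarrow>\<^sub>E Q. indep V u v}"
  proof (intro equalityI subsetI)
   fix v assume v: "v : {v : ?T. lspan V u v = Q}"
   have i: "indep V u v" and l: "lspan V u v = Q" and vW: "v : {..<u} \<rightarrow>\<^sub>E W" using v by blast+
   have "v i : Q" if "i < u" for i by (rule basis_mem[OF V i l that])
   thus "v : {v : {..<u} \<rightarrow>\<^sub>E Q. indep V u v}" using i vW by (auto simp: PiE_iff)
  next
   fix v assume v: "v : {v : {..<u} \<rightarrow>\<^sub>E Q. indep V u v}"
   have i: "indep V u v" and vQ: "\<And>i. i < u ==> v i : Q" using v by auto
   have "lspan V u v \<subseteq> Q" by (rule lspan_subset[OF sQ(1)]) (rule vQ)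
   hence "lspan V u v = Q" by (rule card_subset_eq[OF fQ]) (simp add: card_lspan[OF V i] cQ)
   moreover have "v : {..<u} \<rightarrow>\<^sub>E W" using v sQ(2) by (auto simp: PiE_iff)
   ultimately show "v : {v : ?T. lspan V u v = Q}" using i by blast
  qed
  also have "card \<dots> = (\<Prod>r<u. card Q - q ^ r)"
   by (rule card_indep_tuples[OF V]) (use sQ fQ in auto)
  finally show "card {v : ?T. lspan V u v = Q} = (\<Prod>r<u. q ^ u - q ^ r)" unfolding cQ .
 qed
 moreover have "card ?T = (\<Prod>r<u. card W - q ^ r)"
  by (rule card_indep_tuples[OF V]) (use W in auto)
 ultimately have "real (card ?B) * real (\<Prod>r<u. q ^ u - q ^ r) = real (\<Prod>r<u. q ^ sdim W - q ^ r)"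
  unfolding card_subspace[OF W, symmetric] by (simp only: of_nat_mult[symmetric])
 thus ?thesis unfolding ij_nat .
qed

end

section \<open>Comparison with the dimension and the linear maps of the library\<close>

context finite_field
begin

text \<open>Taking linear combinations over a basis is a bijection from coefficient functions to
  vectors. This links the dimension in the definitions to cardinalities and hence to
  \<open>sdim\<close>.\<close>

lemma fin_dim_card:
 assumes "vectorspace K V" "vectorspace.fin_dim K V"
 shows "finite (carrier V)" "card (carrier V) = q ^ vectorspace.dim K V"
proof -
 interpret V: vectorspace K V by fact
 obtain \<beta> where \<beta>: "finite \<beta>" "V.basis \<beta>" using V.finite_basis_exists[OF assms(2)] by blast
 have \<beta>V: "\<beta> \<subseteq> carrier V" using \<beta>(2) by (simp add: V.basis_def)
 have ex: "\<exists>!a. a : \<beta> \<rightarrow>\<^sub>E carrier K \<and> V.lincomb a \<beta> = v" if "v : carrier V" for v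
  using V.basis_criterion[OF \<beta>(1) \<beta>V] \<beta>(2) that by blast
 have cl: "V.lincomb a \<beta> : carrier V" if "a : \<beta> \<rightarrow>\<^sub>E carrier K" for a
  by (rule V.lincomb_closed[OF \<beta>V]) (use that in auto)
 have "bij_betw (%a. V.lincomb a \<beta>) (\<beta> \<rightarrow>\<^sub>E carrier K) (carrier V)"
 proof (rule bij_betw_imageI)
  show "inj_on (%a. V.lincomb a \<beta>) (\<beta> \<rightarrow>\<^sub>E carrier K)"
  proof (rule inj_onI)
   fix a a' assume a: "a : \<beta> \<rightarrow>\<^sub>E carrier K" "a' : \<beta> \<rightarrow>\<^sub>E carrier K" "V.lincomb a \<beta> = V.lincomb a' \<beta>"
   show "a = a'" using ex[OF cl[OF a(1)]] a by metis
  qed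
  show "(%a. V.lincomb a \<beta>) ` (\<beta> \<rightarrow>\<^sub>E carrier K) = carrier V" using ex cl by blast
 qed
 moreover have "finite (\<beta> \<rightarrow>\<^sub>E carrier K)" using \<beta>(1) finite_K by (intro finite_PiE) auto
 ultimately show "finite (carrier V)" "card (carrier V) = q ^ V.dim"
  using bij_betw_finite bij_betw_same_card[of _ "\<beta> \<rightarrow>\<^sub>E carrier K" "carrier V"] V.dim_basis[OF \<beta>]
  by (auto simp: card_PiE[OF \<beta>(1)] q_def)
qed

lemma finite_fin_dim:
 assumes "vectorspace K V" "finite (carrier V)"
 shows "vectorspace.fin_dim K V"
proof -
 interpret V: vectorspace K V by fact
 have "V.span (carrier V) = carrier V"
  using V.span_is_subset2[of "carrier V"] V.in_own_span[of "carrier V"] by blast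
 thus ?thesis using assms(2) unfolding V.fin_dim_def by blast
qed

lemma dim_eq_sdim:
 assumes "vectorspace K V" "finite (carrier V)"
 shows "vectorspace.dim K V = sdim (carrier V)"
 using sdim_eqI[OF fin_dim_card(2)[OF assms(1) finite_fin_dim[OF assms]]] by simp

lemma linear_map_iff: "linear_map K V W f \<longleftrightarrow> vectorspace K V \<and> vectorspace K W \<and> lin V (carrier V) W f"
 unfolding linear_map_def mod_hom_def mod_hom_axioms_def module_hom_def lin_def vectorspace_def by blast

lemma subspace_restrict_vs: "subspace K U V ==> vectorspace K (V\<lparr>carrier := U\<rparr>)"
 using vectorspace.subspace_is_vs subspace_D(1) by blast

lemma lin_inv_into:
 assumes f: "lin V (carrier V) W f" and V: "vectorspace K V" and b: "bij_betw f (carrier V) (carrier W)"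
 shows "lin W (carrier W) V (inv_into (carrier V) f)"
proof (rule linI)
 let ?g = "inv_into (carrier V) f"
 have g: "?g y : carrier V" "f (?g y) = y" if "y : carrier W" for y
  using that b by (auto simp: bij_betw_def inv_into_into f_inv_into_f)
 have gi: "?g (f x) = x" if "x : carrier V" for x using that b by (simp add: bij_betw_def)
 show "?g x : carrier V" if "x : carrier W" for x by (rule g(1)[OF that])
 show "?g (x \<oplus>\<^bsub>W\<^esub> y) = ?g x \<oplus>\<^bsub>V\<^esub> ?g y" if xy: "x : carrier W" "y : carrier W" for x y
 proof -
  have "f (?g x \<oplus>\<^bsub>V\<^esub> ?g y) = x \<oplus>\<^bsub>W\<^esub> y" unfolding lin_D(2)[OF f g(1)[OF xy(1)] g(1)[OF xy(2)]] g(2)[OF xy(1)] g(2)[OF xy(2)] ..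
  moreover have "?g (f (?g x \<oplus>\<^bsub>V\<^esub> ?g y)) = ?g x \<oplus>\<^bsub>V\<^esub> ?g y" by (rule gi) (rule vs_add_closed[OF V g(1)[OF xy(1)] g(1)[OF xy(2)]])
  ultimately show ?thesis by simp
 qed
 show "?g (c \<odot>\<^bsub>W\<^esub> x) = c \<odot>\<^bsub>V\<^esub> ?g x" if c: "c : carrier K" and x: "x : carrier W" for c x
 proof -
  have "f (c \<odot>\<^bsub>V\<^esub> ?g x) = c \<odot>\<^bsub>W\<^esub> x" unfolding lin_D(3)[OF f c g(1)[OF x]] g(2)[OF x] ..
  moreover have "?g (f (c \<odot>\<^bsub>V\<^esub> ?g x)) = c \<odot>\<^bsub>V\<^esub> ?g x" by (rule gi) (rule vs_smult_closed[OF V c g(1)[OF x]])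
  ultimately show ?thesis by simp
 qed
qed

end

section \<open>Isometries\<close>

locale quiver_field = odd_field K + quiver_duality Q s0 s1 s \<tau>
 for K :: "'k ring" (structure) and Q :: "('v, 'a) pre_digraph"
  and s0 :: "'v => 'v" and s1 :: "'a => 'a" and s :: "'v => int" and \<tau> :: "'a => int"
begin

abbreviation "src \<equiv> tail Q"
abbreviation "tgt \<equiv> head Q"
abbreviation "QV \<equiv> verts Q"
abbreviation "QA \<equiv> arcs Q"
abbreviation "Iso M N \<equiv> isometries K Q M N"
abbreviation "TS M \<equiv> carrier (total_space Q M)"

lemma tail_head_verts: "al : QA ==> src al : QV" "al : QA ==> tgt al : QV"
 by (rule wf_digraph.tail_in_verts wf_digraph.head_in_verts; unfold_locales; assumption)+

lemma TS_def: "TS M = (\<Pi>\<^sub>E i\<in>QV. carrier (space M i))"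
 by (simp add: total_space_def)

lemma is_rep_D:
 assumes "is_rep K Q M"
 shows "i : QV ==> vectorspace K (space M i)" "i : QV ==> finite (carrier (space M i))"
  "i : QV ==> vectorspace.dim K (space M i) = sdim (carrier (space M i))"
  "al : QA ==> lin (space M (src al)) (carrier (space M (src al))) (space M (tgt al)) (arrow_map M al)"
 using assms fin_dim_card(1) dim_eq_sdim by (auto simp: is_rep_def linear_map_iff)

lemma iso_D:
 assumes "fi : Iso M N"
 shows "i : QV ==> lin (space M i) (carrier (space M i)) (space N i) (fi i)"
  "i : QV ==> bij_betw (fi i) (carrier (space M i)) (carrier (space N i))"
  "al : QA ==> x : carrier (space M (src al)) ==> fi (tgt al) (arrow_map M al x) = arrow_map N al (fi (src al) x)"
  "u : TS M ==> w : TS M ==> form N (\<lambda>i\<in>QV. fi i (u i)) (\<lambda>i\<in>QV. fi i (w i)) = form M u w"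
  "fi : (\<Pi>\<^sub>E i\<in>QV. carrier (space M i) \<rightarrow>\<^sub>E carrier (space N i))"
 using assms unfolding isometries_def linear_map_iff by blast+

lemma isoI:
 assumes "is_rep K Q M" "is_rep K Q N"
  "fi : (\<Pi>\<^sub>E i\<in>QV. carrier (space M i) \<rightarrow>\<^sub>E carrier (space N i))"
  "\<And>i. i : QV ==> lin (space M i) (carrier (space M i)) (space N i) (fi i)"
  "\<And>i. i : QV ==> bij_betw (fi i) (carrier (space M i)) (carrier (space N i))"
  "\<And>al x. al : QA ==> x : carrier (space M (src al)) ==> fi (tgt al) (arrow_map M al x) = arrow_map N al (fi (src al) x)"
  "\<And>x y. x : TS M ==> y : TS M ==> form N (\<lambda>i\<in>QV. fi i (x i)) (\<lambda>i\<in>QV. fi i (y i)) = form M x y"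
 shows "fi : Iso M N"
 using assms(3-) is_rep_D(1)[OF assms(1)] is_rep_D(1)[OF assms(2)] unfolding isometries_def linear_map_iff by blast

lemma PiE_PiE_ext:
 assumes "fi : (\<Pi>\<^sub>E i\<in>I. A i \<rightarrow>\<^sub>E B i)" "\<psi> : (\<Pi>\<^sub>E i\<in>I. A i \<rightarrow>\<^sub>E B i)"
  "\<And>i x. i : I ==> x : A i ==> fi i x = \<psi> i x"
 shows "fi = \<psi>"
proof (rule PiE_ext[OF assms(1,2)])
 fix i assume i: "i : I"
 show "fi i = \<psi> i"
  by (rule PiE_ext[OF PiE_mem[OF assms(1) i] PiE_mem[OF assms(2) i]]) (rule assms(3)[OF i])
qed

text \<open>Restricted to the carriers, because isometries are extensional by definition and
  composites have to be isometries again.\<close>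

definition icomp :: "('v, 'a, 'k, 'm) sd_rep => ('v => 'n => 'l) => ('v => 'm => 'n) => 'v => 'm => 'l" where
 "icomp M \<psi> fi = (\<lambda>i\<in>QV. \<lambda>x\<in>carrier (space M i). \<psi> i (fi i x))"

lemma icomp_apply: "i : QV ==> x : carrier (space M i) ==> icomp M \<psi> fi i x = \<psi> i (fi i x)"
 by (simp add: icomp_def)

lemma iso_comp:
 assumes M: "is_rep K Q M" and L: "is_rep K Q L" and fi: "fi : Iso M N" and \<psi>: "\<psi> : Iso N L"
 shows "icomp M \<psi> fi : Iso M L"
proof -
 have fic: "fi i x : carrier (space N i)" if "i : QV" "x : carrier (space M i)" for i x
  by (rule lin_D(1)[OF iso_D(1)[OF fi that(1)] that(2)])
 have \<psi>c: "\<psi> i x : carrier (space L i)" if "i : QV" "x : carrier (space N i)" for i x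
  by (rule lin_D(1)[OF iso_D(1)[OF \<psi> that(1)] that(2)])
 show ?thesis
 proof (rule isoI[OF M L])
  show "icomp M \<psi> fi : (\<Pi>\<^sub>E i\<in>QV. carrier (space M i) \<rightarrow>\<^sub>E carrier (space L i))"
   unfolding icomp_def using fic \<psi>c by simp
  fix i assume i: "i : QV"
  have ap: "\<psi> i (fi i x) = icomp M \<psi> fi i x" if "x : carrier (space M i)" for x using i that by (simp add: icomp_def)
  show "lin (space M i) (carrier (space M i)) (space L i) (icomp M \<psi> fi i)"
   by (rule lin_cong[OF lin_comp[OF iso_D(1)[OF fi i] iso_D(1)[OF \<psi> i] fic[OF i]] subspace_carrier[OF is_rep_D(1)[OF M i]]])
    (simp_all add: ap)
  have "bij_betw (\<psi> i \<circ> fi i) (carrier (space M i)) (carrier (space L i))"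
   by (rule bij_betw_trans[OF iso_D(2)[OF fi i] iso_D(2)[OF \<psi> i]])
  thus "bij_betw (icomp M \<psi> fi i) (carrier (space M i)) (carrier (space L i))"
   by (rule bij_betw_cong[THEN iffD1, rotated]) (simp add: ap)
 next
  fix al x assume al: "al : QA" and x: "x : carrier (space M (src al))"
  have ax: "arrow_map M al x : carrier (space M (tgt al))" by (rule lin_D(1)[OF is_rep_D(4)[OF M al] x])
  show "icomp M \<psi> fi (tgt al) (arrow_map M al x) = arrow_map L al (icomp M \<psi> fi (src al) x)"
   unfolding icomp_apply[OF tail_head_verts(2)[OF al] ax] icomp_apply[OF tail_head_verts(1)[OF al] x]
    iso_D(3)[OF fi al x] iso_D(3)[OF \<psi> al fic[OF tail_head_verts(1)[OF al] x]] ..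
 next
  fix x y assume xy: "x : TS M" "y : TS M"
  have 1: "(\<lambda>i\<in>QV. fi i (z i)) : TS N" and 2: "(\<lambda>i\<in>QV. icomp M \<psi> fi i (z i)) = (\<lambda>i\<in>QV. \<psi> i ((\<lambda>i\<in>QV. fi i (z i)) i))"
   if z: "z : TS M" for z
  proof -
   have zc: "z i : carrier (space M i)" if "i : QV" for i using z that by (auto simp: TS_def)
   show "(\<lambda>i\<in>QV. fi i (z i)) : TS N" unfolding TS_def using fic zc by simp
   show "(\<lambda>i\<in>QV. icomp M \<psi> fi i (z i)) = (\<lambda>i\<in>QV. \<psi> i ((\<lambda>i\<in>QV. fi i (z i)) i))"
    by (rule restrict_ext) (simp add: icomp_apply zc)
  qed
  show "form L (\<lambda>i\<in>QV. icomp M \<psi> fi i (x i)) (\<lambda>i\<in>QV. icomp M \<psi> fi i (y i)) = form M x y"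
   unfolding 2[OF xy(1)] 2[OF xy(2)] iso_D(4)[OF \<psi> 1[OF xy(1)] 1[OF xy(2)]] iso_D(4)[OF fi xy] ..
 qed
qed

definition iinv :: "('v, 'a, 'k, 'm) sd_rep => ('v, 'a, 'k, 'n) sd_rep => ('v => 'm => 'n) => 'v => 'n => 'm" where
 "iinv M N fi = (\<lambda>i\<in>QV. \<lambda>y\<in>carrier (space N i). inv_into (carrier (space M i)) (fi i) y)"

lemma iinv_apply:
 assumes fi: "fi : Iso M N" and i: "i : QV"
 shows "y : carrier (space N i) ==> iinv M N fi i y : carrier (space M i)"
  "y : carrier (space N i) ==> fi i (iinv M N fi i y) = y"
  "x : carrier (space M i) ==> iinv M N fi i (fi i x) = x"
 using iso_D(2)[OF fi i] lin_D(1)[OF iso_D(1)[OF fi i]] i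
 by (simp_all add: iinv_def bij_betw_def inv_into_into f_inv_into_f)

lemma iso_inv:
 assumes M: "is_rep K Q M" and N: "is_rep K Q N" and fi: "fi : Iso M N"
 shows "iinv M N fi : Iso N M"
proof (rule isoI[OF N M])
 note inv = iinv_apply[OF fi]
 show "iinv M N fi : (\<Pi>\<^sub>E i\<in>QV. carrier (space N i) \<rightarrow>\<^sub>E carrier (space M i))"
  unfolding PiE_iff
 proof (intro conjI ballI)
  fix i x assume i: "i : QV" 
  show "x : carrier (space N i) ==> iinv M N fi i x : carrier (space M i)" by (rule inv(1)[OF i])
  show "iinv M N fi i : extensional (carrier (space N i))" using i by (simp add: iinv_def)
 qed (simp add: iinv_def)
 fix i assume i: "i : QV"
 show "lin (space N i) (carrier (space N i)) (space M i) (iinv M N fi i)"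
  by (rule lin_cong[OF lin_inv_into[OF iso_D(1)[OF fi i] is_rep_D(1)[OF M i] iso_D(2)[OF fi i]] subspace_carrier[OF is_rep_D(1)[OF N i]]])
   (simp add: iinv_def i)
 show "bij_betw (iinv M N fi i) (carrier (space N i)) (carrier (space M i))"
  by (rule bij_betw_cong[THEN iffD1, OF _ bij_betw_inv_into[OF iso_D(2)[OF fi i]]]) (simp add: iinv_def i)
next
 note inv = iinv_apply[OF fi]
 fix al y assume al: "al : QA" and y: "y : carrier (space N (src al))"
 note t = tail_head_verts(1)[OF al] and h = tail_head_verts(2)[OF al]
 define x where "x = iinv M N fi (src al) y"
 have x: "x : carrier (space M (src al))" unfolding x_def by (rule inv(1)[OF t y])
 have yx: "y = fi (src al) x" unfolding x_def by (rule inv(2)[OF t y, symmetric])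
 have "iinv M N fi (tgt al) (arrow_map N al y) = iinv M N fi (tgt al) (fi (tgt al) (arrow_map M al x))"
  unfolding yx iso_D(3)[OF fi al x] ..
 also have "\<dots> = arrow_map M al x" by (rule inv(3)[OF h lin_D(1)[OF is_rep_D(4)[OF M al] x]])
 finally show "iinv M N fi (tgt al) (arrow_map N al y) = arrow_map M al (iinv M N fi (src al) y)" unfolding x_def .
next
 note inv = iinv_apply[OF fi]
 fix x y assume xy: "x : TS N" "y : TS N"
 have 1: "(\<lambda>i\<in>QV. iinv M N fi i (z i)) : TS M" and 2: "(\<lambda>i\<in>QV. fi i ((\<lambda>i\<in>QV. iinv M N fi i (z i)) i)) = z"
  if z: "z : TS N" for z
 proof -
  have zc: "z i : carrier (space N i)" if "i : QV" for i using z that by (auto simp: TS_def)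
  show "(\<lambda>i\<in>QV. iinv M N fi i (z i)) : TS M" unfolding TS_def using inv(1) zc by simp
  show "(\<lambda>i\<in>QV. fi i ((\<lambda>i\<in>QV. iinv M N fi i (z i)) i)) = z"
  proof
   fix i show "(\<lambda>i\<in>QV. fi i ((\<lambda>i\<in>QV. iinv M N fi i (z i)) i)) i = z i"
    using inv(2)[of i "z i"] zc[of i] PiE_arb[OF z[unfolded TS_def], of i] by (cases "i : QV") simp_all
  qed
 qed
 show "form M (\<lambda>i\<in>QV. iinv M N fi i (x i)) (\<lambda>i\<in>QV. iinv M N fi i (y i)) = form N x y"
  using iso_D(4)[OF fi 1[OF xy(1)] 1[OF xy(2)]] unfolding 2[OF xy(1)] 2[OF xy(2)] by simp
qed

lemma iso_id:
 assumes M: "is_rep K Q M"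
 shows "(\<lambda>i\<in>QV. \<lambda>x\<in>carrier (space M i). x) : Iso M M"
proof (rule isoI[OF M M])
 let ?id = "\<lambda>i\<in>QV. \<lambda>x\<in>carrier (space M i). x"
 fix i assume i: "i : QV"
 have "lin (space M i) (carrier (space M i)) (space M i) (%x. x)" by (rule linI) simp_all
 thus "lin (space M i) (carrier (space M i)) (space M i) (?id i)"
  by (rule lin_cong[OF _ subspace_carrier[OF is_rep_D(1)[OF M i]]]) (simp add: i)
 show "bij_betw (?id i) (carrier (space M i)) (carrier (space M i))"
  using i by (simp add: bij_betw_def inj_on_def)
next
 fix al x assume al: "al : QA" and x: "x : carrier (space M (src al))"
 show "(\<lambda>i\<in>QV. \<lambda>x\<in>carrier (space M i). x) (tgt al) (arrow_map M al x) =
   arrow_map M al ((\<lambda>i\<in>QV. \<lambda>x\<in>carrier (space M i). x) (src al) x)"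
  using tail_head_verts[OF al] x lin_D(1)[OF is_rep_D(4)[OF M al] x] by simp
next
 fix x y assume xy: "x : TS M" "y : TS M"
 have "(\<lambda>i\<in>QV. (\<lambda>i\<in>QV. \<lambda>x\<in>carrier (space M i). x) i (z i)) = z" if z: "z : TS M" for z
 proof
  fix i show "(\<lambda>i\<in>QV. (\<lambda>i\<in>QV. \<lambda>x\<in>carrier (space M i). x) i (z i)) i = z i"
   using PiE_mem[OF z[unfolded TS_def], of i] PiE_arb[OF z[unfolded TS_def], of i] by (cases "i : QV") simp_all
 qed
 thus "form M (\<lambda>i\<in>QV. (\<lambda>i\<in>QV. \<lambda>x\<in>carrier (space M i). x) i (x i))
  (\<lambda>i\<in>QV. (\<lambda>i\<in>QV. \<lambda>x\<in>carrier (space M i). x) i (y i)) = form M x y" using xy by simp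
qed simp

text \<open>Composition with one isometry is a bijection: the isometries between isometric objects
  form a torsor under the automorphism group.\<close>

lemma card_iso:
 assumes M: "is_rep K Q M" and N: "is_rep K Q N" and ne: "Iso N M \<noteq> {}"
 shows "card (Iso N M) = card (Aut_S K Q M)"
proof -
 obtain \<psi> where \<psi>: "\<psi> : Iso N M" using ne by blast
 have "bij_betw (%fi. icomp N fi \<psi>) (Iso M M) (Iso N M)"
 proof (rule bij_betw_imageI)
  show "inj_on (%fi. icomp N fi \<psi>) (Iso M M)"
  proof (rule inj_onI)
   fix fi fi' assume fi: "fi : Iso M M" "fi' : Iso M M" and eq: "icomp N fi \<psi> = icomp N fi' \<psi>"
   show "fi = fi'"
   proof (rule PiE_PiE_ext[OF iso_D(5)[OF fi(1)] iso_D(5)[OF fi(2)]])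
    fix i x assume i: "i : QV" and x: "x : carrier (space M i)"
    define y where "y = iinv N M \<psi> i x"
    have y: "y : carrier (space N i)" "\<psi> i y = x" unfolding y_def using iinv_apply[OF \<psi> i] x by blast+
    have "icomp N fi \<psi> i y = icomp N fi' \<psi> i y" using eq by simp
    thus "fi i x = fi' i x" unfolding icomp_apply[OF i y(1)] y(2) .
   qed
  qed
  show "(%fi. icomp N fi \<psi>) ` Iso M M = Iso N M"
  proof (intro equalityI subsetI)
   fix \<chi> assume "\<chi> : (%fi. icomp N fi \<psi>) ` Iso M M"
   thus "\<chi> : Iso N M" using iso_comp[OF N M \<psi>] by blast
  next
   fix \<chi> assume \<chi>: "\<chi> : Iso N M"
   define fi where "fi = icomp M \<chi> (iinv N M \<psi>)"
   have fi: "fi : Iso M M" unfolding fi_def by (rule iso_comp[OF M M iso_inv[OF N M \<psi>] \<chi>])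
   have "\<chi> = icomp N fi \<psi>"
   proof (rule PiE_PiE_ext[OF iso_D(5)[OF \<chi>] iso_D(5)[OF iso_comp[OF N M \<psi> fi]]])
    fix i x assume i: "i : QV" and x: "x : carrier (space N i)"
    have "\<psi> i x : carrier (space M i)" by (rule lin_D(1)[OF iso_D(1)[OF \<psi> i] x])
    thus "\<chi> i x = icomp N fi \<psi> i x" unfolding icomp_apply[OF i x] fi_def
     using iinv_apply(3)[OF \<psi> i x] by (simp add: icomp_apply[OF i])
   qed
   thus "\<chi> : (%fi. icomp N fi \<psi>) ` Iso M M" using fi by blast
  qed
 qed
 thus ?thesis unfolding Aut_S_def by (metis bij_betw_same_card)
qed

lemma finite_Iso:
 assumes M: "is_rep K Q M" and N: "is_rep K Q N"
 shows "finite (Iso M N)"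
proof (rule finite_subset)
 show "Iso M N \<subseteq> (\<Pi>\<^sub>E i\<in>QV. carrier (space M i) \<rightarrow>\<^sub>E carrier (space N i))" using iso_D(5) by blast
 show "finite (\<Pi>\<^sub>E i\<in>QV. carrier (space M i) \<rightarrow>\<^sub>E carrier (space N i))"
  using finite_verts is_rep_D(2)[OF M] is_rep_D(2)[OF N] by (intro finite_PiE) auto
qed

lemma iso_dim_vec:
 assumes M: "is_rep K Q M" and N: "is_rep K Q N" and fi: "fi : Iso M N"
 shows "dim_vec K Q M = dim_vec K Q N"
proof
 fix i show "dim_vec K Q M i = dim_vec K Q N i"
 proof (cases "i : QV")
  case True
  have "card (carrier (space M i)) = card (carrier (space N i))" by (rule bij_betw_same_card[OF iso_D(2)[OF fi True]])
  thus ?thesis using True is_rep_D(3)[OF M True] is_rep_D(3)[OF N True] by (simp add: dim_vec_def sdim_def)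
 qed (simp add: dim_vec_def)
qed

lemma dim_vec_sub_rep:
 assumes M: "is_rep K Q M" and U: "is_subrep K Q M U"
 shows "dim_vec K Q (sub_rep M U) = (%i. if i : QV then int (sdim (U i)) else 0)"
proof
 fix i show "dim_vec K Q (sub_rep M U) i = (if i : QV then int (sdim (U i)) else 0)"
 proof (cases "i : QV")
  case True
  have sU: "subspace K (U i) (space M i)" using U True by (simp add: is_subrep_def)
  have "finite (U i)" using subspace_D(2)[OF sU] is_rep_D(2)[OF M True] finite_subset by blast
  thus ?thesis using dim_eq_sdim[OF subspace_restrict_vs[OF sU]] True by (simp add: dim_vec_def sub_rep_def)
 qed (simp add: dim_vec_def)
qed

text \<open>Subrepresentations are carried to their images, with isotropy and dimension vector
  preserved.\<close>

lemma sd_semistable_iso: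
 assumes M: "is_rep K Q M" and N: "is_rep K Q N" and fi: "fi : Iso M N" and st: "sd_semistable K Q \<theta> N"
 shows "sd_semistable K Q \<theta> M"
 unfolding sd_semistable_def
proof (intro allI impI, elim conjE)
 fix U assume U: "is_subrep K Q M U" "nonzero_subrep Q M U" "isotropic K Q M U"
 define W where "W = (%i. fi i ` U i)"
 have sU: "subspace K (U i) (space M i)" if "i : QV" for i using U(1) that by (simp add: is_subrep_def)
 have inj: "inj_on (fi i) (carrier (space M i))" if "i : QV" for i by (rule bij_betw_imp_inj_on[OF iso_D(2)[OF fi that]])
 have W: "is_subrep K Q N W" unfolding is_subrep_def
 proof (intro conjI ballI)
  fix i assume i: "i : QV"
  note l = iso_D(1)[OF fi i] and u = subspace_D[OF sU[OF i]]
  show "subspace K (W i) (space N i)"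
  proof (rule subspaceI[OF is_rep_D(1)[OF N i]])
   show "W i \<subseteq> carrier (space N i)" unfolding W_def using lin_D(1)[OF l] u(2) by blast
   have "fi i \<zero>\<^bsub>space M i\<^esub> = \<zero>\<^bsub>space N i\<^esub>"
    by (rule lin_zero[OF l subspace_carrier[OF is_rep_D(1)[OF M i]] is_rep_D(1)[OF N i]])
   thus "\<zero>\<^bsub>space N i\<^esub> : W i" unfolding W_def using u(3) by (metis imageI)
   fix x y assume "x : W i" "y : W i"
   then obtain a b where ab: "a : U i" "b : U i" "x = fi i a" "y = fi i b" unfolding W_def by blast
   have "x \<oplus>\<^bsub>space N i\<^esub> y = fi i (a \<oplus>\<^bsub>space M i\<^esub> b)"
    unfolding ab(3,4) by (rule lin_D(2)[OF l u(4)[OF ab(1)] u(4)[OF ab(2)], symmetric])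
   thus "x \<oplus>\<^bsub>space N i\<^esub> y : W i" unfolding W_def using u(5)[OF ab(1,2)] by simp
  next
   fix c x assume c: "c : carrier K" and "x : W i"
   then obtain a where a: "a : U i" "x = fi i a" unfolding W_def by blast
   have "c \<odot>\<^bsub>space N i\<^esub> x = fi i (c \<odot>\<^bsub>space M i\<^esub> a)"
    unfolding a(2) by (rule lin_D(3)[OF l c u(4)[OF a(1)], symmetric])
   thus "c \<odot>\<^bsub>space N i\<^esub> x : W i" unfolding W_def using u(6)[OF c a(1)] by simp
  qed
 next
  fix al assume al: "al : QA"
  show "arrow_map N al ` W (src al) \<subseteq> W (tgt al)"
  proof
   fix y assume "y : arrow_map N al ` W (src al)"
   then obtain a where a: "a : U (src al)" "y = arrow_map N al (fi (src al) a)" unfolding W_def by blast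
   have "a : carrier (space M (src al))" by (rule subspace_D(4)[OF sU[OF tail_head_verts(1)[OF al]] a(1)])
   from iso_D(3)[OF fi al this] have "y = fi (tgt al) (arrow_map M al a)" unfolding a(2) by simp
   moreover have "arrow_map M al a : U (tgt al)" using U(1) al a(1) unfolding is_subrep_def by blast
   ultimately show "y : W (tgt al)" unfolding W_def by blast
  qed
 qed
 have "nonzero_subrep Q N W"
 proof -
  obtain i where i: "i : QV" "U i \<noteq> {\<zero>\<^bsub>space M i\<^esub>}" using U(2) unfolding nonzero_subrep_def by blast
  then obtain x where x: "x : U i" "x \<noteq> \<zero>\<^bsub>space M i\<^esub>" using subspace_D(3)[OF sU[OF i(1)]] by blast
  have xc: "x : carrier (space M i)" by (rule subspace_D(4)[OF sU[OF i(1)] x(1)])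
  have zc: "\<zero>\<^bsub>space M i\<^esub> : carrier (space M i)" using is_rep_D(1)[OF M i(1)] by simp
  have "fi i \<zero>\<^bsub>space M i\<^esub> = \<zero>\<^bsub>space N i\<^esub>"
   by (rule lin_zero[OF iso_D(1)[OF fi i(1)] subspace_carrier[OF is_rep_D(1)[OF M i(1)]] is_rep_D(1)[OF N i(1)]])
  hence "fi i x \<noteq> \<zero>\<^bsub>space N i\<^esub>" using inj_onD[OF inj[OF i(1)] _ xc zc] x(2) by metis
  moreover have "fi i x : W i" unfolding W_def using x(1) by blast
  ultimately have "W i \<noteq> {\<zero>\<^bsub>space N i\<^esub>}" by blast
  thus ?thesis unfolding nonzero_subrep_def using i(1) by blast
 qed
 moreover have "isotropic K Q N W" unfolding isotropic_def
 proof (intro ballI)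
  fix x y assume xy: "x : (\<Pi>\<^sub>E i\<in>QV. W i)" "y : (\<Pi>\<^sub>E i\<in>QV. W i)"
  have ex: "\<exists>a\<in>(\<Pi>\<^sub>E i\<in>QV. U i). z = (\<lambda>i\<in>QV. fi i (a i))" if z: "z : (\<Pi>\<^sub>E i\<in>QV. W i)" for z
  proof -
   have "\<forall>i\<in>QV. \<exists>a. a : U i \<and> z i = fi i a"
    using PiE_mem[OF z] unfolding W_def by blast
   then obtain a where a: "\<forall>i\<in>QV. a i : U i \<and> z i = fi i (a i)" using bchoice[of "QV" "%i a. a : U i \<and> z i = fi i a"] by blast
   have "z = (\<lambda>i\<in>QV. fi i (restrict a (QV) i))"
   proof
    fix i show "z i = (\<lambda>i\<in>QV. fi i (restrict a (QV) i)) i"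
     using a PiE_arb[OF z, of i] by (cases "i : QV") simp_all
   qed
   moreover have "restrict a (QV) : (\<Pi>\<^sub>E i\<in>QV. U i)" using a by simp
   ultimately show ?thesis by blast
  qed
  obtain a b where ab: "a : (\<Pi>\<^sub>E i\<in>QV. U i)" "b : (\<Pi>\<^sub>E i\<in>QV. U i)"
   "x = (\<lambda>i\<in>QV. fi i (a i))" "y = (\<lambda>i\<in>QV. fi i (b i))" using ex[OF xy(1)] ex[OF xy(2)] by blast
  have "z : TS M" if "z : (\<Pi>\<^sub>E i\<in>QV. U i)" for z
   using that subspace_D(4)[OF sU] unfolding TS_def by (auto simp: PiE_iff)
  hence "a : TS M" "b : TS M" using ab by blast+
  from iso_D(4)[OF fi this] have "form N x y = form M a b" unfolding ab(3,4) .
  also have "\<dots> = \<zero>" using U(3) ab(1,2) unfolding isotropic_def by blast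
  finally show "form N x y = \<zero>" .
 qed
 ultimately have "slope Q \<theta> (dim_vec K Q (sub_rep N W)) \<le> 0" using st W unfolding sd_semistable_def by blast
 moreover have "dim_vec K Q (sub_rep N W) = dim_vec K Q (sub_rep M U)"
 proof -
  have "sdim (W i) = sdim (U i)" if "i : QV" for i
  proof -
   have "card (W i) = card (U i)" unfolding W_def
    by (rule card_image[OF inj_on_subset[OF inj[OF that] subspace_D(2)[OF sU[OF that]]]])
   thus ?thesis by (simp add: sdim_def)
  qed
  thus ?thesis unfolding dim_vec_sub_rep[OF M U(1)] dim_vec_sub_rep[OF N W] by auto
 qed
 ultimately show "slope Q \<theta> (dim_vec K Q (sub_rep M U)) \<le> 0" by simp
qed

end

context quiver_field
begin

lemma add_pow_sg:
 assumes "ep : {1, -1 :: int}" "x : carrier K"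
 shows "[ep] \<cdot>\<^bsub>K\<^esub> x = sg ep x"
proof (cases "ep = 1")
 case True
 thus ?thesis using assms(2) by (simp add: sg_def add_pow_def int_pow_def nat_pow_def)
next
 case False
 hence "ep = -1" using assms(1) by simp
 thus ?thesis using assms(2) by (simp add: sg_def add_pow_def int_pow_def nat_pow_def a_inv_def)
qed

lemma sg_sg_mult: "a : {1, -1} ==> b : {1, -1} ==> x : carrier K ==> sg a (sg b x) = sg (a * b) x"
 by (auto simp: sg_def)

lemma total_space_simps [simp]:
 "zero (total_space Q M) = (\<lambda>i\<in>QV. \<zero>\<^bsub>space M i\<^esub>)"
 "add (total_space Q M) = (%x y. \<lambda>i\<in>QV. x i \<oplus>\<^bsub>space M i\<^esub> y i)"
 "smult (total_space Q M) = (%c x. \<lambda>i\<in>QV. c \<odot>\<^bsub>space M i\<^esub> x i)"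
 by (simp_all add: total_space_def)

subsection \<open>The components of a form\<close>

text \<open>The block that pairs the spaces at \<open>i\<close> and \<open>s0 i\<close>; by the
  orthogonality condition all other blocks of the form vanish.\<close>

definition bf :: "('v, 'a, 'k, 'm) sd_rep => 'v => 'm => 'm => 'k" where
 "bf M i x y = form M (embed Q M i x) (embed Q M (s0 i) y)"

lemma embed_apply: "i : QV ==> embed Q M i x i = x"
 "j : QV ==> j \<noteq> i ==> embed Q M i x j = \<zero>\<^bsub>space M j\<^esub>"
 by (simp_all add: embed_def)

lemma embed_TS: "is_rep K Q M ==> x : carrier (space M i) ==> embed Q M i x : TS M"
 by (auto simp: TS_def embed_def is_rep_D)

lemma embed_add:
 assumes "is_rep K Q M"
 shows "embed Q M i (x \<oplus>\<^bsub>space M i\<^esub> y) = embed Q M i x \<oplus>\<^bsub>total_space Q M\<^esub> embed Q M i y"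
 unfolding embed_def total_space_simps by (rule restrict_ext) (simp add: vs_simps is_rep_D(1)[OF assms])

lemma embed_smult:
 assumes "is_rep K Q M" "c : carrier K"
 shows "embed Q M i (c \<odot>\<^bsub>space M i\<^esub> x) = c \<odot>\<^bsub>total_space Q M\<^esub> embed Q M i x"
 unfolding embed_def total_space_simps by (rule restrict_ext) (simp add: vs_simps is_rep_D(1)[OF assms(1)] assms(2))

lemma sd_rep_D:
 assumes "is_sd_rep K Q s0 s1 s \<tau> M"
 shows "is_rep K Q M" "bilinear_form K (total_space Q M) (form M)"
  "nondegenerate_form K (total_space Q M) (form M)"
  "i : QV ==> j : QV ==> i \<noteq> s0 j ==> x : carrier (space M i) ==> y : carrier (space M j) ==>
   form M (embed Q M i x) (embed Q M j y) = \<zero>"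
  "i : QV ==> u : partial_sum Q M {i, s0 i} ==> w : partial_sum Q M {i, s0 i} ==>
   form M u w = [s i] \<cdot>\<^bsub>K\<^esub> form M w u"
  "al : QA ==> x : carrier (space M (src al)) ==> y : carrier (space M (s0 (tgt al))) ==>
    form M (embed Q M (tgt al) (arrow_map M al x)) (embed Q M (s0 (tgt al)) y) =
    [\<tau> al] \<cdot>\<^bsub>K\<^esub> form M (embed Q M (src al) x) (embed Q M (s0 (src al)) (arrow_map M (s1 al) y))"
 using assms unfolding is_sd_rep_def by blast+

lemma bilinear_D:
 assumes "bilinear_form K W \<beta>"
 shows "x : carrier W ==> y : carrier W ==> \<beta> x y : carrier K"
  "x : carrier W ==> y : carrier W ==> z : carrier W ==> \<beta> (x \<oplus>\<^bsub>W\<^esub> y) z = \<beta> x z \<oplus> \<beta> y z"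
  "x : carrier W ==> y : carrier W ==> z : carrier W ==> \<beta> x (y \<oplus>\<^bsub>W\<^esub> z) = \<beta> x y \<oplus> \<beta> x z"
  "c : carrier K ==> x : carrier W ==> y : carrier W ==> \<beta> (c \<odot>\<^bsub>W\<^esub> x) y = c \<otimes> \<beta> x y"
  "c : carrier K ==> x : carrier W ==> y : carrier W ==> \<beta> x (c \<odot>\<^bsub>W\<^esub> y) = c \<otimes> \<beta> x y"
 using assms unfolding bilinear_form_def by blast+

lemma form_lin:
 assumes "bilinear_form K (total_space Q M) (form M)" "is_rep K Q M" and y: "y : TS M"
 shows "lin (space M i) (carrier (space M i)) KV (%x. form M (embed Q M i x) y)"
  "lin (space M i) (carrier (space M i)) KV (%x. form M y (embed Q M i x))"
proof -
 note b = bilinear_D[OF assms(1)] and e = embed_TS[OF assms(2)]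
 show "lin (space M i) (carrier (space M i)) KV (%x. form M (embed Q M i x) y)"
  by (rule linI) (simp_all add: b(1)[OF e y] b(2)[OF e e y] embed_add[OF assms(2)] embed_smult[OF assms(2)] b(4)[OF _ e y]
    del: total_space_simps)
 show "lin (space M i) (carrier (space M i)) KV (%x. form M y (embed Q M i x))"
  by (rule linI) (simp_all add: b(1)[OF y e] b(3)[OF y e e] embed_add[OF assms(2)] embed_smult[OF assms(2)] b(5)[OF _ y e]
    del: total_space_simps)
qed

lemma form_additive:
 assumes M: "is_rep K Q M" and f: "\<And>u w. u : TS M ==> w : TS M ==> f (u \<oplus>\<^bsub>total_space Q M\<^esub> w) = f u \<oplus> f w"
  and fc: "\<And>u. u : TS M ==> f u : carrier K" and x: "x : TS M"
 shows "f x = (\<Oplus>i\<in>QV. f (embed Q M i (x i)))"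
proof -
 have xc: "x i : carrier (space M i)" if "i : QV" for i using x that by (auto simp: TS_def)
 \<comment> \<open>The truncation of \<open>x\<close> to the nodes in \<open>J\<close>, built up one
   node at a time.\<close>
 define r where "r = (%J. \<lambda>i\<in>QV. if i : J then x i else \<zero>\<^bsub>space M i\<^esub>)"
 have rT: "r J : TS M" for J unfolding r_def TS_def using xc is_rep_D(1)[OF M] by simp
 have e: "embed Q M i (x i) : TS M" if "i : QV" for i by (rule embed_TS[OF M xc[OF that]])
 have "f (r J) = (\<Oplus>i\<in>J. f (embed Q M i (x i)))" if "finite J" "J \<subseteq> QV" for J
  using that
 proof (induction J rule: finite_induct)
  case empty
  have "r {} \<oplus>\<^bsub>total_space Q M\<^esub> r {} = r {}" unfolding total_space_simps r_def
   by (rule restrict_ext) (simp add: vs_simps is_rep_D(1)[OF M])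
  hence "f (r {}) = f (r {}) \<oplus> f (r {})" using f[OF rT rT, of "{}" "{}"] by simp
  hence "f (r {}) = \<zero>" using fc[OF rT, of "{}"] by (metis add.r_cancel_one')
  thus ?case by simp
 next
  case (insert j J)
  have j: "j : QV" using insert by simp
  have "r (insert j J) = embed Q M j (x j) \<oplus>\<^bsub>total_space Q M\<^esub> r J" unfolding total_space_simps r_def embed_def
   by (rule restrict_ext) (use insert.hyps(2) xc in \<open>auto simp: vs_simps is_rep_D(1)[OF M]\<close>)
  hence "f (r (insert j J)) = f (embed Q M j (x j)) \<oplus> f (r J)" using f[OF e[OF j] rT] by simp
  also have "f (r J) = (\<Oplus>i\<in>J. f (embed Q M i (x i)))" using insert by simp
  also have "f (embed Q M j (x j)) \<oplus> \<dots> = (\<Oplus>i\<in>insert j J. f (embed Q M i (x i)))"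
   using insert.hyps insert.prems fc e by (subst finsum_insert) auto
  finally show ?case .
 qed
 from this[OF finite_verts subset_refl] have "f (r (QV)) = (\<Oplus>i\<in>QV. f (embed Q M i (x i)))" .
 moreover have "r (QV) = x"
 proof
  fix i show "r (QV) i = x i"
   using PiE_arb[OF x[unfolded TS_def], of i] by (cases "i : QV") (simp_all add: r_def)
 qed
 ultimately show ?thesis by simp
qed

lemma finsum_single:
 assumes "i : QV" "f i : carrier K" "\<And>j. j : QV ==> j \<noteq> i ==> f j = \<zero>"
 shows "(\<Oplus>j\<in>QV. f j) = f i"
proof -
 have "(\<Oplus>j\<in>QV. f j) = (\<Oplus>j\<in>QV. if i = j then f j else \<zero>)"
  by (rule finsum_cong') (use assms in auto)
 also have "\<dots> = (\<Oplus>j\<in>QV. if i = j then (%_. f i) j else \<zero>)"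
  by (rule finsum_cong') (use assms in auto)
 also have "\<dots> = f i" by (rule finsum_singleton[OF assms(1) finite_verts]) (use assms in auto)
 finally show ?thesis .
qed

lemma form_left_embed:
 assumes M: "is_sd_rep K Q s0 s1 s \<tau> M" and i: "i : QV" and x: "x : carrier (space M i)" and y: "y : TS M"
 shows "form M (embed Q M i x) y = bf M i x (y (s0 i))"
proof -
 note R = sd_rep_D(1)[OF M] and b = bilinear_D[OF sd_rep_D(2)[OF M]]
 note e = embed_TS[OF R x]
 have yc: "y j : carrier (space M j)" if "j : QV" for j using y that by (auto simp: TS_def)
 have ye: "embed Q M j (y j) : TS M" if "j : QV" for j by (rule embed_TS[OF R yc[OF that]])
 have "form M (embed Q M i x) y = (\<Oplus>j\<in>QV. form M (embed Q M i x) (embed Q M j (y j)))"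
  by (rule form_additive[where f = "form M (embed Q M i x)", OF R b(3)[OF e] b(1)[OF e] y])
 also have "\<dots> = form M (embed Q M i x) (embed Q M (s0 i) (y (s0 i)))"
 proof (rule finsum_single[OF node_closed[OF i]])
  show "form M (embed Q M i x) (embed Q M (s0 i) (y (s0 i))) : carrier K"
   by (rule b(1)[OF e ye[OF node_closed[OF i]]])
  fix j assume j: "j : QV" "j \<noteq> s0 i"
  hence "i \<noteq> s0 j" using node_invol by auto
  thus "form M (embed Q M i x) (embed Q M j (y j)) = \<zero>" by (rule sd_rep_D(4)[OF M i j(1) _ x yc[OF j(1)]])
 qed
 finally show ?thesis by (simp add: bf_def)
qed

lemma form_eq_bf:
 assumes M: "is_sd_rep K Q s0 s1 s \<tau> M" and x: "x : TS M" and y: "y : TS M"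
 shows "form M x y = (\<Oplus>i\<in>QV. bf M i (x i) (y (s0 i)))"
proof -
 note R = sd_rep_D(1)[OF M] and b = bilinear_D[OF sd_rep_D(2)[OF M]]
 have xc: "x j : carrier (space M j)" if "j : QV" for j using x that by (auto simp: TS_def)
 have "form M x y = (\<Oplus>i\<in>QV. form M (embed Q M i (x i)) y)"
  by (rule form_additive[where f = "%u. form M u y", OF R b(2)[OF _ _ y] b(1)[OF _ y] x])
 also have "\<dots> = (\<Oplus>i\<in>QV. bf M i (x i) (y (s0 i)))"
  by (rule finsum_cong'[OF refl])
   (use form_left_embed[OF M _ xc y] b(1)[OF embed_TS[OF R xc] y] in auto)
 finally show ?thesis .
qed

lemma bf_sym:
 assumes M: "is_sd_rep K Q s0 s1 s \<tau> M" and i: "i : QV"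
  and x: "x : carrier (space M i)" and y: "y : carrier (space M (s0 i))"
 shows "bf M (s0 i) y x = sg (s i) (bf M i x y)"
proof -
 note R = sd_rep_D(1)[OF M]
 have "embed Q M i x : partial_sum Q M {i, s0 i}" "embed Q M (s0 i) y : partial_sum Q M {i, s0 i}"
  unfolding partial_sum_def using embed_TS[OF R x] embed_TS[OF R y] by (auto simp: embed_def)
 from sd_rep_D(5)[OF M i this(2,1)] have "form M (embed Q M (s0 i) y) (embed Q M i x) = [s i] \<cdot>\<^bsub>K\<^esub> bf M i x y"
  by (simp add: bf_def)
 also have "\<dots> = sg (s i) (bf M i x y)"
  unfolding bf_def by (rule add_pow_sg[OF s_sign[OF i] bilinear_D(1)[OF sd_rep_D(2)[OF M] embed_TS[OF R x] embed_TS[OF R y]]])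
 finally show ?thesis by (simp add: bf_def node_invol[OF i])
qed

lemma bf_Bil:
 assumes M: "is_sd_rep K Q s0 s1 s \<tau> M" 
 shows "y : carrier (space M (s0 i)) ==> lin (space M i) (carrier (space M i)) KV (%x. bf M i x y)"
  "x : carrier (space M i) ==> lin (space M (s0 i)) (carrier (space M (s0 i))) KV (bf M i x)"
 unfolding bf_def
 using form_lin[OF sd_rep_D(2,1)[OF M] embed_TS[OF sd_rep_D(1)[OF M]]] by blast+

lemma bf_nondeg:
 assumes M: "is_sd_rep K Q s0 s1 s \<tau> M" and i: "i : QV" and x: "x : carrier (space M i)"
  and z: "\<And>y. y : carrier (space M (s0 i)) ==> bf M i x y = \<zero>"
 shows "x = \<zero>\<^bsub>space M i\<^esub>"
proof -
 have "form M (embed Q M i x) y = \<zero>" if "y : TS M" for y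
  using form_left_embed[OF M i x that] z that node_closed[OF i] by (auto simp: TS_def)
 hence "embed Q M i x = \<zero>\<^bsub>total_space Q M\<^esub>"
  using sd_rep_D(3)[OF M] embed_TS[OF sd_rep_D(1)[OF M] x] unfolding nondegenerate_form_def by blast
 hence "embed Q M i x i = \<zero>\<^bsub>total_space Q M\<^esub> i" by simp
 thus ?thesis using i by (simp add: embed_apply)
qed

end

section \<open>Coordinates\<close>

locale quiver_data = quiver_field K Q s0 s1 s \<tau>
 for K :: "'k ring" (structure) and Q :: "('v, 'a) pre_digraph"
  and s0 :: "'v => 'v" and s1 :: "'a => 'a" and s :: "'v => int" and \<tau> :: "'a => int" +
 fixes d :: "'v => int"
 assumes d_inv: "d : Lam_inv_pos Q s0"
begin

lemma d_D: "i \<notin> QV ==> d i = 0" "0 \<le> d i" "i : QV ==> d (s0 i) = d i"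
proof -
 have *: "d : Lam_pos Q" "inv_act Q s0 d = d" using d_inv by (auto simp: Lam_inv_pos_def)
 show "i \<notin> QV ==> d i = 0" "0 \<le> d i" using *(1) by (auto simp: Lam_pos_def Lam_def)
 show "d (s0 i) = d i" if "i : QV" using fun_cong[OF *(2), of i] that by (simp add: inv_act_def)
qed

definition n :: "'v => nat" where "n i = nat (d i)"

definition V :: "'v => ('k, nat => 'k) module" where "V i = Vs (n i)"

abbreviation "VC i \<equiv> carrier (V i)"
abbreviation "BV i j \<equiv> Bil (V i) (VC i) (V j) (VC j)"
abbreviation "LV i j \<equiv> Lin (V i) (VC i) (V j)"
abbreviation "ndV i j \<equiv> left_nondeg (V i) (VC i) (VC j)"

lemma vs_V [simp]: "vectorspace K (V i)" and finite_V: "finite (VC i)" and sdim_V: "sdim (VC i) = n i"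
 and card_V: "card (VC i) = q ^ n i" and V_subspace: "subspace K (VC i) (V i)"
 using sdim_eqI[of "VC i" "n i"] card_cf[of "n i"] finite_cf[of "n i"] subspace_carrier[of "V i"] by (simp_all add: V_def)

lemma n_sigma: "i : QV ==> n (s0 i) = n i"
 by (simp add: n_def d_D)

text \<open>Self-dual structures on the standard spaces. Left nondegeneracy at all nodes is enough,
  because the symmetry condition turns right nondegeneracy at \<open>i\<close> into left
  nondegeneracy at \<open>s0 i\<close>. All components are extensional, so that each structure is
  counted once.\<close>

definition Dat :: "(('a => (nat => 'k) => (nat => 'k)) \<times> ('v => (nat => 'k) => (nat => 'k) => 'k)) set" where
 "Dat = {(m, b). m : (\<Pi>\<^sub>E al\<in>QA. LV (src al) (tgt al)) \<and>
  b : (\<Pi>\<^sub>E i\<in>QV. BV i (s0 i)) \<and>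
  (\<forall>i\<in>QV. \<forall>x\<in>VC i. \<forall>y\<in>VC (s0 i). b (s0 i) y x = sg (s i) (b i x y)) \<and>
  (\<forall>i\<in>QV. ndV i (s0 i) (b i)) \<and>
  (\<forall>al\<in>QA. \<forall>x\<in>VC (src al). \<forall>y\<in>VC (s0 (tgt al)).
    b (tgt al) (m al x) y = sg (\<tau> al) (b (src al) x (m (s1 al) y)))}"

definition mk :: "('a => (nat => 'k) => (nat => 'k)) \<times> ('v => (nat => 'k) => (nat => 'k) => 'k) =>
  ('v, 'a, 'k, nat => 'k) sd_rep" where
 "mk D = \<lparr>space = V, arrow_map = fst D, form = (%x y. \<Oplus>i\<in>QV. snd D i (x i) (y (s0 i)))\<rparr>"

lemma mk_simps [simp]: "space (mk D) = V" "arrow_map (mk D) = fst D"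
 "form (mk D) x y = (\<Oplus>i\<in>QV. snd D i (x i) (y (s0 i)))"
 by (simp_all add: mk_def)

lemma Dat_D:
 assumes "D : Dat"
 shows "al : QA ==> fst D al : LV (src al) (tgt al)"
  "i : QV ==> snd D i : BV i (s0 i)"
  "i : QV ==> x : VC i ==> y : VC (s0 i) ==> snd D (s0 i) y x = sg (s i) (snd D i x y)"
  "i : QV ==> ndV i (s0 i) (snd D i)"
  "al : QA ==> x : VC (src al) ==> y : VC (s0 (tgt al)) ==>
    snd D (tgt al) (fst D al x) y = sg (\<tau> al) (snd D (src al) x (fst D (s1 al) y))"
  "fst D : (\<Pi>\<^sub>E al\<in>QA. LV (src al) (tgt al))"
  "snd D : (\<Pi>\<^sub>E i\<in>QV. BV i (s0 i))"
proof -
 obtain m b where D: "D = (m, b)" by (cases D)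
 have 1: "m : (\<Pi>\<^sub>E al\<in>QA. LV (src al) (tgt al))"
  and 2: "b : (\<Pi>\<^sub>E i\<in>QV. BV i (s0 i))"
  and 3: "\<forall>i\<in>QV. \<forall>x\<in>VC i. \<forall>y\<in>VC (s0 i). b (s0 i) y x = sg (s i) (b i x y)"
  and 4: "\<forall>i\<in>QV. ndV i (s0 i) (b i)"
  and 5: "\<forall>al\<in>QA. \<forall>x\<in>VC (src al). \<forall>y\<in>VC (s0 (tgt al)).
    b (tgt al) (m al x) y = sg (\<tau> al) (b (src al) x (m (s1 al) y))"
  using assms unfolding Dat_def D by blast+
 show "fst D : (\<Pi>\<^sub>E al\<in>QA. LV (src al) (tgt al))"
  "snd D : (\<Pi>\<^sub>E i\<in>QV. BV i (s0 i))"
  unfolding D fst_conv snd_conv by (rule 1 2)+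
 show "al : QA ==> fst D al : LV (src al) (tgt al)"
  unfolding D fst_conv by (rule PiE_mem[OF 1])
 show "i : QV ==> snd D i : BV i (s0 i)"
  unfolding D snd_conv by (rule PiE_mem[OF 2])
 show "i : QV ==> x : VC i ==> y : VC (s0 i) ==> snd D (s0 i) y x = sg (s i) (snd D i x y)"
  unfolding D snd_conv using 3 by blast
 show "i : QV ==> ndV i (s0 i) (snd D i)"
  unfolding D snd_conv using 4 by blast
 show "al : QA ==> x : VC (src al) ==> y : VC (s0 (tgt al)) ==>
    snd D (tgt al) (fst D al x) y = sg (\<tau> al) (snd D (src al) x (fst D (s1 al) y))"
  unfolding D fst_conv snd_conv using 5 by blast
qed

lemma finite_Dat: "finite Dat"
proof (rule finite_subset)
 show "Dat \<subseteq> (\<Pi>\<^sub>E al\<in>QA. VC (src al) \<rightarrow>\<^sub>E VC (tgt al)) \<times> (\<Pi>\<^sub>E i\<in>QV. BV i (s0 i))"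
 proof
  fix D assume D: "D : Dat"
  have "fst D : (\<Pi>\<^sub>E al\<in>QA. VC (src al) \<rightarrow>\<^sub>E VC (tgt al))"
   by (rule subsetD[OF PiE_mono Dat_D(6)[OF D]]) (auto simp: Lin_def)
  thus "D : (\<Pi>\<^sub>E al\<in>QA. VC (src al) \<rightarrow>\<^sub>E VC (tgt al)) \<times> (\<Pi>\<^sub>E i\<in>QV. BV i (s0 i))"
   using Dat_D(7)[OF D] by (simp add: mem_Times_iff)
 qed
 show "finite ((\<Pi>\<^sub>E al\<in>QA. VC (src al) \<rightarrow>\<^sub>E VC (tgt al)) \<times> (\<Pi>\<^sub>E i\<in>QV. BV i (s0 i)))"
  using finite_verts finite_arcs finite_V by (intro finite_cartesian_product finite_PiE finite_Bil) auto
qed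

lemma Dat_lin: "D : Dat ==> al : QA ==> lin (V (src al)) (VC (src al)) (V (tgt al)) (fst D al)"
 using Dat_D(1) by (auto simp: Lin_def)

lemma is_rep_mk: "D : Dat ==> is_rep K Q (mk D)"
 unfolding is_rep_def linear_map_iff using finite_fin_dim[OF vs_V finite_V] Dat_lin by simp

lemma dim_vec_mk: "dim_vec K Q (mk D) = d"
proof
 fix i show "dim_vec K Q (mk D) i = d i"
  using dim_eq_sdim[OF vs_V finite_V, of i] d_D(1)[of i] d_D(2)[of i] by (simp add: dim_vec_def sdim_V n_def)
qed

lemma Dat_zero:
 assumes D: "D : Dat" and i: "i : QV"
 shows "y : VC (s0 i) ==> snd D i \<zero>\<^bsub>V i\<^esub> y = \<zero>" "x : VC i ==> snd D i x \<zero>\<^bsub>V (s0 i)\<^esub> = \<zero>"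
 using lin_zero[OF Bil_D(1)[OF Dat_D(2)[OF D i]] V_subspace vs_KV] lin_zero[OF Bil_D(2)[OF Dat_D(2)[OF D i]] V_subspace vs_KV]
 by auto

lemma TS_mk: "TS (mk D) = (\<Pi>\<^sub>E i\<in>QV. VC i)"
 by (simp add: TS_def)

lemma mk_term_closed:
 assumes D: "D : Dat" and "x : TS (mk D)" "y : TS (mk D)" "i : QV"
 shows "snd D i (x i) (y (s0 i)) : carrier K"
proof (rule Bil_D(3)[OF Dat_D(2)[OF D assms(4)]])
 show "x i : VC i" using assms(2,4) unfolding TS_mk by (rule PiE_mem)
 show "y (s0 i) : VC (s0 i)" using assms(3) node_closed[OF assms(4)] unfolding TS_mk by (rule PiE_mem)
qed

lemma form_mk_embed_left:
 assumes D: "D : Dat" and i: "i : QV" and x: "x : VC i" and y: "y : TS (mk D)"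
 shows "form (mk D) (embed Q (mk D) i x) y = snd D i x (y (s0 i))"
proof -
 let ?f = "%j. snd D j (embed Q (mk D) i x j) (y (s0 j))"
 have yc: "y j : VC j" if "j : QV" for j using y that by (auto simp: TS_mk)
 have "form (mk D) (embed Q (mk D) i x) y = (\<Oplus>j\<in>QV. ?f j)" by simp
 also have "\<dots> = ?f i"
 proof (rule finsum_single[OF i])
  show "?f i : carrier K"
   using Bil_D(3)[OF Dat_D(2)[OF D i] x yc[OF node_closed[OF i]]] by (simp add: embed_apply i)
  fix j assume j: "j : QV" "j \<noteq> i"
  show "?f j = \<zero>" using Dat_zero(1)[OF D j(1) yc[OF node_closed[OF j(1)]]] j by (simp add: embed_apply)
 qed
 finally show ?thesis by (simp only: embed_apply(1)[OF i])
qed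

lemma bf_mk:
 assumes D: "D : Dat" and i: "i : QV" and x: "x : VC i" and y: "y : VC (s0 i)"
 shows "bf (mk D) i x y = snd D i x y"
proof -
 have "embed Q (mk D) (s0 i) y : TS (mk D)" by (rule embed_TS[OF is_rep_mk[OF D]]) (simp add: y)
 from form_mk_embed_left[OF D i x this] show ?thesis
  unfolding bf_def embed_apply(1)[OF node_closed[OF i]] .
qed

lemma is_sd_rep_mk:
 assumes D: "D : Dat"
 shows "is_sd_rep K Q s0 s1 s \<tau> (mk D)"
 unfolding is_sd_rep_def
proof (intro conjI ballI impI)
 note R = is_rep_mk[OF D]
 let ?T = "total_space Q (mk D)"
 have TC: "x i : VC i" if "x : TS (mk D)" "i : QV" for x i using that by (auto simp: TS_mk)
 have TC': "x (s0 i) : VC (s0 i)" if "x : TS (mk D)" "i : QV" for x i by (rule TC[OF that(1) node_closed[OF that(2)]])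
 note tc = mk_term_closed[OF D]
 note B = Bil_D[OF Dat_D(2)[OF D]]
 show "is_rep K Q (mk D)" by (rule R)
 show "bilinear_form K ?T (form (mk D))" unfolding bilinear_form_def
 proof (intro conjI ballI)
  fix x y assume xy: "x : TS (mk D)" "y : TS (mk D)"
  show "form (mk D) x y : carrier K" unfolding mk_simps by (rule finsum_closed) (use tc[OF xy] in blast)
  fix c assume c: "c : carrier K"
  show "form (mk D) (c \<odot>\<^bsub>?T\<^esub> x) y = c \<otimes> form (mk D) x y"
  proof -
   have "form (mk D) (c \<odot>\<^bsub>?T\<^esub> x) y = (\<Oplus>i\<in>QV. c \<otimes> snd D i (x i) (y (s0 i)))" unfolding mk_simps
   proof (rule finsum_cong'[OF refl])
    show "(%i. c \<otimes> snd D i (x i) (y (s0 i))) : QV \<rightarrow> carrier K" using tc[OF xy] c by blast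
    fix i assume i: "i : QV"
    show "snd D i ((c \<odot>\<^bsub>?T\<^esub> x) i) (y (s0 i)) = c \<otimes> snd D i (x i) (y (s0 i))"
     using lin_D(3)[OF B(1)[OF i TC'[OF xy(2) i]] c TC[OF xy(1) i]] i by simp
   qed
   also have "\<dots> = c \<otimes> form (mk D) x y" unfolding mk_simps
    by (rule finsum_rdistr[symmetric, OF finite_verts c]) (use tc[OF xy] in blast)
   finally show ?thesis .
  qed
  show "form (mk D) x (c \<odot>\<^bsub>?T\<^esub> y) = c \<otimes> form (mk D) x y"
  proof -
   have "form (mk D) x (c \<odot>\<^bsub>?T\<^esub> y) = (\<Oplus>i\<in>QV. c \<otimes> snd D i (x i) (y (s0 i)))" unfolding mk_simps
   proof (rule finsum_cong'[OF refl])
    show "(%i. c \<otimes> snd D i (x i) (y (s0 i))) : QV \<rightarrow> carrier K" using tc[OF xy] c by blast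
    fix i assume i: "i : QV"
    show "snd D i (x i) ((c \<odot>\<^bsub>?T\<^esub> y) (s0 i)) = c \<otimes> snd D i (x i) (y (s0 i))"
     using lin_D(3)[OF B(2)[OF i TC[OF xy(1) i]] c TC'[OF xy(2) i]] node_closed[OF i] by simp
   qed
   also have "\<dots> = c \<otimes> form (mk D) x y" unfolding mk_simps
    by (rule finsum_rdistr[symmetric, OF finite_verts c]) (use tc[OF xy] in blast)
   finally show ?thesis .
  qed
 next
  fix x y z assume xyz: "x : TS (mk D)" "y : TS (mk D)" "z : TS (mk D)"
  show "form (mk D) (x \<oplus>\<^bsub>?T\<^esub> y) z = form (mk D) x z \<oplus> form (mk D) y z"
  proof -
   have "form (mk D) (x \<oplus>\<^bsub>?T\<^esub> y) z = (\<Oplus>i\<in>QV. snd D i (x i) (z (s0 i)) \<oplus> snd D i (y i) (z (s0 i)))" unfolding mk_simps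
   proof (rule finsum_cong'[OF refl])
    show "(%i. snd D i (x i) (z (s0 i)) \<oplus> snd D i (y i) (z (s0 i))) : QV \<rightarrow> carrier K"
     using tc[OF xyz(1,3)] tc[OF xyz(2,3)] by blast
    fix i assume i: "i : QV"
    show "snd D i ((x \<oplus>\<^bsub>?T\<^esub> y) i) (z (s0 i)) = snd D i (x i) (z (s0 i)) \<oplus> snd D i (y i) (z (s0 i))"
     using lin_D(2)[OF B(1)[OF i TC'[OF xyz(3) i]] TC[OF xyz(1) i] TC[OF xyz(2) i]] i by simp
   qed
   also have "\<dots> = form (mk D) x z \<oplus> form (mk D) y z" unfolding mk_simps
    by (rule finsum_addf) (use tc[OF xyz(1,3)] tc[OF xyz(2,3)] in blast)+
   finally show ?thesis .
  qed
  show "form (mk D) x (y \<oplus>\<^bsub>?T\<^esub> z) = form (mk D) x y \<oplus> form (mk D) x z"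
  proof -
   have "form (mk D) x (y \<oplus>\<^bsub>?T\<^esub> z) = (\<Oplus>i\<in>QV. snd D i (x i) (y (s0 i)) \<oplus> snd D i (x i) (z (s0 i)))" unfolding mk_simps
   proof (rule finsum_cong'[OF refl])
    show "(%i. snd D i (x i) (y (s0 i)) \<oplus> snd D i (x i) (z (s0 i))) : QV \<rightarrow> carrier K"
     using tc[OF xyz(1,2)] tc[OF xyz(1,3)] by blast
    fix i assume i: "i : QV"
    show "snd D i (x i) ((y \<oplus>\<^bsub>?T\<^esub> z) (s0 i)) = snd D i (x i) (y (s0 i)) \<oplus> snd D i (x i) (z (s0 i))"
     using lin_D(2)[OF B(2)[OF i TC[OF xyz(1) i]] TC'[OF xyz(2) i] TC'[OF xyz(3) i]] node_closed[OF i] by simp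
   qed
   also have "\<dots> = form (mk D) x y \<oplus> form (mk D) x z" unfolding mk_simps
    by (rule finsum_addf) (use tc[OF xyz(1,2)] tc[OF xyz(1,3)] in blast)+
   finally show ?thesis .
  qed
 qed
 \<comment> \<open>Reindexing the sum by the involution exchanges the two arguments, at the cost of
   the sign \<open>s i\<close> at each node.\<close>
 have form_flip: "form (mk D) x y = (\<Oplus>i\<in>QV. sg (s i) (snd D i (y i) (x (s0 i))))"
  if xy: "x : TS (mk D)" "y : TS (mk D)" for x y
 proof -
  have im: "s0 ` QV = QV" using node_closed node_invol by force
  have inj: "inj_on s0 (QV)" using node_invol by (metis inj_onI)
  have "form (mk D) x y = (\<Oplus>i\<in>s0 ` QV. snd D i (x i) (y (s0 i)))" unfolding mk_simps im ..
  also have "\<dots> = (\<Oplus>i\<in>QV. snd D (s0 i) (x (s0 i)) (y (s0 (s0 i))))"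
   by (rule finsum_reindex[OF _ inj]) (unfold im, use tc[OF xy] in blast)
  also have "\<dots> = (\<Oplus>i\<in>QV. sg (s i) (snd D i (y i) (x (s0 i))))"
  proof (rule finsum_cong'[OF refl])
   show "(%i. sg (s i) (snd D i (y i) (x (s0 i)))) : QV \<rightarrow> carrier K"
    using sg_simps(1)[OF tc[OF xy(2,1)]] by blast
   fix i assume i: "i : QV"
   show "snd D (s0 i) (x (s0 i)) (y (s0 (s0 i))) = sg (s i) (snd D i (y i) (x (s0 i)))"
    unfolding node_invol[OF i] by (rule Dat_D(3)[OF D i TC[OF xy(2) i] TC'[OF xy(1) i]])
  qed
  finally show ?thesis .
 qed
 show "nondegenerate_form K ?T (form (mk D))" unfolding nondegenerate_form_def
 proof (intro conjI ballI impI)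
  have ext: "x = \<zero>\<^bsub>?T\<^esub>" if "x : TS (mk D)" "\<And>i. i : QV ==> x i = \<zero>\<^bsub>V i\<^esub>" for x
  proof
   fix i show "x i = \<zero>\<^bsub>?T\<^esub> i"
    using that PiE_arb[OF that(1)[unfolded TS_mk], of i] by (cases "i : QV") simp_all
  qed
  have left: "x i = \<zero>\<^bsub>V i\<^esub>" if x: "x : TS (mk D)" and x0: "\<And>y. y : VC (s0 i) ==> snd D i (x i) y = \<zero>" and i: "i : QV" for x i
   using Dat_D(4)[OF D i] TC[OF x i] x0 unfolding left_nondeg_def by blast
  have eT: "embed Q (mk D) j y : TS (mk D)" if "y : VC j" for j y
   by (rule embed_TS[OF R]) (simp add: that)
  fix x assume x: "x : TS (mk D)"
  {
   assume x0: "\<forall>y\<in>TS (mk D). form (mk D) x y = \<zero>"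
   show "x = \<zero>\<^bsub>?T\<^esub>"
   proof (rule ext[OF x left[OF x]])
    fix i y assume i: "i : QV" and y: "y : VC (s0 i)"
    define e where "e = embed Q (mk D) (s0 i) y"
    have e: "e : TS (mk D)" unfolding e_def by (rule eT[OF y])
    have "form (mk D) x e = (\<Oplus>j\<in>QV. snd D j (x j) (e (s0 j)))" by simp
    also have "\<dots> = snd D i (x i) (e (s0 i))"
    proof (rule finsum_single[of i "%j. snd D j (x j) (e (s0 j))", OF i tc[OF x e i]])
     fix j assume j: "j : QV" "j \<noteq> i"
     hence "s0 j \<noteq> s0 i" using node_invol i by metis
     hence "e (s0 j) = \<zero>\<^bsub>V (s0 j)\<^esub>" unfolding e_def using embed_apply(2)[OF node_closed[OF j(1)], of "s0 i" "mk D" y] by simp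
     thus "snd D j (x j) (e (s0 j)) = \<zero>" using Dat_zero(2)[OF D j(1) TC[OF x j(1)]] by simp
    qed
    finally have "form (mk D) x e = snd D i (x i) (e (s0 i))" .
    moreover have "form (mk D) x e = \<zero>" using x0 e by blast
    ultimately have "snd D i (x i) (e (s0 i)) = \<zero>" by (rule trans[OF sym])
    thus "snd D i (x i) y = \<zero>" unfolding e_def embed_apply(1)[OF node_closed[OF i]] .
   qed
  next
   assume x0: "\<forall>y\<in>TS (mk D). form (mk D) y x = \<zero>"
   show "x = \<zero>\<^bsub>?T\<^esub>"
   proof (rule ext[OF x left[OF x]])
    fix i y assume i: "i : QV" and y: "y : VC (s0 i)"
    have yi: "x i : VC (s0 (s0 i))" using TC[OF x i] by (simp add: node_invol[OF i])
    have "form (mk D) (embed Q (mk D) (s0 i) y) x = \<zero>" using x0 eT[OF y] by blast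
    hence "snd D (s0 i) y (x (s0 (s0 i))) = \<zero>"
     unfolding form_mk_embed_left[OF D node_closed[OF i] y x] .
    hence "sg (s i) (snd D i (x i) y) = \<zero>"
     using Dat_D(3)[OF D i TC[OF x i] y] by (simp only: node_invol[OF i])
    thus "snd D i (x i) y = \<zero>" using sg_zero_iff[OF B(3)[OF i TC[OF x i] y]] by blast
   qed
  }
 qed
 show "form (mk D) (embed Q (mk D) i x) (embed Q (mk D) j y) = \<zero>"
  if i: "i : QV" and j: "j : QV" and ij: "i \<noteq> s0 j" and x: "x : carrier (space (mk D) i)" and y: "y : carrier (space (mk D) j)" for i j x y
 proof -
  have x': "x : VC i" using x by simp
  have "s0 i \<noteq> j" using ij i node_invol by metis
  hence "embed Q (mk D) j y (s0 i) = \<zero>\<^bsub>V (s0 i)\<^esub>" using embed_apply(2)[OF node_closed[OF i], of j "mk D" y] by simp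
  thus ?thesis using form_mk_embed_left[OF D i x' embed_TS[OF R y]] Dat_zero(2)[OF D i x'] by (simp only:)
 qed
 show "form (mk D) x y = [s i] \<cdot>\<^bsub>K\<^esub> form (mk D) y x"
  if i: "i : QV" and x: "x : partial_sum Q (mk D) {i, s0 i}" and y: "y : partial_sum Q (mk D) {i, s0 i}" for i x y
 proof -
  have xT: "x : TS (mk D)" and yT: "y : TS (mk D)" using x y by (simp_all add: partial_sum_def)
  have "form (mk D) x y = (\<Oplus>j\<in>QV. sg (s j) (snd D j (y j) (x (s0 j))))" by (rule form_flip[OF xT yT])
  also have "\<dots> = (\<Oplus>j\<in>QV. sg (s i) (snd D j (y j) (x (s0 j))))"
  proof (rule finsum_cong'[OF refl])
   show "(%j. sg (s i) (snd D j (y j) (x (s0 j)))) : QV \<rightarrow> carrier K"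
    using sg_simps(1)[OF tc[OF yT xT]] by blast
   fix j assume j: "j : QV"
   \<comment> \<open>For vectors in \<open>partial_sum\<close> only the nodes \<open>i\<close> and
     \<open>s0 i\<close> contribute, and these have the same sign.\<close>
   show "sg (s j) (snd D j (y j) (x (s0 j))) = sg (s i) (snd D j (y j) (x (s0 j)))"
   proof (cases "j : {i, s0 i}")
    case True thus ?thesis using s_invariant[OF i] by auto
   next
    case False
    hence "y j = \<zero>\<^bsub>V j\<^esub>" using y j by (simp add: partial_sum_def)
    hence "snd D j (y j) (x (s0 j)) = \<zero>" using Dat_zero(1)[OF D j TC'[OF xT j]] by simp
    thus ?thesis by simp
   qed
  qed
  also have "\<dots> = (\<Oplus>j\<in>QV. sg (s i) \<one> \<otimes> snd D j (y j) (x (s0 j)))"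
   by (rule finsum_cong'[OF refl]) (use tc[OF yT xT] in \<open>auto simp: sg_def l_minus\<close>)
  also have "\<dots> = sg (s i) \<one> \<otimes> form (mk D) y x" unfolding mk_simps
   by (rule finsum_rdistr[symmetric, OF finite_verts]) (use tc[OF yT xT] in auto)
  also have fc: "form (mk D) y x : carrier K" unfolding mk_simps by (rule finsum_closed) (use tc[OF yT xT] in blast)
  hence "sg (s i) \<one> \<otimes> form (mk D) y x = sg (s i) (form (mk D) y x)" by (simp only: sg_def) (simp add: l_minus)
  also have "\<dots> = [s i] \<cdot>\<^bsub>K\<^esub> form (mk D) y x" by (rule add_pow_sg[OF s_sign[OF i] fc, symmetric])
  finally show ?thesis .
 qed
 show "form (mk D) (embed Q (mk D) (tgt al) (arrow_map (mk D) al x)) (embed Q (mk D) (s0 (tgt al)) y) =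
   [\<tau> al] \<cdot>\<^bsub>K\<^esub> form (mk D) (embed Q (mk D) (src al) x) (embed Q (mk D) (s0 (src al)) (arrow_map (mk D) (s1 al) y))"
  if al: "al : QA" and x: "x : carrier (space (mk D) (src al))" and y: "y : carrier (space (mk D) (s0 (tgt al)))" for al x y
 proof -
  have x': "x : VC (src al)" and y': "y : VC (s0 (tgt al))" using x y by simp_all
  note th = tail_head_verts[OF al]
  have mx: "fst D al x : VC (tgt al)" by (rule lin_D(1)[OF Dat_lin[OF D al] x'])
  have my: "fst D (s1 al) y : VC (s0 (src al))"
   using lin_D(1)[OF Dat_lin[OF D arrow_closed[OF al]], of y] y' tail_invol[OF al] head_invol[OF al] by simp
  have "bf (mk D) (tgt al) (fst D al x) y = sg (\<tau> al) (snd D (src al) x (fst D (s1 al) y))"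
   unfolding bf_mk[OF D th(2) mx y'] by (rule Dat_D(5)[OF D al x' y'])
  also have "\<dots> = [\<tau> al] \<cdot>\<^bsub>K\<^esub> snd D (src al) x (fst D (s1 al) y)"
   by (rule add_pow_sg[OF tau_sign[OF al] B(3)[OF th(1) x' my], symmetric])
  also have "snd D (src al) x (fst D (s1 al) y) = bf (mk D) (src al) x (fst D (s1 al) y)"
   by (rule bf_mk[OF D th(1) x' my, symmetric])
  finally show ?thesis unfolding bf_def mk_simps(2) .
 qed
qed

end

section \<open>Frames and transport of structure\<close>

context quiver_data
begin

text \<open>Frames: linear identifications of the standard spaces with those of \<open>M\<close>.
  For \<open>M\<close> of dimension vector \<open>d\<close> the product of the general linear groups
  acts on them simply transitively.\<close>

definition Fr :: "('v, 'a, 'k, 'm) sd_rep => ('v => (nat => 'k) => 'm) set" where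
 "Fr M = (\<Pi>\<^sub>E i\<in>QV. {g : Lin (V i) (VC i) (space M i). bij_betw g (VC i) (carrier (space M i))})"

text \<open>The structure of \<open>M\<close> written in a frame; the frame becomes an isometry from
  this structure to \<open>M\<close>.\<close>

definition pull :: "('v, 'a, 'k, 'm) sd_rep => ('v => (nat => 'k) => 'm) =>
 ('a => (nat => 'k) => (nat => 'k)) \<times> ('v => (nat => 'k) => (nat => 'k) => 'k)" where
 "pull M fi = (\<lambda>al\<in>QA. \<lambda>x\<in>VC (src al). inv_into (VC (tgt al)) (fi (tgt al)) (arrow_map M al (fi (src al) x)),
  \<lambda>i\<in>QV. \<lambda>x\<in>VC i. \<lambda>y\<in>VC (s0 i). bf M i (fi i x) (fi (s0 i) y))"

lemma sdim_space:
 assumes M: "is_rep K Q M" and d: "dim_vec K Q M = d" and i: "i : QV"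
 shows "card (carrier (space M i)) = card (VC i)"
proof -
 have "int (sdim (carrier (space M i))) = d i" using fun_cong[OF d, of i] i is_rep_D(3)[OF M i] by (simp add: dim_vec_def)
 hence "sdim (carrier (space M i)) = n i" by (simp add: n_def)
 thus ?thesis using card_subspace[OF subspace_carrier[OF is_rep_D(1)[OF M i]] is_rep_D(2)[OF M i]] by (simp add: card_V)
qed

lemma card_Fr:
 assumes M: "is_rep K Q M" and d: "dim_vec K Q M = d"
 shows "real (card (Fr M)) = (\<Prod>i\<in>QV. ij (n i) (n i))"
proof -
 have "real (card (Fr M)) = (\<Prod>i\<in>QV. real (card {g : Lin (V i) (VC i) (space M i). bij_betw g (VC i) (carrier (space M i))}))"
  unfolding Fr_def by (simp add: card_PiE[OF finite_verts])
 also have "\<dots> = (\<Prod>i\<in>QV. ij (n i) (n i))"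
  by (intro prod.cong refl) (simp add: card_GL[OF vs_V finite_V is_rep_D(1)[OF M] is_rep_D(2)[OF M] sdim_space[OF M d]] sdim_V)
 finally show ?thesis .
qed

lemma Fr_D:
 assumes "fi : Fr M" "i : QV"
 shows "lin (V i) (VC i) (space M i) (fi i)" "bij_betw (fi i) (VC i) (carrier (space M i))"
  "x : VC i ==> fi i x : carrier (space M i)" "fi i : VC i \<rightarrow>\<^sub>E carrier (space M i)"
 using PiE_mem[OF assms(1)[unfolded Fr_def] assms(2)] by (auto simp: Lin_def)

lemma pull_arrow:
 assumes M: "is_rep K Q M" and fi: "fi : Fr M" and al: "al : QA" and x: "x : VC (src al)"
 shows "fst (pull M fi) al x : VC (tgt al)" "fi (tgt al) (fst (pull M fi) al x) = arrow_map M al (fi (src al) x)"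
proof -
 note th = tail_head_verts[OF al]
 have "arrow_map M al (fi (src al) x) : carrier (space M (tgt al))"
  by (rule lin_D(1)[OF is_rep_D(4)[OF M al] Fr_D(3)[OF fi th(1) x]])
 hence "arrow_map M al (fi (src al) x) : fi (tgt al) ` VC (tgt al)"
  using bij_betw_imp_surj_on[OF Fr_D(2)[OF fi th(2)]] by simp
 thus "fst (pull M fi) al x : VC (tgt al)" "fi (tgt al) (fst (pull M fi) al x) = arrow_map M al (fi (src al) x)"
  using al x by (simp_all add: pull_def inv_into_into f_inv_into_f)
qed

lemma pull_form: "i : QV ==> x : VC i ==> y : VC (s0 i) ==> snd (pull M fi) i x y = bf M i (fi i x) (fi (s0 i) y)"
 by (simp add: pull_def)

lemma pull_Dat:
 assumes M: "is_sd_rep K Q s0 s1 s \<tau> M" and fi: "fi : Fr M"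
 shows "pull M fi : Dat"
proof -
 note R = sd_rep_D(1)[OF M]
 let ?m = "fst (pull M fi)" and ?b = "snd (pull M fi)"
 note pa = pull_arrow[OF R fi]
 have fiz: "fi i \<zero>\<^bsub>V i\<^esub> = \<zero>\<^bsub>space M i\<^esub>" if "i : QV" for i
  by (rule lin_zero[OF Fr_D(1)[OF fi that] V_subspace is_rep_D(1)[OF R that]])
 have inj: "inj_on (fi i) (VC i)" if "i : QV" for i by (rule bij_betw_imp_inj_on[OF Fr_D(2)[OF fi that]])
 have m: "?m al : LV (src al) (tgt al)" if al: "al : QA" for al
 proof -
  note th = tail_head_verts[OF al]
  note l = Fr_D(1)[OF fi th(1)] and lh = Fr_D(1)[OF fi th(2)] and la = is_rep_D(4)[OF R al] and c = Fr_D(3)[OF fi th(1)]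
  have "lin (V (src al)) (VC (src al)) (V (tgt al)) (?m al)"
  proof (rule linI)
   show "?m al x : VC (tgt al)" if "x : VC (src al)" for x by (rule pa(1)[OF al that])
   fix x y assume xy: "x : VC (src al)" "y : VC (src al)"
   have xy': "x \<oplus>\<^bsub>V (src al)\<^esub> y : VC (src al)" using xy by simp
   show "?m al (x \<oplus>\<^bsub>V (src al)\<^esub> y) = ?m al x \<oplus>\<^bsub>V (tgt al)\<^esub> ?m al y"
   proof (rule inj_onD[OF inj[OF th(2)] _ pa(1)[OF al xy']])
    show "?m al x \<oplus>\<^bsub>V (tgt al)\<^esub> ?m al y : VC (tgt al)" using pa(1)[OF al] xy by simp
    show "fi (tgt al) (?m al (x \<oplus>\<^bsub>V (src al)\<^esub> y)) = fi (tgt al) (?m al x \<oplus>\<^bsub>V (tgt al)\<^esub> ?m al y)"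
     unfolding pa(2)[OF al xy'] lin_D(2)[OF lh pa(1)[OF al xy(1)] pa(1)[OF al xy(2)]] pa(2)[OF al xy(1)] pa(2)[OF al xy(2)]
      lin_D(2)[OF l xy] lin_D(2)[OF la c[OF xy(1)] c[OF xy(2)]] ..
   qed
  next
   fix k x assume k: "k : carrier K" and x: "x : VC (src al)"
   have x': "k \<odot>\<^bsub>V (src al)\<^esub> x : VC (src al)" using k x by simp
   show "?m al (k \<odot>\<^bsub>V (src al)\<^esub> x) = k \<odot>\<^bsub>V (tgt al)\<^esub> ?m al x"
   proof (rule inj_onD[OF inj[OF th(2)] _ pa(1)[OF al x']])
    show "k \<odot>\<^bsub>V (tgt al)\<^esub> ?m al x : VC (tgt al)" using pa(1)[OF al] k x by simp
    show "fi (tgt al) (?m al (k \<odot>\<^bsub>V (src al)\<^esub> x)) = fi (tgt al) (k \<odot>\<^bsub>V (tgt al)\<^esub> ?m al x)"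
     unfolding pa(2)[OF al x'] lin_D(3)[OF lh k pa(1)[OF al x]] pa(2)[OF al x] lin_D(3)[OF l k x] lin_D(3)[OF la k c[OF x]] ..
   qed
  qed
  moreover have "?m al : VC (src al) \<rightarrow>\<^sub>E VC (tgt al)"
   using pa(1)[OF al] al by (simp add: PiE_iff pull_def)
  ultimately show ?thesis by (simp add: Lin_def)
 qed
 have b: "?b i : BV i (s0 i)" if i: "i : QV" for i
 proof -
  note c = Fr_D(3)[OF fi i] and c' = Fr_D(3)[OF fi node_closed[OF i]]
  have "(\<lambda>x\<in>VC i. \<lambda>y\<in>VC (s0 i). bf M i (fi i x) (fi (s0 i) y)) : BV i (s0 i)"
  proof (rule BilI[OF V_subspace V_subspace])
   show "lin (V i) (VC i) KV (%x. bf M i (fi i x) (fi (s0 i) y))" if "y : VC (s0 i)" for y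
    by (rule lin_comp[OF Fr_D(1)[OF fi i] bf_Bil(1)[OF M c'[OF that]] c])
   show "lin (V (s0 i)) (VC (s0 i)) KV (%y. bf M i (fi i x) (fi (s0 i) y))" if "x : VC i" for x
    by (rule lin_comp[OF Fr_D(1)[OF fi node_closed[OF i]] bf_Bil(2)[OF M c[OF that]] c'])
  qed
  thus ?thesis using i by (simp add: pull_def)
 qed
 have "(?m, ?b) : Dat" unfolding Dat_def
 proof (intro CollectI case_prodI conjI ballI)
  show "?m : (\<Pi>\<^sub>E al\<in>QA. LV (src al) (tgt al))"
   by (rule PiE_I) (use m in \<open>simp_all add: pull_def\<close>)
  show "?b : (\<Pi>\<^sub>E i\<in>QV. BV i (s0 i))"
   by (rule PiE_I) (use b in \<open>simp_all add: pull_def\<close>)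
 next
  fix i x y assume i: "i : QV" and x: "x : VC i" and y: "y : VC (s0 i)"
  have "?b (s0 i) y x = bf M (s0 i) (fi (s0 i) y) (fi (s0 (s0 i)) x)"
   by (rule pull_form) (simp_all add: node_closed i y node_invol x)
  also have "\<dots> = sg (s i) (bf M i (fi i x) (fi (s0 i) y))" unfolding node_invol[OF i]
   by (rule bf_sym[OF M i Fr_D(3)[OF fi i x] Fr_D(3)[OF fi node_closed[OF i] y]])
  finally show "?b (s0 i) y x = sg (s i) (?b i x y)" unfolding pull_form[OF i x y] .
 next
  fix i assume i: "i : QV"
  show "ndV i (s0 i) (?b i)" unfolding left_nondeg_def
  proof (intro ballI impI)
   fix x assume x: "x : VC i" and x0: "\<forall>y\<in>VC (s0 i). ?b i x y = \<zero>"
   have "fi i x = \<zero>\<^bsub>space M i\<^esub>"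
   proof (rule bf_nondeg[OF M i Fr_D(3)[OF fi i x]])
    fix y assume "y : carrier (space M (s0 i))"
    then obtain w where w: "w : VC (s0 i)" "y = fi (s0 i) w"
     using bij_betw_imp_surj_on[OF Fr_D(2)[OF fi node_closed[OF i]]] by blast
    show "bf M i (fi i x) y = \<zero>" unfolding w(2) using x0 w(1) pull_form[OF i x w(1), of M fi] by simp
   qed
   hence "fi i x = fi i \<zero>\<^bsub>V i\<^esub>" by (simp add: fiz[OF i])
   thus "x = \<zero>\<^bsub>V i\<^esub>" by (rule inj_onD[OF inj[OF i] _ x]) simp
  qed
 next
  fix al x y assume al: "al : QA" and x: "x : VC (src al)" and y: "y : VC (s0 (tgt al))"
  note th = tail_head_verts[OF al] and a' = arrow_closed[OF al]
  have y': "y : VC (src (s1 al))" using y by (simp add: tail_invol[OF al])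
  have my: "?m (s1 al) y : VC (s0 (src al))" using pa(1)[OF a' y'] by (simp add: head_invol[OF al])
  have fim: "fi (s0 (src al)) (?m (s1 al) y) = arrow_map M (s1 al) (fi (s0 (tgt al)) y)"
   using pa(2)[OF a' y'] by (simp add: head_invol[OF al] tail_invol[OF al])
  have x1: "fi (src al) x : carrier (space M (src al))" by (rule Fr_D(3)[OF fi th(1) x])
  have y1: "fi (s0 (tgt al)) y : carrier (space M (s0 (tgt al)))" by (rule Fr_D(3)[OF fi node_closed[OF th(2)] y])
  have my1: "arrow_map M (s1 al) (fi (s0 (tgt al)) y) : carrier (space M (s0 (src al)))"
   unfolding fim[symmetric] by (rule Fr_D(3)[OF fi node_closed[OF th(1)] my])
  have "?b (tgt al) (?m al x) y = bf M (tgt al) (arrow_map M al (fi (src al) x)) (fi (s0 (tgt al)) y)"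
   unfolding pull_form[OF th(2) pa(1)[OF al x] y] pa(2)[OF al x] ..
  also have "\<dots> = [\<tau> al] \<cdot>\<^bsub>K\<^esub> bf M (src al) (fi (src al) x) (arrow_map M (s1 al) (fi (s0 (tgt al)) y))"
   unfolding bf_def by (rule sd_rep_D(6)[OF M al x1 y1])
  also have "\<dots> = sg (\<tau> al) (bf M (src al) (fi (src al) x) (arrow_map M (s1 al) (fi (s0 (tgt al)) y)))"
  proof (rule add_pow_sg[OF tau_sign[OF al]])
   show "bf M (src al) (fi (src al) x) (arrow_map M (s1 al) (fi (s0 (tgt al)) y)) : carrier K"
    using lin_D(1)[OF bf_Bil(1)[OF M my1] x1] by simp
  qed
  finally show "?b (tgt al) (?m al x) y = sg (\<tau> al) (?b (src al) x (?m (s1 al) y))"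
   unfolding pull_form[OF th(1) x my] fim .
 qed
 thus ?thesis by simp
qed

lemma pull_iso:
 assumes M: "is_sd_rep K Q s0 s1 s \<tau> M" and fi: "fi : Fr M"
 shows "fi : Iso (mk (pull M fi)) M"
proof (rule isoI)
 note R = sd_rep_D(1)[OF M] and D = pull_Dat[OF M fi]
 show "is_rep K Q (mk (pull M fi))" by (rule is_rep_mk[OF D])
 show "is_rep K Q M" by (rule R)
 show "fi : (\<Pi>\<^sub>E i\<in>QV. carrier (space (mk (pull M fi)) i) \<rightarrow>\<^sub>E carrier (space M i))"
  by (rule PiE_I) (use Fr_D(4)[OF fi] PiE_arb[OF fi[unfolded Fr_def]] in simp_all)
 show "lin (space (mk (pull M fi)) i) (carrier (space (mk (pull M fi)) i)) (space M i) (fi i)" if "i : QV" for i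
  using Fr_D(1)[OF fi that] by simp
 show "bij_betw (fi i) (carrier (space (mk (pull M fi)) i)) (carrier (space M i))" if "i : QV" for i
  using Fr_D(2)[OF fi that] by simp
 show "fi (tgt al) (arrow_map (mk (pull M fi)) al x) = arrow_map M al (fi (src al) x)"
  if "al : QA" "x : carrier (space (mk (pull M fi)) (src al))" for al x
  using pull_arrow(2)[OF R fi that(1)] that(2) by simp
 fix x y assume xy: "x : TS (mk (pull M fi))" "y : TS (mk (pull M fi))"
 have c: "z i : VC i" if "z : TS (mk (pull M fi))" "i : QV" for z i using that by (auto simp: TS_mk)
 have T: "(\<lambda>i\<in>QV. fi i (z i)) : TS M" if "z : TS (mk (pull M fi))" for z
  unfolding TS_def using Fr_D(3)[OF fi] c[OF that] by simp
 have "form M (\<lambda>i\<in>QV. fi i (x i)) (\<lambda>i\<in>QV. fi i (y i)) =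
  (\<Oplus>i\<in>QV. bf M i ((\<lambda>i\<in>QV. fi i (x i)) i) ((\<lambda>i\<in>QV. fi i (y i)) (s0 i)))"
  by (rule form_eq_bf[OF M T[OF xy(1)] T[OF xy(2)]])
 also have "\<dots> = form (mk (pull M fi)) x y" unfolding mk_simps
 proof (rule finsum_cong'[OF refl])
  show "(%i. snd (pull M fi) i (x i) (y (s0 i))) : QV \<rightarrow> carrier K" using mk_term_closed[OF D xy] by blast
  fix i assume i: "i : QV"
  show "bf M i ((\<lambda>i\<in>QV. fi i (x i)) i) ((\<lambda>i\<in>QV. fi i (y i)) (s0 i)) = snd (pull M fi) i (x i) (y (s0 i))"
   using pull_form[OF i c[OF xy(1) i] c[OF xy(2) node_closed[OF i]], of M fi] i node_closed[OF i] by simp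
 qed
 finally show "form M (\<lambda>i\<in>QV. fi i (x i)) (\<lambda>i\<in>QV. fi i (y i)) = form (mk (pull M fi)) x y" .
qed

lemma iso_Fr:
 assumes M: "is_rep K Q M" and D: "D : Dat" and fi: "fi : Iso (mk D) M"
 shows "fi : Fr M"
 unfolding Fr_def
proof (rule PiE_I)
 fix i assume i: "i : QV"
 have "fi i : VC i \<rightarrow>\<^sub>E carrier (space M i)" using PiE_mem[OF iso_D(5)[OF fi] i] by simp
 thus "fi i : {g : Lin (V i) (VC i) (space M i). bij_betw g (VC i) (carrier (space M i))}"
  using iso_D(1)[OF fi i] iso_D(2)[OF fi i] by (simp add: Lin_def)
next
 fix i assume "i \<notin> QV"
 thus "fi i = undefined" by (rule PiE_arb[OF iso_D(5)[OF fi]])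
qed

text \<open>An isometry to \<open>M\<close> determines the structure from which it starts. This
  makes the decomposition of the frames below disjoint.\<close>

lemma iso_pull:
 assumes M: "is_sd_rep K Q s0 s1 s \<tau> M" and D: "D : Dat" and fi: "fi : Iso (mk D) M"
 shows "D = pull M fi"
proof (rule prod_eqI)
 note R = sd_rep_D(1)[OF M]
 note F = iso_Fr[OF R D fi]
 note P = pull_Dat[OF M F]
 show "fst D = fst (pull M fi)"
 proof (rule PiE_ext[OF Dat_D(6)[OF D] Dat_D(6)[OF P]])
  fix al assume al: "al : QA"
  note th = tail_head_verts[OF al]
  have e: "fst E al : VC (src al) \<rightarrow>\<^sub>E VC (tgt al)" if "E : Dat" for E using Dat_D(1)[OF that al] by (simp add: Lin_def)
  show "fst D al = fst (pull M fi) al"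
  proof (rule PiE_ext[OF e[OF D] e[OF P]])
   fix x assume x: "x : VC (src al)"
   have "fi (tgt al) (fst D al x) = fi (tgt al) (fst (pull M fi) al x)"
    using iso_D(3)[OF fi al, of x] x pull_arrow(2)[OF R F al x] by simp
   thus "fst D al x = fst (pull M fi) al x"
    by (rule inj_onD[OF bij_betw_imp_inj_on[OF Fr_D(2)[OF F th(2)]]]) (use PiE_mem[OF e[OF D] x] PiE_mem[OF e[OF P] x] in auto)
  qed
 qed
 show "snd D = snd (pull M fi)"
 proof (rule PiE_ext[OF Dat_D(7)[OF D] Dat_D(7)[OF P]])
  fix i assume i: "i : QV"
  show "snd D i = snd (pull M fi) i"
  proof (rule Bil_ext[OF Dat_D(2)[OF D i] Dat_D(2)[OF P i]])
   fix x y assume x: "x : VC i" and y: "y : VC (s0 i)"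
   have em: "(\<lambda>j\<in>QV. fi j (embed Q (mk D) k z j)) = embed Q M k (fi k z)" for k z
    unfolding embed_def
   proof (rule restrict_ext)
    fix j assume j: "j : QV"
    have "fi j \<zero>\<^bsub>V j\<^esub> = \<zero>\<^bsub>space M j\<^esub>" by (rule lin_zero[OF Fr_D(1)[OF F j] V_subspace is_rep_D(1)[OF R j]])
    thus "fi j ((\<lambda>j\<in>QV. if j = k then z else \<zero>\<^bsub>space (mk D) j\<^esub>) j) = (if j = k then fi k z else \<zero>\<^bsub>space M j\<^esub>)"
     using j by simp
   qed
   have eT: "embed Q (mk D) k z : TS (mk D)" if "z : VC k" for k z
    by (rule embed_TS[OF is_rep_mk[OF D]]) (simp add: that)
   have "snd D i x y = bf (mk D) i x y" by (rule bf_mk[OF D i x y, symmetric])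
   also have "\<dots> = bf M i (fi i x) (fi (s0 i) y)"
    unfolding bf_def iso_D(4)[OF fi eT[OF x] eT[OF y], symmetric] em ..
   finally show "snd D i x y = snd (pull M fi) i x y" unfolding pull_form[OF i x y] .
  qed
 qed
qed

subsection \<open>The mass of the isometry classes\<close>

text \<open>Each frame is an isometry from exactly one element of \<open>Dat\<close>, its pullback,
  and every nonempty set of isometries to \<open>M\<close> has the size of \<open>Aut_S\<close>.
  This is the orbit-stabiliser formula without an explicit group action.\<close>

lemma Fr_decomposition:
 assumes M: "is_sd_rep K Q s0 s1 s \<tau> M"
 shows "card (Fr M) = card {D : Dat. Iso (mk D) M \<noteq> {}} * card (Aut_S K Q M)"
proof -
 note R = sd_rep_D(1)[OF M]
 have eq: "Fr M = (\<Union>D\<in>{D : Dat. Iso (mk D) M \<noteq> {}}. Iso (mk D) M)"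
  using pull_Dat[OF M] pull_iso[OF M] iso_Fr[OF R] by blast
 have "card (Fr M) = (\<Sum>D\<in>{D : Dat. Iso (mk D) M \<noteq> {}}. card (Iso (mk D) M))"
  unfolding eq
 proof (rule card_UN_disjoint)
  show "finite {D : Dat. Iso (mk D) M \<noteq> {}}" by (rule finite_subset[OF _ finite_Dat]) blast
  show "\<forall>D\<in>{D : Dat. Iso (mk D) M \<noteq> {}}. finite (Iso (mk D) M)" using finite_Iso[OF is_rep_mk R] by blast
  show "\<forall>D\<in>{D : Dat. Iso (mk D) M \<noteq> {}}. \<forall>E\<in>{D : Dat. Iso (mk D) M \<noteq> {}}. D \<noteq> E \<longrightarrow> Iso (mk D) M \<inter> Iso (mk E) M = {}"
   using iso_pull[OF M] by blast
 qed
 also have "\<dots> = (\<Sum>D\<in>{D : Dat. Iso (mk D) M \<noteq> {}}. card (Aut_S K Q M))"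
  by (intro sum.cong refl) (use card_iso[OF R is_rep_mk] in blast)
 finally show ?thesis by simp
qed

text \<open>Every isometry class has the same number of frames, the order of the product of general
  linear groups. Hence 1 / #Aut_S is the number of structures in \<open>Dat\<close> that belong to
  the class, divided by this order.\<close>

theorem mass_formula:
 "(\<Sum>C\<in>isometry_classes K Q (semistable_sd_reps K Q s0 s1 s \<tau> \<theta> d). 1 / real (card (Aut_S K Q (SOME M. M : C)))) =
  real (card {D : Dat. sd_semistable K Q \<theta> (mk D)}) / (\<Prod>i\<in>QV. ij (n i) (n i))"
proof -
 define S where "S = semistable_sd_reps K Q s0 s1 s \<tau> \<theta> d"
 define r where "r = {(M, N). M : S \<and> N : S \<and> Iso M N \<noteq> {}}"
 define G where "G = (\<Prod>i\<in>QV. ij (n i) (n i))"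
 have G0: "G \<noteq> 0" unfolding G_def using finite_verts ij_nonzero by simp
 have SM: "is_sd_rep K Q s0 s1 s \<tau> M" "is_rep K Q M" "sd_semistable K Q \<theta> M" "dim_vec K Q M = d" if "M : S" for M
  using that sd_rep_D(1) by (auto simp: S_def semistable_sd_reps_def)
 have eqv: "equiv S r"
 proof (rule equivI)
  show "r \<subseteq> S \<times> S" unfolding r_def by blast
  show "refl_on S r" unfolding refl_on_def r_def using iso_id SM(2) by fastforce
  show "sym r" unfolding sym_def r_def using iso_inv[OF SM(2) SM(2)] by blast
  show "trans r" unfolding trans_def r_def using iso_comp[OF SM(2) SM(2)] by blast
 qed
 have mkS: "mk D : S" if "D : Dat" "M : S" "Iso (mk D) M \<noteq> {}" for D M
  using is_sd_rep_mk[OF that(1)] dim_vec_mk sd_semistable_iso[OF is_rep_mk[OF that(1)] SM(2)[OF that(2)] _ SM(3)[OF that(2)]] that(3)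
  by (auto simp: S_def semistable_sd_reps_def)
 have exD: "\<exists>D\<in>Dat. Iso (mk D) M \<noteq> {}" if "M : S" for M
 proof -
  have "real (card (Fr M)) \<noteq> 0" unfolding card_Fr[OF SM(2,4)[OF that]] G_def[symmetric] by (rule G0)
  hence "card (Fr M) \<noteq> 0" by simp
  then obtain fi where "fi : Fr M" by (metis card.empty ex_in_conv)
  thus ?thesis using pull_Dat[OF SM(1)[OF that]] pull_iso[OF SM(1)[OF that]] by blast
 qed
 define N where "N = (%C. {D : Dat. mk D : C})"
 have cls: "1 / real (card (Aut_S K Q (SOME M. M : C))) = real (card (N C)) / G" if C: "C : S // r" for C
 proof -
  define M where "M = (SOME M. M : C)"
  have "C \<noteq> {}" by (rule in_quotient_imp_non_empty[OF eqv C])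
  hence MC: "M : C" unfolding M_def by (simp only: some_in_eq not_False_eq_True)
  have CS: "C \<subseteq> S" by (rule in_quotient_imp_subset[OF eqv C])
  have MS: "M : S" using MC CS by blast
  have Cr: "x : C \<longleftrightarrow> (x, M) : r" for x
  proof
   assume "x : C"
   from quotient_eq_iff[OF eqv C C this MC] show "(x, M) : r" by (rule iffD1) (rule refl)
  next
   assume "(x, M) : r"
   moreover have "sym r" using eqv by (simp only: equiv_def)
   ultimately have "(M, x) : r" by (blast dest: symD)
   thus "x : C" by (rule in_quotient_imp_closed[OF eqv C MC])
  qed
  have "N C = {D : Dat. Iso (mk D) M \<noteq> {}}"
   unfolding N_def Cr using mkS[OF _ MS] MS by (auto simp: r_def)
  hence "card (Fr M) = card (N C) * card (Aut_S K Q M)" using Fr_decomposition[OF SM(1)[OF MS]] by simp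
  hence "real (card (N C)) * real (card (Aut_S K Q M)) = G"
   using card_Fr[OF SM(2,4)[OF MS]] unfolding G_def by (metis of_nat_mult)
  thus ?thesis unfolding M_def[symmetric] using G0 by (auto simp: field_simps)
 qed
 \<comment> \<open>Every class contains a structure from the finite set \<open>Dat\<close>.\<close>
 have fin: "finite (S // r)"
 proof (rule finite_subset)
  show "S // r \<subseteq> (%D. r `` {mk D}) ` Dat"
  proof
   fix C assume C: "C : S // r"
   then obtain M where M: "M : S" "C = r `` {M}" by (rule quotientE)
   obtain D where D: "D : Dat" "Iso (mk D) M \<noteq> {}" using exD[OF M(1)] by blast
   have "(mk D, M) : r" unfolding r_def using mkS[OF D(1) M(1) D(2)] M(1) D(2) by blast
   hence "r `` {mk D} = C" unfolding M(2) by (rule equiv_class_eq[OF eqv])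
   thus "C : (%D. r `` {mk D}) ` Dat" using D(1) by blast
  qed
 qed (use finite_Dat in simp)
 have "{D : Dat. sd_semistable K Q \<theta> (mk D)} = (\<Union>C\<in>S // r. N C)"
 proof -
  have "{D : Dat. sd_semistable K Q \<theta> (mk D)} = {D : Dat. mk D : S}"
   unfolding S_def semistable_sd_reps_def using is_sd_rep_mk dim_vec_mk by blast
  also have "\<dots> = (\<Union>C\<in>S // r. N C)" unfolding N_def using Union_quotient[OF eqv] by blast
  finally show ?thesis .
 qed
 hence "card {D : Dat. sd_semistable K Q \<theta> (mk D)} = card (\<Union>C\<in>S // r. N C)" by simp
 also have "\<dots> = (\<Sum>C\<in>S // r. card (N C))"
 proof (rule card_UN_disjoint[OF fin])
  show "\<forall>C\<in>S // r. finite (N C)" using finite_Dat by (simp add: N_def)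
  show "\<forall>C\<in>S // r. \<forall>C'\<in>S // r. C \<noteq> C' \<longrightarrow> N C \<inter> N C' = {}"
   unfolding N_def using quotient_disj[OF eqv] by blast
 qed
 finally have "real (card {D : Dat. sd_semistable K Q \<theta> (mk D)}) / G = (\<Sum>C\<in>S // r. real (card (N C)) / G)"
  by (simp add: sum_divide_distrib)
 also have "\<dots> = (\<Sum>C\<in>S // r. 1 / real (card (Aut_S K Q (SOME M. M : C))))"
  by (intro sum.cong refl) (rule cls[symmetric])
 finally show ?thesis unfolding isometry_classes_def S_def[symmetric] r_def[symmetric] G_def[symmetric] by simp
qed

end

section \<open>The maximal destabilising subrepresentation\<close>

context finite_field
begin

definition ssum :: "('k, 'm, 'z) module_scheme => 'm set => 'm set => 'm set" where
 "ssum V U W = (%(x, y). x \<oplus>\<^bsub>V\<^esub> y) ` (U \<times> W)"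

lemma ssumI: "x : U ==> y : W ==> x \<oplus>\<^bsub>V\<^esub> y : ssum V U W"
 by (auto simp: ssum_def)

lemma ssumE:
 assumes "z : ssum V U W"
 obtains x y where "x : U" "y : W" "z = x \<oplus>\<^bsub>V\<^esub> y"
 using assms by (auto simp: ssum_def)

lemma subspace_ssum:
 assumes U: "subspace K U V" and W: "subspace K W V"
 shows "subspace K (ssum V U W) V"
proof (rule subspaceI)
 note V = subspace_D(1)[OF U] and D = subspace_D[OF U] and E = subspace_D[OF W]
 show "vectorspace K V" by (rule V)
 show "ssum V U W \<subseteq> carrier V" using subspace_D(5)[OF subspace_carrier[OF V]] D(2) E(2) by (auto simp: ssum_def)
 show "\<zero>\<^bsub>V\<^esub> : ssum V U W" using ssumI[OF D(3) E(3), of V] D(4)[OF D(3)] vs_simps(1)[OF V] by simp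
 fix z z' assume "z : ssum V U W" "z' : ssum V U W"
 then obtain x y x' y' where e: "x : U" "y : W" "z = x \<oplus>\<^bsub>V\<^esub> y" "x' : U" "y' : W" "z' = x' \<oplus>\<^bsub>V\<^esub> y'" by (elim ssumE)
 have "z \<oplus>\<^bsub>V\<^esub> z' = (x \<oplus>\<^bsub>V\<^esub> x') \<oplus>\<^bsub>V\<^esub> (y \<oplus>\<^bsub>V\<^esub> y')"
  using e D(4)[of x] D(4)[of x'] E(4)[of y] E(4)[of y'] subspace_D(5)[OF subspace_carrier[OF V]] by (simp add: vs_ac[OF V])
 thus "z \<oplus>\<^bsub>V\<^esub> z' : ssum V U W" using ssumI[OF D(5) E(5)] e by metis
next
 note V = subspace_D(1)[OF U] and D = subspace_D[OF U] and E = subspace_D[OF W]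
 fix c z assume c: "c : carrier K" and "z : ssum V U W"
 then obtain x y where e: "x : U" "y : W" "z = x \<oplus>\<^bsub>V\<^esub> y" by (elim ssumE)
 show "c \<odot>\<^bsub>V\<^esub> z : ssum V U W"
  unfolding e(3) vs_distrib(2)[OF V c D(4)[OF e(1)] E(4)[OF e(2)]] by (rule ssumI[OF D(6)[OF c e(1)] E(6)[OF c e(2)]])
qed

text \<open>Addition maps \<open>U \<times> W\<close> onto the sum, and each of its fibres is a copy
  of the intersection, a translate of the pairs (u, -u).\<close>

lemma sdim_modular:
 assumes U: "subspace K U V" "finite U" and W: "subspace K W V" "finite W"
 shows "sdim (U \<inter> W) + sdim (ssum V U W) = sdim U + sdim W"
proof -
 note V = subspace_D(1)[OF U(1)] and D = subspace_D[OF U(1)] and E = subspace_D[OF W(1)]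
 note cl = subspace_D(5)[OF subspace_carrier[OF V]] and neg = vs_neg[OF V]
 have fS: "finite (ssum V U W)" unfolding ssum_def using U(2) W(2) by simp
 have "card (U \<times> W) = card (ssum V U W) * card (U \<inter> W)"
 proof (rule card_fibres[OF fS, where f = "%(x, y). x \<oplus>\<^bsub>V\<^esub> y"])
  show "(case p of (x, y) => x \<oplus>\<^bsub>V\<^esub> y) : ssum V U W" if "p : U \<times> W" for p using that by (auto simp: ssum_def)
  show "finite (U \<times> W)" using U(2) W(2) by simp
  fix z assume "z : ssum V U W"
  then obtain x0 y0 where z: "x0 : U" "y0 : W" "z = x0 \<oplus>\<^bsub>V\<^esub> y0" by (elim ssumE)
  note x0 = D(4)[OF z(1)] and y0 = E(4)[OF z(2)]
  have m1: "\<ominus> \<one> : carrier K" by simp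
  \<comment> \<open>The difference of first components from a fixed pair with sum \<open>z\<close>.
    It lies in \<open>U\<close>, and by \<open>key\<close> it is minus the difference of second
    components, so it also lies in \<open>W\<close>.\<close>
  let ?g = "%p. fst p \<oplus>\<^bsub>V\<^esub> (\<ominus> \<one>) \<odot>\<^bsub>V\<^esub> x0"
  have key: "x \<oplus>\<^bsub>V\<^esub> (\<ominus> \<one>) \<odot>\<^bsub>V\<^esub> x0 = y0 \<oplus>\<^bsub>V\<^esub> (\<ominus> \<one>) \<odot>\<^bsub>V\<^esub> y"
   if x: "x : carrier V" and y: "y : carrier V" and eq: "x \<oplus>\<^bsub>V\<^esub> y = x0 \<oplus>\<^bsub>V\<^esub> y0" for x y
  proof -
   let ?a = "(\<ominus> \<one>) \<odot>\<^bsub>V\<^esub> x0" and ?b = "(\<ominus> \<one>) \<odot>\<^bsub>V\<^esub> y"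
   have ab: "?a : carrier V" "?b : carrier V" using neg(1) x0 y by auto
   have "x \<oplus>\<^bsub>V\<^esub> ?a = (x \<oplus>\<^bsub>V\<^esub> ?a) \<oplus>\<^bsub>V\<^esub> (y \<oplus>\<^bsub>V\<^esub> ?b)" by (simp add: neg(2)[OF y] vs_simps[OF V] cl x ab)
   also have "\<dots> = (x \<oplus>\<^bsub>V\<^esub> y) \<oplus>\<^bsub>V\<^esub> (?a \<oplus>\<^bsub>V\<^esub> ?b)" by (simp add: vs_ac[OF V] cl x y ab)
   also have "\<dots> = (x0 \<oplus>\<^bsub>V\<^esub> ?a) \<oplus>\<^bsub>V\<^esub> (y0 \<oplus>\<^bsub>V\<^esub> ?b)" unfolding eq by (simp add: vs_ac[OF V] cl x0 y0 ab)
   also have "\<dots> = y0 \<oplus>\<^bsub>V\<^esub> ?b" by (simp add: neg(2)[OF x0] vs_simps[OF V] cl y0 ab)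
   finally show ?thesis .
  qed
  let ?F = "{p : U \<times> W. (case p of (x, y) => x \<oplus>\<^bsub>V\<^esub> y) = z}"
  have bk: "x \<oplus>\<^bsub>V\<^esub> (\<ominus> \<one>) \<odot>\<^bsub>V\<^esub> x0 \<oplus>\<^bsub>V\<^esub> x0 = x" if "x : carrier V" for x
   using vs_ac(2)[OF V that neg(1)[OF x0] x0] by (simp add: neg(3)[OF x0] vs_simps[OF V] that)
  have "bij_betw ?g ?F (U \<inter> W)"
  proof (rule bij_betw_imageI)
   show "inj_on ?g ?F"
   proof (rule inj_onI)
    fix p p' assume p: "p : ?F" "p' : ?F" and eq: "?g p = ?g p'"
    have c: "fst p : carrier V" "snd p : carrier V" "fst p' : carrier V" "snd p' : carrier V"
     using p D(4) E(4) by auto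
    have s: "fst p \<oplus>\<^bsub>V\<^esub> snd p = x0 \<oplus>\<^bsub>V\<^esub> y0" "fst p' \<oplus>\<^bsub>V\<^esub> snd p' = x0 \<oplus>\<^bsub>V\<^esub> y0" using p z(3) by auto
    have f: "fst p = fst p'" by (rule trans[OF bk[OF c(1), symmetric] trans[OF arg_cong[OF eq, of "%u. u \<oplus>\<^bsub>V\<^esub> x0"] bk[OF c(3)]]])
    have cn: "(\<ominus> \<one>) \<odot>\<^bsub>V\<^esub> fst p \<oplus>\<^bsub>V\<^esub> (fst p \<oplus>\<^bsub>V\<^esub> y) = y" if "y : carrier V" for y
     unfolding vs_ac(2)[OF V neg(1)[OF c(1)] c(1) that, symmetric] neg(3)[OF c(1)] by (rule vs_simps(2)[OF V that])
    have e: "fst p \<oplus>\<^bsub>V\<^esub> snd p = fst p \<oplus>\<^bsub>V\<^esub> snd p'" by (rule trans[OF s(1) trans[OF s(2)[symmetric]]]) (simp only: f)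
    have "snd p = snd p'"
     by (rule trans[OF cn[OF c(2), symmetric] trans[OF arg_cong[OF e, of "(\<oplus>\<^bsub>V\<^esub>) ((\<ominus> \<one>) \<odot>\<^bsub>V\<^esub> fst p)"] cn[OF c(4)]]])
    thus "p = p'" using f by (simp only: prod_eq_iff)
   qed
   show "?g ` ?F = U \<inter> W"
   proof (intro equalityI subsetI)
    fix u assume "u : ?g ` ?F"
    then obtain x y where p: "x : U" "y : W" "x \<oplus>\<^bsub>V\<^esub> y = z" "u = x \<oplus>\<^bsub>V\<^esub> (\<ominus> \<one>) \<odot>\<^bsub>V\<^esub> x0" by auto
    have "u : U" unfolding p(4) by (rule D(5)[OF p(1) D(6)[OF m1 z(1)]])
    moreover have "u : W" unfolding p(4) key[OF D(4)[OF p(1)] E(4)[OF p(2)] p(3)[unfolded z(3)]]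
     by (rule E(5)[OF z(2) E(6)[OF m1 p(2)]])
    ultimately show "u : U \<inter> W" ..
   next
    fix u assume u: "u : U \<inter> W"
    have uc: "u : carrier V" using u D(4) by blast
    have "(u \<oplus>\<^bsub>V\<^esub> x0) \<oplus>\<^bsub>V\<^esub> (y0 \<oplus>\<^bsub>V\<^esub> (\<ominus> \<one>) \<odot>\<^bsub>V\<^esub> u) = (u \<oplus>\<^bsub>V\<^esub> (\<ominus> \<one>) \<odot>\<^bsub>V\<^esub> u) \<oplus>\<^bsub>V\<^esub> (x0 \<oplus>\<^bsub>V\<^esub> y0)"
     by (simp add: vs_ac[OF V] cl x0 y0 uc neg(1)[OF uc])
    also have "\<dots> = z" by (simp add: neg(2)[OF uc] vs_simps[OF V] cl x0 y0 z(3))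
    finally have "(u \<oplus>\<^bsub>V\<^esub> x0, y0 \<oplus>\<^bsub>V\<^esub> (\<ominus> \<one>) \<odot>\<^bsub>V\<^esub> u) : ?F"
     using D(5)[of u x0] E(5)[of y0] E(6)[OF m1, of u] u z by simp
    moreover have "u = ?g (u \<oplus>\<^bsub>V\<^esub> x0, y0 \<oplus>\<^bsub>V\<^esub> (\<ominus> \<one>) \<odot>\<^bsub>V\<^esub> u)"
     using vs_ac(2)[OF V uc x0 neg(1)[OF x0]] by (simp add: neg(2)[OF x0] vs_simps[OF V] uc)
    ultimately show "u : ?g ` ?F" by (rule rev_image_eqI)
   qed
  qed
  thus "card ?F = card (U \<inter> W)" by (rule bij_betw_same_card)
 qed
 moreover have "finite (U \<inter> W)" using U(2) by simp
 ultimately have "q ^ sdim U * q ^ sdim W = q ^ sdim (ssum V U W) * q ^ sdim (U \<inter> W)"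
  unfolding card_subspace[OF subspace_ssum[OF U(1) W(1)] fS, symmetric] card_subspace[OF U, symmetric] card_subspace[OF W, symmetric]
  using card_subspace[OF subspace_Int[OF U(1) W(1)]] by (simp add: card_cartesian_product)
 hence "q ^ (sdim (U \<inter> W) + sdim (ssum V U W)) = q ^ (sdim U + sdim W)" by (simp add: power_add mult_ac)
 thus ?thesis using q_gt_1 by simp
qed

end

locale quiver_stab = quiver_data K Q s0 s1 s \<tau> d
 for K :: "'k ring" (structure) and Q :: "('v, 'a) pre_digraph"
  and s0 :: "'v => 'v" and s1 :: "'a => 'a" and s :: "'v => int" and \<tau> :: "'a => int" and d +
 fixes \<theta> :: "('v => int) => int" and P0 :: "'v set" and P1 :: "'a set"
 assumes compat: "compatible_stability Q s0 \<theta>" and splitting: "involution_splitting Q s0 s1 P0 P1"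
  and d_even: "\<And>i. i : QV ==> s0 i = i ==> s i = -1 ==> even (d i)"
begin

text \<open>Graded subspaces, ordered by pointwise inclusion. Off the nodes all of them take the
  same default value, so the order compares the subspaces at the nodes only.\<close>

definition Gr :: "('v => (nat => 'k) set) set" where
 "Gr = (\<Pi>\<^sub>E i\<in>QV. {U. subspace K U (V i)})"

definition dimv :: "('v => (nat => 'k) set) => 'v => int" where
 "dimv U = (%i. if i : QV then int (sdim (U i)) else 0)"

definition stable :: "('a => (nat => 'k) => (nat => 'k)) => ('v => (nat => 'k) set) => bool" where
 "stable m U \<longleftrightarrow> (\<forall>al\<in>QA. m al ` U (src al) \<subseteq> U (tgt al))"

definition isot :: "('v => (nat => 'k) => (nat => 'k) => 'k) => ('v => (nat => 'k) set) => bool" where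
 "isot b U \<longleftrightarrow> (\<forall>i\<in>QV. \<forall>x\<in>U i. \<forall>y\<in>U (s0 i). b i x y = \<zero>)"

text \<open>The poset of destabilising isotropic subrepresentations; semistability means that it is
  empty.\<close>

definition PD where
 "PD D = {U : Gr. \<theta> (dimv U) > 0 \<and> stable (fst D) U \<and> isot (snd D) U}"

lemma Gr_D:
 assumes "U : Gr" "i : QV"
 shows "subspace K (U i) (V i)" "U i \<subseteq> VC i" "finite (U i)" "sdim (U i) \<le> n i"
proof -
 show *: "subspace K (U i) (V i)" using PiE_mem[OF assms(1)[unfolded Gr_def] assms(2)] by simp
 show **: "U i \<subseteq> VC i" by (rule subspace_D(2)[OF *])
 show "finite (U i)" by (rule finite_subset[OF ** finite_V])
 show "sdim (U i) \<le> n i" using sdim_mono[OF * V_subspace finite_V **] by (simp add: sdim_V)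
qed

lemma GrI: "U : extensional (QV) ==> (\<And>i. i : QV ==> subspace K (U i) (V i)) ==> U : Gr"
 unfolding Gr_def by (simp add: PiE_iff)

lemma finite_Gr: "finite Gr"
proof -
 have "finite {U. subspace K U (V i)}" for i
  by (rule finite_subset[of _ "Pow (VC i)"]) (use finite_V subspace_D(2) in auto)
 thus ?thesis unfolding Gr_def by (intro finite_PiE finite_verts)
qed

lemma finite_PD: "finite (PD D)"
 by (rule finite_subset[OF _ finite_Gr]) (auto simp: PD_def)

lemma Lam_simps: "d : Lam Q" "dimv U : Lam Q" "x : Lam Q ==> y : Lam Q ==> x + y : Lam Q"
 "x : Lam Q ==> inv_act Q s0 x : Lam Q" "0 : Lam Q"
 by (auto simp: Lam_def dimv_def inv_act_def d_D)

lemma theta_add: "x : Lam Q ==> y : Lam Q ==> \<theta> (x + y) = \<theta> x + \<theta> y"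
 using compat unfolding compatible_stability_def stability_def by blast

lemma theta_inv: "x : Lam Q ==> \<theta> (inv_act Q s0 x) = - \<theta> x"
 using compat unfolding compatible_stability_def by blast

lemma theta_zero: "\<theta> 0 = 0" "\<theta> d = 0"
proof -
 show "\<theta> 0 = 0" using theta_add[OF Lam_simps(5) Lam_simps(5)] by simp
 have "inv_act Q s0 d = d" using d_inv by (simp add: Lam_inv_pos_def)
 thus "\<theta> d = 0" using theta_inv[OF Lam_simps(1)] by simp
qed

text \<open>For the zero vector the division by zero gives slope 0, in accordance with
  \<open>\<theta> 0 = 0\<close>; otherwise the denominator is positive.\<close>

lemma slope_pos_iff:
 assumes "x : Lam_pos Q"
 shows "slope Q \<theta> x > 0 \<longleftrightarrow> \<theta> x > 0"
proof -
 have x: "x : Lam Q" "\<And>i. 0 \<le> x i" using assms by (auto simp: Lam_pos_def)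
 have S: "0 \<le> (\<Sum>i\<in>QV. x i)" by (rule sum_nonneg) (rule x(2))
 show ?thesis
 proof (cases "(\<Sum>i\<in>QV. x i) = 0")
  case True
  hence "x i = 0" for i using x sum_nonneg_eq_0_iff[OF finite_verts, of x] by (cases "i : QV") (auto simp: Lam_def)
  hence "x = 0" by (simp add: fun_eq_iff)
  thus ?thesis by (simp add: theta_zero slope_def)
 next
  case False
  hence "(0 :: rat) < of_int (\<Sum>i\<in>QV. x i)" unfolding of_int_0_less_iff using S by linarith
  thus ?thesis unfolding slope_def by (simp add: zero_less_divide_iff del: of_int_sum)
 qed
qed

lemma dimv_pos: "dimv U : Lam_pos Q"
 by (simp add: Lam_pos_def Lam_simps) (simp add: dimv_def)

lemma isotropic_mk:
 assumes D: "D : Dat" and U: "\<And>i. i : QV ==> subspace K (U i) (V i)"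
 shows "isotropic K Q (mk D) U \<longleftrightarrow> isot (snd D) U"
proof
 assume I: "isotropic K Q (mk D) U"
 show "isot (snd D) U" unfolding isot_def
 proof (intro ballI)
  fix i x y assume i: "i : QV" and x: "x : U i" and y: "y : U (s0 i)"
  have e: "embed Q (mk D) j z : (\<Pi>\<^sub>E i\<in>QV. U i)" if "z : U j" for z j
   unfolding embed_def using that subspace_D(3)[OF U] by auto
  have xV: "x : VC i" and yV: "y : VC (s0 i)"
   by (rule subspace_D(4)[OF U[OF i] x], rule subspace_D(4)[OF U[OF node_closed[OF i]] y])
  have "snd D i x y = form (mk D) (embed Q (mk D) i x) (embed Q (mk D) (s0 i) y)"
   using bf_mk[OF D i xV yV] unfolding bf_def by simp
  also have "\<dots> = \<zero>" using I e[OF x] e[OF y] unfolding isotropic_def by blast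
  finally show "snd D i x y = \<zero>" .
 qed
next
 assume I: "isot (snd D) U"
 show "isotropic K Q (mk D) U" unfolding isotropic_def
 proof (intro ballI)
  fix x y assume xy: "x : (\<Pi>\<^sub>E i\<in>QV. U i)" "y : (\<Pi>\<^sub>E i\<in>QV. U i)"
  have "snd D i (x i) (y (s0 i)) = \<zero>" if "i : QV" for i
   using I PiE_mem[OF xy(1) that] PiE_mem[OF xy(2) node_closed[OF that]] that unfolding isot_def by blast
  hence "form (mk D) x y = (\<Oplus>i\<in>QV. \<zero>)" unfolding mk_simps by (intro finsum_cong') auto
  thus "form (mk D) x y = \<zero>" by simp
 qed
qed

text \<open>Positivity of \<open>\<theta>\<close> excludes the zero subspace, which matches the
  nonzero condition in the definition of semistability.\<close>

lemma semistable_iff: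
 assumes D: "D : Dat"
 shows "sd_semistable K Q \<theta> (mk D) \<longleftrightarrow> PD D = {}"
proof
 assume ss: "sd_semistable K Q \<theta> (mk D)"
 show "PD D = {}"
 proof (rule ccontr)
  assume "PD D \<noteq> {}"
  then obtain U where U: "U : Gr" "\<theta> (dimv U) > 0" "stable (fst D) U" "isot (snd D) U" by (auto simp: PD_def)
  have sub: "is_subrep K Q (mk D) U" using Gr_D(1)[OF U(1)] U(3) by (simp add: is_subrep_def stable_def)
  have "nonzero_subrep Q (mk D) U"
  proof (rule ccontr)
   assume "\<not> nonzero_subrep Q (mk D) U"
   hence "dimv U = 0" by (auto simp: nonzero_subrep_def dimv_def fun_eq_iff sdim_zero)
   thus False using U(2) theta_zero by simp
  qed
  hence "slope Q \<theta> (dim_vec K Q (sub_rep (mk D) U)) \<le> 0"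
   using ss sub isotropic_mk[OF D Gr_D(1)[OF U(1)]] U(4) unfolding sd_semistable_def by blast
  hence "slope Q \<theta> (dimv U) \<le> 0" unfolding dim_vec_sub_rep[OF is_rep_mk[OF D] sub] dimv_def .
  thus False using slope_pos_iff[OF dimv_pos, of U] U(2) by simp
 qed
next
 assume E: "PD D = {}"
 show "sd_semistable K Q \<theta> (mk D)" unfolding sd_semistable_def
 proof (intro allI impI)
  fix U assume U: "is_subrep K Q (mk D) U \<and> nonzero_subrep Q (mk D) U \<and> isotropic K Q (mk D) U"
  have s: "subspace K (U i) (V i)" if "i : QV" for i using U that by (simp add: is_subrep_def)
  define U' where "U' = restrict U (QV)"
  have G: "U' : Gr" by (rule GrI) (simp_all add: U'_def s)
  have "stable (fst D) U'" using U tail_head_verts by (simp add: U'_def stable_def is_subrep_def)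
  moreover have "isot (snd D) U'" using U isotropic_mk[OF D s] node_closed by (simp add: U'_def isot_def)
  ultimately have "\<not> \<theta> (dimv U') > 0" using E G by (auto simp: PD_def)
  hence "\<not> slope Q \<theta> (dimv U') > 0" using slope_pos_iff[OF dimv_pos] by simp
  moreover have "dimv U' = dim_vec K Q (sub_rep (mk D) U)"
   unfolding dim_vec_sub_rep[OF is_rep_mk[OF D] conjunct1[OF U]] by (auto simp: dimv_def U'_def)
  ultimately show "slope Q \<theta> (dim_vec K Q (sub_rep (mk D) U)) \<le> 0" by simp
 qed
qed

text \<open>Additivity of \<open>\<theta>\<close> combined with the modular law for dimensions at
  each node.\<close>

lemma theta_modular:
 assumes U: "U : Gr" and W: "W : Gr"
 shows "inf U W : Gr" "(\<lambda>i\<in>QV. ssum (V i) (U i) (W i)) : Gr"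
  "\<theta> (dimv (inf U W)) + \<theta> (dimv (\<lambda>i\<in>QV. ssum (V i) (U i) (W i))) = \<theta> (dimv U) + \<theta> (dimv W)"
proof -
 \<comment> \<open>The default value off the nodes is idempotent under intersection, so
   \<open>inf\<close> stays extensional.\<close>
 have "U i \<inter> W i = undefined" if "i \<notin> QV" for i
  using PiE_arb[OF U[unfolded Gr_def] that] PiE_arb[OF W[unfolded Gr_def] that] by simp
 thus "inf U W : Gr" by (intro GrI) (auto simp: extensional_def intro: subspace_Int Gr_D(1)[OF U] Gr_D(1)[OF W])
 show "(\<lambda>i\<in>QV. ssum (V i) (U i) (W i)) : Gr" by (rule GrI) (simp_all add: subspace_ssum Gr_D(1)[OF U] Gr_D(1)[OF W])
 have "dimv (inf U W) + dimv (\<lambda>i\<in>QV. ssum (V i) (U i) (W i)) = dimv U + dimv W"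
 proof
  fix i show "(dimv (inf U W) + dimv (\<lambda>i\<in>QV. ssum (V i) (U i) (W i))) i = (dimv U + dimv W) i"
  proof (cases "i : QV")
   case True
   from arg_cong[OF sdim_modular[OF Gr_D(1,3)[OF U True] Gr_D(1,3)[OF W True]], of int] True
   show ?thesis by (simp add: dimv_def)
  qed (simp add: dimv_def)
 qed
 from arg_cong[OF this, of \<theta>]
 show "\<theta> (dimv (inf U W)) + \<theta> (dimv (\<lambda>i\<in>QV. ssum (V i) (U i) (W i))) = \<theta> (dimv U) + \<theta> (dimv W)"
  unfolding theta_add[OF Lam_simps(2) Lam_simps(2)] .
qed

lemma stable_modular:
 assumes D: "D : Dat" and U: "U : Gr" "stable (fst D) U" and W: "W : Gr" "stable (fst D) W"
 shows "stable (fst D) (inf U W)" "stable (fst D) (\<lambda>i\<in>QV. ssum (V i) (U i) (W i))"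
proof -
 show "stable (fst D) (inf U W)" using U(2) W(2) unfolding stable_def inf_fun_def by blast
 show "stable (fst D) (\<lambda>i\<in>QV. ssum (V i) (U i) (W i))" unfolding stable_def
 proof (intro ballI image_subsetI)
  fix al z assume al: "al : QA" and z: "z : (\<lambda>i\<in>QV. ssum (V i) (U i) (W i)) (src al)"
  note th = tail_head_verts[OF al]
  obtain x y where xy: "x : U (src al)" "y : W (src al)" "z = x \<oplus>\<^bsub>V (src al)\<^esub> y"
   using z unfolding restrict_apply'[OF th(1)] by (rule ssumE)
  have "fst D al z = fst D al x \<oplus>\<^bsub>V (tgt al)\<^esub> fst D al y" unfolding xy(3)
   by (rule lin_D(2)[OF Dat_lin[OF D al] subsetD[OF Gr_D(2)[OF U(1) th(1)] xy(1)] subsetD[OF Gr_D(2)[OF W(1) th(1)] xy(2)]])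
  also have "\<dots> : ssum (V (tgt al)) (U (tgt al)) (W (tgt al))"
  proof (rule ssumI)
   show "fst D al x : U (tgt al)" using U(2) al xy(1) unfolding stable_def by blast
   show "fst D al y : W (tgt al)" using W(2) al xy(2) unfolding stable_def by blast
  qed
  finally show "fst D al z : (\<lambda>i\<in>QV. ssum (V i) (U i) (W i)) (tgt al)" using th(2) by simp
 qed
qed

text \<open>Stability of the complement comes from the adjointness of the maps of \<open>al\<close>
  and \<open>s1 al\<close>. Its dimension vector is \<open>d\<close> minus the image of
  \<open>dimv U\<close> under the involution; as \<open>\<theta>\<close> changes sign under the
  involution and vanishes at \<open>d\<close>, it takes the same value on both.\<close>

lemma perp_graded:
 assumes D: "D : Dat" and U: "U : Gr" "stable (fst D) U"
 defines "U' \<equiv> (\<lambda>i\<in>QV. perp (snd D (s0 i)) (U (s0 i)) (VC i))"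
 shows "U' : Gr" "stable (fst D) U'" "\<theta> (dimv U') = \<theta> (dimv U)"
proof -
 have pf: "subspace K (perp (snd D (s0 i)) (U (s0 i)) (VC i)) (V i)"
  "sdim (U (s0 i)) + sdim (perp (snd D (s0 i)) (U (s0 i)) (VC i)) = n i" if i: "i : QV" for i
 proof -
  note j = node_closed[OF i]
  have b: "snd D (s0 i) : BV (s0 i) i" and nd: "ndV (s0 i) i (snd D (s0 i))"
   using Dat_D(2)[OF D j] Dat_D(4)[OF D j] unfolding node_invol[OF i] .
  have sd: "sdim (VC (s0 i)) = sdim (VC i)" by (simp add: sdim_V n_sigma[OF i])
  note p = perp_facts[OF b V_subspace finite_V V_subspace finite_V sd nd Gr_D(1)[OF U(1) j] Gr_D(2)[OF U(1) j]]
  show "subspace K (perp (snd D (s0 i)) (U (s0 i)) (VC i)) (V i)" by (rule p(1))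
  show "sdim (U (s0 i)) + sdim (perp (snd D (s0 i)) (U (s0 i)) (VC i)) = n i" using p(3) by (simp add: sdim_V)
 qed
 show "U' : Gr" unfolding U'_def by (rule GrI) (simp_all add: pf)
 show "stable (fst D) U'" unfolding stable_def
 proof (intro ballI image_subsetI)
  fix al y assume al: "al : QA" and y: "y : U' (src al)"
  note th = tail_head_verts[OF al] and a' = arrow_closed[OF al]
  have y': "y : VC (src al)" "\<And>x. x : U (s0 (src al)) ==> snd D (s0 (src al)) x y = \<zero>"
   using y th(1) by (auto simp: U'_def perp_def)
  have my: "fst D al y : VC (tgt al)" by (rule lin_D(1)[OF Dat_lin[OF D al] y'(1)])
  have "snd D (s0 (tgt al)) x (fst D al y) = \<zero>" if x: "x : U (s0 (tgt al))" for x
  proof -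
   have xV: "x : VC (s0 (tgt al))" using Gr_D(2)[OF U(1) node_closed[OF th(2)]] x by blast
   have mx: "fst D (s1 al) x : U (s0 (src al))"
   proof -
    have "fst D (s1 al) ` U (src (s1 al)) \<subseteq> U (tgt (s1 al))" using U(2) a' unfolding stable_def by blast
    thus ?thesis unfolding tail_invol[OF al] head_invol[OF al] using x by blast
   qed
   have c: "snd D (s0 (tgt al)) x (fst D al y) : carrier K"
    by (rule Bil_D(3)[OF Dat_D(2)[OF D node_closed[OF th(2)]] xV]) (simp add: node_invol[OF th(2)] my)
   have "snd D (tgt (s1 al)) (fst D (s1 al) x) y = sg (\<tau> (s1 al)) (snd D (src (s1 al)) x (fst D (s1 (s1 al)) y))"
    by (rule Dat_D(5)[OF D a']) (simp_all add: tail_invol[OF al] head_invol[OF al] xV node_invol[OF th(1)] y'(1))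
   hence "sg (\<tau> (s1 al)) (snd D (s0 (tgt al)) x (fst D al y)) = \<zero>"
    unfolding tail_invol[OF al] head_invol[OF al] arrow_invol[OF al] y'(2)[OF mx] by (rule sym)
   thus ?thesis using c by (auto simp: sg_def split: if_splits)
  qed
  thus "fst D al y : U' (tgt al)" using my th(2) by (simp add: U'_def perp_def)
 qed
 have "dimv U' + inv_act Q s0 (dimv U) = d"
 proof
  fix i show "(dimv U' + inv_act Q s0 (dimv U)) i = d i"
  proof (cases "i : QV")
   case True
   have "int (sdim (U (s0 i)) + sdim (perp (snd D (s0 i)) (U (s0 i)) (VC i))) = d i"
    unfolding pf(2)[OF True] n_def using d_D(2) by simp
   thus ?thesis using True node_closed[OF True] by (simp add: dimv_def inv_act_def U'_def)
  qed (simp add: dimv_def inv_act_def d_D)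
 qed
 from arg_cong[OF this, of \<theta>] have "\<theta> (dimv U') + \<theta> (inv_act Q s0 (dimv U)) = \<theta> d"
  unfolding theta_add[OF Lam_simps(2) Lam_simps(4)[OF Lam_simps(2)]] .
 thus "\<theta> (dimv U') = \<theta> (dimv U)" by (simp add: theta_inv[OF Lam_simps(2)] theta_zero)
qed

text \<open>The cone point is the smallest maximiser \<open>W\<close> of \<open>\<theta>\<close> among all stable graded subspaces; it is
 isotropic because \<open>\<theta>\<close> takes the same value on its orthogonal complement.\<close>

theorem chain_sum_PD:
 assumes D: "D : Dat"
 shows "chain_sum (PD D) = (if sd_semistable K Q \<theta> (mk D) then 1 else 0)"
proof (cases "PD D = {}")
 case True
 thus ?thesis using semistable_iff[OF D] by simp
next
 case False
 define S where "S = {U : Gr. stable (fst D) U}"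
 have fS: "finite S" unfolding S_def using finite_Gr by simp
 have S0: "S \<noteq> {}" using False by (auto simp: S_def PD_def)
 define f where "f = (%U. \<theta> (dimv U))"
 define M where "M = Max (f ` S)"
 have M: "f U \<le> M" if "U : S" for U unfolding M_def using fS that by simp
 have "M : f ` S" unfolding M_def using fS S0 by (intro Max_in) auto
 hence ne: "{U : S. f U = M} \<noteq> {}" by auto
 obtain W where W: "W : {U : S. f U = M}" "\<And>U. U : {U : S. f U = M} ==> U \<le> W ==> W = U"
  using finite_has_minimal[of "{U : S. f U = M}"] fS ne by auto
 have WS: "W : Gr" "stable (fst D) W" "W : S" "f W = M" using W(1) by (auto simp: S_def)
 \<comment> \<open>The sum of \<open>U\<close> and \<open>W\<close> has value at most
   \<open>f W\<close>, so modularity leaves at least \<open>f U\<close> for the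
   intersection.\<close>
 have cl: "inf U W : S" "f (inf U W) \<ge> f U" if U: "U : S" for U
 proof -
  have U': "U : Gr" "stable (fst D) U" using U by (auto simp: S_def)
  note t = theta_modular[OF U'(1) WS(1)] and st = stable_modular[OF D U' WS(1,2)]
  show "inf U W : S" using t(1) st(1) by (simp add: S_def)
  have "(\<lambda>i\<in>QV. ssum (V i) (U i) (W i)) : S" using t(2) st(2) by (simp add: S_def)
  from M[OF this] t(3) WS(4) show "f (inf U W) \<ge> f U" unfolding f_def by linarith
 qed
 \<comment> \<open>The intersection with another maximiser is again a maximiser, so the minimal one
   is the least.\<close>
 have least: "W \<le> U" if U: "U : S" "f U = M" for U
 proof -
  have "f (inf U W) = M" using cl[OF U(1)] M[OF cl(1)[OF U(1)]] U(2) by linarith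
  hence "W = inf U W" using W(2)[of "inf U W"] cl(1)[OF U(1)] by simp
  thus ?thesis by (metis inf_le1)
 qed
 have iso: "isot (snd D) W"
 proof -
  note p = perp_graded[OF D WS(1,2)]
  have le: "W \<le> (\<lambda>i\<in>QV. perp (snd D (s0 i)) (W (s0 i)) (VC i))"
   by (rule least) (use p WS(4) in \<open>simp_all add: S_def f_def\<close>)
  show ?thesis unfolding isot_def
  proof (intro ballI)
   fix i x y assume i: "i : QV" and x: "x : W i" and y: "y : W (s0 i)"
   have "y : perp (snd D i) (W i) (VC (s0 i))"
    using le_funD[OF le, of "s0 i"] y node_closed[OF i] by (auto simp: node_invol[OF i])
   thus "snd D i x y = \<zero>" using x by (simp add: perp_def)
  qed
 qed
 obtain U0 where U0: "U0 : PD D" using False by blast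
 have "f W > 0" using M[of U0] U0 WS(4) by (auto simp: S_def PD_def f_def)
 hence WP: "W : PD D" using WS iso by (simp add: PD_def f_def)
 have "chain_sum (PD D) = 0"
 proof (rule chain_sum_cone[OF finite_PD WP])
  fix U assume U: "U : PD D"
  hence US: "U : S" "f U > 0" by (auto simp: S_def PD_def f_def)
  have "isot (snd D) (inf U W)" using iso by (auto simp: isot_def)
  hence m: "inf U W : PD D" using cl[OF US(1)] US(2) by (auto simp: PD_def S_def f_def)
  show "\<exists>m\<in>PD D. m \<le> U \<and> m \<le> W \<and> (\<forall>z\<in>PD D. z \<le> U \<longrightarrow> z \<le> W \<longrightarrow> z \<le> m)"
   by (rule bexI[OF _ m]) (intro conjI ballI impI le_infI inf_le1 inf_le2)
 qed
 thus ?thesis using False semistable_iff[OF D] by simp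
qed

end

section \<open>Self-dual structures compatible with a flag\<close>

context quiver_stab
begin

text \<open>The zero space is put in front of the flag, so member \<open>k\<close> is at list
  position \<open>k - 1\<close>.\<close>

definition uk :: "('v => (nat => 'k) set) list => 'v => nat => (nat => 'k) set" where
 "uk xs i k = (if k = 0 then {\<zero>\<^bsub>V i\<^esub>} else (xs ! (k - 1)) i)"

text \<open>The flag extended by its orthogonal complements.\<close>

definition fl :: "('v => (nat => 'k) set) list => ('v => (nat => 'k) => (nat => 'k) => 'k) => 'v => nat => (nat => 'k) set" where
 "fl xs b i k = (if k \<le> length xs then uk xs i k else perp (b (s0 i)) (uk xs (s0 i) (Suc (2 * length xs) - k)) (VC i))"

text \<open>The dimensions of the extended flag, expressed through those of the given flag
  alone.\<close>

definition fd :: "nat => ('v => nat => nat) => 'v => nat => nat" where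
 "fd N u i k = (if k \<le> N then u i k else n i - u (s0 i) (Suc (2 * N) - k))"

text \<open>The number of matrix positions left free, as counted by \<open>card_NZ\<close>, for
  forms on the spaces at \<open>i\<close> and \<open>j\<close> that vanish along the extended
  flags.\<close>

definition ex :: "nat => ('v => nat => nat) => 'v => 'v => nat" where
 "ex N u i j = (\<Sum>k<Suc (2 * N). (fd N u i (Suc k) - fd N u i k) * (fd N u j (Suc (2 * N)) - fd N u j (Suc (2 * N) - Suc k)))"

text \<open>Isotropy is asked of the largest member, which covers the whole flag because it
  increases.\<close>

definition Sb where
 "Sb xs i = {c : BV i (s0 i). ndV i (s0 i) c \<and>
  (orth c (uk xs i (length xs)) (uk xs (s0 i) (length xs)))}"

definition tb where
 "tb i c = (\<lambda>y\<in>VC (s0 i). \<lambda>x\<in>VC i. sg (s i) (c x y))"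

definition Bfam where
 "Bfam xs = {b : Pi\<^sub>E (QV) (Sb xs). \<forall>i\<in>QV. b (s0 i) = tb i (b i)}"

definition LM :: "('a => (nat => 'k) => (nat => 'k)) set" where
 "LM = (\<Pi>\<^sub>E al\<in>QA. LV (src al) (tgt al))"

definition adj where
 "adj b m \<longleftrightarrow> (\<forall>al\<in>QA. \<forall>x\<in>VC (src al). \<forall>y\<in>VC (s0 (tgt al)).
  b (tgt al) (m al x) y = sg (\<tau> al) (b (src al) x (m (s1 al) y)))"

definition kst where
 "kst xs m \<longleftrightarrow> (\<forall>k\<le>length xs. \<forall>al\<in>QA. \<forall>x\<in>uk xs (src al) k. m al x : uk xs (tgt al) k)"

text \<open>The image of the flag-preserving maps under the passage from \<open>m\<close> to
  \<open>b (m x) y\<close>: in the extended flag, members \<open>k\<close> and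
  \<open>Suc (2 * length xs) - k\<close> are orthogonal complements of each other.\<close>

definition Za where
 "Za xs b al = {c : BV (src al) (s0 (tgt al)).
  \<forall>k\<le>Suc (2 * length xs). orth c (fl xs b (src al) k) (fl xs b (s0 (tgt al)) (Suc (2 * length xs) - k))}"

text \<open>The signed transposition that expresses adjointness: \<open>s\<close> comes from
  exchanging the arguments of the form, \<open>\<tau>\<close> from the adjointness relation.\<close>

definition ta where
 "ta al c = (\<lambda>y\<in>VC (s0 (tgt al)). \<lambda>x\<in>VC (src al). sg (s (src al) * \<tau> al) (c x y))"

definition Wfam where
 "Wfam xs b = {z : Pi\<^sub>E (QA) (Za xs b). \<forall>al\<in>QA. z (s1 al) = ta al (z al)}"

definition tobil where
 "tobil b m = (\<lambda>al\<in>QA. \<lambda>x\<in>VC (src al). \<lambda>y\<in>VC (s0 (tgt al)). b (tgt al) (m al x) y)"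

lemmas split_D =
 splitting[unfolded involution_splitting_def fixed_nodes_def fixed_arrows_def, THEN conjunct1]
 splitting[unfolded involution_splitting_def fixed_nodes_def fixed_arrows_def, THEN conjunct2, THEN conjunct1]
 splitting[unfolded involution_splitting_def fixed_nodes_def fixed_arrows_def, THEN conjunct2, THEN conjunct2, THEN conjunct1]
 splitting[unfolded involution_splitting_def fixed_nodes_def fixed_arrows_def, THEN conjunct2, THEN conjunct2, THEN conjunct2, THEN conjunct2, THEN conjunct1]
 splitting[unfolded involution_splitting_def fixed_nodes_def fixed_arrows_def, THEN conjunct2, THEN conjunct2, THEN conjunct2, THEN conjunct2, THEN conjunct2, THEN conjunct1]
 splitting[unfolded involution_splitting_def fixed_nodes_def fixed_arrows_def, THEN conjunct2, THEN conjunct2, THEN conjunct2, THEN conjunct2, THEN conjunct2, THEN conjunct2, THEN conjunct1]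

lemma P_sub: "i : P0 ==> i : QV" "al : P1 ==> al : QA"
 using split_D(1)[THEN equalityD1] split_D(4)[THEN equalityD1] by (simp_all add: subset_iff)

context
 fixes xs
 assumes xs: "set xs \<subseteq> Gr" and chain: "sorted_wrt (<) xs"
begin

lemma uk_0: "uk xs i 0 = {\<zero>\<^bsub>V i\<^esub>}"
 by (simp add: uk_def)

lemma uk_subspace: "k \<le> length xs ==> i : QV ==> subspace K (uk xs i k) (V i)"
proof (cases k)
 case (Suc j)
 assume "k \<le> length xs" "i : QV"
 moreover from this have "xs ! j : Gr" using xs Suc nth_mem by fastforce
 ultimately show ?thesis using Gr_D(1)[of "xs ! j" i] by (simp add: uk_def Suc)
qed (simp add: uk_0 subspace_zero)

lemma uk_VC: "k \<le> length xs ==> i : QV ==> uk xs i k \<subseteq> VC i"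
 by (rule subspace_D(2)[OF uk_subspace])

lemma uk_step: "k < length xs ==> i : QV ==> uk xs i k \<subseteq> uk xs i (Suc k)"
proof (cases k)
 case 0
 assume "k < length xs" "i : QV"
 thus ?thesis using subspace_D(3)[OF uk_subspace[of "Suc k" i]] by (simp add: 0 uk_0 Suc_le_eq)
next
 case (Suc j)
 assume "k < length xs"
 hence "xs ! j < xs ! k" using sorted_wrt_nth_less[OF chain, of j k] Suc by simp
 hence "(xs ! j) i \<subseteq> (xs ! k) i" by (rule le_funD[OF less_imp_le])
 thus ?thesis by (simp add: uk_def Suc)
qed

lemma uk_mono:
 assumes "j \<le> k" "k \<le> length xs" "i : QV"
 shows "uk xs i j \<subseteq> uk xs i k"
 using assms(1,2)
proof (induction rule: dec_induct)
 case (step k)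
 have "uk xs i j \<subseteq> uk xs i k" using step by simp
 also have "\<dots> \<subseteq> uk xs i (Suc k)" using uk_step[OF _ assms(3), of k] step by simp
 finally show ?case .
qed simp

lemma isot_iff:
 assumes b: "\<And>i. i : QV ==> b i : BV i (s0 i)"
 shows "(\<forall>U\<in>set xs. isot b U) \<longleftrightarrow> (\<forall>i\<in>QV. \<forall>x\<in>uk xs i (length xs). \<forall>y\<in>uk xs (s0 i) (length xs). b i x y = \<zero>)"
proof (intro iffI ballI)
 fix i x y assume A: "\<forall>U\<in>set xs. isot b U" and i: "i : QV" and x: "x : uk xs i (length xs)" and y: "y : uk xs (s0 i) (length xs)"
 show "b i x y = \<zero>"
 proof (cases "length xs = 0")
  case True
  have "y : VC (s0 i)" using uk_VC[OF order_refl node_closed[OF i]] y by blast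
  from lin_zero[OF Bil_D(1)[OF b[OF i] this] V_subspace vs_KV] show ?thesis using x True by (simp add: uk_0)
 next
  case False
  hence "xs ! (length xs - 1) : set xs" by simp
  hence "isot b (xs ! (length xs - 1))" using A by blast
  thus ?thesis using x y i False unfolding isot_def uk_def by simp
 qed
next
 fix U assume A: "\<forall>i\<in>QV. \<forall>x\<in>uk xs i (length xs). \<forall>y\<in>uk xs (s0 i) (length xs). b i x y = \<zero>" and "U : set xs"
 then obtain k where k: "k < length xs" "U = xs ! k" by (metis in_set_conv_nth)
 have sub: "U i \<subseteq> uk xs i (length xs)" if "i : QV" for i
  using uk_mono[of "Suc k" "length xs" i] k that by (simp add: uk_def)
 show "isot b U" unfolding isot_def using A sub node_closed by blast
qed

lemma stable_iff:
 assumes m: "m : LM"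
 shows "(\<forall>U\<in>set xs. stable m U) \<longleftrightarrow> kst xs m"
proof
 assume A: "\<forall>U\<in>set xs. stable m U"
 show "kst xs m" unfolding kst_def
 proof (intro allI impI ballI)
  fix k al x assume k: "k \<le> length xs" and al: "al : QA" and x: "x : uk xs (src al) k"
  show "m al x : uk xs (tgt al) k"
  proof (cases k)
   case 0
   have "lin (V (src al)) (VC (src al)) (V (tgt al)) (m al)" using PiE_mem[OF m[unfolded LM_def] al] by (simp add: Lin_def)
   from lin_zero[OF this V_subspace vs_V] show ?thesis using x 0 by (simp add: uk_0)
  next
   case (Suc j)
   hence "xs ! j : set xs" using k by simp
   hence "m al ` (xs ! j) (src al) \<subseteq> (xs ! j) (tgt al)" using A al unfolding stable_def by blast
   thus ?thesis using x by (auto simp: Suc uk_def)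
  qed
 qed
next
 assume A: "kst xs m"
 show "\<forall>U\<in>set xs. stable m U"
 proof
  fix U assume "U : set xs"
  then obtain k where k: "k < length xs" "U = xs ! k" by (metis in_set_conv_nth)
  have "uk xs i (Suc k) = U i" for i by (simp add: uk_def k)
  thus "stable m U" using A k(1) unfolding stable_def kst_def by (metis Suc_leI image_subsetI)
 qed
qed

lemma Bfam_D:
 assumes "b : Bfam xs" "i : QV"
 shows "b i : BV i (s0 i)" "ndV i (s0 i) (b i)"
  "x : VC i ==> y : VC (s0 i) ==> b (s0 i) y x = sg (s i) (b i x y)"
  "x : uk xs i (length xs) ==> y : uk xs (s0 i) (length xs) ==> b i x y = \<zero>"
proof -
 have "b : Pi\<^sub>E (QV) (Sb xs)" and t: "b (s0 i) = tb i (b i)" using assms unfolding Bfam_def by blast+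
 from PiE_mem[OF this(1) assms(2)]
 show "b i : BV i (s0 i)" "ndV i (s0 i) (b i)"
  "x : uk xs i (length xs) ==> y : uk xs (s0 i) (length xs) ==> b i x y = \<zero>" unfolding Sb_def by blast+
 show "b (s0 i) y x = sg (s i) (b i x y)" if "x : VC i" "y : VC (s0 i)" unfolding t tb_def using that by simp
qed

text \<open>Separates the form from the arrow maps: a symmetric family for which the flag is
  isotropic, then adjoint maps that preserve the flag.\<close>

lemma Dat_flag_iff:
 "(m, b) : Dat \<and> (\<forall>U\<in>set xs. stable m U \<and> isot b U) \<longleftrightarrow> b : Bfam xs \<and> m : {m : LM. adj b m \<and> kst xs m}"
proof
 assume A: "(m, b) : Dat \<and> (\<forall>U\<in>set xs. stable m U \<and> isot b U)"
 note D = Dat_D[OF conjunct1[OF A], unfolded fst_conv snd_conv]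
 have m: "m : LM" unfolding LM_def by (rule D(6))
 have i0: "\<forall>i\<in>QV. \<forall>x\<in>uk xs i (length xs). \<forall>y\<in>uk xs (s0 i) (length xs). b i x y = \<zero>"
  using isot_iff[OF D(2)] A by blast
 have "b (s0 i) = tb i (b i)" if i: "i : QV" for i
 proof (rule Bil_ext)
  show "b (s0 i) : BV (s0 i) i" using D(2)[OF node_closed[OF i]] unfolding node_invol[OF i] .
  show "tb i (b i) : BV (s0 i) i" unfolding tb_def by (rule Bil_flip[OF D(2)[OF i] V_subspace V_subspace])
  fix y x assume "y : VC (s0 i)" "x : VC i"
  thus "b (s0 i) y x = tb i (b i) y x" using D(3)[OF i] by (simp add: tb_def)
 qed
 moreover have "b : Pi\<^sub>E (QV) (Sb xs)"
 proof (rule PiE_I)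
  show "b i : Sb xs i" if "i : QV" for i unfolding Sb_def using D(2,4)[OF that] i0 that by blast
  show "b i = undefined" if "i \<notin> QV" for i by (rule PiE_arb[OF D(7) that])
 qed
 moreover have "adj b m" unfolding adj_def using D(5) by blast
 ultimately show "b : Bfam xs \<and> m : {m : LM. adj b m \<and> kst xs m}"
  unfolding Bfam_def using stable_iff[OF m] A m by blast
next
 assume A: "b : Bfam xs \<and> m : {m : LM. adj b m \<and> kst xs m}"
 note B = Bfam_D[OF conjunct1[OF A]]
 have m: "m : LM" using A by blast
 have bP: "b : Pi\<^sub>E (QV) (%i. BV i (s0 i))"
 proof (rule PiE_I)
  have "b : Pi\<^sub>E (QV) (Sb xs)" using A unfolding Bfam_def by blast
  thus "b i = undefined" if "i \<notin> QV" for i by (rule PiE_arb[OF _ that])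
 qed (rule B(1))
 have "(m, b) : Dat" unfolding Dat_def
 proof (intro CollectI case_prodI conjI ballI)
  show "m : (\<Pi>\<^sub>E al\<in>QA. LV (src al) (tgt al))" by (rule m[unfolded LM_def])
  show "b : (\<Pi>\<^sub>E i\<in>QV. BV i (s0 i))" by (rule bP)
  show "b (s0 i) y x = sg (s i) (b i x y)" if "i : QV" "x : VC i" "y : VC (s0 i)" for i x y by (rule B(3)[OF that])
  show "ndV i (s0 i) (b i)" if "i : QV" for i by (rule B(2)[OF that])
  show "b (tgt al) (m al x) y = sg (\<tau> al) (b (src al) x (m (s1 al) y))"
   if "al : QA" "x : VC (src al)" "y : VC (s0 (tgt al))" for al x y using A that unfolding adj_def by blast
 qed
 moreover have "\<forall>U\<in>set xs. isot b U" using isot_iff[OF B(1)] B(4) by blast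
 ultimately show "(m, b) : Dat \<and> (\<forall>U\<in>set xs. stable m U \<and> isot b U)" using stable_iff[OF m] A by blast
qed

lemma finite_Bfam: "finite (Bfam xs)"
proof (rule finite_subset)
 show "Bfam xs \<subseteq> Pi\<^sub>E (QV) (%i. BV i (s0 i))"
  unfolding Bfam_def Sb_def by (intro subsetI, elim CollectE conjE, erule subsetD[OF PiE_mono, rotated]) blast
 show "finite (Pi\<^sub>E (QV) (%i. BV i (s0 i)))"
  by (intro finite_PiE finite_verts finite_Bil finite_V)
qed

text \<open>The involution on the nodes leaves an arbitrary pairing for each node of
  \<open>P0\<close> and an \<open>s i\<close>-symmetric form for each fixed node, each vanishing on
  the largest member of the flag.\<close>

lemma card_Bfam:
 defines "u \<equiv> %i. sdim (uk xs i (length xs))"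
 shows "real (card (Bfam xs)) =
  (\<Prod>i\<in>P0. ij (u i) (n i - u (s0 i)) * ij (n i) (n i) / ij (u i) (n i)) *
  (\<Prod>i\<in>fixed_nodes Q s0. ij (u i) (n i - u i) * (ff (s i) (n i - 2 * u i) *
   real q ^ (u i * (n i - 2 * u i) + u i * (u i - 1) div 2 + (if s i = 1 then u i else 0))))"
proof -
 have S_D: "c : BV i (s0 i)" "ndV i (s0 i) c"
  "x : uk xs i (length xs) ==> y : uk xs (s0 i) (length xs) ==> c x y = \<zero>" if "c : Sb xs i" for i c x y
  using that unfolding Sb_def by blast+
 have tS: "tb i c : Sb xs (s0 i)" if i: "i : QV" and c: "c : Sb xs i" for i c
 proof -
  note D = S_D[OF c] and ii = node_invol[OF i]
  have sd: "sdim (VC i) = sdim (VC (s0 i))" by (simp add: sdim_V n_sigma[OF i])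
  show ?thesis unfolding Sb_def ii
  proof (intro CollectI conjI ballI)
   show "tb i c : BV (s0 i) i" unfolding tb_def by (rule Bil_flip[OF D(1) V_subspace V_subspace])
   show "ndV (s0 i) i (tb i c)" unfolding tb_def
    by (rule right_nondeg[OF D(1) V_subspace finite_V V_subspace finite_V sd D(2)])
   fix y x assume y: "y : uk xs (s0 i) (length xs)" and x: "x : uk xs i (length xs)"
   have "y : VC (s0 i)" "x : VC i" using uk_VC[OF order_refl] x y i node_closed[OF i] by blast+
   thus "tb i c y x = \<zero>" using D(3)[OF x y] by (simp add: tb_def)
  qed
 qed
 have tt: "tb (s0 i) (tb i c) = c" if i: "i : QV" and c: "c : Sb xs i" for i c
 proof (rule Bil_ext)
  note D = S_D[OF c] and ii = node_invol[OF i]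
  show "c : BV i (s0 i)" by (rule D(1))
  show "tb (s0 i) (tb i c) : BV i (s0 i)"
   using S_D(1)[OF tS[OF node_closed[OF i] tS[OF i c]]] unfolding ii .
  show "tb (s0 i) (tb i c) x y = c x y" if "x : VC i" "y : VC (s0 i)" for x y
   using that Bil_D(3)[OF D(1) that] by (simp add: tb_def ii s_invariant[OF i])
 qed
 have "card (Bfam xs) = (\<Prod>i\<in>P0. card (Sb xs i)) * (\<Prod>i\<in>{i : QV. s0 i = i}. card {x : Sb xs i. tb i x = x})"
  unfolding Bfam_def
  by (rule card_twisted_families[OF finite_verts node_closed node_invol split_D(1-3)]) (assumption | (rule tS tt, assumption+))+
 hence "real (card (Bfam xs)) = (\<Prod>i\<in>P0. real (card (Sb xs i))) *
  (\<Prod>i\<in>fixed_nodes Q s0. real (card {x : Sb xs i. tb i x = x}))"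
  unfolding fixed_nodes_def[symmetric] by simp
 also have "(\<Prod>i\<in>P0. real (card (Sb xs i))) = (\<Prod>i\<in>P0. ij (u i) (n i - u (s0 i)) * ij (n i) (n i) / ij (u i) (n i))"
 proof (rule prod.cong[OF refl])
  fix i assume "i : P0"
  hence i: "i : QV" by (rule P_sub)
  note j = node_closed[OF i]
  have sd: "sdim (VC (s0 i)) = sdim (VC i)" by (simp add: sdim_V n_sigma[OF i])
  show "real (card (Sb xs i)) = ij (u i) (n i - u (s0 i)) * ij (n i) (n i) / ij (u i) (n i)"
   unfolding Sb_def u_def
   using card_pairings[OF V_subspace finite_V V_subspace finite_V sd uk_subspace[OF order_refl i] uk_VC[OF order_refl i]
     uk_subspace[OF order_refl j] uk_VC[OF order_refl j]] unfolding sdim_V .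
 qed
 also have "(\<Prod>i\<in>fixed_nodes Q s0. real (card {x : Sb xs i. tb i x = x})) =
  (\<Prod>i\<in>fixed_nodes Q s0. ij (u i) (n i - u i) * (ff (s i) (n i - 2 * u i) *
   real q ^ (u i * (n i - 2 * u i) + u i * (u i - 1) div 2 + (if s i = 1 then u i else 0))))"
 proof (rule prod.cong[OF refl])
  fix i assume "i : fixed_nodes Q s0"
  hence i: "i : QV" and ii: "s0 i = i" by (auto simp: fixed_nodes_def)
  have "{x : Sb xs i. tb i x = x} = {b : Sf (s i) (V i) (VC i). ndV i i b \<and>
    (orth b (uk xs i (length xs)) (uk xs i (length xs)))}" (is "?A = ?B")
  proof (intro equalityI subsetI)
   fix c assume c: "c : ?A"
   hence eq: "tb i c = c" and cS: "c : Sb xs i" by blast+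
   have "c x y = sg (s i) (c y x)" if "x : VC i" "y : VC i" for x y
    using fun_cong[OF fun_cong[OF eq, of x], of y] that by (simp add: tb_def ii)
   thus "c : ?B" using S_D[OF cS] unfolding Sf_def ii by blast
  next
   fix c assume c: "c : ?B"
   hence cS: "c : Sb xs i" unfolding Sb_def Sf_def ii by blast
   have cf: "c : Sf (s i) (V i) (VC i)" using c by blast
   have sy: "c x y = sg (s i) (c y x)" if "x : VC i" "y : VC i" for x y by (rule Sf_sym[OF cf that])
   have "tb i c = c"
   proof (rule Bil_ext[OF S_D(1)[OF tS[OF i cS]] ])
    show "c : BV (s0 i) (s0 (s0 i))" using S_D(1)[OF cS] unfolding ii .
    fix x y assume "x : VC (s0 i)" "y : VC (s0 (s0 i))"
    hence xy: "x : VC i" "y : VC i" unfolding ii .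
    show "tb i c x y = c x y" unfolding sy[OF xy] by (simp add: tb_def ii xy)
   qed
   thus "c : ?A" using cS by blast
  qed
  thus "real (card {x : Sb xs i. tb i x = x}) = ij (u i) (n i - u i) * (ff (s i) (n i - 2 * u i) *
   real q ^ (u i * (n i - 2 * u i) + u i * (u i - 1) div 2 + (if s i = 1 then u i else 0)))"
   using card_isotropic_forms[OF V_subspace finite_V uk_subspace[OF order_refl i] uk_VC[OF order_refl i] s_sign[OF i]]
   unfolding sdim_V u_def by (simp only:)
 qed
 finally show ?thesis .
qed


lemma fl_facts:
 assumes b: "b : Bfam xs" and i: "i : QV"
 defines "T \<equiv> Suc (2 * length xs)"
 shows "k \<le> T ==> subspace K (fl xs b i k) (V i)" "k < T ==> fl xs b i k \<subseteq> fl xs b i (Suc k)"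
  "k \<le> T ==> finite (fl xs b i k)" "fl xs b i 0 = {\<zero>\<^bsub>V i\<^esub>}" "fl xs b i T = VC i"
  "k \<le> T ==> sdim (fl xs b i k) = fd (length xs) (%i k. sdim (uk xs i k)) i k"
proof -
 note j = node_closed[OF i] and ii = node_invol[OF i]
 have sd: "sdim (VC (s0 i)) = sdim (VC i)" by (simp add: sdim_V n_sigma[OF i])
 have B: "b (s0 i) : BV (s0 i) i" "ndV (s0 i) i (b (s0 i))"
  using Bfam_D(1,2)[OF b j] unfolding ii .
 have pf: "subspace K (perp (b (s0 i)) (uk xs (s0 i) l) (VC i)) (V i)"
  "sdim (uk xs (s0 i) l) + sdim (perp (b (s0 i)) (uk xs (s0 i) l) (VC i)) = n i" if l: "l \<le> length xs" for l
  using perp_facts(1,3)[OF B(1) V_subspace finite_V V_subspace finite_V sd B(2) uk_subspace[OF l j] uk_VC[OF l j]]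
  unfolding sdim_V by blast+
 have flp: "fl xs b i k = perp (b (s0 i)) (uk xs (s0 i) (T - k)) (VC i)" if "length xs < k" for k
  using that by (simp add: fl_def T_def)
 have flu: "fl xs b i k = uk xs i k" if "k \<le> length xs" for k using that by (simp add: fl_def)
 show sub: "subspace K (fl xs b i k) (V i)" if "k \<le> T" for k
 proof (cases "k \<le> length xs")
  case True thus ?thesis using uk_subspace[OF True i] by (simp add: flu)
 next
  case False thus ?thesis using pf(1)[of "T - k"] that by (simp add: flp T_def)
 qed
 show "finite (fl xs b i k)" if "k \<le> T" for k by (rule finite_subset[OF subspace_D(2)[OF sub[OF that]] finite_V])
 show "fl xs b i 0 = {\<zero>\<^bsub>V i\<^esub>}" by (simp add: flu uk_0)
 show "fl xs b i T = VC i"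
 proof -
  have "b (s0 i) \<zero>\<^bsub>V (s0 i)\<^esub> y = \<zero>" if "y : VC i" for y
   using lin_zero[OF Bil_D(1)[OF B(1) that] V_subspace vs_KV] by simp
  thus ?thesis unfolding flp[of T, unfolded T_def, simplified] T_def by (auto simp: perp_def uk_0)
 qed
 show "fl xs b i k \<subseteq> fl xs b i (Suc k)" if k: "k < T" for k
 proof -
  consider "k < length xs" | "k = length xs" | "length xs < k" by linarith
  thus ?thesis
  proof cases
   case 1 thus ?thesis using uk_step[OF 1 i] by (simp add: flu)
  next
   \<comment> \<open>The middle inclusion, of the largest member into its orthogonal complement, is
     isotropy.\<close>
   case 2
   have e: "T - Suc k = length xs" using 2 by (simp add: T_def)
   have "uk xs i (length xs) \<subseteq> perp (b (s0 i)) (uk xs (s0 i) (length xs)) (VC i)"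
    unfolding perp_def using uk_VC[OF order_refl i] Bfam_D(4)[OF b j] unfolding ii by blast
   thus ?thesis unfolding flp[of "Suc k", unfolded 2, OF lessI, unfolded e[unfolded 2]] flu[OF order_refl] 2 .
  next
   case 3
   have l: "T - Suc k < length xs" "Suc (T - Suc k) = T - k" using 3 k by (simp_all add: T_def)
   have "uk xs (s0 i) (T - Suc k) \<subseteq> uk xs (s0 i) (T - k)" using uk_step[OF l(1) j] unfolding l(2) .
   from perp_antimono[OF this] show ?thesis using 3 flp[of k] flp[of "Suc k"] by simp
  qed
 qed
 show "sdim (fl xs b i k) = fd (length xs) (%i k. sdim (uk xs i k)) i k" if k: "k \<le> T"
 proof (cases "k \<le> length xs")
  case True thus ?thesis by (simp add: flu fd_def)
 next
  case False
  have "T - k \<le> length xs" using False by (simp add: T_def)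
  from pf(2)[OF this] show ?thesis using False by (simp add: flp fd_def T_def)
 qed
qed

text \<open>Moving the image under \<open>m (s1 al)\<close> into the first argument of
  \<open>b\<close> costs the sign \<open>s\<close>, and adjointness costs \<open>\<tau>\<close>. So
  adjointness says that the forms of \<open>al\<close> and \<open>s1 al\<close> are signed
  transposes of each other.\<close>

lemma tobil_rel:
 assumes b: "b : Bfam xs" and m: "m : LM"
 shows "al : QA ==> x : VC (src al) ==> m al x : VC (tgt al)"
  and "al : QA ==> tobil b m al : BV (src al) (s0 (tgt al))"
  and "al : QA ==> x : VC (src al) ==> y : VC (s0 (tgt al)) ==> tobil b m al x y = b (tgt al) (m al x) y"
  and "adj b m \<longleftrightarrow> (\<forall>al\<in>QA. tobil b m (s1 al) = ta al (tobil b m al))"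
proof -
 have L: "m al : LV (src al) (tgt al)" if "al : QA" for al
  by (rule PiE_mem[OF m[unfolded LM_def] that])
 show mc: "m al x : VC (tgt al)" if "al : QA" "x : VC (src al)" for al x
  using L[OF that(1)] that(2) by (auto simp: Lin_def)
 show tv: "tobil b m al x y = b (tgt al) (m al x) y"
  if "al : QA" "x : VC (src al)" "y : VC (s0 (tgt al))" for al x y using that by (simp add: tobil_def)
 show tB: "tobil b m al : BV (src al) (s0 (tgt al))" if al: "al : QA" for al
 proof -
  note h = tail_head_verts(2)[OF al]
  have sd: "sdim (VC (tgt al)) = sdim (VC (s0 (tgt al)))" by (simp add: sdim_V n_sigma[OF h])
  have e: "tobil b m al = (%m. \<lambda>x\<in>VC (src al). \<lambda>y\<in>VC (s0 (tgt al)). b (tgt al) (m x) y) (m al)"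
   by (simp add: tobil_def al)
  show ?thesis unfolding e
   by (rule bij_betwE[OF hom_bil_bij[OF Bfam_D(1)[OF b h] vs_V finite_V V_subspace finite_V sd Bfam_D(2)[OF b h] V_subspace], rule_format, OF L[OF al]])
 qed
 have "(tobil b m (s1 al) = ta al (tobil b m al)) \<longleftrightarrow> (\<forall>x\<in>VC (src al). \<forall>y\<in>VC (s0 (tgt al)).
  b (tgt al) (m al x) y = sg (\<tau> al) (b (src al) x (m (s1 al) y)))" if al: "al : QA" for al
 proof -
  note th = tail_head_verts[OF al] and a' = arrow_closed[OF al] and ti = tail_invol[OF al] head_invol[OF al] node_invol[OF tail_head_verts(1)[OF al]]
  have m': "m (s1 al) y : VC (s0 (src al))" if "y : VC (s0 (tgt al))" for y
   using mc[OF a', of y] that unfolding ti by blast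
  have pt: "(tobil b m (s1 al) y x = ta al (tobil b m al) y x) \<longleftrightarrow>
    b (tgt al) (m al x) y = sg (\<tau> al) (b (src al) x (m (s1 al) y))"
   if x: "x : VC (src al)" and y: "y : VC (s0 (tgt al))" for x y
  proof -
   define p where "p = b (tgt al) (m al x) y"
   define r where "r = b (src al) x (m (s1 al) y)"
   have c: "p : carrier K" "r : carrier K"
    unfolding p_def r_def by (rule Bil_D(3)[OF Bfam_D(1)[OF b th(2)] mc[OF al x] y], rule Bil_D(3)[OF Bfam_D(1)[OF b th(1)] x m'[OF y]])
   have "tobil b m (s1 al) y x = sg (s (src al)) r"
    unfolding r_def Bfam_D(3)[OF b th(1) x m'[OF y], symmetric] using tv[OF a', of y x] x y unfolding ti by blast
   moreover have "ta al (tobil b m al) y x = sg (s (src al)) (sg (\<tau> al) p)"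
    unfolding p_def using x y tv[OF al x y] sg_sg_mult[OF s_sign[OF th(1)] tau_sign[OF al] c(1)] by (simp add: ta_def p_def)
   moreover have "(sg (s (src al)) r = sg (s (src al)) (sg (\<tau> al) p)) \<longleftrightarrow> p = sg (\<tau> al) r"
    using c sg_simps(1,3) by metis
   ultimately show ?thesis unfolding p_def r_def by simp
  qed
  have B1: "tobil b m (s1 al) : BV (s0 (tgt al)) (src al)"
   using tB[OF a'] unfolding ti .
  have B2: "ta al (tobil b m al) : BV (s0 (tgt al)) (src al)"
   unfolding ta_def by (rule Bil_flip[OF tB[OF al] V_subspace V_subspace])
  show ?thesis
  proof
   assume "tobil b m (s1 al) = ta al (tobil b m al)"
   thus "\<forall>x\<in>VC (src al). \<forall>y\<in>VC (s0 (tgt al)). b (tgt al) (m al x) y = sg (\<tau> al) (b (src al) x (m (s1 al) y))"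
    using pt by simp
  next
   assume A: "\<forall>x\<in>VC (src al). \<forall>y\<in>VC (s0 (tgt al)). b (tgt al) (m al x) y = sg (\<tau> al) (b (src al) x (m (s1 al) y))"
   show "tobil b m (s1 al) = ta al (tobil b m al)" by (rule Bil_ext[OF B1 B2]) (use pt A in blast)
  qed
 qed
 thus "adj b m \<longleftrightarrow> (\<forall>al\<in>QA. tobil b m (s1 al) = ta al (tobil b m al))" unfolding adj_def by blast
qed

text \<open>For \<open>k \<le> length xs\<close>, vanishing on member \<open>k\<close> times its
  complement says that \<open>m al\<close> maps member \<open>k\<close> into its double complement,
  which is member \<open>k\<close> of the target. For larger \<open>k\<close> the conditions are
  those of \<open>s1 al\<close>, transported by adjointness.\<close>

lemma kst_iff:
 assumes b: "b : Bfam xs" and m: "m : LM" and adj: "adj b m"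
 shows "kst xs m \<longleftrightarrow> (\<forall>al\<in>QA. tobil b m al : Za xs b al)"
proof
 note tr = tobil_rel[OF b m]
 let ?N = "length xs" and ?T = "Suc (2 * length xs)"
 {
  assume A: "kst xs m"
  show "\<forall>al\<in>QA. tobil b m al : Za xs b al"
  proof
   fix al assume al: "al : QA"
   note th = tail_head_verts[OF al] and a' = arrow_closed[OF al] and ti = tail_invol[OF al] head_invol[OF al]
   note tj = node_closed[OF th(1)] and hj = node_closed[OF th(2)]
   show "tobil b m al : Za xs b al" unfolding Za_def
   proof (intro CollectI conjI allI impI ballI)
    show "tobil b m al : BV (src al) (s0 (tgt al))" by (rule tr(2)[OF al])
    fix k x y assume k: "k \<le> ?T" and x: "x : fl xs b (src al) k" and y: "y : fl xs b (s0 (tgt al)) (?T - k)"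
    have xV: "x : VC (src al)" by (rule subspace_D(4)[OF fl_facts(1)[OF b th(1) k] x])
    have yV: "y : VC (s0 (tgt al))" by (rule subspace_D(4)[OF fl_facts(1)[OF b hj diff_le_self] y])
    show "tobil b m al x y = \<zero>" unfolding tr(3)[OF al xV yV]
    proof (cases "k \<le> ?N")
     case True
     have "x : uk xs (src al) k" using x True by (simp add: fl_def)
     hence mx: "m al x : uk xs (tgt al) k" using A True al unfolding kst_def by blast
     have "y : perp (b (tgt al)) (uk xs (tgt al) k) (VC (s0 (tgt al)))"
     proof -
      have nk: "\<not> ?T - k \<le> ?N" and e: "?T - (?T - k) = k" using True k by simp_all
      show ?thesis using y unfolding fl_def if_not_P[OF nk] e node_invol[OF th(2)] .
     qed
     thus "b (tgt al) (m al x) y = \<zero>" using mx unfolding perp_def by blast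
    next
     case False
     have le: "?T - k \<le> ?N" using False by simp
     have "y : uk xs (s0 (tgt al)) (?T - k)" using y unfolding fl_def if_P[OF le] .
     with le have my: "m (s1 al) y : uk xs (s0 (src al)) (?T - k)"
      using A a' unfolding kst_def ti[symmetric] by blast
     have myV: "m (s1 al) y : VC (s0 (src al))" using my uk_VC[OF le tj] by blast
     have "x : perp (b (s0 (src al))) (uk xs (s0 (src al)) (?T - k)) (VC (src al))"
      using x False by (simp add: fl_def)
     hence "b (s0 (src al)) (m (s1 al) y) x = \<zero>" using my unfolding perp_def by blast
     hence "sg (s (src al)) (b (src al) x (m (s1 al) y)) = \<zero>"
      unfolding Bfam_D(3)[OF b th(1) xV myV] .
     hence "b (src al) x (m (s1 al) y) = \<zero>" using sg_zero_iff[OF Bil_D(3)[OF Bfam_D(1)[OF b th(1)] xV myV]] by blast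
     moreover have "b (tgt al) (m al x) y = sg (\<tau> al) (b (src al) x (m (s1 al) y))"
      using adj al xV yV unfolding adj_def by blast
     ultimately show "b (tgt al) (m al x) y = \<zero>" by simp
    qed
   qed
  qed
 next
  assume A: "\<forall>al\<in>QA. tobil b m al : Za xs b al"
  show "kst xs m" unfolding kst_def
  proof (intro allI impI ballI)
   fix k al x assume k: "k \<le> ?N" and al: "al : QA" and x: "x : uk xs (src al) k"
   note th = tail_head_verts[OF al]
   have sd: "sdim (VC (tgt al)) = sdim (VC (s0 (tgt al)))" by (simp add: sdim_V n_sigma[OF th(2)])
   have xV: "x : VC (src al)" using uk_VC[OF k th(1)] x by blast
   have xf: "x : fl xs b (src al) k" using x k by (simp add: fl_def)
   have kT: "k \<le> ?T" using k by simp
   show "m al x : uk xs (tgt al) k"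
   proof (rule perp_facts(4)[OF Bfam_D(1)[OF b th(2)] V_subspace finite_V V_subspace finite_V sd Bfam_D(2)[OF b th(2)]
      uk_subspace[OF k th(2)] uk_VC[OF k th(2)] tr(1)[OF al xV]])
    fix y assume y: "y : perp (b (tgt al)) (uk xs (tgt al) k) (VC (s0 (tgt al)))"
    hence yV: "y : VC (s0 (tgt al))" by (simp add: perp_def)
    have nk: "\<not> ?T - k \<le> ?N" and e: "?T - (?T - k) = k" using k by simp_all
    have "y : fl xs b (s0 (tgt al)) (?T - k)" using y unfolding fl_def if_not_P[OF nk] e node_invol[OF th(2)] .
    hence "tobil b m al x y = \<zero>" using A al xf kT unfolding Za_def by blast
    thus "b (tgt al) (m al x) y = \<zero>" unfolding tr(3)[OF al xV yV] .
   qed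
  qed
 }
qed

lemma bij_tobil:
 assumes b: "b : Bfam xs"
 shows "bij_betw (tobil b) {m : LM. adj b m \<and> kst xs m} (Wfam xs b)"
proof (rule bij_betw_imageI)
 have hb: "bij_betw (%m. \<lambda>x\<in>VC (src al). \<lambda>y\<in>VC (s0 (tgt al)). b (tgt al) (m x) y)
   (LV (src al) (tgt al))
   (BV (src al) (s0 (tgt al)))"
  if al: "al : QA" for al
 proof -
  note h = tail_head_verts(2)[OF al]
  have sd: "sdim (VC (tgt al)) = sdim (VC (s0 (tgt al)))" by (simp add: sdim_V n_sigma[OF h])
  show ?thesis by (rule hom_bil_bij[OF Bfam_D(1)[OF b h] vs_V finite_V V_subspace finite_V sd Bfam_D(2)[OF b h] V_subspace])
 qed
 show "inj_on (tobil b) {m : LM. adj b m \<and> kst xs m}"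
 proof (rule inj_onI)
  fix m m' assume m: "m : {m : LM. adj b m \<and> kst xs m}" "m' : {m : LM. adj b m \<and> kst xs m}" and eq: "tobil b m = tobil b m'"
  have mL: "m : LM" "m' : LM" using m by blast+
  show "m = m'"
  proof (rule PiE_ext[OF mL[unfolded LM_def]])
   fix al assume al: "al : QA"
   show "m al = m' al"
    by (rule inj_onD[OF bij_betw_imp_inj_on[OF hb[OF al]] _ PiE_mem[OF mL(1)[unfolded LM_def] al] PiE_mem[OF mL(2)[unfolded LM_def] al]])
     (use fun_cong[OF eq, of al] al in \<open>simp only: tobil_def restrict_apply'\<close>)
  qed
 qed
 show "tobil b ` {m : LM. adj b m \<and> kst xs m} = Wfam xs b"
 proof (intro equalityI image_subsetI subsetI)
  fix m assume m: "m : {m : LM. adj b m \<and> kst xs m}"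
  have mL: "m : LM" and mD: "adj b m" "kst xs m" using m by blast+
  show "tobil b m : Wfam xs b" unfolding Wfam_def
  proof (intro CollectI conjI)
   show "tobil b m : Pi\<^sub>E (QA) (Za xs b)"
    by (rule PiE_I) (use kst_iff[OF b mL mD(1)] mD(2) in \<open>blast, simp add: tobil_def\<close>)
   show "\<forall>al\<in>QA. tobil b m (s1 al) = ta al (tobil b m al)" using tobil_rel(4)[OF b mL] mD(1) by blast
  qed
 next
  fix z assume "z : Wfam xs b"
  hence z: "z : Pi\<^sub>E (QA) (Za xs b)" "\<forall>al\<in>QA. z (s1 al) = ta al (z al)" unfolding Wfam_def by blast+
  define h where "h = (%al m. \<lambda>x\<in>VC (src al). \<lambda>y\<in>VC (s0 (tgt al)). b (tgt al) (m x) y)"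
  define m where "m = (\<lambda>al\<in>QA. inv_into (LV (src al) (tgt al)) (h al) (z al))"
  have zi: "z al : h al ` LV (src al) (tgt al)" if "al : QA" for al
   unfolding h_def bij_betw_imp_surj_on[OF hb[OF that]] using PiE_mem[OF z(1) that] unfolding Za_def by blast
  have mL: "m : LM" unfolding LM_def m_def by (rule PiE_I) (simp_all add: inv_into_into[OF zi])
  have tz: "tobil b m = z"
  proof
   fix al show "tobil b m al = z al"
   proof (cases "al : QA")
    case True
    have "tobil b m al = h al (m al)" by (simp add: tobil_def h_def True)
    also have "\<dots> = z al" by (simp add: m_def True f_inv_into_f[OF zi[OF True]])
    finally show ?thesis .
   next
    case False thus ?thesis using PiE_arb[OF z(1) False] by (simp add: tobil_def)
   qed
  qed
  have ad: "adj b m" unfolding tobil_rel(4)[OF b mL] tz by (rule z(2))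
  moreover have "kst xs m" unfolding kst_iff[OF b mL ad] tz using PiE_mem[OF z(1)] by blast
  ultimately show "z : tobil b ` {m : LM. adj b m \<and> kst xs m}" using mL tz by blast
 qed
qed

text \<open>The involution on the arrows leaves an arbitrary form for each arrow of
  \<open>P1\<close> and a symmetric or alternating one for each fixed arrow, all vanishing along the
  extended flags. The result depends on \<open>b\<close> through no more than the dimensions of the
  flag.\<close>

lemma card_Wfam:
 assumes b: "b : Bfam xs"
 defines "u \<equiv> %i k. sdim (uk xs i k)"
 shows "card (Wfam xs b) = (\<Prod>al\<in>P1. q ^ ex (length xs) u (src al) (s0 (tgt al))) *
  (\<Prod>al\<in>fixed_arrows Q s1. q ^ nat ((int (ex (length xs) u (src al) (src al)) +
    s (src al) * \<tau> al * int (n (src al) - u (src al) (length xs))) div 2))"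
proof -
 let ?N = "length xs" and ?T = "Suc (2 * length xs)"
 have exf: "(\<Sum>k<?T. (sdim (fl xs b i (Suc k)) - sdim (fl xs b i k)) * (sdim (fl xs b j ?T) - sdim (fl xs b j (?T - Suc k)))) = ex ?N u i j"
  if "i : QV" "j : QV" for i j
  unfolding ex_def u_def by (rule sum.cong[OF refl]) (simp add: fl_facts(6)[OF b that(1)] fl_facts(6)[OF b that(2)])
 have Z_B: "c : BV (src al) (s0 (tgt al))"
  and Z_0: "k \<le> ?T ==> x : fl xs b (src al) k ==> y : fl xs b (s0 (tgt al)) (?T - k) ==> c x y = \<zero>"
  if "c : Za xs b al" for c al k x y using that unfolding Za_def by blast+
 have tS: "ta al c : Za xs b (s1 al)" if al: "al : QA" and c: "c : Za xs b al" for al c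
 proof -
  note th = tail_head_verts[OF al]
  note ti = tail_invol[OF al] head_invol[OF al] node_invol[OF th(1)]
  show ?thesis unfolding Za_def ti
  proof (intro CollectI conjI ballI allI impI)
   show "ta al c : BV (s0 (tgt al)) (src al)"
    unfolding ta_def by (rule Bil_flip[OF Z_B[OF c] V_subspace V_subspace])
   fix k y x assume k: "k \<le> ?T" and y: "y : fl xs b (s0 (tgt al)) k" and x: "x : fl xs b (src al) (?T - k)"
   have xy: "x : VC (src al)" "y : VC (s0 (tgt al))"
    by (rule subspace_D(4)[OF fl_facts(1)[OF b th(1) diff_le_self] x], rule subspace_D(4)[OF fl_facts(1)[OF b node_closed[OF th(2)] k] y])
   have "c x y = \<zero>" by (rule Z_0[OF c diff_le_self x]) (use y k in simp)
   thus "ta al c y x = \<zero>" using xy by (simp add: ta_def)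
  qed
 qed
 have sq: "s (src al) * \<tau> al : {1, -1}" if "al : QA" for al
  using s_sign[OF tail_head_verts(1)[OF that]] tau_sign[OF that] by auto
 have tt: "ta (s1 al) (ta al c) = c" if al: "al : QA" and c: "c : Za xs b al" for al c
 proof (rule Bil_ext[OF _ Z_B[OF c]])
  note th = tail_head_verts[OF al]
  note ti = tail_invol[OF al] head_invol[OF al] node_invol[OF th(1)]
  show "ta (s1 al) (ta al c) : BV (src al) (s0 (tgt al))"
   using Z_B[OF tS[OF arrow_closed[OF al] tS[OF al c]]] unfolding arrow_invol[OF al] .
  fix x y assume x: "x : VC (src al)" and y: "y : VC (s0 (tgt al))"
  have cc: "c x y : carrier K" by (rule Bil_D(3)[OF Z_B[OF c] x y])
  \<comment> \<open>The compatibility of \<open>\<tau>\<close> with \<open>s\<close> is what makes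
    the signed transposition an involution.\<close>
  have "s (s0 (tgt al)) * \<tau> (s1 al) = s (src al) * \<tau> al"
   using s_invariant[OF th(2)] tau_s[OF al] tau_sign[OF al] tau_sign[OF arrow_closed[OF al]] s_sign[OF th(1)] s_sign[OF th(2)]
   by auto
  thus "ta (s1 al) (ta al c) x y = c x y" using x y cc by (simp add: ta_def ti)
 qed
 have finA: "finite (QA)" by (rule finite_arcs)
 have "card (Wfam xs b) = (\<Prod>al\<in>P1. card (Za xs b al)) * (\<Prod>al\<in>{al : QA. s1 al = al}. card {x : Za xs b al. ta al x = x})"
  unfolding Wfam_def
  by (rule card_twisted_families[OF finA arrow_closed arrow_invol split_D(4-6)]) (assumption | (rule tS tt, assumption+))+
 also have "(\<Prod>al\<in>P1. card (Za xs b al)) = (\<Prod>al\<in>P1. q ^ ex ?N u (src al) (s0 (tgt al)))"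
 proof (rule prod.cong[OF refl])
  fix al assume "al : P1"
  hence al: "al : QA" by (rule P_sub)
  note t = tail_head_verts(1)[OF al] and h = node_closed[OF tail_head_verts(2)[OF al]]
  from card_Bil_filtered[where T = ?T and L = "fl xs b (src al)" and R = "fl xs b (s0 (tgt al))",
    OF vs_V vs_V fl_facts(1-4)[OF b t] fl_facts(1-3)[OF b h]]
  show "card (Za xs b al) = q ^ ex ?N u (src al) (s0 (tgt al))"
   unfolding Za_def exf[OF t h] unfolding fl_facts(5)[OF b t] fl_facts(5)[OF b h] .
 qed
 also have "(\<Prod>al\<in>{al : QA. s1 al = al}. card {x : Za xs b al. ta al x = x}) =
  (\<Prod>al\<in>fixed_arrows Q s1. q ^ nat ((int (ex ?N u (src al) (src al)) +
    s (src al) * \<tau> al * int (n (src al) - u (src al) ?N)) div 2))"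
  unfolding fixed_arrows_def
 proof (rule prod.cong[OF refl])
  fix al assume "al : {al : QA. s1 al = al}"
  hence al: "al : QA" and fa: "s1 al = al" by blast+
  note t = tail_head_verts(1)[OF al]
  \<comment> \<open>A fixed arrow runs from a node to its image under the involution, so both
    arguments of its form are in the same space.\<close>
  have ht: "s0 (tgt al) = src al" using tail_invol[OF al] unfolding fa by simp
  let ?e = "s (src al) * \<tau> al" and ?L = "fl xs b (src al)"
  have "{x : Za xs b al. ta al x = x} = {c : Sf ?e (V (src al)) (VC (src al)). \<forall>k\<le>?T. orth c (?L k) (?L (?T - k))}"
   (is "?A = ?B")
  proof (intro equalityI subsetI)
   fix c assume c: "c : ?A"
   hence eq: "ta al c = c" and cZ: "c : Za xs b al" by blast+
   have "c x y = sg ?e (c y x)" if "x : VC (src al)" "y : VC (src al)" for x y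
    using fun_cong[OF fun_cong[OF eq, of x], of y] that by (simp add: ta_def ht)
   thus "c : ?B" using cZ unfolding Sf_def Za_def ht by blast
  next
   fix c assume c: "c : ?B"
   hence cZ: "c : Za xs b al" unfolding Za_def Sf_def ht by blast
   have sy: "c x y = sg ?e (c y x)" if "x : VC (src al)" "y : VC (src al)" for x y
    by (rule Sf_sym[OF _ that]) (use c in blast)
   have "ta al c = c"
   proof (rule Bil_ext[OF Z_B[OF tS[OF al cZ], unfolded fa] Z_B[OF cZ]])
    fix x y assume xy: "x : VC (src al)" "y : VC (s0 (tgt al))"
    hence xy: "x : VC (src al)" "y : VC (src al)" unfolding ht .
    show "ta al c x y = c x y" unfolding sy[OF xy] by (simp add: ta_def ht xy)
   qed
   thus "c : ?A" using cZ by blast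
  qed
  hence e: "card {x : Za xs b al. ta al x = x} = card ?B" by (rule arg_cong)
  obtain E where E: "card {c : Sf ?e (V (src al)) (?L ?T). \<forall>k\<le>?T. orth c (?L k) (?L (?T - k))} = q ^ E"
   "2 * int E = int (\<Sum>k<?T. (sdim (?L (Suc k)) - sdim (?L k)) * (sdim (?L ?T) - sdim (?L (?T - Suc k)))) +
   ?e * int (sdim (?L ?T) - sdim (?L ?N))"
   by (rule card_Sf_filtered[where T = ?T and N = ?N and L = ?L, OF vs_V refl sq[OF al] fl_facts(1-4)[OF b t]])
  have "2 * int E = int (ex ?N u (src al) (src al)) + ?e * int (n (src al) - u (src al) ?N)"
  proof -
   have fN: "?L ?N = uk xs (src al) ?N" by (simp add: fl_def)
   show ?thesis using E(2) unfolding exf[OF t t] unfolding fl_facts(5)[OF b t] sdim_V fN u_def .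
  qed
  hence "E = nat ((int (ex ?N u (src al) (src al)) + ?e * int (n (src al) - u (src al) ?N)) div 2)" by simp
  thus "card {x : Za xs b al. ta al x = x} = q ^ nat ((int (ex ?N u (src al) (src al)) + ?e * int (n (src al) - u (src al) ?N)) div 2)"
   unfolding e using E(1) unfolding fl_facts(5)[OF b t] by simp
 qed
 finally show ?thesis .
qed

text \<open>All forms in \<open>Bfam\<close> admit the same number of arrow maps, so the total is a
  product.\<close>

theorem card_flag_structures:
 defines "u \<equiv> %i k. sdim (uk xs i k)"
 shows "card {D : Dat. \<forall>U\<in>set xs. stable (fst D) U \<and> isot (snd D) U} = card (Bfam xs) *
  ((\<Prod>al\<in>P1. q ^ ex (length xs) u (src al) (s0 (tgt al))) *
  (\<Prod>al\<in>fixed_arrows Q s1. q ^ nat ((int (ex (length xs) u (src al) (src al)) +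
    s (src al) * \<tau> al * int (n (src al) - u (src al) (length xs))) div 2)))"
proof (rule card_fibres[where f = snd, OF finite_Bfam])
 show "snd D : Bfam xs" if "D : {D : Dat. \<forall>U\<in>set xs. stable (fst D) U \<and> isot (snd D) U}" for D
  using that Dat_flag_iff[of "fst D" "snd D"] by simp
 show "finite {D : Dat. \<forall>U\<in>set xs. stable (fst D) U \<and> isot (snd D) U}" using finite_Dat by simp
 fix b assume b: "b : Bfam xs"
 have "{D : {D : Dat. \<forall>U\<in>set xs. stable (fst D) U \<and> isot (snd D) U}. snd D = b} = (%m. (m, b)) ` {m : LM. adj b m \<and> kst xs m}"
  (is "?A = ?B")
 proof (intro equalityI subsetI)
  fix D assume "D : ?A"
  thus "D : ?B" using Dat_flag_iff[of "fst D" b] by (cases D) auto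
 next
  fix D assume "D : ?B"
  then obtain m where m: "m : {m : LM. adj b m \<and> kst xs m}" "D = (m, b)" by blast
  show "D : ?A" unfolding m(2) using Dat_flag_iff[of m b] b m(1) by simp
 qed
 hence "card ?A = card {m : LM. adj b m \<and> kst xs m}" by (simp add: card_image inj_on_def)
 also have "\<dots> = card (Wfam xs b)" by (rule bij_betw_same_card[OF bij_tobil[OF b]])
 finally show "card ?A = (\<Prod>al\<in>P1. q ^ ex (length xs) u (src al) (s0 (tgt al))) *
  (\<Prod>al\<in>fixed_arrows Q s1. q ^ nat ((int (ex (length xs) u (src al) (src al)) +
    s (src al) * \<tau> al * int (n (src al) - u (src al) (length xs))) div 2))"
  unfolding card_Wfam[OF b] u_def .
qed

end

end

section \<open>Counting flags\<close>

text \<open>The second elementary symmetric polynomial of the entries, arranged for appending an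
  entry.\<close>

definition prs :: "nat list => nat" where
 "prs es = (\<Sum>k<length es. es ! k * sum_list (take k es))"

lemma prs_snoc: "prs (es @ [e]) = prs es + e * sum_list es"
proof -
 have "(\<Sum>k<length es. (es @ [e]) ! k * sum_list (take k (es @ [e]))) = prs es"
  unfolding prs_def by (rule sum.cong) (simp_all add: nth_append)
 thus ?thesis by (simp add: prs_def nth_append)
qed

context odd_field
begin

abbreviation "ph n \<equiv> qpoch (1 / real q) n"

lemma ph_0: "ph 0 = 1" and ph_Suc: "ph (Suc n) = ph n * (1 - (1 / real q) ^ Suc n)"
 by (simp_all add: qpoch_def)

lemma q_real: "real q > 1" "real q \<noteq> 0"
 using q_gt_1 by auto

lemma ph_pos: "ph n > 0"
proof (induction n)
 case (Suc n)
 have "(1 / real q) ^ Suc n < 1" using q_real by (intro power_Suc_less_one) auto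
 thus ?case using Suc unfolding ph_Suc by (intro mult_pos_pos) simp_all
qed (simp add: ph_0)

lemma ph_nz [simp]: "ph n \<noteq> 0"
 using ph_pos[of n] by simp

text \<open>The factors with odd exponent make up \<open>hh\<close>, and those with even exponent
  are the factors of the product in q^-2.\<close>

lemma hh_ph: "ph n = hh n * qpoch ((1 / real q)\<^sup>2) (n div 2)"
proof (induction n)
 case 0 thus ?case by (simp add: qpoch_def)
next
 case (Suc n)
 show ?case
 proof (cases "even n")
  case True
  hence "Suc n div 2 = n div 2" by simp
  thus ?thesis unfolding ph_Suc Suc using True by (simp add: power_divide)
 next
  case False
  then obtain m where m: "n = 2 * m + 1" by (elim oddE)
  have d: "Suc n div 2 = Suc m" "n div 2 = m" by (simp_all add: m)
  have e: "((1 / real q)\<^sup>2) ^ Suc m = (1 / real q) ^ Suc n" unfolding m power_mult[symmetric] by simp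
  have "qpoch ((1 / real q)\<^sup>2) (Suc m) = qpoch ((1 / real q)\<^sup>2) m * (1 - ((1 / real q)\<^sup>2) ^ Suc m)"
   by (simp add: qpoch_def)
  thus ?thesis unfolding ph_Suc Suc d e using False by simp
 qed
qed

text \<open>A factor q^n - q^r is q^n (1 - q^-(n-r)), and for r < a the exponent n - r runs from n -
  a + 1 to n.\<close>

lemma ij_ph: "a \<le> n ==> ij a n = real q ^ (n * a) * ph n / ph (n - a)"
proof (induction a)
 case 0 thus ?case by (simp add: ij_def)
next
 case (Suc a)
 have e: "n - a = Suc (n - Suc a)" using Suc.prems by simp
 have "real q ^ n - real q ^ a = real q ^ n * (1 - (1 / real q) ^ (n - a))"
 proof -
  have "real q ^ n = real q ^ (n - a) * real q ^ a" using Suc.prems by (simp add: power_add[symmetric])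
  thus ?thesis using q_real by (simp add: field_simps)
 qed
 hence "ij (Suc a) n = real q ^ (n * a) * ph n / ph (n - a) * (real q ^ n * (1 - (1 / real q) ^ (n - a)))"
  using Suc by (simp add: ij_def)
 moreover have "ph (n - a) = ph (n - Suc a) * (1 - (1 / real q) ^ (n - a))" unfolding e ph_Suc ..
 moreover have "1 - (1 / real q) ^ (n - a) \<noteq> 0"
  using ph_nz[of "n - a"] unfolding e ph_Suc by auto
 ultimately show ?case by (simp add: power_add mult_ac)
qed

definition phs :: "nat list => real" where
 "phs es = (\<Prod>k<length es. ph (es ! k))"

lemma phs_snoc: "phs (es @ [e]) = phs es * ph e"
 by (simp add: phs_def nth_append)

lemma phs_nz [simp]: "phs es \<noteq> 0"
 by (simp add: phs_def)

text \<open>The number of flags with subquotients of dimensions \<open>es\<close> in a space of dimension \<open>w\<close>.\<close>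

definition flagno :: "nat => nat list => real" where
 "flagno w es = real q ^ ((w - sum_list es) * sum_list es + prs es) * ph w / (ph (w - sum_list es) * phs es)"

lemma flagno_nil: "flagno w [] = 1"
 by (simp add: flagno_def prs_def phs_def)

text \<open>The quotient of the two \<open>ij\<close> counts the choices of the largest member; the
  other members form a flag inside it.\<close>

lemma flagno_snoc:
 assumes "sum_list es + e \<le> w"
 shows "flagno w (es @ [e]) = ij (sum_list es + e) w / ij (sum_list es + e) (sum_list es + e) * flagno (sum_list es + e) es"
proof -
 define a m where "a = sum_list es" and "m = sum_list es + e"
 have m: "m \<le> w" using assms by (simp add: m_def)
 have e: "m - a = e" "sum_list es = a" "sum_list (es @ [e]) = m" by (simp_all add: a_def m_def)
 have p: "real q ^ (w * m) = real q ^ ((w - m) * m) * real q ^ (m * m)"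
 proof -
  have "w * m = (w - m) * m + m * m" using m by (metis add_mult_distrib le_add_diff_inverse2)
  thus ?thesis by (simp only: power_add)
 qed
 show ?thesis unfolding m_def[symmetric] unfolding flagno_def e prs_snoc phs_snoc ij_ph[OF m] ij_ph[OF order_refl] p
  using q_real by (simp add: power_add ph_0 field_simps)
qed

lemma flagno_pos: "flagno w es > 0"
 using ph_pos q_real unfolding flagno_def phs_def by (simp add: prod_pos)

text \<open>The contribution of two nodes exchanged by the involution: flags at both nodes times
  pairings, divided by both general linear groups. All Pochhammer products cancel except that of
  \<open>c\<close> and those of the flag entries.\<close>

lemma node_pair:
 assumes "n = sum_list D + sum_list D' + c"
 shows "flagno n D * flagno n D' * (ij (sum_list D) (n - sum_list D') * ij n n / ij (sum_list D) n) / (ij n n * ij n n) =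
  real q powi (int ((n - sum_list D) * sum_list D + prs D + ((n - sum_list D') * sum_list D' + prs D') + (n - sum_list D') * sum_list D)
   - int (n * sum_list D + n * n)) / (ph c * (phs D * phs D'))"
proof -
 define a b where "a = sum_list D" and "b = sum_list D'"
 have le: "a \<le> n - b" "a \<le> n" "n - b - a = c" using assms by (simp_all add: a_def b_def)
 show ?thesis unfolding flagno_def a_def[symmetric] b_def[symmetric] ij_ph[OF le(1)] ij_ph[OF le(2)] ij_ph[OF order_refl] le(3)
  using q_real by (simp add: power_int_diff power_int_of_nat power_add ph_0 field_simps del: of_nat_add of_nat_mult)
qed

text \<open>The contribution of a fixed node. The parity assumption is essential: in odd dimension
  \<open>c\<close> there is no nondegenerate alternating form, so the left side would be 0, while
  the right side never vanishes.\<close>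

lemma node_fixed:
 assumes "n = 2 * sum_list D + c" and ep: "ep = 1 \<or> even c"
 defines "a \<equiv> sum_list D"
 shows "flagno n D * (ij a (n - a) * (ff ep (n - 2 * a) *
   real q ^ (a * (n - 2 * a) + a * (a - 1) div 2 + (if ep = 1 then a else 0)))) / ij n n =
  real q powi (int ((n - a) * a + prs D + (n - a) * a + (c * (c - 1) div 2 + (if ep = 1 then c else 0)) +
   (a * c + a * (a - 1) div 2 + (if ep = 1 then a else 0))) - int (n * n)) / (qpoch ((1 / real q)\<^sup>2) (c div 2) * phs D)"
proof -
 have le: "a \<le> n - a" "n - a - a = c" "n - 2 * a = c" using assms by (simp_all add: a_def)
 define z where "z = qpoch ((1 / real q)\<^sup>2) (c div 2)"
 have pc: "ph c = hh c * z" unfolding z_def by (rule hh_ph)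
 have nz: "hh c \<noteq> 0" "z \<noteq> 0" using ph_nz[of c] unfolding pc by auto
 define A B where "A = c * (c - 1) div 2 + (if ep = 1 then c else 0)" and "B = a * c + a * (a - 1) div 2 + (if ep = 1 then a else 0)"
 have f: "ff ep c = real q ^ A * hh c" using ep by (auto simp: ff_def A_def)
 show ?thesis unfolding le(3) B_def[symmetric] z_def[symmetric] f unfolding A_def[symmetric] flagno_def a_def[symmetric] ij_ph[OF le(1)] ij_ph[OF order_refl] le(2) pc
  using q_real nz by (simp add: power_int_diff power_int_of_nat power_add ph_0 field_simps del: of_nat_add of_nat_mult)
qed

end

context quiver_stab
begin

text \<open>The inclusions are weak; the members are told apart by their dimension vectors once the
  entries of \<open>ds\<close> are nonzero.\<close>

definition flags :: "('v => (nat => 'k) set) => ('v => int) list => ('v => (nat => 'k) set) list set" where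
 "flags W ds = {xs. length xs = length ds \<and> set xs \<subseteq> Gr \<and> (\<forall>U\<in>set xs. U \<le> W) \<and> sorted_wrt (\<le>) xs \<and>
  (\<forall>k<length ds. dimv (xs ! k) = sum_list (take (Suc k) ds))}"

definition nds :: "('v => int) list => 'v => nat list" where
 "nds ds i = map (%e. nat (e i)) ds"

lemma finite_flags: "finite (flags W ds)"
 by (rule finite_subset[OF _ finite_lists_length_eq[OF finite_Gr, of "length ds"]]) (auto simp: flags_def)

lemma sum_list_nds:
 assumes "set ds \<subseteq> Lam_pos Q"
 shows "int (sum_list (nds ds i)) = sum_list ds i"
 using assms by (induction ds) (auto simp: nds_def Lam_pos_def)

lemma Lam_pos_sum_list: "set ds \<subseteq> Lam_pos Q ==> sum_list ds : Lam_pos Q"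
proof (induction ds)
 case Nil thus ?case by (simp add: Lam_pos_def Lam_def)
next
 case (Cons e ds)
 hence "e : Lam_pos Q" "sum_list ds : Lam_pos Q" by simp_all
 thus ?case by (simp add: Lam_pos_def Lam_def)
qed

lemma card_graded:
 assumes W: "W : Gr" and a: "a : Lam_pos Q"
 shows "real (card {U : Gr. U \<le> W \<and> dimv U = a}) = (\<Prod>i\<in>QV. ij (nat (a i)) (sdim (W i)) / ij (nat (a i)) (nat (a i)))"
proof -
 have "{U : Gr. U \<le> W \<and> dimv U = a} = (\<Pi>\<^sub>E i\<in>QV. {S. subspace K S (V i) \<and> S \<subseteq> W i \<and> sdim S = nat (a i)})" (is "?A = ?B")
 proof (intro equalityI subsetI)
  fix U assume U: "U : ?A"
  have "nat (a i) = sdim (U i)" if "i : QV" for i using U that by (auto simp: dimv_def)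
  thus "U : ?B" using U by (auto simp: Gr_def PiE_iff le_fun_def)
 next
  fix U assume U: "U : ?B"
  have G: "U : Gr" using U by (auto simp: Gr_def PiE_iff)
  have "U i \<subseteq> W i" for i
  proof (cases "i : QV")
   case True thus ?thesis using PiE_mem[OF U True] by blast
  next
   case False thus ?thesis using PiE_arb[OF U False] PiE_arb[OF W[unfolded Gr_def] False] by simp
  qed
  moreover have "dimv U = a"
  proof
   fix i show "dimv U i = a i"
    using PiE_mem[OF U, of i] a by (cases "i : QV") (auto simp: dimv_def Lam_pos_def Lam_def)
  qed
  ultimately show "U : ?A" using G by (simp add: le_fun_def)
 qed
 hence "real (card ?A) = (\<Prod>i\<in>QV. real (card {S. subspace K S (V i) \<and> S \<subseteq> W i \<and> sdim S = nat (a i)}))"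
  by (simp add: card_PiE[OF finite_verts])
 also have "\<dots> = (\<Prod>i\<in>QV. ij (nat (a i)) (sdim (W i)) / ij (nat (a i)) (nat (a i)))"
 proof (rule prod.cong[OF refl])
  fix i assume "i : QV"
  from card_subspaces[OF Gr_D(1,3)[OF W this], of "nat (a i)"] ij_nonzero[OF order_refl, of "nat (a i)"]
  show "real (card {S. subspace K S (V i) \<and> S \<subseteq> W i \<and> sdim S = nat (a i)}) = ij (nat (a i)) (sdim (W i)) / ij (nat (a i)) (nat (a i))"
   by (simp add: eq_divide_eq)
 qed
 finally show ?thesis .
qed

text \<open>The largest member is chosen first, hence the induction from the right.\<close>

lemma card_flags:
 assumes "W : Gr" "set ds \<subseteq> Lam_pos Q" "\<And>i. i : QV ==> sum_list (nds ds i) \<le> sdim (W i)"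
 shows "real (card (flags W ds)) = (\<Prod>i\<in>QV. flagno (sdim (W i)) (nds ds i))"
 using assms
proof (induction ds arbitrary: W rule: rev_induct)
 case Nil
 have "flags W [] = {[]}" by (auto simp: flags_def)
 thus ?case by (simp add: nds_def flagno_nil)
next
 case (snoc e ds)
 let ?a = "sum_list (ds @ [e])"
 define B where "B = {U : Gr. U \<le> W \<and> dimv U = ?a}"
 have ds: "set ds \<subseteq> Lam_pos Q" and eL: "e : Lam_pos Q" using snoc.prems(2) by auto
 have aL: "?a : Lam_pos Q" by (rule Lam_pos_sum_list[OF snoc.prems(2)])
 have nd: "nds (ds @ [e]) i = nds ds i @ [nat (e i)]" for i by (simp add: nds_def)
 have na: "nat (?a i) = sum_list (nds ds i) + nat (e i)" for i
  using eL by (simp add: sum_list_nds[OF ds, symmetric] nat_add_distrib Lam_pos_def)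
 have fB: "finite B" unfolding B_def using finite_Gr by simp
 have BD: "U : Gr" "U \<le> W" "dimv U = ?a" "i : QV ==> sdim (U i) = sum_list (nds ds i) + nat (e i)" if "U : B" for U i
 proof -
  show *: "U : Gr" "U \<le> W" "dimv U = ?a" using that by (auto simp: B_def)
  assume "i : QV"
  hence "int (sdim (U i)) = ?a i" using fun_cong[OF *(3), of i] by (simp add: dimv_def)
  thus "sdim (U i) = sum_list (nds ds i) + nat (e i)" using na[of i] by simp
 qed
 have "flags W (ds @ [e]) = (\<Union>U\<in>B. (%ys. ys @ [U]) ` flags U ds)"
 proof (intro equalityI subsetI)
  fix xs assume xs: "xs : flags W (ds @ [e])"
  hence "xs \<noteq> []" by (auto simp: flags_def)
  then obtain ys U where x: "xs = ys @ [U]" by (metis append_butlast_last_id)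
  have l: "length ys = length ds" using xs by (simp add: flags_def x)
  have k: "dimv ((ys @ [U]) ! k) = sum_list (take (Suc k) (ds @ [e]))" if "k < Suc (length ds)" for k
   using xs that by (simp add: flags_def x)
  have "dimv U = ?a" using k[of "length ds"] by (simp add: nth_append l)
  moreover have "dimv (ys ! j) = sum_list (take (Suc j) ds)" if "j < length ds" for j
   using k[of j] that by (simp add: nth_append l)
  ultimately have "U : B" "ys : flags U ds" using xs l by (auto simp: flags_def x B_def sorted_wrt_append)
  thus "xs : (\<Union>U\<in>B. (%ys. ys @ [U]) ` flags U ds)" unfolding x by blast
 next
  fix xs assume "xs : (\<Union>U\<in>B. (%ys. ys @ [U]) ` flags U ds)"
  then obtain ys U where x: "xs = ys @ [U]" "U : B" "ys : flags U ds" by blast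
  have y: "length ys = length ds" "set ys \<subseteq> Gr" "\<And>Y. Y : set ys ==> Y \<le> U" "sorted_wrt (\<le>) ys"
   "\<And>k. k < length ds ==> dimv (ys ! k) = sum_list (take (Suc k) ds)" using x(3) by (auto simp: flags_def)
  note U = BD(1-3)[OF x(2)]
  have "dimv (xs ! k) = sum_list (take (Suc k) (ds @ [e]))" if k: "k < length (ds @ [e])" for k
  proof (cases "k < length ds")
   case True thus ?thesis using y(5)[OF True] by (simp add: x(1) nth_append y(1))
  next
   case False
   hence "k = length ds" using k by simp
   thus ?thesis using U(3) by (simp add: x(1) nth_append y(1))
  qed
  moreover have "Y \<le> W" if "Y : set xs" for Y using that y(3) U(2) order_trans by (fastforce simp: x(1))
  ultimately show "xs : flags W (ds @ [e])" using y(1,2,3,4) U(1) by (simp add: flags_def x(1) sorted_wrt_append)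
 qed
 hence "card (flags W (ds @ [e])) = card (\<Union>U\<in>B. (%ys. ys @ [U]) ` flags U ds)" by (rule arg_cong)
 also have "\<dots> = (\<Sum>U\<in>B. card ((%ys. ys @ [U]) ` flags U ds))"
  by (rule card_UN_disjoint[OF fB]) (use finite_flags in auto)
 also have "\<dots> = (\<Sum>U\<in>B. card (flags U ds))" by (rule sum.cong[OF refl], rule card_image) (simp add: inj_on_def)
 finally have "real (card (flags W (ds @ [e]))) = (\<Sum>U\<in>B. real (card (flags U ds)))" by simp
 also have "\<dots> = (\<Sum>U\<in>B. \<Prod>i\<in>QV. flagno (sum_list (nds ds i) + nat (e i)) (nds ds i))"
 proof (rule sum.cong[OF refl])
  fix U assume U: "U : B"
  have "real (card (flags U ds)) = (\<Prod>i\<in>QV. flagno (sdim (U i)) (nds ds i))"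
   by (rule snoc.IH[OF BD(1)[OF U] ds]) (simp add: BD(4)[OF U])
  also have "\<dots> = (\<Prod>i\<in>QV. flagno (sum_list (nds ds i) + nat (e i)) (nds ds i))"
   by (rule prod.cong[OF refl]) (simp add: BD(4)[OF U])
  finally show "real (card (flags U ds)) = (\<Prod>i\<in>QV. flagno (sum_list (nds ds i) + nat (e i)) (nds ds i))" .
 qed
 also have "\<dots> = real (card B) * (\<Prod>i\<in>QV. flagno (sum_list (nds ds i) + nat (e i)) (nds ds i))" by simp
 also have "\<dots> = (\<Prod>i\<in>QV. ij (nat (?a i)) (sdim (W i)) / ij (nat (?a i)) (nat (?a i)) * flagno (sum_list (nds ds i) + nat (e i)) (nds ds i))"
  unfolding B_def card_graded[OF snoc.prems(1) aL] by (rule prod.distrib[symmetric])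
 also have "\<dots> = (\<Prod>i\<in>QV. flagno (sdim (W i)) (nds (ds @ [e]) i))"
 proof (rule prod.cong[OF refl])
  fix i assume i: "i : QV"
  have "sum_list (nds ds i) + nat (e i) \<le> sdim (W i)" using snoc.prems(3)[OF i] unfolding nd by simp
  from flagno_snoc[OF this] show "ij (nat (?a i)) (sdim (W i)) / ij (nat (?a i)) (nat (?a i)) * flagno (sum_list (nds ds i) + nat (e i)) (nds ds i) =
   flagno (sdim (W i)) (nds (ds @ [e]) i)" unfolding nd na by simp
 qed
 finally show ?case .
qed

end

section \<open>Summation over types\<close>

context quiver_stab
begin

definition ftype :: "('v => (nat => 'k) set) list => ('v => int) list" where
 "ftype xs = map (%k. dimv (xs ! k) - (if k = 0 then 0 else dimv (xs ! (k - 1)))) [0..<length xs]"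

text \<open>The only candidate for \<open>dinf\<close> once \<open>ds\<close> is given; it may have
  negative entries.\<close>

definition tinf :: "('v => int) list => 'v => int" where
 "tinf ds = d - sum_list (map (hyp Q s0) ds)"

definition topgr :: "'v => (nat => 'k) set" where
 "topgr = (\<lambda>i\<in>QV. VC i)"

definition Pos where "Pos = {U : Gr. \<theta> (dimv U) > 0}"

text \<open>For a chain in \<open>Pos\<close> this is the number of structures \<open>D\<close> for
  which the chain lies in \<open>PD D\<close>.\<close>

definition Cf where
 "Cf xs = card {D : Dat. \<forall>U\<in>set xs. stable (fst D) U \<and> isot (snd D) U}"

lemma topgr: "topgr : Gr" "i : QV ==> sdim (topgr i) = n i" "U : Gr ==> U \<le> topgr"
proof -
 show "topgr : Gr" by (rule GrI) (simp_all add: topgr_def V_subspace)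
 show "i : QV ==> sdim (topgr i) = n i" by (simp add: topgr_def sdim_V)
 assume U: "U : Gr"
 show "U \<le> topgr"
 proof (rule le_funI)
  fix i show "U i \<le> topgr i"
   using Gr_D(2)[OF U, of i] PiE_arb[OF U[unfolded Gr_def], of i] by (cases "i : QV") (auto simp: topgr_def)
 qed
qed

lemma ftype_simps: "length (ftype xs) = length xs" "k < length xs ==> sum_list (take (Suc k) (ftype xs)) = dimv (xs ! k)"
proof -
 show l: "length (ftype xs) = length xs" by (simp add: ftype_def)
 show "k < length xs ==> sum_list (take (Suc k) (ftype xs)) = dimv (xs ! k)"
 proof (induction k)
  case 0 thus ?case by (simp add: take_Suc_conv_app_nth l) (simp add: ftype_def)
 next
  case (Suc k)
  thus ?case by (simp add: take_Suc_conv_app_nth[of "Suc k"] l) (simp add: ftype_def)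
 qed
qed

lemma hyp_sum: "sum_list (map (hyp Q s0) ds) i = sum_list ds i + (if i : QV then sum_list ds (s0 i) else 0)"
 by (induction ds) (auto simp: hyp_def inv_act_def)

lemma tinf_inv:
 assumes "set ds \<subseteq> Lam_pos Q" "tinf ds : Lam_pos Q"
 shows "tinf ds : Lam_inv_pos Q s0"
proof -
 have "inv_act Q s0 (tinf ds) i = tinf ds i" for i
  using node_closed[of i] node_invol[of i] d_D(1,3)[of i] Lam_pos_sum_list[OF assms(1)]
  by (cases "i : QV") (simp_all add: inv_act_def tinf_def hyp_sum Lam_pos_def Lam_def)
 thus ?thesis using assms(2) by (simp add: Lam_inv_pos_def fun_eq_iff)
qed

lemma dimv_less:
 assumes U: "U : Gr" and W: "W : Gr" and lt: "U < W"
 shows "dimv W - dimv U : Lam_pos Q" "dimv W \<noteq> dimv U"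
proof -
 have le: "U i \<subseteq> W i" for i using le_funD[OF less_imp_le[OF lt]] .
 have sd: "sdim (U i) \<le> sdim (W i)" if "i : QV" for i
  by (rule sdim_mono[OF Gr_D(1)[OF U that] Gr_D(1,3)[OF W that] le])
 show "dimv W - dimv U : Lam_pos Q" using sd by (simp add: Lam_pos_def Lam_def dimv_def)
 show "dimv W \<noteq> dimv U"
 proof
  assume eq: "dimv W = dimv U"
  have "U i = W i" for i
  proof (cases "i : QV")
   case True
   have "sdim (W i) = sdim (U i)" using fun_cong[OF eq, of i] True by (simp add: dimv_def)
   hence "card (U i) = card (W i)" using card_subspace[OF Gr_D(1,3)[OF U True]] card_subspace[OF Gr_D(1,3)[OF W True]] by simp
   thus ?thesis by (rule card_subset_eq[OF Gr_D(3)[OF W True] le])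
  next
   case False thus ?thesis using PiE_arb[OF U[unfolded Gr_def] False] PiE_arb[OF W[unfolded Gr_def] False] by simp
  qed
  thus False using lt by (simp add: fun_eq_iff less_le)
 qed
qed

lemma HN_D:
 assumes "(ds, dinf) : HN_types Q s0 \<theta> d"
 shows "set ds \<subseteq> Lam_pos Q" "k < length ds ==> ds ! k \<noteq> 0" "dinf : Lam_inv_pos Q s0" "dinf = tinf ds"
  "k < length ds ==> \<theta> (sum_list (take (Suc k) ds)) > 0"
  "i : QV ==> d i = sum_list ds i + sum_list ds (s0 i) + dinf i" "0 \<le> dinf i"
proof -
 have a: "\<forall>x\<in>set ds. x : Lam_pos Q \<and> x \<noteq> 0" and b: "dinf : Lam_inv_pos Q s0"
  and c: "sum_list (map (hyp Q s0) ds) + dinf = d"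
  and e: "(ds, dinf) = ([], d) \<or> (\<forall>j\<in>{1..length ds}. slope Q \<theta> (sum_list (take j ds)) > 0)"
  using assms by (auto simp: HN_types_def)
 show l: "set ds \<subseteq> Lam_pos Q" using a by blast
 show "k < length ds ==> ds ! k \<noteq> 0" using a nth_mem by blast
 show "dinf : Lam_inv_pos Q s0" by (rule b)
 show "dinf = tinf ds" using c unfolding tinf_def by (simp add: eq_diff_eq add.commute)
 show "0 \<le> dinf i" using b by (simp add: Lam_inv_pos_def Lam_pos_def)
 show "d i = sum_list ds i + sum_list ds (s0 i) + dinf i" if "i : QV"
  using fun_cong[OF c, of i] that by (simp add: hyp_sum)
 assume k: "k < length ds"
 have "set (take (Suc k) ds) \<subseteq> Lam_pos Q" using l set_take_subset[of "Suc k" ds] by blast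
 moreover have "slope Q \<theta> (sum_list (take (Suc k) ds)) > 0" using e k by auto
 ultimately show "\<theta> (sum_list (take (Suc k) ds)) > 0" using slope_pos_iff[OF Lam_pos_sum_list] by blast
qed

lemma psum_mono:
 assumes "set ds \<subseteq> Lam_pos Q" "j \<le> k"
 shows "sum_list (take j ds) i \<le> sum_list (take k ds) i"
proof -
 have "take k ds = take j ds @ take (k - j) (drop j ds)" using assms(2) by (metis le_add_diff_inverse take_add)
 moreover have "set (take (k - j) (drop j ds)) \<subseteq> Lam_pos Q"
  using assms(1) set_take_subset set_drop_subset by (metis subset_trans)
 ultimately show ?thesis using Lam_pos_sum_list by (simp add: Lam_pos_def)
qed

text \<open>Nonzero entries of \<open>ds\<close> make the inclusions strict, and positivity of the
  partial sums puts the members into \<open>Pos\<close>.\<close>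

lemma flags_type:
 assumes HN: "(ds, dinf) : HN_types Q s0 \<theta> d" and xs: "xs : flags topgr ds"
 shows "set xs \<subseteq> Gr" "sorted_wrt (<) xs" "ftype xs = ds" "set xs \<subseteq> Pos"
proof -
 note H = HN_D[OF HN]
 have l: "length xs = length ds" and G: "set xs \<subseteq> Gr" and so: "sorted_wrt (\<le>) xs"
  and dv: "\<And>k. k < length ds ==> dimv (xs ! k) = sum_list (take (Suc k) ds)" using xs by (auto simp: flags_def)
 show "set xs \<subseteq> Gr" by (rule G)
 show "sorted_wrt (<) xs" unfolding sorted_wrt_iff_nth_less
 proof (intro allI impI)
  fix j k assume jk: "j < k" "k < length xs"
  have k: "k < length ds" using jk l by simp
  have "ds ! k : Lam_pos Q" using H(1) k nth_mem by blast
  then obtain i where i: "(ds ! k) i > 0" using H(2)[OF k] unfolding Lam_pos_def fun_eq_iff by (auto simp: less_le)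
  have "sum_list (take (Suc j) ds) i \<le> sum_list (take k ds) i" by (rule psum_mono[OF H(1)]) (use jk in simp)
  also have "\<dots> < sum_list (take (Suc k) ds) i" using i k by (simp add: take_Suc_conv_app_nth)
  finally have "dimv (xs ! j) \<noteq> dimv (xs ! k)" using dv[OF k] dv[of j] jk k by auto
  hence "xs ! j \<noteq> xs ! k" by auto
  moreover have "xs ! j \<le> xs ! k" by (rule sorted_wrt_nth_less[OF so jk])
  ultimately show "xs ! j < xs ! k" by simp
 qed
 show "ftype xs = ds"
 proof (rule nth_equalityI)
  show "length (ftype xs) = length ds" by (simp add: ftype_simps l)
  fix k assume "k < length (ftype xs)"
  hence k: "k < length ds" by (simp add: ftype_simps l)
  show "ftype xs ! k = ds ! k"
  proof (cases k)
   case 0 thus ?thesis using k dv[OF k] by (simp add: ftype_def l take_Suc_conv_app_nth)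
  next
   case (Suc j)
   have "sum_list (take (Suc k) ds) = sum_list (take k ds) + ds ! k" using k by (simp add: take_Suc_conv_app_nth)
   thus ?thesis using k dv[OF k] dv[of j] Suc by (simp add: ftype_def l)
  qed
 qed
 show "set xs \<subseteq> Pos"
 proof
  fix U assume "U : set xs"
  then obtain k where k: "k < length ds" "U = xs ! k" unfolding l[symmetric] by (metis in_set_conv_nth)
  show "U : Pos" using \<open>U : set xs\<close> G H(5)[OF k(1)] dv[OF k(1)] k(2) by (auto simp: Pos_def)
 qed
qed

text \<open>Conversely, a chain in \<open>Pos\<close> has nonzero successive differences and partial
  sums of positive \<theta>; the hypothesis supplies nonnegativity of the remaining part.\<close>

lemma ftype_HN:
 assumes xs: "xs : strict_lists Pos" and t: "tinf (ftype xs) : Lam_pos Q"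
 shows "(ftype xs, tinf (ftype xs)) : HN_types Q s0 \<theta> d" "xs : flags topgr (ftype xs)"
proof -
 have so: "sorted_wrt (<) xs" and P: "set xs \<subseteq> Pos" using xs by (auto simp: strict_lists_def)
 have G: "xs ! k : Gr" "\<theta> (dimv (xs ! k)) > 0" if "k < length xs" for k
  using P nth_mem[OF that] by (auto simp: Pos_def)
 have el: "ftype xs ! k : Lam_pos Q \<and> ftype xs ! k \<noteq> 0" if k: "k < length xs" for k
 proof (cases k)
  case 0
  hence "ftype xs ! k = dimv (xs ! k)" using k by (simp add: ftype_def)
  thus ?thesis using dimv_pos[of "xs ! k"] G(2)[OF k] theta_zero(1) by (cases "dimv (xs ! k) = 0") auto
 next
  case (Suc j)
  have "ftype xs ! k = dimv (xs ! k) - dimv (xs ! j)" using k Suc by (simp add: ftype_def)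
  moreover have "xs ! j < xs ! k" using sorted_wrt_nth_less[OF so, of j k] k Suc by simp
  ultimately show ?thesis using dimv_less[OF G(1)[of j] G(1)[OF k]] k Suc by simp
 qed
 have el': "\<forall>x\<in>set (ftype xs). x : Lam_pos Q \<and> x \<noteq> 0"
  using el by (metis in_set_conv_nth ftype_simps(1))
 have ds: "set (ftype xs) \<subseteq> Lam_pos Q" using el' by blast
 have "\<forall>j\<in>{1..length (ftype xs)}. slope Q \<theta> (sum_list (take j (ftype xs))) > 0"
 proof
  fix j assume "j : {1..length (ftype xs)}"
  then obtain k where k: "j = Suc k" "k < length xs" by (cases j) (auto simp: ftype_simps)
  show "slope Q \<theta> (sum_list (take j (ftype xs))) > 0"
   unfolding k(1) ftype_simps(2)[OF k(2)] using slope_pos_iff[OF dimv_pos] G(2)[OF k(2)] by blast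
 qed
 thus "(ftype xs, tinf (ftype xs)) : HN_types Q s0 \<theta> d"
  unfolding HN_types_def using el' tinf_inv[OF ds t] by (simp add: tinf_def)
 have "set xs \<subseteq> Gr" using P by (auto simp: Pos_def)
 moreover have "sorted_wrt (\<le>) xs" using sorted_wrt_mono_rel[OF _ so] by (simp add: less_imp_le)
 ultimately show "xs : flags topgr (ftype xs)" using topgr(3) ftype_simps by (auto simp: flags_def)
qed

text \<open>If the largest member \<open>U\<close> is isotropic for some structure, its part at
  \<open>s0 i\<close> lies in the complement of its part at \<open>i\<close>, so the two dimensions
  add up to at most \<open>d i\<close>. Chains that violate this contribute 0 to the sum over
  chains.\<close>

lemma Cf_zero:
 assumes xs: "xs : strict_lists Pos" and nz: "Cf xs \<noteq> 0"
 shows "tinf (ftype xs) : Lam_pos Q"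
proof -
 have "\<exists>D. D : Dat \<and> (\<forall>U\<in>set xs. stable (fst D) U \<and> isot (snd D) U)"
 proof (rule ccontr)
  assume "\<not> ?thesis"
  hence e: "{D : Dat. \<forall>U\<in>set xs. stable (fst D) U \<and> isot (snd D) U} = {}" by blast
  show False using nz unfolding Cf_def e by simp
 qed
 then obtain D where D: "D : Dat" "\<forall>U\<in>set xs. stable (fst D) U \<and> isot (snd D) U" by blast
 show ?thesis
 proof (cases "xs = []")
  case True
  thus ?thesis using d_inv by (simp add: ftype_def tinf_def Lam_inv_pos_def)
 next
  case False
  define U where "U = xs ! (length xs - 1)"
  have k: "length xs - 1 < length xs" using False by simp
  have US: "U : set xs" unfolding U_def by (rule nth_mem[OF k])
  hence UG: "U : Gr" and I: "isot (snd D) U" using xs D(2) by (auto simp: strict_lists_def Pos_def)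
  have s: "sum_list (ftype xs) = dimv U"
   using ftype_simps(2)[OF k] ftype_simps(1)[of xs] False unfolding U_def by simp
  have "sdim (U i) + sdim (U (s0 i)) \<le> n i" if i: "i : QV" for i
  proof -
   note j = node_closed[OF i]
   have sd: "sdim (VC i) = sdim (VC (s0 i))" by (simp add: sdim_V n_sigma[OF i])
   note p = perp_facts[OF Dat_D(2)[OF D(1) i] V_subspace finite_V V_subspace finite_V sd Dat_D(4)[OF D(1) i] Gr_D(1)[OF UG i] Gr_D(2)[OF UG i]]
   have "U (s0 i) \<subseteq> perp (snd D i) (U i) (VC (s0 i))"
    using I i Gr_D(2)[OF UG j] unfolding isot_def perp_def by blast
   from sdim_mono[OF Gr_D(1)[OF UG j] p(1) finite_subset[OF p(2) finite_V] this] p(3)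
   show ?thesis by (simp add: sdim_V n_sigma[OF i])
  qed
  hence "int (sdim (U i)) + int (sdim (U (s0 i))) \<le> d i" if "i : QV" for i
   using that d_D(2)[of i] unfolding n_def by fastforce
  thus ?thesis using node_closed d_D(1,2)
   by (simp add: tinf_def hyp_sum s Lam_pos_def Lam_def) (simp add: dimv_def)
 qed
qed

text \<open>Nonemptiness makes the type map surjective onto \<open>HN_types\<close>, from which the
  finiteness of that set is deduced.\<close>

lemma flags_nonempty:
 assumes HN: "(ds, dinf) : HN_types Q s0 \<theta> d"
 shows "real (card (flags topgr ds)) = (\<Prod>i\<in>QV. flagno (n i) (nds ds i))" "flags topgr ds \<noteq> {}"
proof -
 note H = HN_D[OF HN]
 have le: "sum_list (nds ds i) \<le> sdim (topgr i)" if i: "i : QV" for i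
 proof -
  have "int (sum_list (nds ds i)) \<le> d i"
   using H(6)[OF i] H(7)[of i] Lam_pos_sum_list[OF H(1)] unfolding sum_list_nds[OF H(1)] by (simp add: Lam_pos_def)
  thus ?thesis using topgr(2)[OF i] by (simp add: n_def)
 qed
 have c: "real (card (flags topgr ds)) = (\<Prod>i\<in>QV. flagno (sdim (topgr i)) (nds ds i))"
  by (rule card_flags[OF topgr(1) H(1) le])
 also have "\<dots> = (\<Prod>i\<in>QV. flagno (n i) (nds ds i))" by (rule prod.cong[OF refl]) (simp add: topgr(2))
 finally show e: "real (card (flags topgr ds)) = (\<Prod>i\<in>QV. flagno (n i) (nds ds i))" .
 have "(\<Prod>i\<in>QV. flagno (n i) (nds ds i)) > 0" by (intro prod_pos) (simp add: flagno_pos)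
 thus "flags topgr ds \<noteq> {}" unfolding e[symmetric] by auto
qed

text \<open>Chains with nonnegative remainder are grouped by their type; the fibre over a type is
  its set of flags.\<close>

lemma HN_finite: "finite (HN_types Q s0 \<theta> d)"
 and sum_types: "(\<Sum>xs\<in>strict_lists Pos. (-1) ^ length xs * int (Cf xs)) =
  (\<Sum>(ds, dinf)\<in>HN_types Q s0 \<theta> d. (-1) ^ length ds * (\<Sum>xs\<in>flags topgr ds. int (Cf xs)))"
proof -
 define X where "X = {xs : strict_lists Pos. tinf (ftype xs) : Lam_pos Q}"
 define g where "g = (%xs. (ftype xs, tinf (ftype xs)))"
 have "finite Pos" unfolding Pos_def using finite_Gr by simp
 hence fS: "finite (strict_lists Pos)" by (rule finite_strict_lists)
 hence fX: "finite X" unfolding X_def by simp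
 have fib: "{xs : X. g xs = (ds, dinf)} = flags topgr ds" if HN: "(ds, dinf) : HN_types Q s0 \<theta> d" for ds dinf
 proof (intro equalityI subsetI)
  fix xs assume "xs : {xs : X. g xs = (ds, dinf)}"
  thus "xs : flags topgr ds" using ftype_HN(2)[of xs] by (auto simp: X_def g_def)
 next
  fix xs assume xs: "xs : flags topgr ds"
  note F = flags_type[OF HN xs] and H = HN_D(3,4)[OF HN]
  have "dinf : Lam_pos Q" using H(1) by (simp add: Lam_inv_pos_def)
  thus "xs : {xs : X. g xs = (ds, dinf)}" using F H(2) by (simp add: X_def g_def strict_lists_def)
 qed
 have gX: "g ` X = HN_types Q s0 \<theta> d"
 proof (intro equalityI subsetI)
  fix t assume "t : g ` X"
  thus "t : HN_types Q s0 \<theta> d" using ftype_HN(1) by (auto simp: X_def g_def)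
 next
  fix t assume t: "t : HN_types Q s0 \<theta> d"
  obtain ds dinf where e: "t = (ds, dinf)" by (cases t)
  obtain xs where "xs : flags topgr ds" using flags_nonempty(2)[OF t[unfolded e]] by blast
  thus "t : g ` X" unfolding fib[OF t[unfolded e], symmetric] e by (auto intro: image_eqI[OF sym])
 qed
 show fH: "finite (HN_types Q s0 \<theta> d)" unfolding gX[symmetric] using fX by simp
 have "(\<Sum>xs\<in>strict_lists Pos. (-1) ^ length xs * int (Cf xs)) = (\<Sum>xs\<in>X. (-1) ^ length xs * int (Cf xs))"
  by (rule sum.mono_neutral_right[OF fS]) (use Cf_zero in \<open>auto simp: X_def\<close>)
 also have "\<dots> = (\<Sum>t\<in>HN_types Q s0 \<theta> d. \<Sum>xs\<in>{xs : X. g xs = t}. (-1) ^ length xs * int (Cf xs))"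
  by (rule sum.group[symmetric, OF fX fH]) (simp add: gX)
 also have "\<dots> = (\<Sum>(ds, dinf)\<in>HN_types Q s0 \<theta> d. (-1) ^ length ds * (\<Sum>xs\<in>flags topgr ds. int (Cf xs)))"
 proof (rule sum.cong[OF refl])
  fix t assume t: "t : HN_types Q s0 \<theta> d"
  obtain ds dinf where e: "t = (ds, dinf)" by (cases t)
  have "length xs = length ds" if "xs : flags topgr ds" for xs using that by (simp add: flags_def)
  thus "(\<Sum>xs\<in>{xs : X. g xs = t}. (-1) ^ length xs * int (Cf xs)) =
   (case t of (ds, dinf) => (-1) ^ length ds * (\<Sum>xs\<in>flags topgr ds. int (Cf xs)))"
   unfolding e fib[OF t[unfolded e]] by (simp add: sum_distrib_left)
 qed
 finally show "(\<Sum>xs\<in>strict_lists Pos. (-1) ^ length xs * int (Cf xs)) =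
  (\<Sum>(ds, dinf)\<in>HN_types Q s0 \<theta> d. (-1) ^ length ds * (\<Sum>xs\<in>flags topgr ds. int (Cf xs)))" .
qed

theorem semistable_count:
 "int (card {D : Dat. sd_semistable K Q \<theta> (mk D)}) =
  (\<Sum>(ds, dinf)\<in>HN_types Q s0 \<theta> d. (-1) ^ length ds * (\<Sum>xs\<in>flags topgr ds. int (Cf xs)))"
proof -
 have "finite Pos" unfolding Pos_def using finite_Gr by simp
 hence fS: "finite (strict_lists Pos)" by (rule finite_strict_lists)
 have "int (card {D : Dat. sd_semistable K Q \<theta> (mk D)}) = (\<Sum>D\<in>Dat. if sd_semistable K Q \<theta> (mk D) then 1 else 0)"
  using finite_Dat by (simp add: sum.If_cases Int_def)
 also have "\<dots> = (\<Sum>D\<in>Dat. chain_sum (PD D))" by (rule sum.cong[OF refl]) (simp add: chain_sum_PD)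
 \<comment> \<open>A chain in \<open>PD D\<close> is a chain in \<open>Pos\<close> whose members are
   stable and isotropic for \<open>D\<close>. As \<open>Pos\<close> does not depend on
   \<open>D\<close>, the sums can be exchanged.\<close>
 also have "\<dots> = (\<Sum>D\<in>Dat. \<Sum>xs\<in>{xs : strict_lists Pos. \<forall>U\<in>set xs. stable (fst D) U \<and> isot (snd D) U}. (-1) ^ length xs)"
  unfolding chain_sum_def
  by (intro sum.cong refl) (auto simp: strict_lists_def PD_def Pos_def)
 also have "\<dots> = (\<Sum>xs\<in>strict_lists Pos. \<Sum>D\<in>{D : Dat. \<forall>U\<in>set xs. stable (fst D) U \<and> isot (snd D) U}. (-1) ^ length xs)"
  by (rule sum.swap_restrict[OF finite_Dat fS])
 also have "\<dots> = (\<Sum>xs\<in>strict_lists Pos. (-1) ^ length xs * int (Cf xs))"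
  unfolding Cf_def by (simp add: mult.commute)
 also note sum_types
 finally show ?thesis .
qed

end

section \<open>Exponents\<close>

text \<open>Summation by parts: both sides are the sum of x k * y l over l \<le> k, grouped by l and
  by k.\<close>

lemma abel_sum:
 fixes x y X Y :: "nat => int"
 assumes X: "\<And>k. k < N ==> X (Suc k) = X k + x k" and Y: "\<And>k. k < N ==> Y (Suc k) = Y k + y k" "Y 0 = 0"
 shows "(\<Sum>l<N. y l * (X N - X l)) = (\<Sum>k<N. x k * Y (Suc k))"
proof -
 have Ys: "M \<le> N ==> Y M = (\<Sum>l<M. y l)" for M by (induction M) (simp_all add: Y)
 have "M \<le> N ==> (\<Sum>l<M. y l * (X M - X l)) = (\<Sum>k<M. x k * Y (Suc k))" for M
 proof (induction M)
  case (Suc M)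
  hence M: "M < N" by simp
  have "(\<Sum>l<Suc M. y l * (X (Suc M) - X l)) = (\<Sum>l<M. y l * (X M - X l) + x M * y l) + y M * x M"
   by (simp add: X[OF M] algebra_simps)
  also have "\<dots> = (\<Sum>k<M. x k * Y (Suc k)) + x M * Y M + y M * x M"
   using Suc Ys[of M] by (simp add: sum.distrib sum_distrib_left[symmetric])
  finally show ?case by (simp add: Y(1)[OF M] algebra_simps)
 qed simp
 thus ?thesis by simp
qed

text \<open>The extended flag is symmetric about its middle step \<open>N\<close>; the upper half is
  summed in reflected order.\<close>

lemma sum_symmetric_split: "(\<Sum>k<Suc (2 * N). g k) = (\<Sum>k<N. g k) + g N + (\<Sum>l<N. g (2 * N - l))" for g :: "nat => int"
proof -
 have e: "{..<Suc (2 * N)} = insert N ({..<N} \<union> (%l. 2 * N - l) ` {..<N})"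
 proof (intro equalityI subsetI)
  fix k assume k: "k : {..<Suc (2 * N)}"
  show "k : insert N ({..<N} \<union> (%l. 2 * N - l) ` {..<N})"
  proof (cases "k \<le> N")
   case False
   hence "k = 2 * N - (2 * N - k)" "2 * N - k < N" using k by auto
   thus ?thesis by blast
  qed auto
 qed auto
 have "(\<Sum>k\<in>{..<N} \<union> (%l. 2 * N - l) ` {..<N}. g k) = (\<Sum>k<N. g k) + (\<Sum>k\<in>(%l. 2 * N - l) ` {..<N}. g k)"
  by (rule sum.union_disjoint) auto
 moreover have "(\<Sum>k\<in>(%l. 2 * N - l) ` {..<N}. g k) = (\<Sum>l<N. g (2 * N - l))"
  by (subst sum.reindex) (auto simp: inj_on_def)
 moreover have "(\<Sum>k<Suc (2 * N). g k) = g N + (\<Sum>k\<in>{..<N} \<union> (%l. 2 * N - l) ` {..<N}. g k)"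
  unfolding e by (rule sum.insert) auto
 ultimately show ?thesis by simp
qed

lemma double_half: "ep : {1, -1} ==> 2 * ((z * (z + ep)) div 2) = z * (z + ep)" "ep : {1, -1} ==> 2 * ((z * (z - ep)) div 2) = z * (z - ep)"
 for z ep :: int
 by auto

lemma triangle_int:
 assumes "ep : {1, -1}"
 shows "2 * int (c * (c - 1) div 2 + (if ep = 1 then c else 0)) = int c * (int c + ep)"
proof -
 have "even (c * (c - 1))" by (cases "even c") auto
 hence "2 * (c * (c - 1) div 2) = c * (c - 1)" by simp
 hence "2 * int (c * (c - 1) div 2) = int (c * (c - 1))" by (metis of_nat_mult of_nat_numeral)
 also have "\<dots> = int c * (int c - 1)" by (cases c) (simp_all add: algebra_simps)
 finally show ?thesis using assms by (auto simp: algebra_simps)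
qed

lemma prod_powi: "(z::real) \<noteq> 0 ==> (\<Prod>i\<in>I. z powi f i) = z powi (\<Sum>i\<in>I. f i)"
 by (induction I rule: infinite_finite_induct) (simp_all add: power_int_add)

lemma halves_nonneg: "ep : {1, -1} ==> 0 \<le> z ==> 0 \<le> z * (z + ep)" for z ep :: int
 by (cases "z = 0") auto

context quiver_stab
begin

lemma
 fixes f :: "'v => real" and g :: "'v => int"
 shows split_verts: "(\<Prod>i\<in>QV. f i) = (\<Prod>i\<in>P0. f i * f (s0 i)) * (\<Prod>i\<in>fixed_nodes Q s0. f i)"
 and split_verts_sum: "(\<Sum>i\<in>QV. g i) = (\<Sum>i\<in>P0. g i + g (s0 i)) + (\<Sum>i\<in>fixed_nodes Q s0. g i)"
proof -
 have e: "QV = (P0 \<union> s0 ` P0) \<union> fixed_nodes Q s0" and dj: "(P0 \<union> s0 ` P0) \<inter> fixed_nodes Q s0 = {}" "P0 \<inter> s0 ` P0 = {}"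
  using splitting unfolding involution_splitting_def by auto
 have fin: "finite P0" "finite (s0 ` P0)" "finite (P0 \<union> s0 ` P0)" "finite (fixed_nodes Q s0)"
  using finite_verts unfolding e by auto
 have inj: "inj_on s0 P0" by (rule inj_onI) (metis node_invol P_sub(1))
 show "(\<Prod>i\<in>QV. f i) = (\<Prod>i\<in>P0. f i * f (s0 i)) * (\<Prod>i\<in>fixed_nodes Q s0. f i)"
  unfolding e prod.union_disjoint[OF fin(3,4) dj(1)] prod.union_disjoint[OF fin(1,2) dj(2)] prod.reindex[OF inj] by (simp add: prod.distrib)
 show "(\<Sum>i\<in>QV. g i) = (\<Sum>i\<in>P0. g i + g (s0 i)) + (\<Sum>i\<in>fixed_nodes Q s0. g i)"
  unfolding e sum.union_disjoint[OF fin(3,4) dj(1)] sum.union_disjoint[OF fin(1,2) dj(2)] sum.reindex[OF inj] by (simp add: sum.distrib)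
qed

lemma split_arcs_sum: "(\<Sum>al\<in>QA. g al) = (\<Sum>al\<in>P1. g al + g (s1 al)) + (\<Sum>al\<in>fixed_arrows Q s1. g al)" for g :: "'a => int"
proof -
 have e: "QA = (P1 \<union> s1 ` P1) \<union> fixed_arrows Q s1" and dj: "(P1 \<union> s1 ` P1) \<inter> fixed_arrows Q s1 = {}" "P1 \<inter> s1 ` P1 = {}"
  using splitting unfolding involution_splitting_def by auto
 have fin: "finite P1" "finite (s1 ` P1)" "finite (P1 \<union> s1 ` P1)" "finite (fixed_arrows Q s1)"
  using finite_arcs unfolding e by auto
 have inj: "inj_on s1 P1" by (rule inj_onI) (metis arrow_invol P_sub(2))
 show ?thesis
  unfolding e sum.union_disjoint[OF fin(3,4) dj(1)] sum.union_disjoint[OF fin(1,2) dj(2)] sum.reindex[OF inj] by (simp add: sum.distrib)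
qed

section \<open>The exponents attached to one type\<close>

context
 fixes ds dinf
 assumes HN: "(ds, dinf) : HN_types Q s0 \<theta> d"
begin

abbreviation "NN \<equiv> length ds"
abbreviation "pp k i \<equiv> sum_list (take k ds) i"
abbreviation "AA i \<equiv> sum_list ds i"
text \<open>The sum over l \<le> k of entry k at \<open>i\<close> times entry l at \<open>j\<close>.
  The Euler forms of all pairs in the tuple, diagonal terms included, are built from these
  sums.\<close>

abbreviation "RR i j \<equiv> \<Sum>k<length ds. (ds ! k) i * sum_list (take (Suc k) ds) j"

lemmas H = HN_D[OF HN]

lemma pp_Suc: "k < NN ==> pp (Suc k) i = pp k i + (ds ! k) i"
 by (simp add: take_Suc_conv_app_nth)

lemma pp_nonneg: "0 \<le> pp k i" "0 \<le> (ds ! k) i \<or> NN \<le> k" "pp k i \<le> AA i"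
proof -
 show "0 \<le> pp k i" using psum_mono[OF H(1), of 0 k i] by simp
 show "0 \<le> (ds ! k) i \<or> NN \<le> k"
 proof (cases "k < NN")
  case True
  hence "ds ! k : Lam_pos Q" using H(1) nth_mem by blast
  thus ?thesis by (simp add: Lam_pos_def)
 qed simp
 show "pp k i \<le> AA i" using psum_mono[OF H(1), of k "max k NN" i] by simp
qed

lemma abel_pp: "(\<Sum>l<NN. (ds ! l) i * (AA j - pp l j)) = RR j i"
 using abel_sum[of NN "%k. pp k j" "%k. (ds ! k) j" "%k. pp k i" "%k. (ds ! k) i"] pp_Suc by simp

lemma AA_sum: "AA i = (\<Sum>k<NN. (ds ! k) i)"
proof -
 have "k \<le> NN ==> pp k i = (\<Sum>l<k. (ds ! l) i)" for k by (induction k) (simp_all add: pp_Suc)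
 from this[of NN] show ?thesis by simp
qed

lemma n_int: "i : QV ==> int (n i) = AA i + AA (s0 i) + dinf i" "i : QV ==> dinf (s0 i) = dinf i"
proof -
 show "i : QV ==> int (n i) = AA i + AA (s0 i) + dinf i" using H(6)[of i] d_D(2)[of i] by (simp add: n_def)
 have "inv_act Q s0 dinf = dinf" using H(3) by (simp add: Lam_inv_pos_def)
 thus "i : QV ==> dinf (s0 i) = dinf i" using fun_cong[of _ _ i] by (fastforce simp: inv_act_def)
qed

lemma AA_nonneg: "0 \<le> AA i"
 using pp_nonneg(1)[of NN i] by simp

lemma nds_int: "int (sum_list (nds ds i)) = AA i" "int (prs (nds ds i)) = AA i * AA i - RR i i"
proof -
 show "int (sum_list (nds ds i)) = AA i" by (rule sum_list_nds[OF H(1)])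
 have "int (sum_list (take k (nds ds i))) = pp k i" for k
  using sum_list_nds[of "take k ds" i] H(1) set_take_subset[of k ds] by (simp add: nds_def take_map)
 hence "int (prs (nds ds i)) = (\<Sum>k<NN. int (nds ds i ! k) * pp k i)" by (simp add: prs_def) (simp add: nds_def)
 also have "\<dots> = (\<Sum>k<NN. (ds ! k) i * pp k i)" using pp_nonneg(2)[of _ i] by (intro sum.cong refl) (fastforce simp: nds_def)
 also have "\<dots> = (\<Sum>k<NN. (ds ! k) i * AA i - (ds ! k) i * (AA i - pp k i))" by (rule sum.cong) (simp_all add: algebra_simps)
 also have "\<dots> = AA i * AA i - RR i i" unfolding sum_subtractf abel_pp sum_distrib_right[symmetric] AA_sum[symmetric] ..
 finally show "int (prs (nds ds i)) = AA i * AA i - RR i i" .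
qed

text \<open>The steps of the extended flag at \<open>i\<close> are the entries of \<open>ds\<close>
  at \<open>i\<close>, then \<open>dinf i\<close>, then the entries at \<open>s0 i\<close> in
  reverse order. The sum is evaluated separately over these three ranges.\<close>

lemma ex_int:
 assumes u: "\<And>i k. i : QV ==> k \<le> NN ==> int (u i k) = pp k i" and i: "i : QV" and j: "j : QV"
 shows "int (ex NN u i j) = RR i (s0 j) + dinf i * (AA (s0 j) + dinf j) + AA (s0 i) * (AA (s0 j) + dinf j) + RR j (s0 i)"
proof -
 define T where "T = Suc (2 * NN)"
 \<comment> \<open>The integer version of \<open>fd\<close>, free of truncated subtraction.\<close>
 define F where "F = (%i k. if k \<le> NN then pp k i else int (n i) - pp (T - k) (s0 i))"
 have ple: "pp k i \<le> int (n i)" if "i : QV" for i k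
  using pp_nonneg(3)[of k i] AA_nonneg[of "s0 i"] H(7)[of i] unfolding n_int(1)[OF that] by linarith
 have ple': "pp k (s0 i) \<le> int (n i)" if "i : QV" for i k
  using ple[OF node_closed[OF that], of k] by (simp add: n_sigma[OF that])
 have Ff: "int (fd NN u i k) = F i k" if iv: "i : QV" and k: "k \<le> T" for i k
 proof (cases "k \<le> NN")
  case True thus ?thesis using u[OF iv] by (simp add: fd_def F_def)
 next
  case False
  hence "T - k \<le> NN" by (simp add: T_def)
  from u[OF node_closed[OF iv] this] ple'[OF iv, of "T - k"] False show ?thesis by (simp add: fd_def F_def T_def of_nat_diff)
 qed
 have Fd: "F i (Suc k) - F i k = (if k < NN then (ds ! k) i else if k = NN then dinf i else (ds ! (2 * NN - k)) (s0 i))"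
  if iv: "i : QV" and k: "k < T" for i k
 proof -
  consider "k < NN" | "k = NN" | "NN < k" by linarith
  thus ?thesis
  proof cases
   case 1 thus ?thesis by (simp add: F_def pp_Suc)
  next
   case 2 thus ?thesis by (simp add: F_def T_def n_int(1)[OF iv])
  next
   case 3
   have e: "T - k = Suc (2 * NN - k)" "T - Suc k = 2 * NN - k" "2 * NN - k < NN" using 3 k by (simp_all add: T_def)
   thus ?thesis using 3 by (simp add: F_def pp_Suc)
  qed
 qed
 have Fm: "F i k \<le> F i (Suc k)" if "i : QV" "k < T" for i k
 proof -
  have "0 \<le> F i (Suc k) - F i k" unfolding Fd[OF that] using H(7)[of i] pp_nonneg(2)[of k i] pp_nonneg(2)[of "2 * NN - k" "s0 i"] that(2)
   by (auto simp: T_def)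
  thus ?thesis by simp
 qed
 have FT: "F i T = int (n i)" for i by (simp add: F_def T_def)
 have FmT: "F i k \<le> F i T" if "i : QV" for i k
  using ple[OF that, of k] pp_nonneg(1)[of "T - k" "s0 i"] unfolding FT by (simp add: F_def)
 have t: "int ((fd NN u i (Suc k) - fd NN u i k) * (fd NN u j T - fd NN u j (T - Suc k))) = (F i (Suc k) - F i k) * (F j T - F j (T - Suc k))"
  if k: "k < T" for k
 proof -
  have "fd NN u i k \<le> fd NN u i (Suc k)" using Fm[OF i k] Ff[OF i, of k] Ff[OF i, of "Suc k"] k by simp
  moreover have "fd NN u j (T - Suc k) \<le> fd NN u j T" using FmT[OF j, of "T - Suc k"] Ff[OF j, of T] Ff[OF j, of "T - Suc k"] by simp
  ultimately show ?thesis using Ff[OF i, of k] Ff[OF i, of "Suc k"] Ff[OF j, of T] Ff[OF j, of "T - Suc k"] k by (simp add: of_nat_diff)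
 qed
 have "int (ex NN u i j) = (\<Sum>k<T. (F i (Suc k) - F i k) * (F j T - F j (T - Suc k)))"
  unfolding ex_def T_def[symmetric] of_nat_sum by (rule sum.cong) (simp_all add: t del: of_nat_mult)
 also have "\<dots> = (\<Sum>k<NN. (F i (Suc k) - F i k) * (F j T - F j (T - Suc k))) + (F i (Suc NN) - F i NN) * (F j T - F j (T - Suc NN)) +
   (\<Sum>l<NN. (F i (Suc (2 * NN - l)) - F i (2 * NN - l)) * (F j T - F j (T - Suc (2 * NN - l))))"
  unfolding T_def by (rule sum_symmetric_split)
 also have "(\<Sum>k<NN. (F i (Suc k) - F i k) * (F j T - F j (T - Suc k))) = RR i (s0 j)"
 proof (rule sum.cong[OF refl])
  fix k assume "k : {..<NN}"
  hence k: "k < T" "k < NN" "\<not> T - Suc k \<le> NN" "T - (T - Suc k) = Suc k" by (simp_all add: T_def)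
  show "(F i (Suc k) - F i k) * (F j T - F j (T - Suc k)) = (ds ! k) i * pp (Suc k) (s0 j)"
   unfolding Fd[OF i k(1)] FT using k by (simp add: F_def)
 qed
 also have "(F i (Suc NN) - F i NN) * (F j T - F j (T - Suc NN)) = dinf i * (AA (s0 j) + dinf j)"
 proof -
  have k: "NN < T" "T - Suc NN = NN" by (simp_all add: T_def)
  show ?thesis unfolding Fd[OF i k(1)] FT k(2) n_int(1)[OF j] by (simp add: F_def)
 qed
 also have "(\<Sum>l<NN. (F i (Suc (2 * NN - l)) - F i (2 * NN - l)) * (F j T - F j (T - Suc (2 * NN - l)))) =
   (\<Sum>l<NN. (ds ! l) (s0 i) * (AA (s0 j) + dinf j) + (ds ! l) (s0 i) * (AA j - pp l j))"
 proof (rule sum.cong[OF refl])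
  fix l assume "l : {..<NN}"
  hence k: "2 * NN - l < T" "\<not> 2 * NN - l < NN" "2 * NN - l \<noteq> NN" "2 * NN - (2 * NN - l) = l" "T - Suc (2 * NN - l) = l" "l \<le> NN"
   by (simp_all add: T_def)
  have f: "F j l = pp l j" using k(6) by (simp add: F_def)
  show "(F i (Suc (2 * NN - l)) - F i (2 * NN - l)) * (F j T - F j (T - Suc (2 * NN - l))) =
   (ds ! l) (s0 i) * (AA (s0 j) + dinf j) + (ds ! l) (s0 i) * (AA j - pp l j)"
   unfolding Fd[OF i k(1)] FT k(5) f n_int(1)[OF j] using k(2-4) by (simp add: algebra_simps)
 qed
 also have "\<dots> = AA (s0 i) * (AA (s0 j) + dinf j) + RR j (s0 i)"
  unfolding sum.distrib abel_pp sum_distrib_right[symmetric] AA_sum[symmetric] ..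
 finally show ?thesis by simp
qed

lemma euler_pp: "euler Q e (sum_list (take k ds)) = (\<Sum>l<k. euler Q e (ds ! l))" if "k \<le> NN"
 using that
proof (induction k)
 case 0 thus ?case by (simp add: euler_def)
next
 case (Suc k)
 have "euler Q e (sum_list (take (Suc k) ds)) = euler Q e (sum_list (take k ds)) + euler Q e (ds ! k)"
  using Suc.prems by (simp add: take_Suc_conv_app_nth euler_def algebra_simps sum.distrib)
 thus ?case using Suc by simp
qed

text \<open>The share of a node in the total of all Euler form terms of the type; \<open>RA\<close>
  is the share of an arrow.\<close>

definition "RN i = RR i i + dinf i * AA i"
definition "RA al = RR (src al) (tgt al) + dinf (src al) * AA (tgt al)"

text \<open>Adding the diagonal terms completes the pairs i < j to i \<le> j, so that each entry is
  paired with a full partial sum.\<close>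

lemma euler_total:
 "euler_tuple Q ds + (\<Sum>k<NN. euler Q (ds ! k) (ds ! k)) + euler_vec_tuple Q dinf ds = (\<Sum>i\<in>QV. RN i) - (\<Sum>al\<in>QA. RA al)"
proof -
 have "euler_tuple Q ds + (\<Sum>k<NN. euler Q (ds ! k) (ds ! k)) = (\<Sum>k<NN. euler Q (ds ! k) (sum_list (take (Suc k) ds)))"
  unfolding euler_tuple_def sum.distrib[symmetric] by (rule sum.cong) (simp_all add: euler_pp)
 also have "\<dots> = (\<Sum>i\<in>QV. RR i i) - (\<Sum>al\<in>QA. RR (src al) (tgt al))"
  unfolding euler_def sum_subtractf
  by (rule arg_cong2[where f = "(-)"]; rule sum.swap)
 moreover have "euler_vec_tuple Q dinf ds = (\<Sum>i\<in>QV. dinf i * AA i) - (\<Sum>al\<in>QA. dinf (src al) * AA (tgt al))"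
  using euler_pp[of NN dinf] unfolding euler_vec_tuple_def by (simp add: euler_def)
 ultimately show ?thesis unfolding RN_def RA_def sum.distrib by simp
qed

text \<open>All factors are sorted by orbits of the involution: \<open>eP\<close> and
  \<open>eF\<close> are the exponents for pairs of nodes and fixed nodes, \<open>eA\<close> and
  \<open>eX\<close> those for pairs of arrows and fixed arrows. Summed up, the parts in
  \<open>RN\<close> and \<open>RA\<close> give the Euler forms, and the other terms in
  \<open>AA\<close> and in \<open>dinf\<close> give the values of \<open>E\<close> at the sum of
  \<open>ds\<close> and at \<open>dinf\<close>.\<close>

lemma term_formula:
 defines "E \<equiv> sd_euler Q s0 s1 s \<tau> P0 P1"
 shows "real_of_int (\<Sum>xs\<in>flags topgr ds. int (Cf xs)) / (\<Prod>i\<in>QV. ij (n i) (n i)) =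
  real q powi (- euler_tuple Q ds - euler_vec_tuple Q dinf ds - E (sum_list ds))
   * (\<Prod>k<NN. real q powi (- euler Q (ds ! k) (ds ! k)) / qpoch_vec Q (1 / real q) (ds ! k))
   * (real q powi (- E dinf) / qpoch_sd Q s0 P0 (1 / real q) dinf)"
proof -
 define a where "a = (%i. sum_list (nds ds i))"
 define c where "c = (%i. nat (dinf i))"
 have ai: "int (a i) = AA i" for i unfolding a_def by (rule nds_int(1))
 have ci: "int (c i) = dinf i" for i using H(7)[of i] by (simp add: c_def)
 have na: "n i = a i + a (s0 i) + c i" if "i : QV" for i
 proof -
  have "int (n i) = int (a i + a (s0 i) + c i)" unfolding n_int(1)[OF that] by (simp add: ai ci)
  thus ?thesis by (rule of_nat_eq_iff[THEN iffD1])
 qed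
 define eP where "eP = (%i. int ((n i - a i) * a i + prs (nds ds i) + ((n i - a (s0 i)) * a (s0 i) + prs (nds ds (s0 i))) + (n i - a (s0 i)) * a i)
   - int (n i * a i + n i * n i))"
 define eF where "eF = (%i. int ((n i - a i) * a i + prs (nds ds i) + (n i - a i) * a i + (c i * (c i - 1) div 2 + (if s i = 1 then c i else 0)) +
   (a i * c i + a i * (a i - 1) div 2 + (if s i = 1 then a i else 0))) - int (n i * n i))"
 define eA where "eA = (%al. RA al + RA (s1 al) + AA (s0 (src al)) * AA (tgt al) + dinf (s0 (src al)) * dinf (tgt al))"
 define eX where "eX = (%al. RA al + (AA (tgt al) * (AA (tgt al) + \<tau> al * s (tgt al))) div 2 +
  (dinf (tgt al) * (dinf (tgt al) + \<tau> al * s (tgt al))) div 2)"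
 have eP: "eP i = - (RN i + RN (s0 i)) - AA (s0 i) * AA i - dinf (s0 i) * dinf i" if "i : P0" for i
 proof -
  note iv = P_sub(1)[OF that]
  have m: "n i - a i = a (s0 i) + c i" "n i - a (s0 i) = a i + c i" using na[OF iv] by simp_all
  show ?thesis unfolding eP_def m unfolding na[OF iv] RN_def n_int(2)[OF iv] of_nat_add of_nat_mult nds_int(2) ai ci
   by (simp add: algebra_simps)
 qed
 have eF: "eF i = - RN i - (AA i * (AA i - s i)) div 2 - (dinf i * (dinf i - s i)) div 2" if "i : fixed_nodes Q s0" for i
 proof -
  have iv: "i : QV" and ii: "s0 i = i" using that by (auto simp: fixed_nodes_def)
  note si = s_sign[OF iv]
  have m: "n i - a i = a i + c i" using na[OF iv] by (simp add: ii)
  have t: "2 * int (c i * (c i - 1) div 2 + (if s i = 1 then c i else 0)) = dinf i * (dinf i + s i)"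
   "2 * int (a i * (a i - 1) div 2 + (if s i = 1 then a i else 0)) = AA i * (AA i + s i)"
   using triangle_int[OF si, of "c i"] triangle_int[OF si, of "a i"] unfolding ai ci by blast+
  have "eF i = (AA i + dinf i) * AA i + (AA i * AA i - RR i i) + (AA i + dinf i) * AA i + int (c i * (c i - 1) div 2 + (if s i = 1 then c i else 0)) +
   (AA i * dinf i + int (a i * (a i - 1) div 2 + (if s i = 1 then a i else 0))) - (AA i + AA i + dinf i) * (AA i + AA i + dinf i)"
   unfolding eF_def m unfolding na[OF iv] ii by (simp only: of_nat_add of_nat_mult nds_int(2) ai ci add.assoc)
  \<comment> \<open>Doubled, so that the exact divisions by two disappear.\<close>
  hence "2 * eF i = 2 * (- RN i - (AA i * (AA i - s i)) div 2 - (dinf i * (dinf i - s i)) div 2)"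
   using t double_half(2)[OF si, of "AA i"] double_half(2)[OF si, of "dinf i"] unfolding RN_def by (simp add: algebra_simps)
  thus ?thesis by simp
 qed
 have Esum: "(\<Sum>i\<in>P0. eP i) + (\<Sum>i\<in>fixed_nodes Q s0. eF i) + (\<Sum>al\<in>P1. eA al) + (\<Sum>al\<in>fixed_arrows Q s1. eX al) =
  (- euler_tuple Q ds - euler_vec_tuple Q dinf ds - E (sum_list ds)) + (\<Sum>k<NN. - euler Q (ds ! k) (ds ! k)) + (- E dinf)"
 proof -
  have "(\<Sum>i\<in>P0. eP i) = - (\<Sum>i\<in>P0. RN i + RN (s0 i)) - (\<Sum>i\<in>P0. AA (s0 i) * AA i) - (\<Sum>i\<in>P0. dinf (s0 i) * dinf i)"
   unfolding sum_negf[symmetric] sum_subtractf[symmetric] by (rule sum.cong[OF refl]) (rule eP)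
  moreover have "(\<Sum>i\<in>fixed_nodes Q s0. eF i) = - (\<Sum>i\<in>fixed_nodes Q s0. RN i) - (\<Sum>i\<in>fixed_nodes Q s0. (AA i * (AA i - s i)) div 2) -
    (\<Sum>i\<in>fixed_nodes Q s0. (dinf i * (dinf i - s i)) div 2)"
   unfolding sum_negf[symmetric] sum_subtractf[symmetric] by (rule sum.cong[OF refl]) (rule eF)
  ultimately show ?thesis
   using euler_total split_verts_sum[of RN] split_arcs_sum[of RA]
   unfolding eA_def eX_def E_def sd_euler_def sum.distrib sum_negf by simp
 qed
 define u where "u = (%i k. nat (pp k i))"
 have ui: "int (u i k) = pp k i" for i k using pp_nonneg(1)[of k i] by (simp add: u_def)
 have exA: "real q ^ ex NN u (src al) (s0 (tgt al)) = real q powi eA al" if "al : P1" for al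
 proof -
  note al = P_sub(2)[OF that]
  note th = tail_head_verts[OF al]
  have "int (ex NN u (src al) (s0 (tgt al))) = eA al"
   unfolding ex_int[OF ui th(1) node_closed[OF th(2)]] eA_def RA_def node_invol[OF th(2)] tail_invol[OF al] head_invol[OF al]
    n_int(2)[OF th(1)] n_int(2)[OF th(2)] by (simp add: algebra_simps)
  thus ?thesis by (metis power_int_of_nat)
 qed
 have exX: "real q ^ nat ((int (ex NN u (src al) (src al)) + s (src al) * \<tau> al * int (n (src al) - u (src al) NN)) div 2) = real q powi eX al"
  if "al : fixed_arrows Q s1" for al
 proof -
  have al: "al : QA" and fa: "s1 al = al" using that by (auto simp: fixed_arrows_def)
  note th = tail_head_verts[OF al]
  have ht: "s0 (src al) = tgt al" using head_invol[OF al] unfolding fa by simp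
  have ch: "dinf (tgt al) = dinf (src al)" using n_int(2)[OF th(1)] unfolding ht .
  have sh: "s (tgt al) = s (src al)" using s_invariant[OF th(1)] unfolding ht .
  define ep where "ep = \<tau> al * s (tgt al)"
  have ep: "ep : {1, -1}" unfolding ep_def using s_sign[OF th(2)] tau_sign[OF al] by auto
  have e': "s (src al) * \<tau> al = ep" unfolding ep_def sh by simp
  have nu: "int (n (src al) - u (src al) NN) = AA (tgt al) + dinf (src al)"
   using na[OF th(1)] ui[of "src al" NN] ai[of "src al"] ai[of "tgt al"] ci[of "src al"] unfolding ht by simp
  note dh = double_half(1)[OF ep, of "AA (tgt al)"] double_half(1)[OF ep, of "dinf (tgt al)"]
  have "int (ex NN u (src al) (src al)) + s (src al) * \<tau> al * int (n (src al) - u (src al) NN) = 2 * eX al"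
   using dh unfolding e' nu ex_int[OF ui th(1) th(1)] eX_def RA_def ht ep_def[symmetric] ch by (simp add: algebra_simps)
  \<comment> \<open>The counting lemma gives this exponent through \<open>nat\<close>, which is
    faithful for nonnegative values only.\<close>
  moreover have "0 \<le> eX al"
  proof -
   have "0 \<le> RA al" unfolding RA_def
    by (intro add_nonneg_nonneg sum_nonneg mult_nonneg_nonneg pp_nonneg(1) AA_nonneg H(7)) (use pp_nonneg(2) in \<open>fastforce\<close>)
   thus ?thesis using dh halves_nonneg[OF ep AA_nonneg, of "tgt al"] halves_nonneg[OF ep H(7), of "tgt al"]
    unfolding eX_def ep_def[symmetric] by linarith
  qed
  ultimately show ?thesis by (simp add: power_int_def)
 qed
 define B1 where "B1 = (\<Prod>i\<in>P0. ij (a i) (n i - a (s0 i)) * ij (n i) (n i) / ij (a i) (n i))"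
 define B2 where "B2 = (\<Prod>i\<in>fixed_nodes Q s0. ij (a i) (n i - a i) * (ff (s i) (n i - 2 * a i) *
   real q ^ (a i * (n i - 2 * a i) + a i * (a i - 1) div 2 + (if s i = 1 then a i else 0))))"
 define Bv where "Bv = B1 * B2"
 define Ev where "Ev = (\<Prod>al\<in>P1. real q powi eA al) * (\<Prod>al\<in>fixed_arrows Q s1. real q powi eX al)"
 have Cf: "real (Cf xs) = Bv * Ev" if xs: "xs : flags topgr ds" for xs
 proof -
  note F = flags_type[OF HN xs]
  have l: "length xs = NN" and dv: "\<And>k. k < NN ==> dimv (xs ! k) = sum_list (take (Suc k) ds)" using xs by (auto simp: flags_def)
  have uk: "sdim (uk xs i k) = u i k" if "i : QV" "k \<le> NN" for i k
  proof (cases k)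
   case 0 thus ?thesis by (simp add: uk_def u_def sdim_zero)
  next
   case (Suc j)
   have "int (sdim ((xs ! j) i)) = pp k i" using fun_cong[OF dv[of j], of i] that Suc by (simp add: dimv_def)
   thus ?thesis unfolding ui[symmetric] by (simp add: uk_def Suc)
  qed
  have ua: "sdim (uk xs i NN) = a i" if "i : QV" for i
   using uk[OF that order_refl] ui[of i NN] ai[of i] by simp
  have fdu: "fd NN (%i k. sdim (uk xs i k)) i k = fd NN u i k" if "i : QV" "k \<le> Suc (2 * NN)" for i k
   using that uk[of i k] uk[of "s0 i" "Suc (2 * NN) - k"] node_closed by (simp add: fd_def)
  have exu: "ex NN (%i k. sdim (uk xs i k)) i j = ex NN u i j" if "i : QV" "j : QV" for i j
   unfolding ex_def by (rule sum.cong) (simp_all add: fdu that)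
  have B: "real (card (Bfam xs)) = Bv"
   unfolding card_Bfam[OF F(1,2)] l Bv_def B1_def B2_def
   by (intro arg_cong2[where f = "(*)"] prod.cong refl) (auto simp: ua node_closed P_sub fixed_nodes_def)
  have "real (Cf xs) = real (card (Bfam xs)) * ((\<Prod>al\<in>P1. real q ^ ex NN u (src al) (s0 (tgt al))) *
   (\<Prod>al\<in>fixed_arrows Q s1. real q ^ nat ((int (ex NN u (src al) (src al)) + s (src al) * \<tau> al * int (n (src al) - u (src al) NN)) div 2)))"
   unfolding Cf_def card_flag_structures[OF F(1,2)] l of_nat_mult of_nat_prod of_nat_power
   by (intro arg_cong2[where f = "(*)"] prod.cong refl)
    (simp_all add: exu uk P_sub tail_head_verts node_closed fixed_arrows_def)
  also have "\<dots> = Bv * Ev" unfolding B Ev_def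
   by (intro arg_cong2[where f = "(*)"] prod.cong refl) (simp_all add: exA exX)
  finally show ?thesis .
 qed
 define pX where "pX = (%i. flagno (n i) (nds ds i))"
 have q0: "real q \<noteq> 0" using q_real by simp
 have ijn: "ij (n i) (n i) \<noteq> 0" for i by (rule ij_nonzero) simp
 have P: "pX i * pX (s0 i) * (ij (a i) (n i - a (s0 i)) * ij (n i) (n i) / ij (a i) (n i)) / (ij (n i) (n i) * ij (n (s0 i)) (n (s0 i))) =
  real q powi eP i / (ph (c i) * (phs (nds ds i) * phs (nds ds (s0 i))))" if "i : P0" for i
  using node_pair[OF na[OF P_sub(1)[OF that], unfolded a_def]]
  unfolding pX_def eP_def a_def n_sigma[OF P_sub(1)[OF that]] .
 have Fx: "pX i * (ij (a i) (n i - a i) * (ff (s i) (n i - 2 * a i) *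
   real q ^ (a i * (n i - 2 * a i) + a i * (a i - 1) div 2 + (if s i = 1 then a i else 0)))) / ij (n i) (n i) =
  real q powi eF i / (qpoch ((1 / real q)\<^sup>2) (c i div 2) * phs (nds ds i))" if "i : fixed_nodes Q s0" for i
 proof -
  have iv: "i : QV" and ii: "s0 i = i" using that by (auto simp: fixed_nodes_def)
  have n2: "n i = 2 * sum_list (nds ds i) + c i" using na[OF iv] unfolding ii a_def by simp
  \<comment> \<open>For \<open>s i = -1\<close> the dimension \<open>n i\<close> is even by
    assumption, and it differs from \<open>c i\<close> by twice the sum of the entries at
    \<open>i\<close>.\<close>
  have "s i = 1 \<or> even (c i)"
  proof (cases "s i = 1")
   case False
   hence "even (d i)" using d_even[OF iv ii] s_sign[OF iv] by auto
   hence "even (n i)" using d_D(2)[of i] by (simp add: n_def even_nat_iff)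
   thus ?thesis unfolding n2 by simp
  qed simp
  from node_fixed[OF n2 this] show ?thesis unfolding pX_def eF_def a_def .
 qed
 have "real_of_int (\<Sum>xs\<in>flags topgr ds. int (Cf xs)) = (\<Sum>xs\<in>flags topgr ds. real (Cf xs))" by simp
 also have "\<dots> = (\<Prod>i\<in>QV. pX i) * (Bv * Ev)"
  using flags_nonempty(1)[OF HN] by (simp add: Cf pX_def)
 finally have "real_of_int (\<Sum>xs\<in>flags topgr ds. int (Cf xs)) / (\<Prod>i\<in>QV. ij (n i) (n i)) =
  ((\<Prod>i\<in>QV. pX i) * Bv / (\<Prod>i\<in>QV. ij (n i) (n i))) * Ev" by simp
 also have "(\<Prod>i\<in>QV. pX i) * Bv / (\<Prod>i\<in>QV. ij (n i) (n i)) =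
  (\<Prod>i\<in>P0. real q powi eP i / (ph (c i) * (phs (nds ds i) * phs (nds ds (s0 i))))) *
  (\<Prod>i\<in>fixed_nodes Q s0. real q powi eF i / (qpoch ((1 / real q)\<^sup>2) (c i div 2) * phs (nds ds i)))"
 proof -
  have p1: "(\<Prod>i\<in>P0. real q powi eP i / (ph (c i) * (phs (nds ds i) * phs (nds ds (s0 i))))) =
   (\<Prod>i\<in>P0. pX i * pX (s0 i)) * B1 / (\<Prod>i\<in>P0. ij (n i) (n i) * ij (n (s0 i)) (n (s0 i)))"
   unfolding B1_def prod.distrib[symmetric] prod_dividef[symmetric] by (rule prod.cong[OF refl P[symmetric]])
  have p2: "(\<Prod>i\<in>fixed_nodes Q s0. real q powi eF i / (qpoch ((1 / real q)\<^sup>2) (c i div 2) * phs (nds ds i))) =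
   (\<Prod>i\<in>fixed_nodes Q s0. pX i) * B2 / (\<Prod>i\<in>fixed_nodes Q s0. ij (n i) (n i))"
   unfolding B2_def prod.distrib[symmetric] prod_dividef[symmetric] by (rule prod.cong[OF refl Fx[symmetric]])
  show ?thesis unfolding p1 p2 Bv_def split_verts by simp
 qed
 also have "\<dots> = (real q powi (\<Sum>i\<in>P0. eP i) * real q powi (\<Sum>i\<in>fixed_nodes Q s0. eF i)) /
  (qpoch_sd Q s0 P0 (1 / real q) dinf * (\<Prod>i\<in>QV. phs (nds ds i)))"
  unfolding prod_dividef prod_powi[OF q0] qpoch_sd_def split_verts prod.distrib c_def by simp
 also have "(\<Prod>i\<in>QV. phs (nds ds i)) = (\<Prod>k<NN. qpoch_vec Q (1 / real q) (ds ! k))"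
 proof -
  have "(\<Prod>i\<in>QV. phs (nds ds i)) = (\<Prod>i\<in>QV. \<Prod>k<NN. ph (nat ((ds ! k) i)))"
   unfolding phs_def by (intro prod.cong) (simp_all add: nds_def)
  also have "\<dots> = (\<Prod>k<NN. qpoch_vec Q (1 / real q) (ds ! k))" unfolding qpoch_vec_def by (rule prod.swap)
  finally show ?thesis .
 qed
 finally have "real_of_int (\<Sum>xs\<in>flags topgr ds. int (Cf xs)) / (\<Prod>i\<in>QV. ij (n i) (n i)) =
  real q powi ((\<Sum>i\<in>P0. eP i) + (\<Sum>i\<in>fixed_nodes Q s0. eF i) + (\<Sum>al\<in>P1. eA al) + (\<Sum>al\<in>fixed_arrows Q s1. eX al)) /
  (qpoch_sd Q s0 P0 (1 / real q) dinf * (\<Prod>k<NN. qpoch_vec Q (1 / real q) (ds ! k)))"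
  unfolding Ev_def prod_powi[OF q0] power_int_add[OF disjI1[OF q0]] by (simp add: mult.assoc)
 also have "\<dots> = real q powi (- euler_tuple Q ds - euler_vec_tuple Q dinf ds - E (sum_list ds))
   * (\<Prod>k<NN. real q powi (- euler Q (ds ! k) (ds ! k)) / qpoch_vec Q (1 / real q) (ds ! k))
   * (real q powi (- E dinf) / qpoch_sd Q s0 P0 (1 / real q) dinf)"
  unfolding Esum power_int_add[OF disjI1[OF q0]] prod_dividef prod_powi[OF q0] by simp
 finally show ?thesis .
qed

end

theorem A_coeff_formula:
 defines "E \<equiv> sd_euler Q s0 s1 s \<tau> P0 P1"
 shows "A_coeff K Q s0 s1 s \<tau> P0 P1 \<theta> d = real q powr (real_of_int (E d) / 2) *
  (\<Sum>(ds, dinf)\<in>HN_types Q s0 \<theta> d.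
    (-1) ^ length ds
    * real q powi (- euler_tuple Q ds - euler_vec_tuple Q dinf ds - E (sum_list ds))
    * (\<Prod>i<length ds. real q powi (- euler Q (ds ! i) (ds ! i)) / qpoch_vec Q (1 / real q) (ds ! i))
    * (real q powi (- E dinf) / qpoch_sd Q s0 P0 (1 / real q) dinf))"
proof -
 define G where "G = (\<Prod>i\<in>QV. ij (n i) (n i))"
 have "real (card {D : Dat. sd_semistable K Q \<theta> (mk D)}) / G =
  real_of_int (\<Sum>(ds, dinf)\<in>HN_types Q s0 \<theta> d. (-1) ^ length ds * (\<Sum>xs\<in>flags topgr ds. int (Cf xs))) / G"
  unfolding semistable_count[symmetric] by simp
 also have "\<dots> = (\<Sum>(ds, dinf)\<in>HN_types Q s0 \<theta> d. (-1) ^ length ds * (real_of_int (\<Sum>xs\<in>flags topgr ds. int (Cf xs)) / G))"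
 proof -
  have "real_of_int (\<Sum>(ds, dinf)\<in>HN_types Q s0 \<theta> d. (-1) ^ length ds * S ds) / G =
   (\<Sum>(ds, dinf)\<in>HN_types Q s0 \<theta> d. (-1) ^ length ds * (real_of_int (S ds) / G))" for S :: "_ => int"
   by (simp add: sum_divide_distrib case_prod_unfold)
  thus ?thesis .
 qed
 also have "\<dots> = (\<Sum>(ds, dinf)\<in>HN_types Q s0 \<theta> d.
    (-1) ^ length ds
    * real q powi (- euler_tuple Q ds - euler_vec_tuple Q dinf ds - E (sum_list ds))
    * (\<Prod>i<length ds. real q powi (- euler Q (ds ! i) (ds ! i)) / qpoch_vec Q (1 / real q) (ds ! i))
    * (real q powi (- E dinf) / qpoch_sd Q s0 P0 (1 / real q) dinf))"
  unfolding G_def E_def by (intro sum.cong refl) (auto simp only: term_formula mult.assoc split: prod.splits)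
 finally have "(\<Sum>C\<in>isometry_classes K Q (semistable_sd_reps K Q s0 s1 s \<tau> \<theta> d). 1 / real (card (Aut_S K Q (SOME M. M : C)))) = \<dots>"
  unfolding mass_formula G_def .
 moreover have "A_coeff K Q s0 s1 s \<tau> P0 P1 \<theta> d = real q powr (real_of_int (E d) / 2) *
  (\<Sum>C\<in>isometry_classes K Q (semistable_sd_reps K Q s0 s1 s \<tau> \<theta> d). 1 / real (card (Aut_S K Q (SOME M. M : C))))"
  unfolding A_coeff_def E_def sum_distrib_left q_def by simp
 ultimately show ?thesis by simp
qed

end

section \<open>Dependence on the cardinality of the field\<close>

definition evp :: "int poly => real => real" where
 "evp p u = poly (map_poly of_int p) u"

lemma evp_pCons: "evp 0 u = 0" "evp (pCons a p) u = of_int a + u * evp p u"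
 by (simp_all add: evp_def map_poly_pCons)

lemma evp_add: "evp (p + p') u = evp p u + evp p' u"
proof -
 have "map_poly of_int (p + p') = map_poly of_int p + (map_poly of_int p' :: real poly)"
  by (simp add: poly_eq_iff coeff_map_poly)
 thus ?thesis by (simp add: evp_def)
qed

lemma evp_smult: "evp (Polynomial.smult c p) u = of_int c * evp p u"
 by (induction p) (simp_all add: evp_pCons algebra_simps)

lemma evp_mult: "evp (p * p') u = evp p u * evp p' u"
 by (induction p) (simp_all add: evp_pCons evp_add evp_smult algebra_simps)

text \<open>One fraction of integer polynomials serves all arguments above 1. The argument stands
  for the square root of \<open>q\<close>, so this expresses that a single rational function covers
  all fields.\<close>

definition ratl :: "(real => real) => bool" where
 "ratl f \<longleftrightarrow> (\<exists>p g. \<forall>u>1. evp g u \<noteq> 0 \<and> f u = evp p u / evp g u)"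

lemma ratlI: "(\<And>u. u > 1 ==> evp g u \<noteq> 0 \<and> f u = evp p u / evp g u) ==> ratl f"
 unfolding ratl_def by blast

lemma ratl_const: "ratl (%u. of_int c)"
 by (rule ratlI[where p = "[:c:]" and g = "[:1:]"]) (simp add: evp_pCons)

lemma ratl_one: "ratl (%u. 1)" and ratl_zero: "ratl (%u. 0)" and ratl_minus_one: "ratl (%u. -1)"
 using ratl_const[of 1] ratl_const[of 0] ratl_const[of "-1"] by simp_all

lemma ratl_id: "ratl (%u. u)"
 by (rule ratlI[where p = "[:0, 1:]" and g = "[:1:]"]) (simp add: evp_pCons)

lemma ratl_add:
 assumes "ratl f" "ratl h"
 shows "ratl (%u. f u + h u)"
proof -
 obtain p g where f: "\<And>u. u > 1 ==> evp g u \<noteq> 0" "\<And>u. u > 1 ==> f u = evp p u / evp g u" using assms(1) unfolding ratl_def by blast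
 obtain p' g' where h: "\<And>u. u > 1 ==> evp g' u \<noteq> 0" "\<And>u. u > 1 ==> h u = evp p' u / evp g' u" using assms(2) unfolding ratl_def by blast
 show ?thesis
  by (rule ratlI[where p = "p * g' + p' * g" and g = "g * g'"]) (simp add: f h evp_add evp_mult field_simps)
qed

lemma ratl_mult:
 assumes "ratl f" "ratl h"
 shows "ratl (%u. f u * h u)"
proof -
 obtain p g where f: "\<And>u. u > 1 ==> evp g u \<noteq> 0" "\<And>u. u > 1 ==> f u = evp p u / evp g u" using assms(1) unfolding ratl_def by blast
 obtain p' g' where h: "\<And>u. u > 1 ==> evp g' u \<noteq> 0" "\<And>u. u > 1 ==> h u = evp p' u / evp g' u" using assms(2) unfolding ratl_def by blast
 show ?thesis
  by (rule ratlI[where p = "p * p'" and g = "g * g'"]) (simp add: f h evp_mult)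
qed

lemma ratl_inverse:
 assumes "ratl f" "\<And>u. u > 1 ==> f u \<noteq> 0"
 shows "ratl (%u. inverse (f u))"
proof -
 obtain p g where f: "\<And>u. u > 1 ==> evp g u \<noteq> 0" "\<And>u. u > 1 ==> f u = evp p u / evp g u" using assms(1) unfolding ratl_def by blast
 show ?thesis
 proof (rule ratlI[where p = g and g = p])
  fix u :: real assume u: "u > 1"
  show "evp p u \<noteq> 0 \<and> inverse (f u) = evp g u / evp p u" using assms(2)[OF u] f(2)[OF u] by auto
 qed
qed

lemma ratl_divide: "ratl f ==> ratl h ==> (\<And>u. u > 1 ==> h u \<noteq> 0) ==> ratl (%u. f u / h u)"
 unfolding divide_inverse by (intro ratl_mult ratl_inverse)

lemma ratl_prod: "(\<And>i. i : I ==> ratl (f i)) ==> ratl (%u. \<Prod>i\<in>I. f i u)"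
 by (induction I rule: infinite_finite_induct) (simp_all add: ratl_one ratl_mult)

lemma ratl_sum: "(\<And>i. i : I ==> ratl (f i)) ==> ratl (%u. \<Sum>i\<in>I. f i u)"
 by (induction I rule: infinite_finite_induct) (simp_all add: ratl_zero ratl_add)

lemma ratl_power: "ratl f ==> ratl (%u. f u ^ n)"
 by (induction n) (simp_all add: ratl_one ratl_mult)

lemma ratl_powi: "ratl f ==> (\<And>u. u > 1 ==> f u \<noteq> 0) ==> ratl (%u. f u powi n)"
 unfolding power_int_def by (cases "0 \<le> n") (simp_all add: ratl_power ratl_inverse)

lemma ratl_qpoch: "ratl f ==> ratl (%u. qpoch (f u) n)"
proof -
 assume f: "ratl f"
 have "ratl (%u. 1 + (-1) * f u ^ i)" for i by (intro ratl_add ratl_mult ratl_one ratl_minus_one ratl_power f)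
 thus ?thesis unfolding qpoch_def by (intro ratl_prod) simp
qed

lemma prod_nonzero: "(\<And>i. i : I ==> f i \<noteq> 0) ==> (\<Prod>i\<in>I. f i) \<noteq> (0::real)"
 by (induction I rule: infinite_finite_induct) simp_all

lemma qpoch_nonzero:
 assumes "0 \<le> y" "y < 1"
 shows "qpoch y n \<noteq> 0"
 unfolding qpoch_def
proof (rule prod_nonzero)
 fix i assume "i : {1..n}"
 thus "1 - y ^ i \<noteq> 0" using power_decreasing[of 1 i y] assms by auto
qed

text \<open>If 1 + 1 were 0, the order of 1 would be an odd divisor of 2, hence 1, and 1 would be
  0.\<close>

lemma odd_finite_field_two:
 fixes K :: "'k ring" (structure)
 assumes "odd_finite_field K"
 shows "odd_field K"
proof -
 interpret field K using assms by (simp add: odd_finite_field_def)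
 show ?thesis
 proof
  show "finite (carrier K)" using assms by (simp add: odd_finite_field_def)
  show "\<one> \<oplus> \<one> \<noteq> \<zero>"
  proof
   assume z: "\<one> \<oplus> \<one> = \<zero>"
   have "[(2::nat)] \<cdot> \<one> = \<zero>" using z by (simp add: numeral_2_eq_2)
   hence "group.ord (add_monoid K) \<one> dvd 2" using add.pow_eq_id[of \<one> 2] by simp
   hence "group.ord (add_monoid K) \<one> \<le> 2" by (rule dvd_imp_le) simp
   moreover have "odd (group.ord (add_monoid K) \<one>)" using assms by (simp add: odd_finite_field_def)
   moreover have "k \<le> 2 ==> odd k ==> k = 1" for k :: nat by presburger
   ultimately have "group.ord (add_monoid K) \<one> = 1" by blast
   thus False using add.ord_eq_1[of \<one>] by simp
  qed
 qed
qed

theorem theorem3p4: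
  fixes Q :: "('v, 'a) pre_digraph"
    and \<sigma>0 :: "'v \<Rightarrow> 'v" and \<sigma>1 :: "'a \<Rightarrow> 'a"
    and s :: "'v \<Rightarrow> int" and \<tau> :: "'a \<Rightarrow> int"
    and P0 :: "'v set" and P1 :: "'a set"
    and \<theta> :: "('v \<Rightarrow> int) \<Rightarrow> int" and d :: "'v \<Rightarrow> int"
  assumes "quiver_duality Q \<sigma>0 \<sigma>1 s \<tau>"
    and "involution_splitting Q \<sigma>0 \<sigma>1 P0 P1"
    and "compatible_stability Q \<sigma>0 \<theta>"
    and "d \<in> Lam_inv_pos Q \<sigma>0"
    and "\<And>i. i \<in> verts Q \<Longrightarrow> \<sigma>0 i = i \<Longrightarrow> s i = -1 \<Longrightarrow> even (d i)"
  shows "(\<forall>K :: 'k ring. odd_finite_field K \<longrightarrow>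
            (let q = real (card (carrier K)); E = sd_euler Q \<sigma>0 \<sigma>1 s \<tau> P0 P1 in
             A_coeff K Q \<sigma>0 \<sigma>1 s \<tau> P0 P1 \<theta> d =
             q powr (real_of_int (E d) / 2) *
             (\<Sum>(ds, dinf)\<in>HN_types Q \<sigma>0 \<theta> d.
                (-1) ^ length ds
                * q powi (- euler_tuple Q ds - euler_vec_tuple Q dinf ds - E (sum_list ds))
                * (\<Prod>i<length ds. q powi (- euler Q (ds ! i) (ds ! i)) / qpoch_vec Q (1 / q) (ds ! i))
                * (q powi (- E dinf) / qpoch_sd Q \<sigma>0 P0 (1 / q) dinf))))
       \<and> (\<exists>a :: int poly fract. \<forall>K :: 'k ring. odd_finite_field K \<longrightarrow>
            specializes_at a (sqrt (real (card (carrier K))))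
              (A_coeff K Q \<sigma>0 \<sigma>1 s \<tau> P0 P1 \<theta> d))"
proof -
 define E where "E = sd_euler Q \<sigma>0 \<sigma>1 s \<tau> P0 P1"
 define S :: "real \<Rightarrow> real" where "S = (\<lambda>q. \<Sum>(ds, dinf)\<in>HN_types Q \<sigma>0 \<theta> d.
        (-1) ^ length ds
        * q powi (- euler_tuple Q ds - euler_vec_tuple Q dinf ds - E (sum_list ds))
        * (\<Prod>i<length ds. q powi (- euler Q (ds ! i) (ds ! i)) / qpoch_vec Q (1 / q) (ds ! i))
        * (q powi (- E dinf) / qpoch_sd Q \<sigma>0 P0 (1 / q) dinf))"
 have main: "A_coeff K Q \<sigma>0 \<sigma>1 s \<tau> P0 P1 \<theta> d = real (card (carrier K)) powr (real_of_int (E d) / 2) * S (real (card (carrier K)))"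
  and card1: "real (card (carrier K)) > 1"
  if K: "odd_finite_field K" for K :: "'k ring"
 proof -
  interpret quiver_stab K Q \<sigma>0 \<sigma>1 s \<tau> d \<theta> P0 P1
   unfolding quiver_stab_def quiver_data_def quiver_field_def quiver_stab_axioms_def quiver_data_axioms_def
   using odd_finite_field_two[OF K] assms by blast
  show "A_coeff K Q \<sigma>0 \<sigma>1 s \<tau> P0 P1 \<theta> d = real (card (carrier K)) powr (real_of_int (E d) / 2) * S (real (card (carrier K)))"
   unfolding S_def E_def using A_coeff_formula unfolding q_def .
  show "real (card (carrier K)) > 1" using q_gt_1 unfolding q_def by simp
 qed
 \<comment> \<open>From here on \<open>q\<close> is the square of \<open>u\<close>, so that the
   half-integral power becomes an integral power of \<open>u\<close>.\<close>
 have sq: "ratl (\<lambda>u. u\<^sup>2)" by (intro ratl_power ratl_id)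
 have sq0: "u\<^sup>2 \<noteq> 0" "0 \<le> 1 / u\<^sup>2" "1 / u\<^sup>2 < 1" if "u > 1" for u :: real
 proof -
  have "1 < u\<^sup>2" using that by (simp add: one_less_power)
  thus "u\<^sup>2 \<noteq> 0" "0 \<le> 1 / u\<^sup>2" "1 / u\<^sup>2 < 1" by (auto simp: divide_less_eq)
 qed
 have iq: "ratl (\<lambda>u. 1 / u\<^sup>2)" by (intro ratl_divide ratl_one sq) (rule sq0)
 have sqi: "ratl (\<lambda>u. (u\<^sup>2) powi k)" for k by (rule ratl_powi[OF sq sq0(1)])
 have y2: "(1 / u\<^sup>2)\<^sup>2 < 1" if "u > 1" for u :: real
 proof -
  have "(1 / u\<^sup>2)\<^sup>2 \<le> (1 / u\<^sup>2) ^ 1" by (rule power_decreasing) (use sq0[OF that] in auto)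
  thus ?thesis using sq0(3)[OF that] by (simp only: power_one_right order.strict_trans1)
 qed
 have vec: "ratl (\<lambda>u. qpoch_vec Q (1 / u\<^sup>2) e)" "u > 1 \<Longrightarrow> qpoch_vec Q (1 / u\<^sup>2) e \<noteq> 0" for e u
  unfolding qpoch_vec_def by (intro ratl_prod ratl_qpoch iq, intro prod_nonzero qpoch_nonzero sq0)
 have sd: "ratl (\<lambda>u. qpoch_sd Q \<sigma>0 P0 (1 / u\<^sup>2) e)" for e
  unfolding qpoch_sd_def by (intro ratl_mult ratl_prod ratl_qpoch ratl_power iq)
 have sd0: "qpoch_sd Q \<sigma>0 P0 (1 / u\<^sup>2) e \<noteq> 0" if u: "u > 1" for u e
 proof -
  have "qpoch ((1 / u\<^sup>2)\<^sup>2) m \<noteq> 0" for m by (rule qpoch_nonzero[OF zero_le_power2 y2[OF u]])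
  moreover have "qpoch (1 / u\<^sup>2) m \<noteq> 0" for m by (rule qpoch_nonzero[OF sq0(2,3)[OF u]])
  ultimately show ?thesis unfolding qpoch_sd_def by (intro no_zero_divisors prod_nonzero)
 qed
 have "ratl (\<lambda>u. (-1) ^ length ds * (u\<^sup>2) powi (- euler_tuple Q ds - euler_vec_tuple Q dinf ds - E (sum_list ds))
        * (\<Prod>i<length ds. (u\<^sup>2) powi (- euler Q (ds ! i) (ds ! i)) / qpoch_vec Q (1 / u\<^sup>2) (ds ! i))
        * ((u\<^sup>2) powi (- E dinf) / qpoch_sd Q \<sigma>0 P0 (1 / u\<^sup>2) dinf))" for ds dinf
  by (intro ratl_mult ratl_power ratl_minus_one sqi ratl_prod ratl_divide vec sd sd0)
 \<comment> \<open>The index set \<open>HN_types\<close> does not depend on the field, so the sum is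
   one rational function.\<close>
 hence "ratl (\<lambda>u. S (u\<^sup>2))" unfolding S_def case_prod_unfold by (intro ratl_sum) simp
 moreover have "ratl (\<lambda>u. u powi E d)" by (rule ratl_powi[OF ratl_id]) simp
 ultimately have "ratl (\<lambda>u. u powi E d * S (u\<^sup>2))" by (intro ratl_mult)
 then obtain p g where pg: "\<And>u. u > 1 \<Longrightarrow> evp g u \<noteq> 0" "\<And>u. u > 1 \<Longrightarrow> u powi E d * S (u\<^sup>2) = evp p u / evp g u"
  unfolding ratl_def by blast
 have "specializes_at (Fract p g) (sqrt (real (card (carrier K)))) (A_coeff K Q \<sigma>0 \<sigma>1 s \<tau> P0 P1 \<theta> d)"
  if K: "odd_finite_field K" for K :: "'k ring"
 proof -
  define r where "r = real (card (carrier K))"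
  have r: "r > 1" unfolding r_def by (rule card1[OF K])
  have u: "sqrt r > 1" "(sqrt r)\<^sup>2 = r" using r by simp_all
  \<comment> \<open>The prefactor is the \<open>E d\<close>-th integer power of the square root of
    the cardinality, the point at which the fraction is evaluated.\<close>
  have "r powr (real_of_int (E d) / 2) = (r powr (1 / 2)) powr real_of_int (E d)" by (simp add: powr_powr)
  also have "\<dots> = sqrt r powi E d" using r u(1) by (simp add: powr_half_sqrt powr_real_of_int')
  finally have "A_coeff K Q \<sigma>0 \<sigma>1 s \<tau> P0 P1 \<theta> d = evp p (sqrt r) / evp g (sqrt r)"
   using main[OF K] pg(2)[OF u(1)] unfolding r_def[symmetric] u(2) by simp
  thus ?thesis unfolding specializes_at_def r_def[symmetric] using pg(1)[OF u(1)] unfolding evp_def by blast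
 qed
 moreover have "\<forall>K :: 'k ring. odd_finite_field K \<longrightarrow>
      (let q = real (card (carrier K)); E = sd_euler Q \<sigma>0 \<sigma>1 s \<tau> P0 P1 in
      A_coeff K Q \<sigma>0 \<sigma>1 s \<tau> P0 P1 \<theta> d =
      q powr (real_of_int (E d) / 2) *
      (\<Sum>(ds, dinf)\<in>HN_types Q \<sigma>0 \<theta> d.
        (-1) ^ length ds
        * q powi (- euler_tuple Q ds - euler_vec_tuple Q dinf ds - E (sum_list ds))
        * (\<Prod>i<length ds. q powi (- euler Q (ds ! i) (ds ! i)) / qpoch_vec Q (1 / q) (ds ! i))
        * (q powi (- E dinf) / qpoch_sd Q \<sigma>0 P0 (1 / q) dinf)))"
  using main unfolding Let_def S_def E_def by blast
 ultimately show ?thesis by blast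
qed

end
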